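(* Let $B_*\subset\mathbb{C}$ and $B_0,B_x\subset\mathbb{C}\setminus\{0\}$ be given bounded domains, and let $\delta$ be a given positive number such that $\delta<\pi/2$. Then the system $$x\frac{dA_0}{dx}=[A_x,A_0],\qquad x\frac{dA_x}{dx}=[A_0,A_x]+\frac x2[J,A_x]\qquad (\mathrm S)$$ admits a three-parameter family of solutions $\{(A_0(\mathbf c,\sigma,x),A_x(\mathbf c,\sigma,x));\ (\mathbf c,\sigma)=(c_0,c_x,\sigma)\in B_0\times B_x\times B_*\}$ with $$A_0=f_0J+f_+\Delta_++f_-\Delta_-,\qquad A_x=g_0J+g_+\Delta_++g_-\Delta_-,$$ satisfying the conditions: (a) the eigenvalues of $A_0$ and $A_x$ are $\pm\theta_0/2$ and $\pm\theta_x/2$, respectively; (b) $(A_0+A_x)_{11}=-(A_0+A_x)_{22}\equiv-\theta_\infty/2$. The entries $f_0,f_\pm,g_0,g_\pm$ are holomorphic in $(\mathbf c,\sigma,x)\in B_0\times B_x\times D(B_*,\varepsilon,x_\infty,\delta)$ and are represented by the following convergent series in powers of $(e^xx^{\sigma-1},e^{-x}x^{-\sigma-1})$: $$\begin{aligned} f_0={}&\tfrac{\sigma-\theta_\infty}4-\tfrac12\big((\sigma+\theta_\infty)\gamma^0_+\gamma^0_-+(\sigma-\theta_\infty)\gamma^x_+\gamma^x_-\big)x^{-2}+[x^{-3}]\\ &+\gamma^0_-\gamma^x_+(1+[x^{-1}])e^xx^{\sigma-1}+\sum_{n\ge2}(\gamma^0_-\gamma^x_+)^n[x^{-n+1}](e^xx^{\sigma-1})^n\\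 &+\gamma^0_+\gamma^x_-(1+[x^{-1}])e^{-x}x^{-\sigma-1}+\sum_{n\ge2}(\gamma^0_+\gamma^x_-)^n[x^{-n+1}](e^{-x}x^{-\sigma-1})^n,\\ g_0={}&-\theta_\infty/2-f_0,\\ x^{(\sigma+\theta_\infty)/2}f_+={}&\gamma^0_+(1+[x^{-1}])-\gamma^x_+\big(\tfrac{\sigma-\theta_\infty}2+[x^{-1}]\big)e^xx^{\sigma-1}-\gamma^0_-(\gamma^x_+)^2(1+[x^{-1}])(e^xx^{\sigma-1})^2\\ &+\sum_{n\ge3}\gamma^x_+(\gamma^0_-\gamma^x_+)^{n-1}[x^{-n+2}](e^xx^{\sigma-1})^n+2(\gamma^0_+)^2\gamma^x_-(1+[x^{-1}])e^{-x}x^{-\sigma-2}\\ &+\sum_{n\ge2}\gamma^0_+(\gamma^0_+\gamma^x_-)^n[x^{-n}](e^{-x}x^{-\sigma-1})^n,\\ e^{-x}x^{-(\sigma-\theta_\infty)/2}g_+={}&\gamma^x_+(1+[x^{-1}])+2\gamma^0_-(\gamma^x_+)^2(1+[x^{-1}])e^xx^{\sigma-2}+\sum_{n\ge2}\gamma^x_+(\gamma^0_-\gamma^x_+)^n[x^{-n}](e^xx^{\sigma-1})^n\\ &-\gamma^0_+\big(\tfrac{\sigma+\theta_\infty}2+[x^{-1}]\big)e^{-x}x^{-\sigma-1}-(\gamma^0_+)^2\gamma^x_-(1+[x^{-1}])(e^{-x}x^{-\sigma-1})^2\\ &+\sum_{n\ge3}\gamma^0_+(\gamma^0_+\gamma^x_-)^{n-1}[x^{-n+2}](e^{-x}x^{-\sigma-1})^n,\\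 x^{-(\sigma+\theta_\infty)/2}f_-={}&\gamma^0_-(1+[x^{-1}])+2(\gamma^0_-)^2\gamma^x_+(1+[x^{-1}])e^xx^{\sigma-2}+\sum_{n\ge2}\gamma^0_-(\gamma^0_-\gamma^x_+)^n[x^{-n}](e^xx^{\sigma-1})^n\\ &-\gamma^x_-\big(\tfrac{\sigma-\theta_\infty}2+[x^{-1}]\big)e^{-x}x^{-\sigma-1}-\gamma^0_+(\gamma^x_-)^2(1+[x^{-1}])(e^{-x}x^{-\sigma-1})^2\\ &+\sum_{n\ge3}\gamma^x_-(\gamma^0_+\gamma^x_-)^{n-1}[x^{-n+2}](e^{-x}x^{-\sigma-1})^n,\\ e^xx^{(\sigma-\theta_\infty)/2}g_-={}&\gamma^x_-(1+[x^{-1}])-\gamma^0_-\big(\tfrac{\sigma+\theta_\infty}2+[x^{-1}]\big)e^xx^{\sigma-1}-(\gamma^0_-)^2\gamma^x_+(1+[x^{-1}])(e^xx^{\sigma-1})^2\\ &+\sum_{n\ge3}\gamma^0_-(\gamma^0_-\gamma^x_+)^{n-1}[x^{-n+2}](e^xx^{\sigma-1})^n+2\gamma^0_+(\gamma^x_-)^2(1+[x^{-1}])e^{-x}x^{-\sigma-2}\\ &+\sum_{n\ge2}\gamma^x_-(\gamma^0_+\gamma^x_-)^n[x^{-n}](e^{-x}x^{-\sigma-1})^n. \end{aligned}$$ Here: (i) $\varepsilon=\varepsilon(B_0,B_x,B_*,\delta)$ (respectively, $x_\infty=x_\infty(B_0,B_x,B_*,\delta)>\varepsilon^{-1}$) is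 a sufficiently small (respectively, large) positive number depending on $(B_0,B_x,B_*,\delta)$; (ii) $\gamma^0_\pm=\gamma^0_\pm(\mathbf c,\sigma)$, $\gamma^x_\pm=\gamma^x_\pm(\mathbf c,\sigma)$ denote $$\gamma^0_+=\tfrac{c_0}4(\sigma+2\theta_0-\theta_\infty),\quad \gamma^0_-=\tfrac{c_0^{-1}}4(-\sigma+2\theta_0+\theta_\infty),\quad \gamma^x_+=\tfrac{c_x}4(-\sigma+2\theta_x-\theta_\infty),\quad \gamma^x_-=\tfrac{c_x^{-1}}4(\sigma+2\theta_x+\theta_\infty);$$ (iii) the asymptotic series for $[x^{-1}],[x^{-n}],\dots$ are valid uniformly in $(\mathbf c,\sigma)\in B_0\times B_x\times B_*$ as $x$ tends to $\infty$ through the sector $|\arg x-\pi/2|<\pi/2-\delta$, $|x|>x_\infty$.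
   Context: $\theta_0,\theta_x,\theta_\infty\in\mathbb C$ are fixed. $J=\mathrm{diag}[1,-1]$, $\Delta_+=\begin{pmatrix}0&1\\0&0\end{pmatrix}$, $\Delta_-=\begin{pmatrix}0&0\\1&0\end{pmatrix}$; $A_0,A_x$ are $2\times2$ matrix functions of $x$. $\mathcal R(\mathbb C\setminus\{0\})$ is the universal covering of $\mathbb C\setminus\{0\}$; powers $x^a$ are defined on it via $\log x=\log|x|+i\arg x$. For $\varepsilon,x_\infty,\delta$ with $\delta<\pi/2$, $x_\infty>\varepsilon^{-1}$ and for $\sigma\in B_*$, $$\Sigma(\sigma,\varepsilon,x_\infty,\delta)=\{x\in\mathcal R(\mathbb C\setminus\{0\}):\ |\arg x-\pi/2|<\pi/2-\delta,\ |e^xx^{\sigma-1}|<\varepsilon,\ |e^{-x}x^{-\sigma-1}|<\varepsilon,\ |x|>x_\infty\},$$ $$D(B_*,\varepsilon,x_\infty,\delta)=\bigcup_{\sigma\in B_*}\{\sigma\}\times\Sigma(\sigma,\varepsilon,x_\infty,\delta).$$ $\mathbb Q_*=\mathbb Q[\theta_0,\theta_x,\theta_\infty,c_0,c_0^{-1},c_x,c_x^{-1},\sigma]$. For an integer $k\ge0$, $[x^{-k}]$ denotes a holomorphic function (possibly different at each occurrence) admitting an asymptotic representation $x^{-k}\sum_{j\ge0}f_jx^{-j}$ with $f_j\in\mathbb Q_*$ (not necessarily nonzero) as $x\to\infty$ through the indicated sector.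
   Formalization: The bounded domains B_0, B_x in C\{0} are also assumed to have closures not containing 0; otherwise c_0^{-1} or c_x^{-1} is unbounded and poles of f_0 enter D for every choice of ε and x_∞. *)

theory Defs
  imports "HOL-Analysis.Analysis"
begin

section \<open>Matrices\<close>

type_synonym mat2 = "complex^2^2"

definition J :: mat2 where
  "J = vector [vector [1, 0], vector [0, -1]]"

definition Delta_plus :: mat2 where
  "Delta_plus = vector [vector [0, 1], vector [0, 0]]"

definition Delta_minus :: mat2 where
  "Delta_minus = vector [vector [0, 0], vector [1, 0]]"

definition cscale :: "complex \<Rightarrow> mat2 \<Rightarrow> mat2" where
  "cscale a M = map_matrix ((*) a) M"

definition commutator :: "mat2 \<Rightarrow> mat2 \<Rightarrow> mat2" where
  "commutator M N = M ** N - N ** M"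

definition eigenvalues :: "mat2 \<Rightarrow> complex set" where
  "eigenvalues M = {l. \<exists>v. v \<noteq> 0 \<and> M *v v = l *s v}"

definition has_matrix_derivative :: "(complex \<Rightarrow> mat2) \<Rightarrow> mat2 \<Rightarrow> complex \<Rightarrow> bool" where
  "has_matrix_derivative M M' x \<longleftrightarrow>
     (\<forall>i j. ((\<lambda>t. M t $ i $ j) has_field_derivative M' $ i $ j) (at x))"

definition solves_system :: "(complex \<Rightarrow> mat2) \<Rightarrow> (complex \<Rightarrow> mat2) \<Rightarrow> complex set \<Rightarrow> bool" where
  "solves_system A0 Ax S \<longleftrightarrow>
     (\<forall>x\<in>S. \<exists>A0' Ax'.
        has_matrix_derivative A0 A0' x \<and> has_matrix_derivative Ax Ax' x \<and>
        cscale x A0' = commutator (Ax x) (A0 x) \<and>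
        cscale x Ax' = commutator (A0 x) (Ax x) + cscale (x / 2) (commutator J (Ax x)))"


section \<open>Domains and holomorphy\<close>

text \<open>The sector and the domains below lie on the universal covering of the punctured plane.
  Since \<open>0 < \<delta> < pi / 2\<close>, the condition \<open>\<bar>arg x - pi / 2\<bar> < pi / 2 - \<delta>\<close> confines them to
  \<open>\<delta> < arg x < pi - \<delta>\<close>, a part of the sheet that projects injectively into the upper half
  plane and on which \<open>arg\<close> and \<open>log\<close> are the principal \<open>Arg\<close> and \<open>Ln\<close>; hence powers are
  given by \<open>powr\<close>.\<close>

definition sector :: "real \<Rightarrow> real \<Rightarrow> complex set" where
  "sector \<delta> xinf = {x. \<bar>Arg x - pi / 2\<bar> < pi / 2 - \<delta> \<and> norm x > xinf}"

definition Sigma_dom :: "complex \<Rightarrow> real \<Rightarrow> real \<Rightarrow> real \<Rightarrow> complex set" where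
  "Sigma_dom \<sigma> \<epsilon> xinf \<delta> =
     {x. \<bar>Arg x - pi / 2\<bar> < pi / 2 - \<delta> \<and>
         norm (exp x * x powr (\<sigma> - 1)) < \<epsilon> \<and>
         norm (exp (-x) * x powr (-\<sigma> - 1)) < \<epsilon> \<and>
         norm x > xinf}"

definition D_dom :: "complex set \<Rightarrow> real \<Rightarrow> real \<Rightarrow> real \<Rightarrow> (complex \<times> complex) set" where
  "D_dom Bs \<epsilon> xinf \<delta> = (\<Union>\<sigma>\<in>Bs. {\<sigma>} \<times> Sigma_dom \<sigma> \<epsilon> xinf \<delta>)"

text \<open>Functions of \<open>(c\<^sub>0, c\<^sub>x, \<sigma>, x)\<close>. Holomorphy in several variables on an open set:
  Frechet differentiability with a complex-linear derivative.\<close>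

type_synonym fun4 = "complex \<Rightarrow> complex \<Rightarrow> complex \<Rightarrow> complex \<Rightarrow> complex"

definition holomorphic4_on ::
    "fun4 \<Rightarrow> (complex \<times> complex \<times> complex \<times> complex) set \<Rightarrow> bool" where
  "holomorphic4_on f S \<longleftrightarrow>
     (\<forall>p\<in>S. \<exists>a1 a2 a3 a4.
        ((\<lambda>(c0, cx, \<sigma>, x). f c0 cx \<sigma> x) has_derivative
           (\<lambda>(h1, h2, h3, h4). a1 * h1 + a2 * h2 + a3 * h3 + a4 * h4)) (at p))"


section \<open>The coefficient ring and the symbols \<open>[x\<^sup>-\<^sup>k]\<close>\<close>

text \<open>Elements of \<open>Q[\<theta>\<^sub>0, \<theta>\<^sub>x, \<theta>\<^sub>i\<^sub>n\<^sub>f, c\<^sub>0, 1/c\<^sub>0, c\<^sub>x, 1/c\<^sub>x, \<sigma>]\<close>, as functions of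
  \<open>(c\<^sub>0, c\<^sub>x, \<sigma>)\<close> for fixed values of the \<open>\<theta>\<close>s.\<close>

inductive_set Qstar :: "complex \<Rightarrow> complex \<Rightarrow> complex \<Rightarrow>
    (complex \<Rightarrow> complex \<Rightarrow> complex \<Rightarrow> complex) set"
  for \<theta>0 \<theta>x \<theta>inf :: complex where
  "(\<lambda>c0 cx \<sigma>. of_rat q) \<in> Qstar \<theta>0 \<theta>x \<theta>inf"
| "(\<lambda>c0 cx \<sigma>. \<theta>0) \<in> Qstar \<theta>0 \<theta>x \<theta>inf"
| "(\<lambda>c0 cx \<sigma>. \<theta>x) \<in> Qstar \<theta>0 \<theta>x \<theta>inf"
| "(\<lambda>c0 cx \<sigma>. \<theta>inf) \<in> Qstar \<theta>0 \<theta>x \<theta>inf"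
| "(\<lambda>c0 cx \<sigma>. c0) \<in> Qstar \<theta>0 \<theta>x \<theta>inf"
| "(\<lambda>c0 cx \<sigma>. inverse c0) \<in> Qstar \<theta>0 \<theta>x \<theta>inf"
| "(\<lambda>c0 cx \<sigma>. cx) \<in> Qstar \<theta>0 \<theta>x \<theta>inf"
| "(\<lambda>c0 cx \<sigma>. inverse cx) \<in> Qstar \<theta>0 \<theta>x \<theta>inf"
| "(\<lambda>c0 cx \<sigma>. \<sigma>) \<in> Qstar \<theta>0 \<theta>x \<theta>inf"
| "f \<in> Qstar \<theta>0 \<theta>x \<theta>inf \<Longrightarrow> g \<in> Qstar \<theta>0 \<theta>x \<theta>inf \<Longrightarrow>
     (\<lambda>c0 cx \<sigma>. f c0 cx \<sigma> + g c0 cx \<sigma>) \<in> Qstar \<theta>0 \<theta>x \<theta>inf"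
| "f \<in> Qstar \<theta>0 \<theta>x \<theta>inf \<Longrightarrow> g \<in> Qstar \<theta>0 \<theta>x \<theta>inf \<Longrightarrow>
     (\<lambda>c0 cx \<sigma>. f c0 cx \<sigma> * g c0 cx \<sigma>) \<in> Qstar \<theta>0 \<theta>x \<theta>inf"

text \<open>\<open>brk \<dots> k h\<close>: the function \<open>h\<close> is an instance of \<open>[x\<^sup>-\<^sup>k]\<close>. It lives on the whole
  sector, not only on the domain \<open>D\<close>, and the constants \<open>C\<close>, \<open>R\<close> do not depend on
  \<open>(c\<^sub>0, c\<^sub>x, \<sigma>)\<close>, so that the asymptotic expansion is uniform in these.\<close>

definition brk :: "complex \<Rightarrow> complex \<Rightarrow> complex \<Rightarrow> complex set \<Rightarrow> complex set \<Rightarrow> complex set \<Rightarrow>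
    real \<Rightarrow> real \<Rightarrow> nat \<Rightarrow> fun4 \<Rightarrow> bool" where
  "brk \<theta>0 \<theta>x \<theta>inf B0 Bx Bs \<delta> xinf k h \<longleftrightarrow>
     holomorphic4_on h (B0 \<times> Bx \<times> Bs \<times> sector \<delta> xinf) \<and>
     (\<exists>f. (\<forall>j. f j \<in> Qstar \<theta>0 \<theta>x \<theta>inf) \<and>
        (\<forall>N. \<exists>C R. \<forall>c0\<in>B0. \<forall>cx\<in>Bx. \<forall>\<sigma>\<in>Bs. \<forall>x\<in>sector \<delta> xinf. norm x > R \<longrightarrow>
           norm (h c0 cx \<sigma> x - (\<Sum>j<N. f j c0 cx \<sigma> / x ^ (k + j))) \<le> C / norm x ^ (k + N)))"


section \<open>The series for the entries\<close>

definition gam0p :: "complex \<Rightarrow> complex \<Rightarrow> complex \<Rightarrow> complex \<Rightarrow> complex" where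
  "gam0p \<theta>0 \<theta>inf c0 \<sigma> = c0 / 4 * (\<sigma> + 2 * \<theta>0 - \<theta>inf)"

definition gam0m :: "complex \<Rightarrow> complex \<Rightarrow> complex \<Rightarrow> complex \<Rightarrow> complex" where
  "gam0m \<theta>0 \<theta>inf c0 \<sigma> = inverse c0 / 4 * (-\<sigma> + 2 * \<theta>0 + \<theta>inf)"

definition gamxp :: "complex \<Rightarrow> complex \<Rightarrow> complex \<Rightarrow> complex \<Rightarrow> complex" where
  "gamxp \<theta>x \<theta>inf cx \<sigma> = cx / 4 * (-\<sigma> + 2 * \<theta>x - \<theta>inf)"

definition gamxm :: "complex \<Rightarrow> complex \<Rightarrow> complex \<Rightarrow> complex \<Rightarrow> complex" where
  "gamxm \<theta>x \<theta>inf cx \<sigma> = inverse cx / 4 * (\<sigma> + 2 * \<theta>x + \<theta>inf)"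

text \<open>In the following definitions \<open>u\<close>s and \<open>v\<close>s are the symbols \<open>[x\<^sup>-\<^sup>k]\<close> attached to
  the powers of \<open>X = e\<^sup>x x\<^sup>\<sigma>\<^sup>-\<^sup>1\<close> and of \<open>Y = e\<^sup>-\<^sup>x x\<^sup>-\<^sup>\<sigma>\<^sup>-\<^sup>1\<close> respectively, \<open>w\<close> the one free of
  exponentials; each occurrence has its own function. Convergence of a series in powers of
  \<open>(X, Y)\<close> is unconditional, hence \<open>summable_on\<close>.\<close>

definition f0_series :: "complex \<Rightarrow> complex \<Rightarrow> complex \<Rightarrow> complex set \<Rightarrow> complex set \<Rightarrow>
    complex set \<Rightarrow> real \<Rightarrow> real \<Rightarrow> real \<Rightarrow> fun4 \<Rightarrow> bool" where
  "f0_series \<theta>0 \<theta>x \<theta>inf B0 Bx Bs \<delta> \<epsilon> xinf f0 \<longleftrightarrow>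
   (let br = brk \<theta>0 \<theta>x \<theta>inf B0 Bx Bs \<delta> xinf in
    \<exists>w u1 v1 u v.
      br 3 w \<and> br 1 u1 \<and> br 1 v1 \<and> (\<forall>n\<ge>2. br (n - 1) (u n)) \<and> (\<forall>n\<ge>2. br (n - 1) (v n)) \<and>
      (\<forall>c0\<in>B0. \<forall>cx\<in>Bx. \<forall>(\<sigma>, x)\<in>D_dom Bs \<epsilon> xinf \<delta>.
        let g0p = gam0p \<theta>0 \<theta>inf c0 \<sigma>; g0m = gam0m \<theta>0 \<theta>inf c0 \<sigma>;
            gxp = gamxp \<theta>x \<theta>inf cx \<sigma>; gxm = gamxm \<theta>x \<theta>inf cx \<sigma>;
            X = exp x * x powr (\<sigma> - 1); Y = exp (-x) * x powr (-\<sigma> - 1);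
            U = (\<lambda>n. (g0m * gxp) ^ n * u n c0 cx \<sigma> x * X ^ n);
            V = (\<lambda>n. (g0p * gxm) ^ n * v n c0 cx \<sigma> x * Y ^ n)
        in U summable_on {2..} \<and> V summable_on {2..} \<and>
           f0 c0 cx \<sigma> x =
             (\<sigma> - \<theta>inf) / 4
             - 1 / 2 * ((\<sigma> + \<theta>inf) * g0p * g0m + (\<sigma> - \<theta>inf) * gxp * gxm) / x ^ 2
             + w c0 cx \<sigma> x
             + g0m * gxp * (1 + u1 c0 cx \<sigma> x) * X + (\<Sum>\<^sub>\<infinity>n\<in>{2..}. U n)
             + g0p * gxm * (1 + v1 c0 cx \<sigma> x) * Y + (\<Sum>\<^sub>\<infinity>n\<in>{2..}. V n)))"

definition fp_series :: "complex \<Rightarrow> complex \<Rightarrow> complex \<Rightarrow> complex set \<Rightarrow> complex set \<Rightarrow>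
    complex set \<Rightarrow> real \<Rightarrow> real \<Rightarrow> real \<Rightarrow> fun4 \<Rightarrow> bool" where
  "fp_series \<theta>0 \<theta>x \<theta>inf B0 Bx Bs \<delta> \<epsilon> xinf fp \<longleftrightarrow>
   (let br = brk \<theta>0 \<theta>x \<theta>inf B0 Bx Bs \<delta> xinf in
    \<exists>w u1 u2 v1 u v.
      br 1 w \<and> br 1 u1 \<and> br 1 u2 \<and> br 1 v1 \<and>
      (\<forall>n\<ge>3. br (n - 2) (u n)) \<and> (\<forall>n\<ge>2. br n (v n)) \<and>
      (\<forall>c0\<in>B0. \<forall>cx\<in>Bx. \<forall>(\<sigma>, x)\<in>D_dom Bs \<epsilon> xinf \<delta>.
        let g0p = gam0p \<theta>0 \<theta>inf c0 \<sigma>; g0m = gam0m \<theta>0 \<theta>inf c0 \<sigma>;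
            gxp = gamxp \<theta>x \<theta>inf cx \<sigma>; gxm = gamxm \<theta>x \<theta>inf cx \<sigma>;
            X = exp x * x powr (\<sigma> - 1); Y = exp (-x) * x powr (-\<sigma> - 1);
            U = (\<lambda>n. gxp * (g0m * gxp) ^ (n - 1) * u n c0 cx \<sigma> x * X ^ n);
            V = (\<lambda>n. g0p * (g0p * gxm) ^ n * v n c0 cx \<sigma> x * Y ^ n)
        in U summable_on {3..} \<and> V summable_on {2..} \<and>
           x powr ((\<sigma> + \<theta>inf) / 2) * fp c0 cx \<sigma> x =
             g0p * (1 + w c0 cx \<sigma> x)
             - gxp * ((\<sigma> - \<theta>inf) / 2 + u1 c0 cx \<sigma> x) * X
             - g0m * gxp ^ 2 * (1 + u2 c0 cx \<sigma> x) * X ^ 2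
             + (\<Sum>\<^sub>\<infinity>n\<in>{3..}. U n)
             + 2 * g0p ^ 2 * gxm * (1 + v1 c0 cx \<sigma> x) * (exp (-x) * x powr (-\<sigma> - 2))
             + (\<Sum>\<^sub>\<infinity>n\<in>{2..}. V n)))"

definition gp_series :: "complex \<Rightarrow> complex \<Rightarrow> complex \<Rightarrow> complex set \<Rightarrow> complex set \<Rightarrow>
    complex set \<Rightarrow> real \<Rightarrow> real \<Rightarrow> real \<Rightarrow> fun4 \<Rightarrow> bool" where
  "gp_series \<theta>0 \<theta>x \<theta>inf B0 Bx Bs \<delta> \<epsilon> xinf gp \<longleftrightarrow>
   (let br = brk \<theta>0 \<theta>x \<theta>inf B0 Bx Bs \<delta> xinf in
    \<exists>w u1 v1 v2 u v.
      br 1 w \<and> br 1 u1 \<and> br 1 v1 \<and> br 1 v2 \<and>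
      (\<forall>n\<ge>2. br n (u n)) \<and> (\<forall>n\<ge>3. br (n - 2) (v n)) \<and>
      (\<forall>c0\<in>B0. \<forall>cx\<in>Bx. \<forall>(\<sigma>, x)\<in>D_dom Bs \<epsilon> xinf \<delta>.
        let g0p = gam0p \<theta>0 \<theta>inf c0 \<sigma>; g0m = gam0m \<theta>0 \<theta>inf c0 \<sigma>;
            gxp = gamxp \<theta>x \<theta>inf cx \<sigma>; gxm = gamxm \<theta>x \<theta>inf cx \<sigma>;
            X = exp x * x powr (\<sigma> - 1); Y = exp (-x) * x powr (-\<sigma> - 1);
            U = (\<lambda>n. gxp * (g0m * gxp) ^ n * u n c0 cx \<sigma> x * X ^ n);
            V = (\<lambda>n. g0p * (g0p * gxm) ^ (n - 1) * v n c0 cx \<sigma> x * Y ^ n)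
        in U summable_on {2..} \<and> V summable_on {3..} \<and>
           exp (-x) * x powr (-(\<sigma> - \<theta>inf) / 2) * gp c0 cx \<sigma> x =
             gxp * (1 + w c0 cx \<sigma> x)
             + 2 * g0m * gxp ^ 2 * (1 + u1 c0 cx \<sigma> x) * (exp x * x powr (\<sigma> - 2))
             + (\<Sum>\<^sub>\<infinity>n\<in>{2..}. U n)
             - g0p * ((\<sigma> + \<theta>inf) / 2 + v1 c0 cx \<sigma> x) * Y
             - g0p ^ 2 * gxm * (1 + v2 c0 cx \<sigma> x) * Y ^ 2
             + (\<Sum>\<^sub>\<infinity>n\<in>{3..}. V n)))"

definition fm_series :: "complex \<Rightarrow> complex \<Rightarrow> complex \<Rightarrow> complex set \<Rightarrow> complex set \<Rightarrow>
    complex set \<Rightarrow> real \<Rightarrow> real \<Rightarrow> real \<Rightarrow> fun4 \<Rightarrow> bool" where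
  "fm_series \<theta>0 \<theta>x \<theta>inf B0 Bx Bs \<delta> \<epsilon> xinf fm \<longleftrightarrow>
   (let br = brk \<theta>0 \<theta>x \<theta>inf B0 Bx Bs \<delta> xinf in
    \<exists>w u1 v1 v2 u v.
      br 1 w \<and> br 1 u1 \<and> br 1 v1 \<and> br 1 v2 \<and>
      (\<forall>n\<ge>2. br n (u n)) \<and> (\<forall>n\<ge>3. br (n - 2) (v n)) \<and>
      (\<forall>c0\<in>B0. \<forall>cx\<in>Bx. \<forall>(\<sigma>, x)\<in>D_dom Bs \<epsilon> xinf \<delta>.
        let g0p = gam0p \<theta>0 \<theta>inf c0 \<sigma>; g0m = gam0m \<theta>0 \<theta>inf c0 \<sigma>;
            gxp = gamxp \<theta>x \<theta>inf cx \<sigma>; gxm = gamxm \<theta>x \<theta>inf cx \<sigma>;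
            X = exp x * x powr (\<sigma> - 1); Y = exp (-x) * x powr (-\<sigma> - 1);
            U = (\<lambda>n. g0m * (g0m * gxp) ^ n * u n c0 cx \<sigma> x * X ^ n);
            V = (\<lambda>n. gxm * (g0p * gxm) ^ (n - 1) * v n c0 cx \<sigma> x * Y ^ n)
        in U summable_on {2..} \<and> V summable_on {3..} \<and>
           x powr (-(\<sigma> + \<theta>inf) / 2) * fm c0 cx \<sigma> x =
             g0m * (1 + w c0 cx \<sigma> x)
             + 2 * g0m ^ 2 * gxp * (1 + u1 c0 cx \<sigma> x) * (exp x * x powr (\<sigma> - 2))
             + (\<Sum>\<^sub>\<infinity>n\<in>{2..}. U n)
             - gxm * ((\<sigma> - \<theta>inf) / 2 + v1 c0 cx \<sigma> x) * Y
             - g0p * gxm ^ 2 * (1 + v2 c0 cx \<sigma> x) * Y ^ 2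
             + (\<Sum>\<^sub>\<infinity>n\<in>{3..}. V n)))"

definition gm_series :: "complex \<Rightarrow> complex \<Rightarrow> complex \<Rightarrow> complex set \<Rightarrow> complex set \<Rightarrow>
    complex set \<Rightarrow> real \<Rightarrow> real \<Rightarrow> real \<Rightarrow> fun4 \<Rightarrow> bool" where
  "gm_series \<theta>0 \<theta>x \<theta>inf B0 Bx Bs \<delta> \<epsilon> xinf gm \<longleftrightarrow>
   (let br = brk \<theta>0 \<theta>x \<theta>inf B0 Bx Bs \<delta> xinf in
    \<exists>w u1 u2 v1 u v.
      br 1 w \<and> br 1 u1 \<and> br 1 u2 \<and> br 1 v1 \<and>
      (\<forall>n\<ge>3. br (n - 2) (u n)) \<and> (\<forall>n\<ge>2. br n (v n)) \<and>
      (\<forall>c0\<in>B0. \<forall>cx\<in>Bx. \<forall>(\<sigma>, x)\<in>D_dom Bs \<epsilon> xinf \<delta>.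
        let g0p = gam0p \<theta>0 \<theta>inf c0 \<sigma>; g0m = gam0m \<theta>0 \<theta>inf c0 \<sigma>;
            gxp = gamxp \<theta>x \<theta>inf cx \<sigma>; gxm = gamxm \<theta>x \<theta>inf cx \<sigma>;
            X = exp x * x powr (\<sigma> - 1); Y = exp (-x) * x powr (-\<sigma> - 1);
            U = (\<lambda>n. g0m * (g0m * gxp) ^ (n - 1) * u n c0 cx \<sigma> x * X ^ n);
            V = (\<lambda>n. gxm * (g0p * gxm) ^ n * v n c0 cx \<sigma> x * Y ^ n)
        in U summable_on {3..} \<and> V summable_on {2..} \<and>
           exp x * x powr ((\<sigma> - \<theta>inf) / 2) * gm c0 cx \<sigma> x =
             gxm * (1 + w c0 cx \<sigma> x)
             - g0m * ((\<sigma> + \<theta>inf) / 2 + u1 c0 cx \<sigma> x) * X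
             - g0m ^ 2 * gxp * (1 + u2 c0 cx \<sigma> x) * X ^ 2
             + (\<Sum>\<^sub>\<infinity>n\<in>{3..}. U n)
             + 2 * g0p * gxm ^ 2 * (1 + v1 c0 cx \<sigma> x) * (exp (-x) * x powr (-\<sigma> - 2))
             + (\<Sum>\<^sub>\<infinity>n\<in>{2..}. V n)))"

end

theory Submission
  imports Defs "HOL-Complex_Analysis.Cauchy_Integral_Formula"
begin

text \<open>Put \<open>f\<^sub>0 = (\<sigma> - \<theta>inf) / 4 + \<phi>\<close> and strip the other entries of the factors that the theorem
  displays on its left-hand sides. The resulting system for five unknowns involves exponentials only
  through \<open>X\<close> and \<open>Y\<close>. Expand every unknown as \<open>\<Sum>n. z n \<cdot> e n\<close> over the integers, where \<open>e n\<close> is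
  a monomial in the \<open>\<gamma>\<close>s times \<open>X ^ n\<close> or \<open>Y ^ \<bar>n\<bar>\<close>. Since \<open>X Y = x\<^sup>-\<^sup>2\<close> and the products
  \<open>\<gamma>\<^sup>0\<^sub>+ \<gamma>\<^sup>0\<^sub>-\<close>, \<open>\<gamma>\<^sup>x\<^sub>+ \<gamma>\<^sup>x\<^sub>-\<close> are polynomials in \<open>\<sigma>\<close>, the coefficients depend on \<open>(\<sigma>, x)\<close> only and
  satisfy \<open>(d/dx + n + (n \<sigma> - \<bar>n\<bar>) / x) z n = quadratic terms\<close>. The operators on the left are inverted by
  integration towards infinity along rays on which \<open>e n\<close> decays, and the fixed point equation is a
  contraction in an \<open>\<ell>\<^sup>1\<close> space with weights that are powers of \<open>\<bar>x\<bar>\<close>. The iterates have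
  asymptotic expansions with coefficients in the required ring, and since each step of the iteration
  gains a power \<open>\<bar>x\<bar> powr (- 1/4)\<close>, so has the limit.
  The functions \<open>f\<^sub>0\<^sup>2 + f\<^sub>+ f\<^sub>-\<close> and \<open>g\<^sub>0\<^sup>2 + g\<^sub>+ g\<^sub>-\<close> are first integrals; their values, which determine
  the eigenvalues, are found by letting \<open>x\<close> tend to infinity along a curve on which \<open>X\<close> and \<open>Y\<close> tend to \<open>0\<close>.\<close>

section \<open>Holomorphy in several variables\<close>

text \<open>The obstacle is that the quadratic terms are not all small: where
  \<open>m3 s i j = 0\<close> no power of 1/x is gained, and in an unweighted norm the iteration
  does not contract. These terms are triangular, however. They lead from the off-diagonal
  coefficients with \<open>sg q * n <= 0\<close> to those of \<phi> with nonzero n, and from both to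
  the off-diagonal ones with \<open>sg q * n >= 1\<close>; every way back meets X Y = x^-2 or an
  explicit 1/x. Weights that decrease along this chain turn each passage into a gain. Every iterate
  has finitely many nonzero coefficients, so no convergence question arises before the limit. The
  limit is not inserted into the fixed point equation: the summed iterates satisfy a differential
  equation that links iterate N + 1 to iterate N, and uniform convergence of holomorphic functions
  closes it. The parameters c0 and cx enter the estimates only through a bound G for the four
  \<gamma>s. All monomials are bounded by G^2 where X and Y are at most 1 / G^2 in modulus, which is
  the source of \<epsilon>.\<close>

lemma deriv_param_continuous:
  fixes f :: "complex \<Rightarrow> 'a::metric_space \<Rightarrow> complex"
  assumes U: "open U" and cont: "continuous_on (U \<times> V) (\<lambda>(z, v). f z v)"
    and hol: "\<And>v. v \<in> V \<Longrightarrow> (\<lambda>z. f z v) holomorphic_on U"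
  shows "continuous_on (U \<times> V) (\<lambda>(z, v). deriv (\<lambda>z. f z v) z)"
proof (unfold continuous_on_eq_continuous_within, intro ballI)
  fix p assume p: "p \<in> U \<times> V"
  obtain z0 v0 where p0: "p = (z0, v0)" by force
  obtain r where r: "r > 0" "cball z0 r \<subseteq> U"
    using U p p0 open_contains_cball[of U] by auto
  \<comment> \<open>Cauchy's formula for the derivative over one fixed circle: an integral over a
    compact interval with jointly continuous integrand is continuous in (z, v), and inside the
    circle it is the derivative.\<close>
  define g where "g = (\<lambda>q. 1 / (2 * of_real pi * \<i>) *
    integral (cbox 0 1) (\<lambda>t. f (circlepath z0 r t) (snd q) / (circlepath z0 r t - fst q)^2
      * vector_derivative (circlepath z0 r) (at t)))"
  have inU: "circlepath z0 r t \<in> U" if "t \<in> {0..1}" for t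
    using that r by (auto simp: circlepath_def dist_norm norm_mult part_circlepath_def)
  have ne: "circlepath z0 r t \<noteq> z" if "z \<in> ball z0 r" for z t
    using that r by (auto simp: circlepath_def part_circlepath_def dist_norm norm_mult)
  have cf: "continuous_on ((ball z0 r \<times> V) \<times> cbox 0 1) (\<lambda>q. f (circlepath z0 r (snd q)) (snd (fst q)))"
    by (rule continuous_on_compose2[OF cont, of _ "\<lambda>q. (circlepath z0 r (snd q), snd (fst q))", simplified])
      (use inU in \<open>auto simp: circlepath_def part_circlepath_def intro!: continuous_intros\<close>)
  have "continuous_on ((ball z0 r \<times> V) \<times> cbox 0 1) (\<lambda>(q, t). f (circlepath z0 r t) (snd q) / (circlepath z0 r t - fst q)^2
      * vector_derivative (circlepath z0 r) (at t))"
    unfolding split_beta vector_derivative_circlepath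
    by (intro continuous_intros cf) (use ne in \<open>auto simp: circlepath_def part_circlepath_def intro!: continuous_intros\<close>)
  then have gc: "continuous_on (ball z0 r \<times> V) g"
    unfolding g_def by (intro continuous_intros integral_continuous_on_param)
  have geq: "g (z, v) = deriv (\<lambda>z. f z v) z" if "z \<in> ball z0 r" "v \<in> V" for z v
  proof -
    have "continuous_on (cball z0 r) (\<lambda>z. f z v)"
      using hol[OF that(2)] holomorphic_on_imp_continuous_on holomorphic_on_subset r by blast
    moreover have "(\<lambda>z. f z v) holomorphic_on ball z0 r"
      using hol[OF that(2)] holomorphic_on_subset r ball_subset_cball by blast
    ultimately have "deriv (\<lambda>z. f z v) z = 1 / (2 * of_real pi * \<i>) * contour_integral (circlepath z0 r) (\<lambda>u. f u v / (u - z)^2)"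
      using Cauchy_derivative_integral_circlepath(2)[of z0 r "\<lambda>z. f z v" z] that
      by (intro DERIV_imp_deriv) auto
    then show ?thesis by (simp add: g_def contour_integral_integral)
  qed
  have "continuous (at p within ball z0 r \<times> V) g"
    using gc p p0 r by (auto simp: continuous_on_eq_continuous_within)
  then have "continuous (at p within ball z0 r \<times> V) (\<lambda>(z, v). deriv (\<lambda>z. f z v) z)"
    unfolding continuous_within using geq p p0 r
    by (subst (asm) Lim_cong_within[where g="\<lambda>(z, v). deriv (\<lambda>z. f z v) z"]) auto
  moreover have "at p within (U \<times> V) = at p within (ball z0 r \<times> V)"
    by (rule at_within_nhd[of _ "ball z0 r \<times> UNIV"])
      (use p p0 r in \<open>auto simp: open_Times subset_iff\<close>)
  ultimately show "continuous (at p within U \<times> V) (\<lambda>(z, v). deriv (\<lambda>z. f z v) z)" by simp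
qed

text \<open>Leibniz's rule asks for a jointly continuous derivative of the integrand. Cauchy's
  formula provides it, so joint continuity and holomorphy in z are all that has to be checked for
  the integrals below.\<close>

lemma has_field_derivative_integral_param:
  fixes f :: "complex \<Rightarrow> real \<Rightarrow> complex"
  assumes U: "open U" and cont: "continuous_on (U \<times> {a..b}) (\<lambda>(z, s). f z s)"
    and hol: "\<And>s. s \<in> {a..b} \<Longrightarrow> (\<lambda>z. f z s) holomorphic_on U" and z: "z \<in> U"
  shows "((\<lambda>z. integral {a..b} (f z)) has_field_derivative
           integral {a..b} (\<lambda>s. deriv (\<lambda>z. f z s) z)) (at z)"
proof -
  obtain r where r: "r > 0" "ball z r \<subseteq> U" using U z open_contains_ball by blast
  have c: "continuous_on {a..b} (f w)" if "w \<in> U" for w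
    using continuous_on_compose2[OF cont, of "{a..b}" "\<lambda>s. (w, s)"] that
    by (simp add: continuous_on_Pair image_subset_iff)
  have "((\<lambda>z. integral (cbox a b) (f z)) has_field_derivative
           integral (cbox a b) (\<lambda>s. deriv (\<lambda>z. f z s) z)) (at z within ball z r)"
  proof (rule leibniz_rule_field_derivative[where fx = "\<lambda>z s. deriv (\<lambda>z. f z s) z"])
    show "((\<lambda>x. f x t) has_field_derivative deriv (\<lambda>z. f z t) x) (at x within ball z r)"
      if "x \<in> ball z r" "t \<in> cbox a b" for x t
      by (rule holomorphic_derivI[OF hol U]) (use that r in auto)
    show "f x integrable_on cbox a b" if "x \<in> ball z r" for x
    proof -
      have "x \<in> U" using that r by blast
      then show ?thesis using c[of x] by (simp add: integrable_continuous_interval)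
    qed
    show "continuous_on (ball z r \<times> cbox a b) (\<lambda>(x, t). deriv (\<lambda>z. f z t) x)"
      by (rule continuous_on_subset[OF deriv_param_continuous[OF U cont hol]]) (use r in auto)
  qed (use r in auto)
  then show ?thesis using r at_within_open[of z "ball z r"] by simp
qed

text \<open>The inductive step of Osgood's lemma: one holomorphic variable z is adjoined to a
  variable y. Total differentiability needs continuity of one partial derivative only; the one in z
  has it by Cauchy's formula, so in y differentiability at the single point suffices.\<close>

lemma has_derivative_pair_holomorphic:
  fixes f :: "'a::real_normed_vector \<Rightarrow> complex \<Rightarrow> complex"
  assumes S: "open S" and cont: "continuous_on S (\<lambda>(y, z). f y z)"
    and hol: "\<And>y z. (y, z) \<in> S \<Longrightarrow> f y field_differentiable (at z)"
    and p: "(y0, z0) \<in> S" and D: "((\<lambda>y. f y z0) has_derivative D) (at y0)"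
  shows "((\<lambda>(y, z). f y z) has_derivative (\<lambda>(h, k). D h + deriv (f y0) z0 * k)) (at (y0, z0))"
proof -
  obtain A B where AB: "open A" "open B" "y0 \<in> A" "z0 \<in> B" "A \<times> B \<subseteq> S"
    by (rule open_prod_elim[OF S p]) auto
  obtain r where r: "r > 0" "ball z0 r \<subseteq> B" using AB open_contains_ball by blast
  have sub: "A \<times> ball z0 r \<subseteq> S" using AB r by auto
  have "continuous_on (ball z0 r \<times> A) (\<lambda>q. (\<lambda>(y, z). f y z) (snd q, fst q))"
    by (rule continuous_on_compose2[OF cont]) (use sub in \<open>auto intro!: continuous_intros\<close>)
  then have c1: "continuous_on (ball z0 r \<times> A) (\<lambda>(z, y). f y z)"
    by (simp add: case_prod_unfold)
  have h1: "(\<lambda>z. f y z) holomorphic_on ball z0 r" if "y \<in> A" for y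
    unfolding holomorphic_on_def
    by (rule ballI, rule field_differentiable_at_within, rule hol) (use sub that in auto)
  have "continuous_on (ball z0 r \<times> A) (\<lambda>(z, y). deriv (\<lambda>z. f y z) z)"
    by (rule deriv_param_continuous[OF open_ball c1 h1])
  then have "continuous_on (A \<times> ball z0 r) (\<lambda>q. (\<lambda>(z, y). deriv (\<lambda>z. f y z) z) (snd q, fst q))"
    by (rule continuous_on_compose2) (auto intro!: continuous_intros)
  then have c2: "continuous_on (A \<times> ball z0 r) (\<lambda>(y, z). deriv (f y) z)"
    by (simp add: case_prod_unfold)
  have "((\<lambda>(y, z). f y z) has_derivative (\<lambda>(h, k). D h + blinfun_mult_right (deriv (f y0) z0) k))
          (at (y0, z0) within A \<times> ball z0 r)"
  proof (rule has_derivative_partialsI)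
    show "((\<lambda>y. f y z0) has_derivative D) (at y0 within A)" using D has_derivative_at_withinI by blast
    show "((\<lambda>z. f x z) has_derivative blinfun_apply (blinfun_mult_right (deriv (f x) y))) (at y within ball z0 r)"
      if "x \<in> A" "y \<in> ball z0 r" for x y
    proof -
      have "(f x has_field_derivative deriv (f x) y) (at y)"
        by (rule field_differentiable_derivI, rule hol) (use sub that in auto)
      then have "(f x has_derivative blinfun_apply (blinfun_mult_right (deriv (f x) y))) (at y)"
        by (simp add: has_field_derivative_def)
      then show ?thesis by (rule has_derivative_at_withinI)
    qed
    have "continuous (at (y0, z0) within A \<times> ball z0 r) (\<lambda>(y, z). deriv (f y) z)"
      using c2 AB r by (auto simp: continuous_on_eq_continuous_within)
    then show "continuous (at (y0, z0) within A \<times> ball z0 r) (\<lambda>(x, y). blinfun_mult_right (deriv (f x) y))"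
      unfolding case_prod_unfold by (rule bounded_linear.continuous[OF bounded_linear_blinfun_mult_right])
  qed (use r in auto)
  moreover have "at (y0, z0) within A \<times> ball z0 r = at (y0, z0)"
    by (rule at_within_open) (use AB r in \<open>auto intro: open_Times\<close>)
  ultimately show ?thesis by simp
qed

text \<open>Osgood's lemma: by Cauchy's estimates the partial derivatives are jointly continuous.\<close>

lemma holomorphic4_onI:
  assumes S: "open S" and cont: "continuous_on S (\<lambda>(a, b, c, d). f a b c d)"
    and 1: "\<And>a b c d. (a, b, c, d) \<in> S \<Longrightarrow> (\<lambda>a. f a b c d) field_differentiable (at a)"
    and 2: "\<And>a b c d. (a, b, c, d) \<in> S \<Longrightarrow> (\<lambda>b. f a b c d) field_differentiable (at b)"
    and 3: "\<And>a b c d. (a, b, c, d) \<in> S \<Longrightarrow> (\<lambda>c. f a b c d) field_differentiable (at c)"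
    and 4: "\<And>a b c d. (a, b, c, d) \<in> S \<Longrightarrow> (\<lambda>d. f a b c d) field_differentiable (at d)"
  shows "holomorphic4_on f S"
proof (unfold holomorphic4_on_def, intro ballI)
  fix p assume p: "p \<in> S"
  obtain a b c d where p0: "p = (a, b, c, d)" using prod_cases4 by blast
  \<comment> \<open>The induction adds variables at the right end of left-nested pairs, the set S
    consists of right-nested quadruples; \<open>g2\<close>, \<open>g3\<close>, \<open>g4\<close>
    translate and freeze the variables that have not been reached yet.\<close>
  have pre: "open {q. g q \<in> S}" "continuous_on {q. g q \<in> S} (\<lambda>q. (\<lambda>(a, b, c, d). f a b c d) (g q))"
    if "continuous_on UNIV g" for g :: "'z::metric_space \<Rightarrow> _"
  proof -
    show "open {q. g q \<in> S}" using that S open_vimage[of S g] by (simp add: vimage_def)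
    show "continuous_on {q. g q \<in> S} (\<lambda>q. (\<lambda>(a, b, c, d). f a b c d) (g q))"
      using continuous_on_compose2[OF cont, of "{q. g q \<in> S}" g] that continuous_on_subset by blast
  qed
  define g2 :: "complex \<times> complex \<Rightarrow> _" where "g2 = (\<lambda>q. (fst q, snd q, c, d))"
  define g3 :: "(complex \<times> complex) \<times> complex \<Rightarrow> _" where "g3 = (\<lambda>q. (fst (fst q), snd (fst q), snd q, d))"
  define g4 :: "((complex \<times> complex) \<times> complex) \<times> complex \<Rightarrow> _"
    where "g4 = (\<lambda>q. (fst (fst (fst q)), snd (fst (fst q)), snd (fst q), snd q))"
  have g: "continuous_on UNIV g2" "continuous_on UNIV g3" "continuous_on UNIV g4"
    unfolding g2_def g3_def g4_def by (intro continuous_intros)+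
  define d1 where "d1 = deriv (\<lambda>a. f a b c d) a"
  define d2 where "d2 = deriv (\<lambda>b. f a b c d) b"
  define d3 where "d3 = deriv (\<lambda>c. f a b c d) c"
  define d4 where "d4 = deriv (\<lambda>d. f a b c d) d"
  have D1: "((\<lambda>a. f a b c d) has_derivative (\<lambda>h. d1 * h)) (at a)"
    using 1 p p0 field_differentiable_derivI has_field_derivative_def d1_def by blast
  have D2: "((\<lambda>(a, b). f a b c d) has_derivative (\<lambda>(h1, h2). d1 * h1 + d2 * h2)) (at (a, b))"
  proof -
    have "((\<lambda>(q, z). f q z c d) has_derivative (\<lambda>(h, k). d1 * h + deriv ((\<lambda>q z. f q z c d) a) b * k)) (at (a, b))"
    proof (rule has_derivative_pair_holomorphic[of "{q. g2 q \<in> S}"])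
      show "open {q. g2 q \<in> S}" by (rule pre[OF g(1)])
      show "continuous_on {q. g2 q \<in> S} (\<lambda>(q, z). f q z c d)"
        using pre(2)[OF g(1)] by (simp add: g2_def case_prod_unfold)
      show "((\<lambda>q z. f q z c d) q) field_differentiable (at z)" if "(q, z) \<in> {q. g2 q \<in> S}" for q z
        using 2 that by (simp add: g2_def)
      show "(a, b) \<in> {q. g2 q \<in> S}" using p by (simp add: p0 g2_def)
      show "((\<lambda>q. f q b c d) has_derivative (\<lambda>h. d1 * h)) (at a)"
        using D1 by (simp add: case_prod_unfold)
    qed
    then show ?thesis by (simp add: d2_def case_prod_unfold)
  qed
  have D3: "((\<lambda>(q, c). f (fst q) (snd q) c d) has_derivative (\<lambda>(h, h3). (d1 * fst h + d2 * snd h) + d3 * h3)) (at ((a, b), c))"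
  proof -
    have "((\<lambda>(q, z). f (fst q) (snd q) z d) has_derivative (\<lambda>(h, k). (d1 * fst h + d2 * snd h) + deriv ((\<lambda>q z. f (fst q) (snd q) z d) (a, b)) c * k)) (at ((a, b), c))"
    proof (rule has_derivative_pair_holomorphic[of "{q. g3 q \<in> S}"])
      show "open {q. g3 q \<in> S}" by (rule pre[OF g(2)])
      show "continuous_on {q. g3 q \<in> S} (\<lambda>(q, z). f (fst q) (snd q) z d)"
        using pre(2)[OF g(2)] by (simp add: g3_def case_prod_unfold)
      show "((\<lambda>q z. f (fst q) (snd q) z d) q) field_differentiable (at z)" if "(q, z) \<in> {q. g3 q \<in> S}" for q z
        using 3 that by (simp add: g3_def)
      show "((a, b), c) \<in> {q. g3 q \<in> S}" using p by (simp add: p0 g3_def)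
      show "((\<lambda>q. f (fst q) (snd q) c d) has_derivative (\<lambda>h. (d1 * fst h + d2 * snd h))) (at (a, b))"
        using D2 by (simp add: case_prod_unfold)
    qed
    then show ?thesis by (simp add: d3_def case_prod_unfold)
  qed
  have D4: "((\<lambda>(q, d). f (fst (fst q)) (snd (fst q)) (snd q) d) has_derivative (\<lambda>(h, h4). (d1 * fst (fst h) + d2 * snd (fst h) + d3 * snd h) + d4 * h4)) (at (((a, b), c), d))"
  proof -
    have "((\<lambda>(q, z). f (fst (fst q)) (snd (fst q)) (snd q) z) has_derivative (\<lambda>(h, k). (d1 * fst (fst h) + d2 * snd (fst h) + d3 * snd h) + deriv ((\<lambda>q z. f (fst (fst q)) (snd (fst q)) (snd q) z) ((a, b), c)) d * k)) (at (((a, b), c), d))"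
    proof (rule has_derivative_pair_holomorphic[of "{q. g4 q \<in> S}"])
      show "open {q. g4 q \<in> S}" by (rule pre[OF g(3)])
      show "continuous_on {q. g4 q \<in> S} (\<lambda>(q, z). f (fst (fst q)) (snd (fst q)) (snd q) z)"
        using pre(2)[OF g(3)] by (simp add: g4_def case_prod_unfold)
      show "((\<lambda>q z. f (fst (fst q)) (snd (fst q)) (snd q) z) q) field_differentiable (at z)" if "(q, z) \<in> {q. g4 q \<in> S}" for q z
        using 4 that by (simp add: g4_def)
      show "(((a, b), c), d) \<in> {q. g4 q \<in> S}" using p by (simp add: p0 g4_def)
      show "((\<lambda>q. f (fst (fst q)) (snd (fst q)) (snd q) d) has_derivative (\<lambda>h. (d1 * fst (fst h) + d2 * snd (fst h) + d3 * snd h))) (at ((a, b), c))"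
        using D3 by (simp add: case_prod_unfold)
    qed
    then show ?thesis by (simp add: d4_def case_prod_unfold)
  qed
  define re :: "complex \<times> complex \<times> complex \<times> complex \<Rightarrow> _"
    where "re = (\<lambda>q. (((fst q, fst (snd q)), fst (snd (snd q))), snd (snd (snd q))))"
  have "(re has_derivative re) (at p)"
    unfolding re_def by (intro derivative_intros)
  moreover have "re p = (((a, b), c), d)" by (simp add: re_def p0)
  ultimately have "((\<lambda>(q, d). f (fst (fst q)) (snd (fst q)) (snd q) d) \<circ> re has_derivative
     (\<lambda>(h, h4). (d1 * fst (fst h) + d2 * snd (fst h) + d3 * snd h) + d4 * h4) \<circ> re) (at p)"
    using diff_chain_at[of re re p] D4 by simp
  then have "((\<lambda>(a, b, c, d). f a b c d) has_derivative
      (\<lambda>(h1, h2, h3, h4). d1 * h1 + d2 * h2 + d3 * h3 + d4 * h4)) (at p)"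
    by (simp add: o_def re_def case_prod_unfold)
  then show "\<exists>a1 a2 a3 a4. ((\<lambda>(c0, cx, \<sigma>, x). f c0 cx \<sigma> x) has_derivative
      (\<lambda>(h1, h2, h3, h4). a1 * h1 + a2 * h2 + a3 * h3 + a4 * h4)) (at p)" by blast
qed

section \<open>Inverting the linear part\<close>

text \<open>The condition \<open>2 * k\<^sup>2 \<le> 1\<close> says that k is the sine of an angle
  of at most pi / 4. Only then do the two directions orthogonal to the edges of the cone k |x| < Im
  x point into the cone.\<close>

locale sectorial =
  fixes k Bd :: real and Bs :: "complex set"
  assumes k_pos: "0 < k" and k_le: "2 * k\<^sup>2 \<le> 1"
    and Bs_open: "open Bs" and Bd: "\<And>\<sigma>. \<sigma> \<in> Bs \<Longrightarrow> norm \<sigma> \<le> Bd" and Bd_nonneg: "0 \<le> Bd"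
begin

definition S :: "real \<Rightarrow> complex set" where
  "S R = {x. k * norm x < Im x \<and> R < norm x}"

text \<open>Beyond this radius the power of x contained in \<open>E n\<close> can destroy at most
  half of the exponential decay along the paths; the summand 1 ensures |x| >= 1.\<close>

definition R0 :: real where "R0 = 2 * (Bd + 1) / k + 1"

definition E :: "int \<Rightarrow> complex \<Rightarrow> complex \<Rightarrow> complex" where
  "E n \<sigma> x = exp (of_int n * x + (of_int n * \<sigma> - of_int \<bar>n\<bar>) * Ln x)"

text \<open>For nonzero n this is the unit vector orthogonal to one edge of the cone: along it Re (n
  x) falls at the rate |n| k while |x| does not decrease. For n = 0 there is no exponential, and the
  path is the radial one, t = (1 + s) x.\<close>

definition wv :: "int \<Rightarrow> complex \<Rightarrow> complex" where
  "wv n x = (if n > 0 then Complex (- k) (sqrt (1 - k\<^sup>2))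
             else if n < 0 then Complex k (sqrt (1 - k\<^sup>2)) else x)"

definition Lk :: "int \<Rightarrow> (complex \<Rightarrow> complex \<Rightarrow> complex) \<Rightarrow> complex \<Rightarrow> complex \<Rightarrow> real \<Rightarrow> complex" where
  "Lk n r \<sigma> x s = E n \<sigma> (x + s * wv n x) / E n \<sigma> x * r \<sigma> (x + s * wv n x) * wv n x"

text \<open>\<open>L n\<close> inverts \<open>d/dx + n + (n \<sigma> - \<bar>n\<bar>) / x\<close>; the path of integration runs from \<open>x\<close> to
  infinity in a direction in which \<open>E n\<close> decays and \<open>\<bar>x\<bar>\<close> increases.\<close>

definition L :: "int \<Rightarrow> (complex \<Rightarrow> complex \<Rightarrow> complex) \<Rightarrow> complex \<Rightarrow> complex \<Rightarrow> complex" where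
  "L n r \<sigma> x = - (\<Sum>j. integral {real j..real j + 1} (Lk n r \<sigma> x))"

text \<open>The decay of the integrand of \<open>L n\<close> in the path parameter. It is decreasing
  and summable over the integers, which is why the improper integral is cut into unit pieces: the
  M-test then gives uniform convergence. For nonzero n it does not depend on n, so one constant
  \<open>CL\<close> serves all operators.\<close>

definition dk :: "int \<Rightarrow> real \<Rightarrow> real" where
  "dk n s = (if n = 0 then 1 / (1 + s)\<^sup>2 else exp (- (k * s / 2)))"

definition CL :: real where
  "CL = (\<Sum>j. dk 0 (real j)) + (\<Sum>j. dk 1 (real j))"

definition hol2 :: "(complex \<Rightarrow> complex \<Rightarrow> complex) \<Rightarrow> bool" where
  "hol2 h \<longleftrightarrow> continuous_on (Bs \<times> S R0) (\<lambda>(\<sigma>, x). h \<sigma> x) \<and>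
     (\<forall>\<sigma>\<in>Bs. h \<sigma> holomorphic_on S R0) \<and> (\<forall>x\<in>S R0. (\<lambda>\<sigma>. h \<sigma> x) holomorphic_on Bs)"

text \<open>The right-hand sides to which \<open>L n\<close> is applied. The radial integral for n =
  0 converges because of the decay x^-2; for the other n boundedness is enough.\<close>

definition adm :: "int \<Rightarrow> (complex \<Rightarrow> complex \<Rightarrow> complex) \<Rightarrow> bool" where
  "adm n r \<longleftrightarrow> hol2 r \<and>
     (\<exists>\<beta>. \<forall>\<sigma>\<in>Bs. \<forall>x\<in>S R0. norm (r \<sigma> x) \<le> \<beta> / norm x ^ (if n = 0 then 2 else 0))"

lemma R0_ge: "1 \<le> R0" "2 * (Bd + 1) / k \<le> R0"
  using k_pos Bd_nonneg by (auto simp: R0_def)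

lemma S_antimono: "R \<le> R' \<Longrightarrow> S R' \<subseteq> S R"
  by (auto simp: S_def)

lemma open_S: "open (S R)"
proof -
  have "S R = {x. k * norm x < Im x} \<inter> {x. R < norm x}" by (auto simp: S_def)
  then show ?thesis
    by (auto intro!: open_Int open_Collect_less continuous_intros)
qed

lemma S_Im: "x \<in> S R \<Longrightarrow> 0 < Im x"
  using k_pos by (auto simp: S_def) (smt (verit) mult_nonneg_nonneg norm_ge_zero)

lemma S_not_nonpos: "x \<in> S R \<Longrightarrow> x \<notin> \<real>\<^sub>\<le>\<^sub>0"
  using S_Im complex_nonpos_Reals_iff by fastforce

lemma S_nonzero: "x \<in> S R \<Longrightarrow> x \<noteq> 0"
  using S_Im by fastforce

lemma S_norm: "x \<in> S R \<Longrightarrow> R < norm x"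
  by (simp add: S_def)

section \<open>Geometry of the paths of integration\<close>

lemma path_nonzero:
  assumes n: "n \<noteq> 0" and x: "x \<in> S R" and s: "0 \<le> s"
  shows "norm (wv n x) = 1" "norm x \<le> norm (x + of_real s * wv n x)"
    "x + of_real s * wv n x \<in> S R"
    "Re (of_int n * (of_real s * wv n x)) = - (\<bar>of_int n\<bar> * k * s)"
proof -
  define q where "q = sqrt (1 - k\<^sup>2)"
  have q: "q\<^sup>2 = 1 - k\<^sup>2" "0 \<le> q" using k_le by (auto simp: q_def)
  have kq: "k \<le> q" using q k_le k_pos by (auto intro: power2_le_imp_le[of k q])
  define p where "p = (if n > 0 then - k else k)"
  have w: "wv n x = Complex p q" using n by (auto simp: wv_def q_def p_def)
  have p: "p\<^sup>2 = k\<^sup>2" "\<bar>p\<bar> = k" using k_pos by (auto simp: p_def)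
  show nw: "norm (wv n x) = 1" using q p by (simp add: w cmod_def)
  have "(Re x)\<^sup>2 + (Im x)\<^sup>2 = (norm x)\<^sup>2" by (simp add: cmod_power2)
  moreover have "(k * norm x)\<^sup>2 \<le> (Im x)\<^sup>2" using x k_pos by (intro power_mono) (auto simp: S_def)
  ultimately have "(Re x)\<^sup>2 \<le> (q * norm x)\<^sup>2" by (simp add: power_mult_distrib q algebra_simps)
  then have "\<bar>Re x\<bar> \<le> q * norm x" using q by (simp add: abs_le_square_iff[symmetric])
  then have "\<bar>p * Re x\<bar> \<le> k * (q * norm x)" using p k_pos by (simp add: abs_mult)
  moreover have "q * (k * norm x) \<le> q * Im x" using x q by (intro mult_left_mono) (auto simp: S_def)
  \<comment> \<open>The inner product of x with the direction of the path is nonnegative on the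
    whole cone, as the direction is orthogonal to one edge; hence the modulus grows.\<close>
  ultimately have inner: "0 \<le> p * Re x + q * Im x" by (simp add: algebra_simps)
  have "(norm (x + of_real s * wv n x))\<^sup>2 = (norm x)\<^sup>2 + 2 * s * (p * Re x + q * Im x) + s\<^sup>2 * (p\<^sup>2 + q\<^sup>2)"
    unfolding cmod_power2 by (simp add: w power2_eq_square algebra_simps)
  then have "(norm x)\<^sup>2 \<le> (norm (x + of_real s * wv n x))\<^sup>2" using inner s by simp
  then show le: "norm x \<le> norm (x + of_real s * wv n x)" by (rule power2_le_imp_le) simp
  \<comment> \<open>In the inequality that defines the cone the left side grows by at most k s and
    the right side by q s; \<open>kq\<close>, and with it the bound on k, keeps the path
    inside.\<close>
  have "k * norm (x + of_real s * wv n x) \<le> k * (norm x + s)"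
    using k_pos s nw norm_triangle_ineq[of x "of_real s * wv n x"] by (intro mult_left_mono) (auto simp: norm_mult)
  also have "\<dots> < Im x + s * q" using x kq s mult_left_mono[OF kq s] by (auto simp: S_def algebra_simps)
  finally show "x + of_real s * wv n x \<in> S R" using le x by (auto simp: S_def w)
  show "Re (of_int n * (of_real s * wv n x)) = - (\<bar>of_int n\<bar> * k * s)"
    using n by (auto simp: w p_def)
qed

lemma path_in_S:
  assumes x: "x \<in> S R" and s: "0 \<le> s"
  shows "x + of_real s * wv n x \<in> S R" and "norm x \<le> norm (x + of_real s * wv n x)"
proof -
  have *: "x + of_real s * x = of_real (1 + s) * x" by (simp add: algebra_simps)
  have "norm (of_real (1 + s) * x) = (1 + s) * norm x" using s by (simp add: norm_mult del: of_real_add)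
  moreover have "(1 + s) * (k * norm x) < (1 + s) * Im x" using x s by (intro mult_strict_left_mono) (auto simp: S_def)
  moreover have le: "norm x \<le> (1 + s) * norm x" using s by (simp add: mult_le_cancel_right1)
  ultimately have "x + of_real s * x \<in> S R \<and> norm x \<le> norm (x + of_real s * x)"
    using x unfolding * S_def by (auto simp: algebra_simps simp del: of_real_add)
  then show "x + of_real s * wv n x \<in> S R" "norm x \<le> norm (x + of_real s * wv n x)"
    using path_nonzero[of n x R s] x s by (cases "n = 0"; simp add: wv_def)+
qed

lemma E_nonzero [simp]: "E n \<sigma> x \<noteq> 0" by (simp add: E_def)

lemma E_0 [simp]: "E 0 \<sigma> x = 1" by (simp add: E_def)

lemma E_has_field_derivative:
  assumes "x \<in> S R"
  shows "(E n \<sigma> has_field_derivative E n \<sigma> x * (of_int n + (of_int n * \<sigma> - of_int \<bar>n\<bar>) / x)) (at x)"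
  unfolding E_def [abs_def] using S_not_nonpos[OF assms] S_nonzero[OF assms]
  by (auto intro!: derivative_eq_intros simp: divide_simps)

lemma E_holomorphic: "E n \<sigma> holomorphic_on S R"
  using E_has_field_derivative by (fastforce simp: holomorphic_on_open open_S)

text \<open>The mean value inequality on the segment, where the derivative 1/u of \<open>Ln\<close>
  is at most 1/|x| because the modulus never drops below its initial value.\<close>

lemma Ln_path_bound:
  assumes n: "n \<noteq> 0" and x: "x \<in> S R" and s: "0 \<le> s"
  shows "norm (Ln (x + of_real s * wv n x) - Ln x) \<le> s / norm x"
proof -
  let ?t = "x + of_real s * wv n x"
  have seg: "u \<in> S R \<and> norm x \<le> norm u" if u: "u \<in> closed_segment x ?t" for u
  proof -
    from u obtain v where v: "0 \<le> v" "v \<le> 1" "u = (1 - v) *\<^sub>R x + v *\<^sub>R ?t"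
      by (auto simp: closed_segment_def)
    then have "u = x + of_real (v * s) * wv n x"
      by (simp add: scaleR_conv_of_real algebra_simps)
    then show ?thesis using path_in_S[OF x, of "v * s"] v s by simp
  qed
  have "norm (Ln ?t - Ln x) \<le> (1 / norm x) * norm (?t - x)"
  proof (rule field_differentiable_bound[where S = "closed_segment x ?t" and f' = "\<lambda>u. 1 / u"])
    fix u assume u: "u \<in> closed_segment x ?t"
    then have uS: "u \<in> S R" and un: "norm x \<le> norm u" using seg by auto
    show "(Ln has_field_derivative 1 / u) (at u within closed_segment x ?t)"
      using S_not_nonpos[OF uS] by (auto intro!: derivative_eq_intros simp: divide_simps)
    show "norm (1 / u) \<le> 1 / norm x"
      using un S_nonzero[OF x] by (simp add: norm_divide frac_le)
  qed auto
  then show ?thesis using path_nonzero(1)[OF n x s] s by (simp add: norm_mult)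
qed

text \<open>The exponential contributes - |n| k s to the exponent and the power of x at most |n| (Bd
  + 1) s / |x|, which is half of that by the choice of \<open>R0\<close>. The remaining |n| k s / 2
  is weakened to k s / 2 to make the bound independent of n.\<close>

lemma E_ratio_bound:
  assumes n: "n \<noteq> 0" and x: "x \<in> S R" and R: "R0 \<le> R" and s: "0 \<le> s" and \<sigma>: "\<sigma> \<in> Bs"
  shows "norm (E n \<sigma> (x + of_real s * wv n x) / E n \<sigma> x) \<le> exp (- (k * s / 2))"
proof -
  let ?t = "x + of_real s * wv n x"
  have xpos: "norm x > 0" using S_nonzero[OF x] by simp
  have "E n \<sigma> ?t / E n \<sigma> x = exp (of_int n * (of_real s * wv n x) + (of_int n * \<sigma> - of_int \<bar>n\<bar>) * (Ln ?t - Ln x))"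
    unfolding E_def by (simp add: exp_diff[symmetric] algebra_simps)
  then have eq: "norm (E n \<sigma> ?t / E n \<sigma> x)
      = exp (- (\<bar>of_int n\<bar> * k * s) + Re ((of_int n * \<sigma> - of_int \<bar>n\<bar>) * (Ln ?t - Ln x)))"
    using path_nonzero(4)[OF n x s] by simp
  have a: "norm (of_int n * \<sigma> - of_int \<bar>n\<bar>) \<le> \<bar>of_int n\<bar> * (Bd + 1)"
  proof -
    have "norm (of_int n * \<sigma> - of_int \<bar>n\<bar>) \<le> norm (of_int n * \<sigma>) + norm (of_int \<bar>n\<bar> :: complex)"
      by (rule norm_triangle_ineq4)
    also have "\<dots> \<le> \<bar>of_int n\<bar> * Bd + \<bar>of_int n\<bar>"
      using Bd[OF \<sigma>] by (simp add: norm_mult mult_left_mono)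
    finally show ?thesis by (simp add: algebra_simps)
  qed
  have "Re ((of_int n * \<sigma> - of_int \<bar>n\<bar>) * (Ln ?t - Ln x)) \<le> norm (of_int n * \<sigma> - of_int \<bar>n\<bar>) * norm (Ln ?t - Ln x)"
    using complex_Re_le_cmod norm_mult by metis
  also have "\<dots> \<le> \<bar>of_int n\<bar> * (Bd + 1) * (s / norm x)"
    using a Ln_path_bound[OF n x s] Bd_nonneg by (intro mult_mono) auto
  also have "\<dots> \<le> \<bar>of_int n\<bar> * (k * s / 2)"
  proof -
    have "2 * (Bd + 1) / k \<le> norm x" using R0_ge R S_norm[OF x] by linarith
    then have "(Bd + 1) / norm x \<le> k / 2" using k_pos xpos by (simp add: field_simps)
    then have "(Bd + 1) / norm x * s \<le> k / 2 * s" using s by (rule mult_right_mono)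
    then have "\<bar>of_int n\<bar> * ((Bd + 1) / norm x * s) \<le> \<bar>of_int n\<bar> * (k / 2 * s)" by (rule mult_left_mono) simp
    then show ?thesis by (simp add: algebra_simps add_divide_distrib)
  qed
  finally have "- (\<bar>of_int n\<bar> * k * s) + Re ((of_int n * \<sigma> - of_int \<bar>n\<bar>) * (Ln ?t - Ln x)) \<le> - (\<bar>of_int n\<bar> * (k * s / 2))"
    by (simp add: algebra_simps)
  also have "\<dots> \<le> - (k * s / 2)"
  proof -
    have "1 \<le> \<bar>real_of_int n\<bar>" using n by (metis abs_ge_zero int_one_le_iff_zero_less of_int_1_le_iff of_int_abs zero_less_abs_iff)
    then show ?thesis using mult_right_mono[of 1 "\<bar>real_of_int n\<bar>" "k * s / 2"] k_pos s by simp
  qed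
  finally show ?thesis using eq by simp
qed

section \<open>Size, differential equation and holomorphy of the operators
  \<open>L n\<close>\<close>

lemma Lk_bound:
  assumes b: "\<And>t. t \<in> S R \<Longrightarrow> norm (r \<sigma> t) \<le> \<beta> * norm t powr (- e)"
    and R: "R0 \<le> R" and e: "0 \<le> e" "n = 0 \<Longrightarrow> 2 \<le> e" and \<sigma>: "\<sigma> \<in> Bs" and x: "x \<in> S R" and s: "0 \<le> s"
  shows "norm (Lk n r \<sigma> x s) \<le> \<beta> * norm x powr (- e + (if n = 0 then 1 else 0)) * dk n s"
proof -
  let ?t = "x + of_real s * wv n x"
  have xpos: "norm x > 0" using S_nonzero[OF x] by simp
  have "0 \<le> \<beta> * norm x powr (- e)" using b[OF x] norm_ge_zero order_trans by blast
  then have \<beta>: "0 \<le> \<beta>" using xpos by (simp add: zero_le_mult_iff)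
  note t = path_in_S[OF x s, of n]
  show ?thesis
  proof (cases "n = 0")
    case False
    have "norm (r \<sigma> ?t) \<le> \<beta> * norm x powr (- e)"
      using b[OF t(1)] mult_left_mono[OF powr_mono2'[of "-e" "norm x" "norm ?t"] \<beta>] t(2) e xpos by force
    then have "norm (Lk n r \<sigma> x s) \<le> exp (- (k * s / 2)) * (\<beta> * norm x powr (- e)) * 1"
      unfolding Lk_def norm_mult using E_ratio_bound[OF False x R s \<sigma>] path_nonzero(1)[OF False x s] \<beta>
      by (intro mult_mono) auto
    then show ?thesis using False by (simp add: dk_def algebra_simps)
  next
    case True
    have *: "?t = of_real (1 + s) * x" using True by (simp add: wv_def algebra_simps)
    have nt: "norm ?t = (1 + s) * norm x" unfolding * using s by (simp add: norm_mult del: of_real_add)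
    have "norm (Lk n r \<sigma> x s) = norm (r \<sigma> ?t) * norm x" using True by (simp add: Lk_def norm_mult wv_def)
    also have "\<dots> \<le> \<beta> * ((1 + s) * norm x) powr (- e) * norm x"
      using b[OF t(1)] nt by (simp add: mult_right_mono)
    \<comment> \<open>The velocity of the radial path contributes the factor |x|: this is the one
      power of x that \<open>L 0\<close> costs, and it recurs in every later estimate at index
      0.\<close>
    also have "\<dots> = \<beta> * norm x powr (- e + 1) * (1 + s) powr (- e)"
      using s by (subst powr_add) (simp add: powr_mult)
    also have "\<dots> \<le> \<beta> * norm x powr (- e + 1) * (1 + s) powr (- 2)"
      using s \<beta> e True by (intro mult_left_mono powr_mono) auto
    also have "(1 + s) powr (- 2) = dk n s"
      using True s by (simp add: dk_def powr_neg_numeral)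
    finally show ?thesis using True by simp
  qed
qed

lemma dk_nonneg: "0 \<le> dk n s" by (simp add: dk_def)

lemma dk_antimono: "0 \<le> s \<Longrightarrow> s \<le> t \<Longrightarrow> dk n t \<le> dk n s"
  using k_pos by (auto simp: dk_def intro!: divide_left_mono power_mono mult_left_mono)

lemma dk_tendsto: "(\<lambda>j. dk n (real j)) \<longlonglongrightarrow> 0" "(\<lambda>j. (1 + real j) * dk 0 (real j)) \<longlonglongrightarrow> 0"
  and dk_summable: "summable (\<lambda>j. dk n (real j))"
proof -
  have 0: "summable (\<lambda>j. dk 0 (real j))"
  proof -
    have "summable (\<lambda>j. 1 / (real (Suc j))\<^sup>2)"
      using inverse_power_summable[of 2, where 'a=real] summable_Suc_iff[of "\<lambda>j. inverse ((real j)\<^sup>2)"]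
      by (simp add: inverse_eq_divide)
    then show ?thesis by (simp add: dk_def add.commute)
  qed
  have 1: "summable (\<lambda>j. dk n (real j))" if "n \<noteq> 0"
  proof -
    have "summable (\<lambda>j. exp (- (k / 2)) ^ j)" using k_pos by (intro summable_geometric) simp
    moreover have "exp (- (k / 2)) ^ j = dk n (real j)" for j
      using that by (simp add: dk_def exp_of_nat_mult[symmetric] algebra_simps)
    ultimately show ?thesis by simp
  qed
  show s: "summable (\<lambda>j. dk n (real j))" using 0 1 by (cases "n = 0") auto
  then show "(\<lambda>j. dk n (real j)) \<longlonglongrightarrow> 0" by (rule summable_LIMSEQ_zero)
  have "(\<lambda>j. 1 / real (Suc j)) \<longlonglongrightarrow> 0" using LIMSEQ_inverse_real_of_nat by (simp add: inverse_eq_divide)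
  then show "(\<lambda>j. (1 + real j) * dk 0 (real j)) \<longlonglongrightarrow> 0"
    by (simp add: dk_def power2_eq_square add.commute)
qed

lemma suminf_dk_le: "(\<Sum>j. dk n (real j)) \<le> CL"
proof -
  have "n \<noteq> 0 \<Longrightarrow> dk n = dk 1" by (auto simp: dk_def)
  moreover have "0 \<le> (\<Sum>j. dk m (real j))" for m by (rule suminf_nonneg[OF dk_summable dk_nonneg])
  ultimately show ?thesis unfolding CL_def by (cases "n = 0") auto
qed

lemma CL_nonneg: "0 \<le> CL"
  using suminf_dk_le[of 0] suminf_nonneg[OF dk_summable dk_nonneg, of 0] by linarith

lemma hol2D:
  assumes "hol2 h"
  shows "continuous_on (Bs \<times> S R0) (\<lambda>(\<sigma>, x). h \<sigma> x)" "\<sigma> \<in> Bs \<Longrightarrow> h \<sigma> holomorphic_on S R0"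
    "x \<in> S R0 \<Longrightarrow> (\<lambda>\<sigma>. h \<sigma> x) holomorphic_on Bs"
  using assms by (auto simp: hol2_def)

lemma continuous_on_E: "continuous_on (UNIV \<times> S R0) (\<lambda>(\<sigma>, x). E n \<sigma> x)"
  unfolding E_def case_prod_unfold
  by (intro continuous_intros) (use S_not_nonpos in auto)

lemma continuous_on_Lk:
  assumes r: "hol2 r"
  shows "continuous_on ((Bs \<times> S R0) \<times> {0..}) (\<lambda>((\<sigma>, x), s). Lk n r \<sigma> x s)"
proof -
  let ?D = "(Bs \<times> S R0) \<times> {0::real..}"
  have w: "continuous_on ?D (\<lambda>q. wv n (snd (fst q)))"
    unfolding wv_def by (cases "n = 0"; cases "n > 0") (auto intro!: continuous_intros)
  have t: "continuous_on ?D (\<lambda>q. (fst (fst q), snd (fst q) + of_real (snd q) * wv n (snd (fst q))))"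
    by (intro continuous_intros w)
  have "continuous_on ?D (\<lambda>q. (\<lambda>(\<sigma>, x). r \<sigma> x) (fst (fst q), snd (fst q) + of_real (snd q) * wv n (snd (fst q))))"
    by (rule continuous_on_compose2[OF hol2D(1)[OF r] t]) (auto intro: path_in_S)
  moreover have "continuous_on ?D (\<lambda>q. (\<lambda>(\<sigma>, x). E n \<sigma> x) (fst (fst q), snd (fst q) + of_real (snd q) * wv n (snd (fst q))))"
    by (rule continuous_on_compose2[OF continuous_on_E t]) (auto intro: path_in_S)
  moreover have "continuous_on ?D (\<lambda>q. (\<lambda>(\<sigma>, x). E n \<sigma> x) (fst q))"
    by (rule continuous_on_compose2[OF continuous_on_E]) (auto intro!: continuous_intros)
  ultimately show ?thesis
    unfolding Lk_def case_prod_unfold by (intro continuous_intros w) (auto simp: case_prod_unfold)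
qed

lemma continuous_on_Lk_s:
  assumes r: "hol2 r" and "\<sigma> \<in> Bs" "x \<in> S R0" "0 \<le> a"
  shows "continuous_on {a..b} (Lk n r \<sigma> x)"
proof -
  have "continuous_on {a..b} (\<lambda>s. (\<lambda>((\<sigma>, x), s). Lk n r \<sigma> x s) ((\<sigma>, x), s))"
    by (rule continuous_on_compose2[OF continuous_on_Lk[OF r]]) (use assms in \<open>auto intro!: continuous_intros\<close>)
  then show ?thesis by simp
qed

lemma piece_bound:
  assumes r: "hol2 r" and b: "\<And>t. t \<in> S R \<Longrightarrow> norm (r \<sigma> t) \<le> \<beta> * norm t powr (- e)"
    and R: "R0 \<le> R" and e: "0 \<le> e" "n = 0 \<Longrightarrow> 2 \<le> e" and \<sigma>: "\<sigma> \<in> Bs" and x: "x \<in> S R"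
  shows "norm (integral {real j..real j + 1} (Lk n r \<sigma> x))
    \<le> \<beta> * norm x powr (- e + (if n = 0 then 1 else 0)) * dk n (real j)"
proof -
  have xpos: "norm x > 0" using S_nonzero[OF x] by simp
  have "0 \<le> \<beta> * norm x powr (- e)" using b[OF x] norm_ge_zero order_trans by blast
  then have \<beta>: "0 \<le> \<beta>" using xpos by (simp add: zero_le_mult_iff)
  have x0: "x \<in> S R0" using x S_antimono[OF R] by auto
  have "norm (integral {real j..real j + 1} (Lk n r \<sigma> x))
    \<le> \<beta> * norm x powr (- e + (if n = 0 then 1 else 0)) * dk n (real j) * (real j + 1 - real j)"
  proof (rule integral_bound)
    fix s assume s: "s \<in> {real j..real j + 1}"
    have "norm (Lk n r \<sigma> x s) \<le> \<beta> * norm x powr (- e + (if n = 0 then 1 else 0)) * dk n s"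
      using s by (intro Lk_bound[where r = r and \<sigma> = \<sigma> and \<beta> = \<beta> and e = e, OF b R e \<sigma> x]) auto
    also have "\<dots> \<le> \<beta> * norm x powr (- e + (if n = 0 then 1 else 0)) * dk n (real j)"
      using s \<beta> by (intro mult_left_mono dk_antimono) auto
    finally show "norm (Lk n r \<sigma> x s) \<le> \<beta> * norm x powr (- e + (if n = 0 then 1 else 0)) * dk n (real j)" .
  qed (use continuous_on_Lk_s[OF r \<sigma> x0] in auto)
  then show ?thesis by simp
qed

lemma L_bound:
  assumes r: "hol2 r" and b: "\<And>t. t \<in> S R \<Longrightarrow> norm (r \<sigma> t) \<le> \<beta> * norm t powr (- e)"
    and R: "R0 \<le> R" and e: "0 \<le> e" "n = 0 \<Longrightarrow> 2 \<le> e" and \<sigma>: "\<sigma> \<in> Bs" and x: "x \<in> S R"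
  shows "summable (\<lambda>j. integral {real j..real j + 1} (Lk n r \<sigma> x))"
    and "norm (L n r \<sigma> x) \<le> CL * \<beta> * norm x powr (- e + (if n = 0 then 1 else 0))"
proof -
  let ?B = "\<beta> * norm x powr (- e + (if n = 0 then 1 else 0))"
  note pb = piece_bound[where r = r and \<sigma> = \<sigma> and \<beta> = \<beta> and e = e, OF r b R e \<sigma> x]
  have sm: "summable (\<lambda>j. ?B * dk n (real j))" by (rule summable_mult[OF dk_summable])
  have xpos: "norm x > 0" using S_nonzero[OF x] by simp
  have "0 \<le> \<beta> * norm x powr (- e)" using b[OF x] norm_ge_zero order_trans by blast
  then have \<beta>: "0 \<le> \<beta>" using xpos by (simp add: zero_le_mult_iff)
  have ns: "summable (\<lambda>j. norm (integral {real j..real j + 1} (Lk n r \<sigma> x)))"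
    by (rule summable_comparison_test'[OF sm, of 0]) (use pb in auto)
  then show "summable (\<lambda>j. integral {real j..real j + 1} (Lk n r \<sigma> x))" by (rule summable_norm_cancel)
  have "norm (L n r \<sigma> x) \<le> (\<Sum>j. norm (integral {real j..real j + 1} (Lk n r \<sigma> x)))"
    unfolding L_def norm_minus_cancel by (rule summable_norm[OF ns])
  also have "\<dots> \<le> (\<Sum>j. ?B * dk n (real j))" by (rule suminf_le[OF pb ns sm])
  also have "\<dots> = ?B * (\<Sum>j. dk n (real j))" by (rule suminf_mult[OF dk_summable])
  also have "\<dots> \<le> ?B * CL" using \<beta> by (intro mult_left_mono suminf_dk_le) auto
  finally show "norm (L n r \<sigma> x) \<le> CL * \<beta> * norm x powr (- e + (if n = 0 then 1 else 0))"
    by (simp add: algebra_simps)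
qed

lemma admE:
  assumes "adm n r"
  obtains \<beta> where "hol2 r" "\<And>\<sigma> t. \<sigma> \<in> Bs \<Longrightarrow> t \<in> S R0 \<Longrightarrow> norm (r \<sigma> t) \<le> \<beta> * norm t powr (- (if n = 0 then 2 else 0))"
proof -
  obtain \<beta> where h: "hol2 r" and
    \<beta>: "\<And>\<sigma> x. \<sigma> \<in> Bs \<Longrightarrow> x \<in> S R0 \<Longrightarrow> norm (r \<sigma> x) \<le> \<beta> / norm x ^ (if n = 0 then 2 else 0)"
    using assms by (auto simp: adm_def)
  have "\<beta> / norm x ^ (if n = 0 then 2 else 0) = \<beta> * norm x powr (- (if n = 0 then 2 else 0))" if "x \<in> S R0" for x
    using S_nonzero[OF that] by (cases "n = 0") (simp_all add: powr_neg_numeral)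
  with h \<beta> that show ?thesis by metis
qed

lemma adm_summable:
  assumes "adm n r" "\<sigma> \<in> Bs" "x \<in> S R0"
  shows "summable (\<lambda>j. integral {real j..real j + 1} (Lk n r \<sigma> x))"
proof -
  obtain \<beta> where \<beta>: "hol2 r" "\<And>\<sigma> t. \<sigma> \<in> Bs \<Longrightarrow> t \<in> S R0 \<Longrightarrow> norm (r \<sigma> t) \<le> \<beta> * norm t powr (- (if n = 0 then 2 else 0))"
    using admE[OF assms(1)] by blast
  show ?thesis by (rule L_bound(1)[where R = R0, OF \<beta>(1) \<beta>(2)[OF assms(2)]]) (use assms in auto)
qed

lemma L_uniform:
  assumes "adm n r"
  shows "uniform_limit (Bs \<times> S R0) (\<lambda>J (\<sigma>, x). \<Sum>j<J. integral {real j..real j + 1} (Lk n r \<sigma> x))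
           (\<lambda>(\<sigma>, x). - L n r \<sigma> x) sequentially"
proof -
  obtain \<beta> where \<beta>: "hol2 r" "\<And>\<sigma> t. \<sigma> \<in> Bs \<Longrightarrow> t \<in> S R0 \<Longrightarrow> norm (r \<sigma> t) \<le> \<beta> * norm t powr (- (if n = 0 then 2 else 0))"
    using admE[OF assms(1)] by blast
  have "norm (integral {real j..real j + 1} (Lk n r \<sigma> x)) \<le> \<bar>\<beta>\<bar> * dk n (real j)"
    if "\<sigma> \<in> Bs" "x \<in> S R0" for \<sigma> x j
  proof -
    have x1: "1 \<le> norm x" using S_norm[OF that(2)] R0_ge by linarith
    have "norm (integral {real j..real j + 1} (Lk n r \<sigma> x))
        \<le> \<beta> * norm x powr (- (if n = 0 then 2 else 0) + (if n = 0 then 1 else 0)) * dk n (real j)"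
      by (rule piece_bound[where R = R0, OF \<beta>(1) \<beta>(2)[OF that(1)]]) (use that in auto)
    also have "\<dots> \<le> \<bar>\<beta>\<bar> * 1 * dk n (real j)"
      using powr_mono[OF _ x1, of "-1" 0] x1 by (intro mult_mono dk_nonneg) auto
    finally show ?thesis by simp
  qed
  then have "uniform_limit (Bs \<times> S R0) (\<lambda>J q. \<Sum>j<J. integral {real j..real j + 1} (Lk n r (fst q) (snd q)))
           (\<lambda>q. \<Sum>j. integral {real j..real j + 1} (Lk n r (fst q) (snd q))) sequentially"
    by (intro Weierstrass_m_test[where M = "\<lambda>j. \<bar>\<beta>\<bar> * dk n (real j)"] summable_mult dk_summable) auto
  then show ?thesis by (simp add: L_def case_prod_unfold)
qed

lemma has_field_derivative_path:
  "((\<lambda>x. x + of_real s * wv n x) has_field_derivative (if n = 0 then 1 + of_real s else 1)) (at x)"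
  unfolding wv_def by (cases "n = 0"; cases "n > 0") (auto intro!: derivative_eq_intros)

text \<open>After multiplication by \<open>E n \<sigma> x\<close> the integrand is g (z + s w) w,
  and its z-derivative is the s-derivative of \<open>G\<close>: for nonzero n since w is constant,
  for n = 0 by the product rule for (1 + s) g ((1 + s) z). So the derivative of a piece is a
  difference of boundary terms.\<close>

lemma Lk_ODE_piece:
  fixes n :: int
  assumes r: "hol2 r" and \<sigma>: "\<sigma> \<in> Bs" and x: "x \<in> S R0"
  defines "G \<equiv> \<lambda>s. E n \<sigma> (x + of_real s * wv n x) * r \<sigma> (x + of_real s * wv n x) * (if n = 0 then 1 + of_real s else 1)"
  shows "((\<lambda>x. E n \<sigma> x * integral {real j..real j + 1} (Lk n r \<sigma> x)) has_field_derivative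
           G (real j + 1) - G (real j)) (at x)"
proof -
  define g where "g = (\<lambda>t. E n \<sigma> t * r \<sigma> t)"
  define c where "c = (\<lambda>s::real. if n = 0 then 1 + complex_of_real s else 1)"
  have gh: "g holomorphic_on S R0"
    unfolding g_def using hol2D(2)[OF r \<sigma>] E_holomorphic by (intro holomorphic_intros) auto
  have dg: "(g has_field_derivative deriv g t) (at t)" if "t \<in> S R0" for t
    using gh open_S that by (rule holomorphic_derivI)
  define H where "H = (\<lambda>z s. g (z + of_real s * wv n z) * wv n z)"
  have EH: "E n \<sigma> z * Lk n r \<sigma> z s = H z s" for z s by (simp add: Lk_def H_def g_def)
  have dw: "(wv n has_field_derivative (if n = 0 then 1 else 0)) (at z)" for z
    unfolding wv_def [abs_def] by (cases "n = 0"; cases "n > 0") (auto intro!: derivative_eq_intros)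
  have dH: "((\<lambda>z. H z s) has_field_derivative
      deriv g (z + of_real s * wv n z) * c s * wv n z + g (z + of_real s * wv n z) * (if n = 0 then 1 else 0)) (at z)"
    if "z \<in> S R0" "0 \<le> s" for z s
  proof -
    have "((\<lambda>z. g (z + of_real s * wv n z)) has_field_derivative deriv g (z + of_real s * wv n z) * c s) (at z)"
      using DERIV_chain2[OF dg[OF path_in_S(1)[OF that]] has_field_derivative_path] by (simp add: c_def)
    from DERIV_mult[OF this dw] show ?thesis by (simp add: H_def algebra_simps)
  qed
  have Hc: "continuous_on (S R0 \<times> {real j..real j + 1}) (\<lambda>(z, s). H z s)"
  proof -
    have w: "continuous_on D (\<lambda>q. wv n (fst q))" for D :: "(complex \<times> real) set"
      unfolding wv_def by (cases "n = 0"; cases "n > 0") (auto intro!: continuous_intros)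
    show ?thesis unfolding H_def case_prod_unfold
      by (intro continuous_intros continuous_on_compose2[OF holomorphic_on_imp_continuous_on[OF gh]] w)
        (auto intro: path_in_S)
  qed
  have "((\<lambda>z. integral {real j..real j + 1} (H z)) has_field_derivative
          integral {real j..real j + 1} (\<lambda>s. deriv (\<lambda>z. H z s) x)) (at x)"
  proof (rule has_field_derivative_integral_param[OF open_S Hc _ x])
    show "(\<lambda>z. H z s) holomorphic_on S R0" if "s \<in> {real j..real j + 1}" for s
    proof -
      have "0 \<le> s" using that by auto
      then show ?thesis using dH by (auto simp: holomorphic_on_open open_S intro!: exI)
    qed
  qed
  moreover have "((\<lambda>s. deriv (\<lambda>z. H z s) x) has_integral G (real j + 1) - G (real j)) {real j..real j + 1}"
  proof (rule fundamental_theorem_of_calculus)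
    fix s assume s: "s \<in> {real j..real j + 1}"
    then have s0: "0 \<le> s" by auto
    have "((\<lambda>z. x + z * wv n x) has_field_derivative wv n x) (at (of_real s))"
      by (auto intro!: derivative_eq_intros)
    from DERIV_chain2[OF dg[OF path_in_S(1)[OF x s0, of n]] this]
    have g1: "((\<lambda>z. g (x + z * wv n x)) has_field_derivative deriv g (x + of_real s * wv n x) * wv n x) (at (of_real s))" .
    have g2: "((\<lambda>z::complex. if n = 0 then 1 + z else 1) has_field_derivative (if n = 0 then 1 else 0)) (at (of_real s))"
      by (cases "n = 0") (auto intro!: derivative_eq_intros)
    have "((\<lambda>z. g (x + z * wv n x) * (if n = 0 then 1 + z else 1)) has_field_derivative
        deriv (\<lambda>z. H z s) x) (at (of_real s))"
      unfolding DERIV_imp_deriv[OF dH[OF x s0]]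
      using DERIV_mult[OF g1 g2] by (simp add: c_def algebra_simps split: if_splits)
    then have "((\<lambda>s. g (x + of_real s * wv n x) * (if n = 0 then 1 + of_real s else 1)) has_vector_derivative
        deriv (\<lambda>z. H z s) x) (at s)"
      by (rule has_vector_derivative_real_field)
    then show "(G has_vector_derivative deriv (\<lambda>z. H z s) x) (at s within {real j..real j + 1})"
      unfolding G_def g_def by (rule has_vector_derivative_at_within)
  qed simp
  ultimately have "((\<lambda>z. integral {real j..real j + 1} (H z)) has_field_derivative G (real j + 1) - G (real j)) (at x)"
    using integral_unique by metis
  moreover have "integral {real j..real j + 1} (H z) = E n \<sigma> z * integral {real j..real j + 1} (Lk n r \<sigma> z)" for z
    unfolding EH[symmetric] by simp
  ultimately show ?thesis by simp
qed

text \<open>The boundary terms of the pieces telescope. The one at s = 0 is the inhomogeneity r, the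
  one at the far end tends to 0; uniform convergence of the partial sums permits differentiation in
  the limit.\<close>

lemma L_has_field_derivative:
  assumes adm: "adm n r" and \<sigma>: "\<sigma> \<in> Bs" and x: "x \<in> S R0"
  shows "(L n r \<sigma> has_field_derivative r \<sigma> x - (of_int n + (of_int n * \<sigma> - of_int \<bar>n\<bar>) / x) * L n r \<sigma> x) (at x)"
proof -
  obtain \<beta> where r: "hol2 r"
    and \<beta>0: "\<And>\<sigma> t. \<sigma> \<in> Bs \<Longrightarrow> t \<in> S R0 \<Longrightarrow> norm (r \<sigma> t) \<le> \<beta> * norm t powr (- (if n = 0 then 2 else 0))"
    using admE[OF adm] by blast
  note \<beta> = \<beta>0[OF \<sigma>]
  define p where "p = (\<lambda>x. of_int n + (of_int n * \<sigma> - of_int \<bar>n\<bar>) / x)"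
  define G where "G = (\<lambda>x s. E n \<sigma> (x + of_real s * wv n x) * r \<sigma> (x + of_real s * wv n x) * (if n = 0 then 1 + complex_of_real s else 1))"
  define P where "P = (\<lambda>J x. \<Sum>j<J. integral {real j..real j + 1} (Lk n r \<sigma> x))"
  have dP: "(P J has_field_derivative (G z (real J) - G z 0) / E n \<sigma> z - p z * P J z) (at z)" if "z \<in> S R0" for J z
  proof -
    have "((\<lambda>z. E n \<sigma> z * P J z) has_field_derivative (\<Sum>j<J. G z (real (Suc j)) - G z (real j))) (at z)"
      unfolding P_def sum_distrib_left
    proof (rule DERIV_sum)
      fix j
      have e: "real (Suc j) = real j + 1" by simp
      show "((\<lambda>z. E n \<sigma> z * integral {real j..real j + 1} (Lk n r \<sigma> z)) has_field_derivative
          G z (real (Suc j)) - G z (real j)) (at z)"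
        unfolding G_def e by (rule Lk_ODE_piece[OF r \<sigma> that])
    qed
    also have "(\<Sum>j<J. G z (real (Suc j)) - G z (real j)) = G z (real J) - G z 0"
      using sum_lessThan_telescope[of "\<lambda>j. G z (real j)" J] by simp
    finally have "((\<lambda>z. E n \<sigma> z * P J z) has_field_derivative G z (real J) - G z 0) (at z)" .
    from DERIV_divide[OF this E_has_field_derivative[OF that, of n \<sigma>] E_nonzero]
    have "(P J has_field_derivative
       ((G z (real J) - G z 0) * E n \<sigma> z - (E n \<sigma> z * P J z) * (E n \<sigma> z * p z)) / (E n \<sigma> z * E n \<sigma> z)) (at z)"
      by (simp add: p_def)
    moreover have "((G z (real J) - G z 0) * E n \<sigma> z - (E n \<sigma> z * P J z) * (E n \<sigma> z * p z)) / (E n \<sigma> z * E n \<sigma> z)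
        = (G z (real J) - G z 0) / E n \<sigma> z - p z * P J z"
      by (simp add: divide_simps) (simp add: algebra_simps)
    ultimately show ?thesis by simp
  qed
  have ul: "uniform_limit (S R0) P (\<lambda>x. - L n r \<sigma> x) sequentially"
    using uniform_limit_compose'[OF L_uniform[OF adm], of "\<lambda>x. (\<sigma>, x)" "S R0"] \<sigma> by (simp add: P_def)
  \<comment> \<open>Uniform limits of holomorphic functions are differentiable, and the derivatives
    converge to the derivative; its value is identified at the end from the pointwise
    limits.\<close>
  obtain g' where g': "\<And>z. z \<in> S R0 \<Longrightarrow> ((\<lambda>x. - L n r \<sigma> x) has_field_derivative g' z) (at z)"
    "\<And>z. z \<in> S R0 \<Longrightarrow> (\<lambda>J. (G z (real J) - G z 0) / E n \<sigma> z - p z * P J z) \<longlonglongrightarrow> g' z"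
  proof -
    have "\<exists>d>0. cball z d \<subseteq> S R0 \<and> uniform_limit (cball z d) P (\<lambda>x. - L n r \<sigma> x) sequentially" if z: "z \<in> S R0" for z
    proof -
      obtain d where "d > 0" "cball z d \<subseteq> S R0" using open_S[of R0] z open_contains_cball[of "S R0"] by auto
      then show ?thesis using uniform_limit_on_subset[OF ul] by auto
    qed
    from has_complex_derivative_uniform_sequence[OF open_S dP this] that show ?thesis by blast
  qed
  have G0: "(\<lambda>J. G x (real J)) \<longlonglongrightarrow> 0"
  proof (rule Lim_null_comparison)
    have "norm (G x (real J)) \<le> norm (E n \<sigma> x) * \<bar>\<beta>\<bar> * (if n = 0 then (1 + real J) * dk 0 (real J) else dk n (real J))" for J
    proof -
      let ?t = "x + of_real (real J) * wv n x"
      have t: "?t \<in> S R0" using path_in_S(1)[OF x, of "real J" n] by simp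
      show ?thesis
      proof (cases "n = 0")
        case False
        have "norm (G x (real J)) = norm (E n \<sigma> x) * norm (E n \<sigma> ?t / E n \<sigma> x) * norm (r \<sigma> ?t)"
          using False by (simp add: G_def norm_mult norm_divide)
        also have "\<dots> \<le> norm (E n \<sigma> x) * dk n (real J) * \<bar>\<beta>\<bar>"
          using E_ratio_bound[OF False x _ _ \<sigma>, of "real J"] \<beta>[OF t] S_nonzero[OF t] False
          by (intro mult_mono) (auto simp: dk_def)
        finally show ?thesis using False by (simp add: algebra_simps)
      next
        case True
        have x1: "1 \<le> norm x" using S_norm[OF x] R0_ge by linarith
        have teq: "?t = of_real (1 + real J) * x" using True by (simp add: wv_def algebra_simps)
        have nt: "norm ?t = (1 + real J) * norm x" unfolding teq by (simp add: norm_mult del: of_real_add of_real_of_nat_eq)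
        have "norm (1 + complex_of_real (real J)) = 1 + real J"
          by (metis norm_of_real of_real_1 of_real_add abs_of_nonneg of_nat_0_le_iff add_nonneg_nonneg zero_le_one)
        then have "norm (G x (real J)) = norm (r \<sigma> ?t) * (1 + real J)"
          using True by (simp add: G_def norm_mult)
        also have "\<dots> \<le> (\<beta> * norm ?t powr (- 2)) * (1 + real J)"
          using \<beta>[OF t] True by (intro mult_right_mono) auto
        also have "\<dots> \<le> (\<bar>\<beta>\<bar> * (1 + real J) powr (- 2)) * (1 + real J)"
          unfolding nt using x1 mult_left_mono[OF x1, of "1 + real J"]
          by (intro mult_right_mono mult_mono powr_mono2') auto
        also have "\<dots> = \<bar>\<beta>\<bar> * ((1 + real J) * dk 0 (real J))"
          by (simp add: dk_def powr_neg_numeral)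
        finally show ?thesis using True by simp
      qed
    qed
    then show "\<forall>\<^sub>F J in sequentially. norm (G x (real J)) \<le> norm (E n \<sigma> x) * \<bar>\<beta>\<bar> * (if n = 0 then (1 + real J) * dk 0 (real J) else dk n (real J))"
      by simp
    show "(\<lambda>J. norm (E n \<sigma> x) * \<bar>\<beta>\<bar> * (if n = 0 then (1 + real J) * dk 0 (real J) else dk n (real J))) \<longlonglongrightarrow> 0"
      using dk_tendsto tendsto_mult_right_zero by (cases "n = 0") auto
  qed
  have "(\<lambda>J. P J x) \<longlonglongrightarrow> - L n r \<sigma> x" using tendsto_uniform_limitI[OF ul x] .
  then have "(\<lambda>J. (G x (real J) - G x 0) / E n \<sigma> x - p x * P J x) \<longlonglongrightarrow> (0 - G x 0) / E n \<sigma> x - p x * (- L n r \<sigma> x)"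
    using G0 by (intro tendsto_intros) auto
  then have "g' x = (0 - G x 0) / E n \<sigma> x - p x * (- L n r \<sigma> x)"
    using g'(2)[OF x] LIMSEQ_unique by blast
  then have "g' x = - (r \<sigma> x - p x * L n r \<sigma> x)" by (simp add: G_def)
  with DERIV_minus[OF g'(1)[OF x]] show ?thesis by (simp add: p_def)
qed

lemma L_hol2:
  assumes adm: "adm n r"
  shows "hol2 (L n r)"
  unfolding hol2_def
proof (intro conjI ballI)
  have r: "hol2 r" using adm by (simp add: adm_def)
  have ci: "continuous_on (Bs \<times> S R0) (\<lambda>q. integral {real j..real j + 1} (Lk n r (fst q) (snd q)))" for j
  proof -
    have "continuous_on ((Bs \<times> S R0) \<times> cbox (real j) (real j + 1)) (\<lambda>(q, s). Lk n r (fst q) (snd q) s)"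
      using continuous_on_subset[OF continuous_on_Lk[OF r, of n], of "(Bs \<times> S R0) \<times> cbox (real j) (real j + 1)"]
      by (force simp: case_prod_unfold)
    from integral_continuous_on_param[OF this] show ?thesis by simp
  qed
  have "continuous_on (Bs \<times> S R0) (\<lambda>(\<sigma>, x). - L n r \<sigma> x)"
    by (rule uniform_limit_theorem[OF _ L_uniform[OF adm]])
      (auto simp: case_prod_unfold intro!: always_eventually continuous_intros ci)
  then show "continuous_on (Bs \<times> S R0) (\<lambda>(\<sigma>, x). L n r \<sigma> x)"
    using continuous_on_minus by (fastforce simp: case_prod_unfold)
  show "L n r \<sigma> holomorphic_on S R0" if "\<sigma> \<in> Bs" for \<sigma>
    using L_has_field_derivative[OF adm that] by (auto simp: holomorphic_on_open open_S)
  show "(\<lambda>\<sigma>. L n r \<sigma> x) holomorphic_on Bs" if x: "x \<in> S R0" for x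
  proof -
    have ul: "uniform_limit Bs (\<lambda>J \<sigma>. \<Sum>j<J. integral {real j..real j + 1} (Lk n r \<sigma> x)) (\<lambda>\<sigma>. - L n r \<sigma> x) sequentially"
      using uniform_limit_compose'[OF L_uniform[OF adm], of "\<lambda>\<sigma>. (\<sigma>, x)" Bs] x by simp
    have h: "(\<lambda>\<sigma>. integral {real j..real j + 1} (Lk n r \<sigma> x)) holomorphic_on Bs" for j
    proof -
      have "continuous_on (Bs \<times> {real j..real j + 1}) (\<lambda>q. (\<lambda>((\<sigma>, x), s). Lk n r \<sigma> x s) ((fst q, x), snd q))"
        by (rule continuous_on_compose2[OF continuous_on_Lk[OF r]]) (use x in \<open>auto intro!: continuous_intros\<close>)
      then have c: "continuous_on (Bs \<times> {real j..real j + 1}) (\<lambda>(\<sigma>, s). Lk n r \<sigma> x s)"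
        by (simp add: case_prod_unfold)
      have "(\<lambda>\<sigma>. Lk n r \<sigma> x s) holomorphic_on Bs" if "s \<in> {real j..real j + 1}" for s
        unfolding Lk_def E_def using hol2D(3)[OF r path_in_S(1)[OF x, of s n]] that
        by (intro holomorphic_intros) auto
      from has_field_derivative_integral_param[OF Bs_open c this] show ?thesis
        by (auto simp: holomorphic_on_open Bs_open)
    qed
    have "(\<lambda>\<sigma>. - L n r \<sigma> x) holomorphic_on Bs"
    proof (rule holomorphic_uniform_sequence[OF Bs_open])
      show "(\<lambda>\<sigma>. \<Sum>j<J. integral {real j..real j + 1} (Lk n r \<sigma> x)) holomorphic_on Bs" for J
        by (intro holomorphic_intros h)
      show "\<exists>d>0. cball z d \<subseteq> Bs \<and> uniform_limit (cball z d) (\<lambda>J \<sigma>. \<Sum>j<J. integral {real j..real j + 1} (Lk n r \<sigma> x)) (\<lambda>\<sigma>. - L n r \<sigma> x) sequentially"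
        if z: "z \<in> Bs" for z
      proof -
        obtain d where "d > 0" "cball z d \<subseteq> Bs" using Bs_open z open_contains_cball[of Bs] by auto
        then show ?thesis using uniform_limit_on_subset[OF ul] by auto
      qed
    qed
    from holomorphic_on_minus[OF this] show ?thesis by simp
  qed
qed

text \<open>The integral from x to infinity of the derivative of \<open>E n * y\<close> is minus its
  value at x, because the growth condition on y makes the contribution of infinity vanish; it
  excludes multiples of the homogeneous solution 1 / \<open>E n\<close>. In this way explicitly
  known solutions are recognised as values of \<open>L n\<close>.\<close>

lemma L_of_derivative:
  assumes y: "\<And>t. t \<in> S R0 \<Longrightarrow> (y has_field_derivative y' t) (at t)"
    and b: "\<And>t. t \<in> S R0 \<Longrightarrow> norm (y t) \<le> C / norm t ^ (if n = 0 then 1 else 0)"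
    and r: "\<And>t. t \<in> S R0 \<Longrightarrow> r \<sigma> t = y' t + (of_int n + (of_int n * \<sigma> - of_int \<bar>n\<bar>) / t) * y t"
    and \<sigma>: "\<sigma> \<in> Bs" and x: "x \<in> S R0"
  shows "L n r \<sigma> x = y x"
proof -
  define G where "G = (\<lambda>s::real. E n \<sigma> (x + of_real s * wv n x) * y (x + of_real s * wv n x) / E n \<sigma> x)"
  have der: "(G has_vector_derivative Lk n r \<sigma> x s) (at s)" if s: "0 \<le> s" for s
  proof -
    let ?t = "x + of_real s * wv n x"
    have t: "?t \<in> S R0" by (rule path_in_S(1)[OF x s])
    have "((\<lambda>t. E n \<sigma> t * y t) has_field_derivative E n \<sigma> ?t * r \<sigma> ?t) (at ?t)"
      using DERIV_mult[OF E_has_field_derivative[OF t] y[OF t]] by (simp add: r[OF t] algebra_simps)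
    then have "((\<lambda>z. E n \<sigma> (x + z * wv n x) * y (x + z * wv n x)) has_field_derivative E n \<sigma> ?t * r \<sigma> ?t * wv n x) (at (of_real s))"
      by (rule DERIV_chain2) (auto intro!: derivative_eq_intros)
    from DERIV_cdivide[OF this, of "E n \<sigma> x"]
    have "((\<lambda>z. E n \<sigma> (x + z * wv n x) * y (x + z * wv n x) / E n \<sigma> x) has_field_derivative Lk n r \<sigma> x s) (at (of_real s))"
      by (simp add: Lk_def)
    then show ?thesis unfolding G_def by (rule has_vector_derivative_real_field)
  qed
  have int: "integral {real j..real j + 1} (Lk n r \<sigma> x) = G (real (Suc j)) - G (real j)" for j
  proof -
    have "(Lk n r \<sigma> x has_integral G (real j + 1) - G (real j)) {real j..real j + 1}"
      by (rule fundamental_theorem_of_calculus) (auto intro!: has_vector_derivative_at_within der)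
    then show ?thesis by (simp add: integral_unique add.commute)
  qed
  have x1: "1 \<le> norm x" using S_norm[OF x] R0_ge by linarith
  have "(\<lambda>j. G (real j)) \<longlonglongrightarrow> 0"
  proof (rule Lim_null_comparison)
    show "\<forall>\<^sub>F j in sequentially. norm (G (real j)) \<le> \<bar>C\<bar> * (if n = 0 then (1 + real j) * dk 0 (real j) else dk n (real j))"
    proof (rule always_eventually, rule allI)
      fix j
      let ?t = "x + of_real (real j) * wv n x"
      have t: "?t \<in> S R0" using path_in_S(1)[OF x, of "real j" n] by simp
      show "norm (G (real j)) \<le> \<bar>C\<bar> * (if n = 0 then (1 + real j) * dk 0 (real j) else dk n (real j))"
      proof (cases "n = 0")
        case False
        have "norm (G (real j)) = norm (E n \<sigma> ?t / E n \<sigma> x) * norm (y ?t)"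
          by (simp add: G_def norm_mult norm_divide)
        also have "\<dots> \<le> dk n (real j) * \<bar>C\<bar>"
          using E_ratio_bound[OF False x _ _ \<sigma>, of "real j"] b[OF t] False
          by (intro mult_mono) (auto simp: dk_def)
        finally show ?thesis using False by (simp add: algebra_simps)
      next
        case True
        have teq: "?t = of_real (1 + real j) * x" using True by (simp add: wv_def algebra_simps)
        have nt: "norm ?t = (1 + real j) * norm x" unfolding teq by (simp add: norm_mult del: of_real_add of_real_of_nat_eq)
        have "norm (G (real j)) \<le> C / norm ?t" using True b[OF t] by (simp add: G_def)
        also have "\<dots> \<le> \<bar>C\<bar> / (1 + real j)"
          unfolding nt using x1 mult_left_mono[OF x1, of "1 + real j"] by (intro frac_le) auto
        also have "\<dots> = \<bar>C\<bar> * ((1 + real j) * dk 0 (real j))"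
          by (simp add: dk_def power2_eq_square)
        finally show ?thesis using True by simp
      qed
    qed
    show "(\<lambda>j. \<bar>C\<bar> * (if n = 0 then (1 + real j) * dk 0 (real j) else dk n (real j))) \<longlonglongrightarrow> 0"
      using dk_tendsto tendsto_mult_right_zero by (cases "n = 0") auto
  qed
  then have "(\<lambda>j. G (real (Suc j)) - G (real j)) sums (0 - G (real 0))" by (rule telescope_sums)
  then show ?thesis by (simp add: L_def int sums_unique[symmetric] G_def)
qed

lemma L_cong:
  assumes "\<And>t. t \<in> S R \<Longrightarrow> r \<sigma> t = r' \<sigma> t" "x \<in> S R"
  shows "L n r \<sigma> x = L n r' \<sigma> x"
proof -
  have "integral {real j..real j + 1} (Lk n r \<sigma> x) = integral {real j..real j + 1} (Lk n r' \<sigma> x)" for j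
    by (rule integral_cong) (use path_in_S(1)[OF assms(2)] assms(1) in \<open>auto simp: Lk_def\<close>)
  then show ?thesis by (simp add: L_def)
qed

lemma L_zero [simp]: "L n (\<lambda>\<sigma> x. 0) \<sigma> x = 0"
  by (simp add: L_def Lk_def [abs_def])

lemma L_add:
  assumes "adm n r" "adm n r'" and \<sigma>: "\<sigma> \<in> Bs" and x: "x \<in> S R0"
  shows "L n (\<lambda>\<sigma> x. r \<sigma> x + r' \<sigma> x) \<sigma> x = L n r \<sigma> x + L n r' \<sigma> x"
proof -
  have "integral {real j..real j + 1} (Lk n (\<lambda>\<sigma> x. r \<sigma> x + r' \<sigma> x) \<sigma> x)
      = integral {real j..real j + 1} (Lk n r \<sigma> x) + integral {real j..real j + 1} (Lk n r' \<sigma> x)" for j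
  proof -
    have "Lk n (\<lambda>\<sigma> x. r \<sigma> x + r' \<sigma> x) \<sigma> x = (\<lambda>s. Lk n r \<sigma> x s + Lk n r' \<sigma> x s)"
      by (simp add: Lk_def fun_eq_iff algebra_simps)
    then show ?thesis using assms
      by (simp add: adm_def integral_add integrable_continuous_interval continuous_on_Lk_s)
  qed
  then have "L n (\<lambda>\<sigma> x. r \<sigma> x + r' \<sigma> x) \<sigma> x
      = - (\<Sum>j. integral {real j..real j + 1} (Lk n r \<sigma> x) + integral {real j..real j + 1} (Lk n r' \<sigma> x))"
    by (simp add: L_def)
  also have "\<dots> = - ((\<Sum>j. integral {real j..real j + 1} (Lk n r \<sigma> x)) + (\<Sum>j. integral {real j..real j + 1} (Lk n r' \<sigma> x)))"
    by (subst suminf_add[OF adm_summable[OF assms(1) \<sigma> x] adm_summable[OF assms(2) \<sigma> x]]) (rule refl)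
  finally show ?thesis by (simp add: L_def)
qed

lemma L_cmult:
  assumes "adm n r" and \<sigma>: "\<sigma> \<in> Bs" and x: "x \<in> S R0"
  shows "L n (\<lambda>\<sigma> x. c \<sigma> * r \<sigma> x) \<sigma> x = c \<sigma> * L n r \<sigma> x"
proof -
  have "integral {real j..real j + 1} (Lk n (\<lambda>\<sigma> x. c \<sigma> * r \<sigma> x) \<sigma> x) = c \<sigma> * integral {real j..real j + 1} (Lk n r \<sigma> x)" for j
  proof -
    have "Lk n (\<lambda>\<sigma> x. c \<sigma> * r \<sigma> x) \<sigma> x = (\<lambda>s. c \<sigma> * Lk n r \<sigma> x s)"
      by (simp add: Lk_def fun_eq_iff algebra_simps)
    then show ?thesis by simp
  qed
  then show ?thesis using suminf_mult[OF adm_summable[OF assms]] by (simp add: L_def)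
qed

end

section \<open>Asymptotic expansions\<close>

locale painleve = sectorial k Bd Bs for k Bd :: real and Bs :: "complex set" +
  fixes \<theta>0 \<theta>x \<theta>inf :: complex
begin

text \<open>The elements of the coefficient ring that are functions of \<sigma> alone: c0 and cx
  stay in the monomials and never reach the coefficients. Holomorphy and boundedness on Bs are
  carried along for the uniform expansions.\<close>

definition PQ :: "(complex \<Rightarrow> complex) set" where
  "PQ = {f. (\<lambda>c0 cx \<sigma>. f \<sigma>) \<in> Qstar \<theta>0 \<theta>x \<theta>inf \<and> f holomorphic_on Bs \<and> (\<exists>C. \<forall>\<sigma>\<in>Bs. norm (f \<sigma>) \<le> C)}"

definition hol2R :: "real \<Rightarrow> (complex \<Rightarrow> complex \<Rightarrow> complex) \<Rightarrow> bool" where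
  "hol2R R h \<longleftrightarrow> continuous_on (Bs \<times> S R) (\<lambda>(\<sigma>, x). h \<sigma> x) \<and>
     (\<forall>\<sigma>\<in>Bs. h \<sigma> holomorphic_on S R) \<and> (\<forall>x\<in>S R. (\<lambda>\<sigma>. h \<sigma> x) holomorphic_on Bs)"

text \<open>The error bounds hold on all of S R instead of merely for large x, so no threshold
  depending on N has to be followed through products and integrals.\<close>

definition asy :: "real \<Rightarrow> (complex \<Rightarrow> complex \<Rightarrow> complex) \<Rightarrow> (complex \<Rightarrow> nat \<Rightarrow> complex) \<Rightarrow> bool" where
  "asy R h F \<longleftrightarrow> hol2R R h \<and> (\<forall>j. (\<lambda>\<sigma>. F \<sigma> j) \<in> PQ) \<and>
     (\<forall>N. \<exists>C. \<forall>\<sigma>\<in>Bs. \<forall>x\<in>S R. norm (h \<sigma> x - (\<Sum>j<N. F \<sigma> j / x ^ j)) \<le> C / norm x ^ N)"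

definition Asy :: "real \<Rightarrow> nat \<Rightarrow> (complex \<Rightarrow> complex \<Rightarrow> complex) \<Rightarrow> bool" where
  "Asy R m h \<longleftrightarrow> (\<exists>F. asy R h F \<and> (\<forall>\<sigma>. \<forall>j<m. F \<sigma> j = 0))"

lemma hol2R_R0: "hol2R R0 = hol2"
  by (simp add: fun_eq_iff hol2R_def hol2_def)

lemma S_ge1: "R0 \<le> R \<Longrightarrow> x \<in> S R \<Longrightarrow> 1 \<le> norm x"
  using S_norm[of x R] R0_ge by linarith

lemma power_pos_of_ge1 [simp]: "1 \<le> a \<Longrightarrow> 0 < a ^ N" for a :: real
  by (rule zero_less_power) linarith

lemma powr_neg_nat: "x \<in> S R \<Longrightarrow> norm x powr (- real N) = 1 / norm x ^ N"
  using S_nonzero[of x R] by (simp add: powr_minus powr_realpow divide_inverse)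

section \<open>Closure properties of coefficients, holomorphic functions and expansions\<close>

lemma PQ_const:
  "(\<lambda>\<sigma>. of_rat q) \<in> PQ" "(\<lambda>\<sigma>. \<theta>0) \<in> PQ" "(\<lambda>\<sigma>. \<theta>x) \<in> PQ" "(\<lambda>\<sigma>. \<theta>inf) \<in> PQ"
  unfolding PQ_def by (intro CollectI conjI Qstar.intros(1-4); auto)+

lemma PQ_sigma: "(\<lambda>\<sigma>. \<sigma>) \<in> PQ"
  unfolding PQ_def using Bd by (intro CollectI conjI Qstar.intros(9)) auto

lemma PQ_add: assumes "f \<in> PQ" "g \<in> PQ" shows "(\<lambda>\<sigma>. f \<sigma> + g \<sigma>) \<in> PQ"
proof -
  obtain C D where "\<And>\<sigma>. \<sigma> \<in> Bs \<Longrightarrow> norm (f \<sigma>) \<le> C" "\<And>\<sigma>. \<sigma> \<in> Bs \<Longrightarrow> norm (g \<sigma>) \<le> D"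
    using assms by (auto simp: PQ_def)
  then have "\<forall>\<sigma>\<in>Bs. norm (f \<sigma> + g \<sigma>) \<le> C + D" by (meson norm_triangle_mono)
  then show ?thesis using assms by (auto simp: PQ_def intro: Qstar.intros(10) holomorphic_intros)
qed

lemma PQ_mult: assumes "f \<in> PQ" "g \<in> PQ" shows "(\<lambda>\<sigma>. f \<sigma> * g \<sigma>) \<in> PQ"
proof -
  obtain C D where CD: "\<And>\<sigma>. \<sigma> \<in> Bs \<Longrightarrow> norm (f \<sigma>) \<le> C" "\<And>\<sigma>. \<sigma> \<in> Bs \<Longrightarrow> norm (g \<sigma>) \<le> D"
    using assms by (auto simp: PQ_def)
  have "norm (f \<sigma> * g \<sigma>) \<le> \<bar>C\<bar> * \<bar>D\<bar>" if "\<sigma> \<in> Bs" for \<sigma>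
    unfolding norm_mult using CD[OF that] by (intro mult_mono) auto
  then show ?thesis using assms by (auto simp: PQ_def intro: Qstar.intros(11) holomorphic_intros)
qed

lemma PQ_rat: "(\<lambda>\<sigma>. of_int a / of_int b) \<in> PQ"
  using PQ_const(1)[of "of_int a / of_int b"] by (simp add: of_rat_divide)

lemma PQ_int: "(\<lambda>\<sigma>. of_int a) \<in> PQ"
  using PQ_rat[of a 1] by simp

lemma PQ_of_nat: "(\<lambda>\<sigma>. of_nat m) \<in> PQ"
  using PQ_int[of "int m"] by simp

lemma PQ_zero: "(\<lambda>\<sigma>. 0) \<in> PQ" and PQ_one: "(\<lambda>\<sigma>. 1) \<in> PQ"
  using PQ_int[of 0] PQ_int[of 1] by simp_all

lemma PQ_numeral: "(\<lambda>\<sigma>. numeral m) \<in> PQ" "(\<lambda>\<sigma>. 1 / numeral m) \<in> PQ"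
  using PQ_int[of "numeral m"] PQ_rat[of 1 "numeral m"] by simp_all

lemma PQ_minus: "f \<in> PQ \<Longrightarrow> (\<lambda>\<sigma>. - f \<sigma>) \<in> PQ"
  using PQ_mult[OF PQ_int[of "-1"]] by simp

lemma PQ_diff: "f \<in> PQ \<Longrightarrow> g \<in> PQ \<Longrightarrow> (\<lambda>\<sigma>. f \<sigma> - g \<sigma>) \<in> PQ"
  using PQ_add[OF _ PQ_minus] by simp

lemma PQ_divide_numeral: "f \<in> PQ \<Longrightarrow> (\<lambda>\<sigma>. f \<sigma> / numeral m) \<in> PQ"
  using PQ_mult[OF _ PQ_numeral(2), of f m] by simp

lemma PQ_power: "f \<in> PQ \<Longrightarrow> (\<lambda>\<sigma>. f \<sigma> ^ m) \<in> PQ"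
  by (induction m) (auto intro: PQ_one PQ_mult)

lemma PQ_sum: "(\<And>i. i \<in> A \<Longrightarrow> f i \<in> PQ) \<Longrightarrow> (\<lambda>\<sigma>. \<Sum>i\<in>A. f i \<sigma>) \<in> PQ"
  by (induction A rule: infinite_finite_induct) (auto intro: PQ_zero PQ_add)

lemma PQ_bounded: assumes "f \<in> PQ" obtains C where "0 \<le> C" "\<And>\<sigma>. \<sigma> \<in> Bs \<Longrightarrow> norm (f \<sigma>) \<le> C"
proof -
  obtain C where "\<And>\<sigma>. \<sigma> \<in> Bs \<Longrightarrow> norm (f \<sigma>) \<le> C" using assms by (auto simp: PQ_def)
  then have "\<And>\<sigma>. \<sigma> \<in> Bs \<Longrightarrow> norm (f \<sigma>) \<le> \<bar>C\<bar>" by (meson abs_ge_self order_trans)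
  then show ?thesis using that[of "\<bar>C\<bar>"] by simp
qed

lemma PQ_holomorphic: "f \<in> PQ \<Longrightarrow> f holomorphic_on Bs"
  by (simp add: PQ_def)

lemma hol2R_sigma: assumes "f holomorphic_on Bs" shows "hol2R R (\<lambda>\<sigma> x. f \<sigma>)"
proof -
  have "continuous_on (Bs \<times> S R) (\<lambda>q. f (fst q))"
    by (rule continuous_on_compose2[OF holomorphic_on_imp_continuous_on[OF assms]]) (auto intro!: continuous_intros)
  then show ?thesis using assms by (simp add: hol2R_def case_prod_unfold)
qed

lemma hol2R_inverse_power: "hol2R R (\<lambda>\<sigma> x. 1 / x ^ m)"
  unfolding hol2R_def case_prod_unfold using S_nonzero
  by (auto intro!: continuous_intros holomorphic_intros)

lemma hol2R_add: "hol2R R f \<Longrightarrow> hol2R R g \<Longrightarrow> hol2R R (\<lambda>\<sigma> x. f \<sigma> x + g \<sigma> x)"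
  unfolding hol2R_def case_prod_unfold by (auto intro!: continuous_intros holomorphic_intros)

lemma hol2R_mult: "hol2R R f \<Longrightarrow> hol2R R g \<Longrightarrow> hol2R R (\<lambda>\<sigma> x. f \<sigma> x * g \<sigma> x)"
  unfolding hol2R_def case_prod_unfold by (auto intro!: continuous_intros holomorphic_intros)

lemma hol2R_cmult: "f holomorphic_on Bs \<Longrightarrow> hol2R R g \<Longrightarrow> hol2R R (\<lambda>\<sigma> x. f \<sigma> * g \<sigma> x)"
  using hol2R_mult[OF hol2R_sigma] .

lemma hol2R_diff: "hol2R R f \<Longrightarrow> hol2R R g \<Longrightarrow> hol2R R (\<lambda>\<sigma> x. f \<sigma> x - g \<sigma> x)"
  using hol2R_add[OF _ hol2R_cmult[of "\<lambda>\<sigma>. -1" R g]] by simp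

lemma hol2R_sum: "(\<And>i. i \<in> A \<Longrightarrow> hol2R R (f i)) \<Longrightarrow> hol2R R (\<lambda>\<sigma> x. \<Sum>i\<in>A. f i \<sigma> x)"
  by (induction A rule: infinite_finite_induct) (auto intro: hol2R_add hol2R_sigma[of "\<lambda>_. 0"])

lemma hol2R_monomial: "f holomorphic_on Bs \<Longrightarrow> hol2R R (\<lambda>\<sigma> x. f \<sigma> / x ^ m)"
  using hol2R_cmult[OF _ hol2R_inverse_power] by simp

lemma hol2R_subset: assumes "hol2R R h" "R \<le> R'" shows "hol2R R' h"
proof -
  have "Bs \<times> S R' \<subseteq> Bs \<times> S R" using S_antimono[OF assms(2)] by auto
  then show ?thesis using assms S_antimono[OF assms(2)] unfolding hol2R_def
    by (meson continuous_on_subset holomorphic_on_subset subsetD)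
qed

lemma asyD:
  assumes "asy R h F"
  shows "hol2R R h" "(\<lambda>\<sigma>. F \<sigma> j) \<in> PQ"
    "\<exists>C\<ge>0. \<forall>\<sigma>\<in>Bs. \<forall>x\<in>S R. norm (h \<sigma> x - (\<Sum>j<N. F \<sigma> j / x ^ j)) \<le> C / norm x ^ N"
proof -
  show "hol2R R h" "(\<lambda>\<sigma>. F \<sigma> j) \<in> PQ" using assms by (auto simp: asy_def)
  obtain C where C: "\<forall>\<sigma>\<in>Bs. \<forall>x\<in>S R. norm (h \<sigma> x - (\<Sum>j<N. F \<sigma> j / x ^ j)) \<le> C / norm x ^ N"
    using assms unfolding asy_def by blast
  have "C / norm x ^ N \<le> \<bar>C\<bar> / norm x ^ N" for x :: complex by (intro divide_right_mono) auto
  with C show "\<exists>C\<ge>0. \<forall>\<sigma>\<in>Bs. \<forall>x\<in>S R. norm (h \<sigma> x - (\<Sum>j<N. F \<sigma> j / x ^ j)) \<le> C / norm x ^ N"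
    by (intro exI[of _ "\<bar>C\<bar>"]) (meson abs_ge_zero order_trans)
qed

lemma asy_const:
  assumes "f \<in> PQ" shows "asy R (\<lambda>\<sigma> x. f \<sigma>) (\<lambda>\<sigma> j. if j = 0 then f \<sigma> else 0)"
  unfolding asy_def
proof (intro conjI allI)
  show "hol2R R (\<lambda>\<sigma> x. f \<sigma>)" using assms by (intro hol2R_sigma PQ_holomorphic)
  show "(\<lambda>\<sigma>. (if j = 0 then f \<sigma> else 0)) \<in> PQ" for j using assms PQ_zero by (cases "j = 0") auto
  obtain C where C: "\<And>\<sigma>. \<sigma> \<in> Bs \<Longrightarrow> norm (f \<sigma>) \<le> C" using PQ_bounded[OF assms] by blast
  fix N
  have "norm (f \<sigma> - (\<Sum>j<N. (if j = 0 then f \<sigma> else 0) / x ^ j)) \<le> C / norm x ^ N" if "\<sigma> \<in> Bs" "x \<in> S R" for \<sigma> x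
  proof (cases N)
    case 0 then show ?thesis using C[OF that(1)] by simp
  next
    case (Suc m)
    have "(\<Sum>j<N. (if j = 0 then f \<sigma> else 0) / x ^ j) = (\<Sum>j<N. if j = 0 then f \<sigma> else 0)"
      by (intro sum.cong) auto
    also have "\<dots> = f \<sigma>" using Suc by simp
    finally show ?thesis using order_trans[OF norm_ge_zero C[OF that(1)]] by simp
  qed
  then show "\<exists>C. \<forall>\<sigma>\<in>Bs. \<forall>x\<in>S R. norm (f \<sigma> - (\<Sum>j<N. (if j = 0 then f \<sigma> else 0) / x ^ j)) \<le> C / norm x ^ N" by blast
qed

lemma asy_inverse: "R0 \<le> R \<Longrightarrow> asy R (\<lambda>\<sigma> x. 1 / x) (\<lambda>\<sigma> j. if j = 1 then 1 else 0)"
  unfolding asy_def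
proof (intro conjI allI)
  assume R: "R0 \<le> R"
  show "hol2R R (\<lambda>\<sigma> x. 1 / x)" using hol2R_inverse_power[of R 1] by simp
  show "(\<lambda>\<sigma>. (if j = 1 then 1 else 0)) \<in> PQ" for j using PQ_zero PQ_one by (cases "j = 1") auto
  fix N :: nat
  have "norm (1 / x - (\<Sum>j<N. (if j = 1 then 1 else 0) / x ^ j)) \<le> 1 / norm x ^ N" if "x \<in> S R" for x
  proof -
    have x1: "1 \<le> norm x" using S_ge1[OF R that] .
    show ?thesis
    proof (cases "N \<le> 1")
      case True
      then have "(\<Sum>j<N. (if j = 1 then 1 else 0) / x ^ j) = 0" by (intro sum.neutral) auto
      moreover have "N = 0 \<or> N = 1" using True by auto
      ultimately show ?thesis using x1 by (auto simp: norm_divide divide_simps)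
    next
      case False
      have "(\<Sum>j<N. (if j = 1 then 1 else 0) / x ^ j) = (\<Sum>j<N. if j = 1 then 1 / x else 0)"
        by (intro sum.cong) auto
      also have "\<dots> = 1 / x" using False by simp
      finally show ?thesis by simp
    qed
  qed
  then show "\<exists>C. \<forall>\<sigma>\<in>Bs. \<forall>x\<in>S R. norm (1 / x - (\<Sum>j<N. (if j = 1 then 1 else 0) / x ^ j)) \<le> C / norm x ^ N" by blast
qed

lemma asy_add:
  assumes "asy R h F" "asy R g G" shows "asy R (\<lambda>\<sigma> x. h \<sigma> x + g \<sigma> x) (\<lambda>\<sigma> j. F \<sigma> j + G \<sigma> j)"
  unfolding asy_def
proof (intro conjI allI)
  show "hol2R R (\<lambda>\<sigma> x. h \<sigma> x + g \<sigma> x)" using assms by (intro hol2R_add asyD)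
  show "(\<lambda>\<sigma>. (F \<sigma> j + G \<sigma> j)) \<in> PQ" for j using assms by (auto intro: PQ_add asyD)
  fix N
  obtain C D where CD: "\<forall>\<sigma>\<in>Bs. \<forall>x\<in>S R. norm (h \<sigma> x - (\<Sum>j<N. F \<sigma> j / x ^ j)) \<le> C / norm x ^ N"
    "\<forall>\<sigma>\<in>Bs. \<forall>x\<in>S R. norm (g \<sigma> x - (\<Sum>j<N. G \<sigma> j / x ^ j)) \<le> D / norm x ^ N"
    using asyD(3)[OF assms(1), of N] asyD(3)[OF assms(2), of N] by blast
  have "norm (h \<sigma> x + g \<sigma> x - (\<Sum>j<N. (F \<sigma> j + G \<sigma> j) / x ^ j)) \<le> (C + D) / norm x ^ N"
    if "\<sigma> \<in> Bs" "x \<in> S R" for \<sigma> x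
  proof -
    have "h \<sigma> x + g \<sigma> x - (\<Sum>j<N. (F \<sigma> j + G \<sigma> j) / x ^ j)
      = (h \<sigma> x - (\<Sum>j<N. F \<sigma> j / x ^ j)) + (g \<sigma> x - (\<Sum>j<N. G \<sigma> j / x ^ j))"
      by (simp add: sum.distrib add_divide_distrib)
    then show ?thesis using CD that norm_triangle_mono by (metis (no_types, lifting) add_divide_distrib)
  qed
  then show "\<exists>C. \<forall>\<sigma>\<in>Bs. \<forall>x\<in>S R. norm (h \<sigma> x + g \<sigma> x - (\<Sum>j<N. (F \<sigma> j + G \<sigma> j) / x ^ j)) \<le> C / norm x ^ N" by blast
qed

lemma asy_coeff_bound:
  assumes "asy R h F" obtains B where "0 \<le> B" "\<And>\<sigma> j. \<sigma> \<in> Bs \<Longrightarrow> j < N \<Longrightarrow> norm (F \<sigma> j) \<le> B"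
proof -
  have "\<forall>j. \<exists>B\<ge>0. \<forall>\<sigma>\<in>Bs. norm (F \<sigma> j) \<le> B" using PQ_bounded[OF asyD(2)[OF assms]] by metis
  then obtain B where B: "\<And>j. 0 \<le> B j" "\<And>j \<sigma>. \<sigma> \<in> Bs \<Longrightarrow> norm (F \<sigma> j) \<le> B j" by metis
  have "norm (F \<sigma> j) \<le> (\<Sum>j<N. B j)" if "\<sigma> \<in> Bs" "j < N" for \<sigma> j
  proof -
    have "B j \<le> (\<Sum>j<N. B j)" using that B(1) by (intro member_le_sum) auto
    then show ?thesis using B(2)[OF that(1), of j] by linarith
  qed
  then show ?thesis using that[of "\<Sum>j<N. B j"] B(1) by (simp add: sum_nonneg)
qed

lemma sum_lessThan_skip: "(\<And>j. j < m \<Longrightarrow> g j = 0) \<Longrightarrow> (\<Sum>j<m + N. g j) = (\<Sum>j<N. g (m + j))"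
  for g :: "nat \<Rightarrow> complex"
  by (induction N) auto

text \<open>The product of two truncations exceeds the truncated Cauchy product by finitely many
  monomials of degree at least N, which go into the error term of \<open>asy_mult\<close>.\<close>

lemma truncated_product:
  fixes a b :: "nat \<Rightarrow> complex"
  shows "(\<Sum>i<N. a i * y ^ i) * (\<Sum>j<N. b j * y ^ j) - (\<Sum>n<N. (\<Sum>i=0..n. a i * b (n - i)) * y ^ n)
    = (\<Sum>(i, j)\<in>{(i, j). i < N \<and> j < N \<and> N \<le> i + j}. a i * b j * y ^ (i + j))"
proof -
  have fin: "finite {(i, j). i < N \<and> j < N}" using finite_cartesian_product[of "{..<N}" "{..<N}"]
    by (rule finite_subset[rotated]) auto
  have "(\<Sum>i<N. a i * y ^ i) * (\<Sum>j<N. b j * y ^ j) = (\<Sum>(i, j)\<in>{..<N} \<times> {..<N}. a i * b j * y ^ (i + j))"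
    by (simp add: sum_product sum.cartesian_product power_add algebra_simps)
  also have "{..<N} \<times> {..<N} = {(i, j). i + j < N} \<union> {(i, j). i < N \<and> j < N \<and> N \<le> i + j}" by auto
  also have "(\<Sum>(i, j)\<in>\<dots>. a i * b j * y ^ (i + j)) = (\<Sum>(i, j)\<in>{(i, j). i + j < N}. a i * b j * y ^ (i + j))
      + (\<Sum>(i, j)\<in>{(i, j). i < N \<and> j < N \<and> N \<le> i + j}. a i * b j * y ^ (i + j))"
    by (rule sum.union_disjoint) (auto intro: finite_subset[OF _ fin])
  also have "(\<Sum>(i, j)\<in>{(i, j). i + j < N}. a i * b j * y ^ (i + j)) = (\<Sum>n<N. \<Sum>i\<le>n. a i * b (n - i) * y ^ (i + (n - i)))"
    by (rule sum.triangle_reindex)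
  also have "\<dots> = (\<Sum>n<N. (\<Sum>i=0..n. a i * b (n - i)) * y ^ n)"
    unfolding sum_distrib_right atMost_atLeast0 by (intro sum.cong) auto
  finally show ?thesis by simp
qed

lemma asy_mult:
  assumes R: "R0 \<le> R" and "asy R h F" "asy R g G"
  shows "asy R (\<lambda>\<sigma> x. h \<sigma> x * g \<sigma> x) (\<lambda>\<sigma> j. \<Sum>i=0..j. F \<sigma> i * G \<sigma> (j - i))"
  unfolding asy_def
proof (intro conjI allI)
  show "hol2R R (\<lambda>\<sigma> x. h \<sigma> x * g \<sigma> x)" using assms by (intro hol2R_mult asyD)
  show "(\<lambda>\<sigma>. (\<Sum>i=0..j. F \<sigma> i * G \<sigma> (j - i))) \<in> PQ" for j
    using assms by (intro PQ_sum PQ_mult asyD) auto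
  fix N
  obtain C D where CD: "0 \<le> C" "0 \<le> D" "\<And>\<sigma> x. \<sigma> \<in> Bs \<Longrightarrow> x \<in> S R \<Longrightarrow> norm (h \<sigma> x - (\<Sum>j<N. F \<sigma> j / x ^ j)) \<le> C / norm x ^ N"
    "\<And>\<sigma> x. \<sigma> \<in> Bs \<Longrightarrow> x \<in> S R \<Longrightarrow> norm (g \<sigma> x - (\<Sum>j<N. G \<sigma> j / x ^ j)) \<le> D / norm x ^ N"
    using asyD(3)[OF assms(2), of N] asyD(3)[OF assms(3), of N] by blast
  obtain G0 where G0: "0 \<le> G0" "\<And>\<sigma> x. \<sigma> \<in> Bs \<Longrightarrow> x \<in> S R \<Longrightarrow> norm (g \<sigma> x) \<le> G0"
    using asyD(3)[OF assms(3), of 0] by auto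
  obtain BF where BF: "0 \<le> BF" "\<And>\<sigma> j. \<sigma> \<in> Bs \<Longrightarrow> j < N \<Longrightarrow> norm (F \<sigma> j) \<le> BF" using asy_coeff_bound[OF assms(2)] by blast
  obtain BG where BG: "0 \<le> BG" "\<And>\<sigma> j. \<sigma> \<in> Bs \<Longrightarrow> j < N \<Longrightarrow> norm (G \<sigma> j) \<le> BG" using asy_coeff_bound[OF assms(3)] by blast
  let ?P = "{(i, j). i < N \<and> j < N \<and> N \<le> i + j}"
  define K where "K = C * G0 + (real N * BF) * D + real (card ?P) * (BF * BG)"
  have "norm (h \<sigma> x * g \<sigma> x - (\<Sum>j<N. (\<Sum>i=0..j. F \<sigma> i * G \<sigma> (j - i)) / x ^ j)) \<le> K / norm x ^ N"
    if \<sigma>: "\<sigma> \<in> Bs" and x: "x \<in> S R" for \<sigma> x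
  proof -
    have x1: "1 \<le> norm x" using S_ge1[OF R x] .
    define HN where "HN = (\<Sum>j<N. F \<sigma> j / x ^ j)"
    define GN where "GN = (\<Sum>j<N. G \<sigma> j / x ^ j)"
    have y: "F \<sigma> j / x ^ j = F \<sigma> j * (1 / x) ^ j" "G \<sigma> j / x ^ j = G \<sigma> j * (1 / x) ^ j"
      "(\<Sum>i=0..j. F \<sigma> i * G \<sigma> (j - i)) / x ^ j = (\<Sum>i=0..j. F \<sigma> i * G \<sigma> (j - i)) * (1 / x) ^ j" for j
      by (simp_all add: power_divide)
    have eq: "HN * GN - (\<Sum>j<N. (\<Sum>i=0..j. F \<sigma> i * G \<sigma> (j - i)) / x ^ j) = (\<Sum>(i, j)\<in>?P. F \<sigma> i * G \<sigma> j * (1 / x) ^ (i + j))"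
      unfolding HN_def GN_def y by (rule truncated_product)
    have "norm (\<Sum>(i, j)\<in>?P. F \<sigma> i * G \<sigma> j * (1 / x) ^ (i + j)) \<le> real (card ?P) * (BF * BG / norm x ^ N)"
    proof (rule sum_norm_bound)
      fix p assume "p \<in> ?P"
      then obtain i j where p: "p = (i, j)" "i < N" "j < N" "N \<le> i + j" by auto
      have "norm (F \<sigma> i * G \<sigma> j * (1 / x) ^ (i + j)) = norm (F \<sigma> i) * norm (G \<sigma> j) / norm x ^ (i + j)"
        by (simp add: norm_mult norm_divide norm_power power_divide)
      also have "\<dots> \<le> BF * BG / norm x ^ N"
        using p x1 BF BG \<sigma> by (intro frac_le mult_mono power_increasing) auto
      finally show "norm (case p of (i, j) \<Rightarrow> F \<sigma> i * G \<sigma> j * (1 / x) ^ (i + j)) \<le> BF * BG / norm x ^ N"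
        using p by simp
    qed
    moreover have "norm HN \<le> real N * BF"
    proof -
      have "norm HN \<le> real (card {..<N}) * BF" unfolding HN_def
      proof (rule sum_norm_bound)
        fix j assume j: "j \<in> {..<N}"
        have "norm (F \<sigma> j / x ^ j) \<le> BF / 1"
          unfolding norm_divide norm_power using BF(1) BF(2)[OF \<sigma>] j x1 by (intro frac_le) auto
        then show "norm (F \<sigma> j / x ^ j) \<le> BF" by simp
      qed
      then show ?thesis by simp
    qed
    then have "norm (HN * (g \<sigma> x - GN)) \<le> (real N * BF) * (D / norm x ^ N)"
      unfolding norm_mult GN_def using CD \<sigma> x BF by (intro mult_mono) auto
    moreover have "norm ((h \<sigma> x - HN) * g \<sigma> x) \<le> (C / norm x ^ N) * G0"
      unfolding norm_mult HN_def using CD G0 \<sigma> x by (intro mult_mono) auto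
    moreover have "h \<sigma> x * g \<sigma> x - (\<Sum>j<N. (\<Sum>i=0..j. F \<sigma> i * G \<sigma> (j - i)) / x ^ j)
       = (h \<sigma> x - HN) * g \<sigma> x + HN * (g \<sigma> x - GN) + (HN * GN - (\<Sum>j<N. (\<Sum>i=0..j. F \<sigma> i * G \<sigma> (j - i)) / x ^ j))"
      by (simp add: algebra_simps)
    ultimately have "norm (h \<sigma> x * g \<sigma> x - (\<Sum>j<N. (\<Sum>i=0..j. F \<sigma> i * G \<sigma> (j - i)) / x ^ j))
      \<le> (C / norm x ^ N) * G0 + (real N * BF) * (D / norm x ^ N) + real (card ?P) * (BF * BG / norm x ^ N)"
      unfolding eq by (smt (verit) norm_triangle_ineq)
    also have "\<dots> = K / norm x ^ N" by (simp add: K_def add_divide_distrib)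
    finally show ?thesis .
  qed
  then show "\<exists>C. \<forall>\<sigma>\<in>Bs. \<forall>x\<in>S R. norm (h \<sigma> x * g \<sigma> x - (\<Sum>j<N. (\<Sum>i=0..j. F \<sigma> i * G \<sigma> (j - i)) / x ^ j)) \<le> C / norm x ^ N" by blast
qed

lemma Asy_const: "f \<in> PQ \<Longrightarrow> Asy R 0 (\<lambda>\<sigma> x. f \<sigma>)"
  using asy_const by (auto simp: Asy_def)

lemma Asy_zero: "Asy R m (\<lambda>\<sigma> x. 0)"
  using asy_const[OF PQ_zero] by (auto simp: Asy_def intro!: exI[of _ "\<lambda>\<sigma> j. 0"])

lemma Asy_mono: "Asy R m h \<Longrightarrow> m' \<le> m \<Longrightarrow> Asy R m' h"
  by (force simp: Asy_def)

lemma Asy_add: "Asy R m h \<Longrightarrow> Asy R m g \<Longrightarrow> Asy R m (\<lambda>\<sigma> x. h \<sigma> x + g \<sigma> x)"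
  unfolding Asy_def
proof (elim exE conjE)
  fix F G assume "asy R h F" "asy R g G" "\<forall>\<sigma>. \<forall>j<m. F \<sigma> j = 0" "\<forall>\<sigma>. \<forall>j<m. G \<sigma> j = 0"
  then show "\<exists>F. asy R (\<lambda>\<sigma> x. h \<sigma> x + g \<sigma> x) F \<and> (\<forall>\<sigma>. \<forall>j<m. F \<sigma> j = 0)"
    by (intro exI[of _ "\<lambda>\<sigma> j. F \<sigma> j + G \<sigma> j"] conjI asy_add) auto
qed

lemma Asy_sum: "(\<And>i. i \<in> A \<Longrightarrow> Asy R m (f i)) \<Longrightarrow> Asy R m (\<lambda>\<sigma> x. \<Sum>i\<in>A. f i \<sigma> x)"
  by (induction A rule: infinite_finite_induct) (auto intro: Asy_zero Asy_add)

lemma Asy_mult: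
  assumes "R0 \<le> R" "Asy R m h" "Asy R m' g" shows "Asy R (m + m') (\<lambda>\<sigma> x. h \<sigma> x * g \<sigma> x)"
proof -
  obtain F G where F: "asy R h F" "\<And>\<sigma> j. j < m \<Longrightarrow> F \<sigma> j = 0" and G: "asy R g G" "\<And>\<sigma> j. j < m' \<Longrightarrow> G \<sigma> j = 0"
    using assms by (auto simp: Asy_def)
  have "(\<Sum>i=0..j. F \<sigma> i * G \<sigma> (j - i)) = 0" if "j < m + m'" for \<sigma> j
  proof (intro sum.neutral ballI)
    fix i assume "i \<in> {0..j}"
    then have "i < m \<or> j - i < m'" using that by auto
    then show "F \<sigma> i * G \<sigma> (j - i) = 0" using F(2) G(2) by auto
  qed
  then show ?thesis using asy_mult[OF assms(1) F(1) G(1)] by (auto simp: Asy_def)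
qed

lemma Asy_cmult: "R0 \<le> R \<Longrightarrow> f \<in> PQ \<Longrightarrow> Asy R m h \<Longrightarrow> Asy R m (\<lambda>\<sigma> x. f \<sigma> * h \<sigma> x)"
  using Asy_mult[OF _ Asy_const] by force

lemma Asy_inverse_power: "R0 \<le> R \<Longrightarrow> Asy R m (\<lambda>\<sigma> x. 1 / x ^ m)"
proof (induction m)
  case 0 then show ?case using Asy_const[OF PQ_one] by simp
next
  case (Suc m)
  have "Asy R 1 (\<lambda>\<sigma> x. 1 / x)" using asy_inverse[OF Suc.prems] by (auto simp: Asy_def)
  from Asy_mult[OF Suc.prems this Suc.IH[OF Suc.prems]] show ?case by simp
qed

lemma Asy_bound:
  assumes "Asy R m h" shows "\<exists>C\<ge>0. \<forall>\<sigma>\<in>Bs. \<forall>x\<in>S R. norm (h \<sigma> x) \<le> C / norm x ^ m"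
proof -
  obtain F where F: "asy R h F" "\<And>\<sigma> j. j < m \<Longrightarrow> F \<sigma> j = 0" using assms by (auto simp: Asy_def)
  then have "(\<Sum>j<m. F \<sigma> j / x ^ j) = 0" for \<sigma> x by (intro sum.neutral) auto
  then show ?thesis using asyD(3)[OF F(1), of m] by simp
qed

lemma Asy_hol: "Asy R m h \<Longrightarrow> hol2R R h"
  by (auto simp: Asy_def dest: asyD)

lemma Asy_adm: assumes "Asy R0 (if n = 0 then 2 else 0) h" shows "adm n h"
  using Asy_bound[OF assms] Asy_hol[OF assms] unfolding adm_def hol2R_R0 by blast

lemma hol2_bounded_adm:
  assumes "hol2 h" "\<And>\<sigma> x. \<sigma> \<in> Bs \<Longrightarrow> x \<in> S R0 \<Longrightarrow> norm (h \<sigma> x) \<le> C / norm x ^ N" "n = 0 \<Longrightarrow> 2 \<le> N"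
  shows "adm n h"
  unfolding adm_def
proof (intro conjI assms(1) exI[of _ "\<bar>C\<bar>"] ballI)
  fix \<sigma> x assume \<sigma>: "\<sigma> \<in> Bs" and x: "x \<in> S R0"
  have "norm (h \<sigma> x) \<le> C / norm x ^ N" by (rule assms(2)[OF \<sigma> x])
  also have "\<dots> \<le> \<bar>C\<bar> / norm x ^ (if n = 0 then 2 else 0)"
    using S_ge1[OF order_refl x] assms(3) by (intro frac_le power_increasing) auto
  finally show "norm (h \<sigma> x) \<le> \<bar>C\<bar> / norm x ^ (if n = 0 then 2 else 0)" .
qed

section \<open>The operators \<open>L n\<close> on asymptotic expansions\<close>

lemma L_bound_nat:
  assumes r: "hol2 r" and b: "\<And>\<sigma> t. \<sigma> \<in> Bs \<Longrightarrow> t \<in> S R0 \<Longrightarrow> norm (r \<sigma> t) \<le> C / norm t ^ N" and N: "n = 0 \<Longrightarrow> 2 \<le> N"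
    and \<sigma>: "\<sigma> \<in> Bs" and x: "x \<in> S R0"
  shows "norm (L n r \<sigma> x) \<le> CL * C / norm x ^ (if n = 0 then N - 1 else N)"
proof -
  have b': "norm (r \<sigma> t) \<le> C * norm t powr (- real N)" if "t \<in> S R0" for t
    using b[OF \<sigma> that] powr_neg_nat[OF that] by simp
  have "norm (L n r \<sigma> x) \<le> CL * C * norm x powr (- real N + (if n = 0 then 1 else 0))"
    by (rule L_bound(2)[OF r b']) (use N \<sigma> x in auto)
  also have "- real N + (if n = 0 then 1 else 0) = - real (if n = 0 then N - 1 else N)" using N by auto
  finally show ?thesis using powr_neg_nat[OF x] by simp
qed

text \<open>The formal power series solution in 1/x, obtained by comparing coefficients. The only
  division is by the integer n, so the coefficients do not leave the ring.\<close>

primrec Lc :: "int \<Rightarrow> (complex \<Rightarrow> nat \<Rightarrow> complex) \<Rightarrow> nat \<Rightarrow> complex \<Rightarrow> complex" where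
  "Lc n F 0 \<sigma> = F \<sigma> 0 / of_int n"
| "Lc n F (Suc j) \<sigma> = (F \<sigma> (Suc j) - (of_int n * \<sigma> - of_int \<bar>n\<bar> - of_nat j) * Lc n F j \<sigma>) / of_int n"

lemma PQ_divide_int: "f \<in> PQ \<Longrightarrow> (\<lambda>\<sigma>. f \<sigma> / of_int n) \<in> PQ"
  using PQ_mult[of f "\<lambda>\<sigma>. of_int 1 / of_int n"] PQ_rat[of 1 n] by simp

lemma Lc_PQ: "(\<And>j. (\<lambda>\<sigma>. F \<sigma> j) \<in> PQ) \<Longrightarrow> Lc n F j \<in> PQ"
proof (induction j)
  case 0
  have "Lc n F 0 = (\<lambda>\<sigma>. F \<sigma> 0 / of_int n)" by (simp add: fun_eq_iff)
  then show ?case using PQ_divide_int[OF 0, of 0 n] by simp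
next
  case (Suc j)
  have "(\<lambda>\<sigma>. (F \<sigma> (Suc j) - (of_int n * \<sigma> - of_int \<bar>n\<bar> - of_int (int j)) * Lc n F j \<sigma>) / of_int n) \<in> PQ"
    by (intro PQ_divide_int PQ_diff PQ_mult Suc PQ_int PQ_sigma)
  moreover have "Lc n F (Suc j) = (\<lambda>\<sigma>. (F \<sigma> (Suc j) - (of_int n * \<sigma> - of_int \<bar>n\<bar> - of_int (int j)) * Lc n F j \<sigma>) / of_int n)"
    by (simp add: fun_eq_iff)
  ultimately show ?case by simp
qed

text \<open>Applied to a truncation of the formal solution, the differential operator reproduces the
  truncated right-hand side up to a single term of order x^-N, produced by the last summand.\<close>

lemma Lc_recursion:
  assumes n: "n \<noteq> 0" and x: "x \<noteq> 0"
  shows "(\<Sum>j<N. - of_nat j * Lc n F j \<sigma> / x ^ Suc j) + (of_int n + (of_int n * \<sigma> - of_int \<bar>n\<bar>) / x) * (\<Sum>j<N. Lc n F j \<sigma> / x ^ j)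
    = (\<Sum>j<N. F \<sigma> j / x ^ j) + (if N = 0 then 0 else (of_int n * \<sigma> - of_int \<bar>n\<bar> - of_nat (N - 1)) * Lc n F (N - 1) \<sigma> / x ^ N)"
proof (induction N)
  case (Suc N)
  have step: "of_int n * Lc n F N \<sigma> = F \<sigma> N - (if N = 0 then 0 else (of_int n * \<sigma> - of_int \<bar>n\<bar> - of_nat (N - 1)) * Lc n F (N - 1) \<sigma>)"
    using n by (cases N) (simp_all del: of_int_abs)
  have "(\<Sum>j<Suc N. - of_nat j * Lc n F j \<sigma> / x ^ Suc j) + (of_int n + (of_int n * \<sigma> - of_int \<bar>n\<bar>) / x) * (\<Sum>j<Suc N. Lc n F j \<sigma> / x ^ j)
    = (\<Sum>j<N. F \<sigma> j / x ^ j) + (if N = 0 then 0 else (of_int n * \<sigma> - of_int \<bar>n\<bar> - of_nat (N - 1)) * Lc n F (N - 1) \<sigma> / x ^ N)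
      + (of_int n * Lc n F N \<sigma>) / x ^ N + (of_int n * \<sigma> - of_int \<bar>n\<bar> - of_nat N) * Lc n F N \<sigma> / x ^ Suc N"
    unfolding sum.lessThan_Suc Suc.IH[symmetric] using x
    by (simp add: algebra_simps add_divide_distrib diff_divide_distrib del: of_int_abs)
  then show ?case unfolding step by (cases "N = 0") (simp_all add: diff_divide_distrib del: of_int_abs Lc.simps)
qed simp

lemma has_field_derivative_inverse_powers:
  assumes "x \<noteq> 0"
  shows "((\<lambda>x. \<Sum>j<N. c j / x ^ j) has_field_derivative (\<Sum>j<N. - of_nat j * c j / x ^ Suc j)) (at (x::complex))"
proof (rule DERIV_sum)
  fix j assume "j \<in> {..<N}"
  show "((\<lambda>x. c j / x ^ j) has_field_derivative - of_nat j * c j / x ^ Suc j) (at x)"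
  proof (cases j)
    case (Suc i)
    have "((\<lambda>x. x ^ j) has_field_derivative of_nat j * x ^ i) (at x)"
      using DERIV_power_Suc[OF DERIV_ident[of "at x"], of i] Suc by simp
    then have "((\<lambda>x. c j / x ^ j) has_field_derivative (0 * x ^ j - c j * (of_nat j * x ^ i)) / (x ^ j * x ^ j)) (at x)"
      by (intro DERIV_divide DERIV_const) (use assms in auto)
    moreover have "(0 * x ^ j - c j * (of_nat j * x ^ i)) / (x ^ j * x ^ j) = - of_nat j * c j / x ^ Suc j"
      using assms Suc by (simp add: divide_simps) (simp add: algebra_simps)
    ultimately show ?thesis by simp
  qed simp
qed

text \<open>The truncation \<open>P\<close> solves the equation exactly with right-hand side
  \<open>DP\<close>, hence \<open>L n\<close> maps \<open>DP\<close> to \<open>P\<close>. The rest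
  \<open>Q\<close> is O(x^-N), an order that \<open>L n\<close> preserves for nonzero n.\<close>

lemma asy_L:
  assumes n: "n \<noteq> 0" and r: "asy R0 r F"
  shows "asy R0 (L n r) (\<lambda>\<sigma> j. Lc n F j \<sigma>)"
  unfolding asy_def
proof (intro conjI allI)
  have adm: "adm n r" by (rule Asy_adm) (use n r in \<open>auto simp: Asy_def\<close>)
  show "hol2R R0 (L n r)" unfolding hol2R_R0 by (rule L_hol2[OF adm])
  have PQ: "Lc n F j \<in> PQ" for j using r asyD(2) Lc_PQ by blast
  then show "(\<lambda>\<sigma>. Lc n F j \<sigma>) \<in> PQ" for j by simp
  fix N
  obtain C where C: "0 \<le> C" "\<And>\<sigma> x. \<sigma> \<in> Bs \<Longrightarrow> x \<in> S R0 \<Longrightarrow> norm (r \<sigma> x - (\<Sum>j<N. F \<sigma> j / x ^ j)) \<le> C / norm x ^ N"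
    using asyD(3)[OF r, of N] by blast
  define e where "e = (\<lambda>\<sigma>. if N = 0 then 0 else (of_int n * \<sigma> - of_int \<bar>n\<bar> - of_int (int (N - 1))) * Lc n F (N - 1) \<sigma>)"
  have ePQ: "e \<in> PQ" unfolding e_def by (cases "N = 0") (auto intro!: PQ_diff PQ_mult PQ PQ_int PQ_sigma PQ_zero PQ_one PQ_of_nat)
  obtain D where D: "0 \<le> D" "\<And>\<sigma>. \<sigma> \<in> Bs \<Longrightarrow> norm (e \<sigma>) \<le> D" using PQ_bounded[OF ePQ] by blast
  define P where "P = (\<lambda>\<sigma> x. \<Sum>j<N. Lc n F j \<sigma> / x ^ j)"
  define DP where "DP = (\<lambda>\<sigma> x. (\<Sum>j<N. F \<sigma> j / x ^ j) + e \<sigma> / x ^ N)"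
  have DPh: "hol2 DP" unfolding DP_def hol2R_R0[symmetric]
    by (intro hol2R_add hol2R_sum hol2R_monomial PQ_holomorphic ePQ asyD(2)[OF r])
  obtain B where B: "0 \<le> B" "\<And>\<sigma> j. \<sigma> \<in> Bs \<Longrightarrow> j < N \<Longrightarrow> norm (F \<sigma> j) \<le> B" using asy_coeff_bound[OF r] by blast
  have mono_le: "norm (c / x ^ j) \<le> Cc" if "norm c \<le> Cc" "x \<in> S R0" for Cc :: real and c :: complex and x j
  proof -
    have "norm (c / x ^ j) \<le> Cc / 1"
      unfolding norm_divide norm_power using that S_ge1[OF order_refl that(2)] by (intro frac_le) (auto intro: order_trans[OF norm_ge_zero])
    then show ?thesis by simp
  qed
  have DPb: "norm (DP \<sigma> x) \<le> (real N * B + D) / norm x ^ 0" if "\<sigma> \<in> Bs" "x \<in> S R0" for \<sigma> x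
  proof -
    have "norm (\<Sum>j<N. F \<sigma> j / x ^ j) \<le> real (card {..<N}) * B"
      by (rule sum_norm_bound) (use B that mono_le in auto)
    moreover have "norm (e \<sigma> / x ^ N) \<le> D" using D that mono_le by blast
    ultimately show ?thesis unfolding DP_def by (simp add: norm_triangle_mono)
  qed
  have admDP: "adm n DP" by (rule hol2_bounded_adm[OF DPh DPb]) (use n in auto)
  define Q where "Q = (\<lambda>\<sigma> x. r \<sigma> x - DP \<sigma> x)"
  have Qh: "hol2 Q" unfolding Q_def using DPh asyD(1)[OF r] hol2R_diff by (auto simp: hol2R_R0[symmetric])
  have Qb: "norm (Q \<sigma> x) \<le> (C + D) / norm x ^ N" if "\<sigma> \<in> Bs" "x \<in> S R0" for \<sigma> x
  proof -
    have "Q \<sigma> x = (r \<sigma> x - (\<Sum>j<N. F \<sigma> j / x ^ j)) - e \<sigma> / x ^ N" by (simp add: Q_def DP_def)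
    moreover have "norm (e \<sigma> / x ^ N) \<le> D / norm x ^ N" using D(2)[OF that(1)] by (simp add: norm_divide norm_power divide_right_mono)
    ultimately show ?thesis using C(2)[OF that] norm_triangle_ineq4[of "r \<sigma> x - (\<Sum>j<N. F \<sigma> j / x ^ j)" "e \<sigma> / x ^ N"]
      by (simp add: add_divide_distrib)
  qed
  have admQ: "adm n Q" by (rule hol2_bounded_adm[OF Qh Qb]) (use n in auto)
  have LP: "L n DP \<sigma> x = P \<sigma> x" if \<sigma>: "\<sigma> \<in> Bs" and x: "x \<in> S R0" for \<sigma> x
  proof (rule L_of_derivative[OF _ _ _ \<sigma> x])
    fix t assume t: "t \<in> S R0"
    have t0: "t \<noteq> 0" using S_nonzero[OF t] .
    show "(P \<sigma> has_field_derivative (\<Sum>j<N. - of_nat j * Lc n F j \<sigma> / t ^ Suc j)) (at t)"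
      unfolding P_def by (rule has_field_derivative_inverse_powers[OF t0])
    show "DP \<sigma> t = (\<Sum>j<N. - of_nat j * Lc n F j \<sigma> / t ^ Suc j) + (of_int n + (of_int n * \<sigma> - of_int \<bar>n\<bar>) / t) * P \<sigma> t"
      unfolding P_def DP_def Lc_recursion[OF n t0] by (simp add: e_def)
    have "norm (P \<sigma> t) \<le> (\<Sum>j<N. norm (Lc n F j \<sigma>))"
      unfolding P_def by (rule sum_norm_le) (use mono_le t in auto)
    then show "norm (P \<sigma> t) \<le> (\<Sum>j<N. norm (Lc n F j \<sigma>)) / norm t ^ (if n = 0 then 1 else 0)" using n by simp
  qed
  have "norm (L n r \<sigma> x - (\<Sum>j<N. Lc n F j \<sigma> / x ^ j)) \<le> CL * (C + D) / norm x ^ N"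
    if \<sigma>: "\<sigma> \<in> Bs" and x: "x \<in> S R0" for \<sigma> x
  proof -
    have "L n r \<sigma> x = L n (\<lambda>\<sigma> x. Q \<sigma> x + DP \<sigma> x) \<sigma> x" by (rule L_cong[OF _ x]) (simp add: Q_def)
    also have "\<dots> = L n Q \<sigma> x + P \<sigma> x" using L_add[OF admQ admDP \<sigma> x] LP[OF \<sigma> x] by simp
    finally show ?thesis using L_bound_nat[OF Qh Qb _ \<sigma> x, of n] n by (simp add: P_def)
  qed
  then show "\<exists>C. \<forall>\<sigma>\<in>Bs. \<forall>x\<in>S R0. norm (L n r \<sigma> x - (\<Sum>j<N. Lc n F j \<sigma> / x ^ j)) \<le> C / norm x ^ N" by blast
qed

text \<open>Termwise integration sends x^-(j+1) to - x^-j / j. At j = 0 the formula divides by zero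
  and yields 0, the correct constant term, as the integral from infinity vanishes there. Truncations
  are compared at order N + 1, since one power is lost.\<close>

lemma asy_L0:
  assumes r: "asy R0 r F" and F: "\<And>\<sigma> j. j < 2 \<Longrightarrow> F \<sigma> j = 0"
  shows "asy R0 (L 0 r) (\<lambda>\<sigma> j. - F \<sigma> (Suc j) / of_int (int j))"
  unfolding asy_def
proof (intro conjI allI)
  have adm: "adm 0 r" by (rule Asy_adm) (use r F in \<open>auto simp: Asy_def\<close>)
  show "hol2R R0 (L 0 r)" unfolding hol2R_R0 by (rule L_hol2[OF adm])
  show PQ: "(\<lambda>\<sigma>. (- F \<sigma> (Suc j) / of_int (int j))) \<in> PQ" for j
    by (intro PQ_divide_int PQ_minus asyD(2)[OF r])
  define G where "G = (\<lambda>j \<sigma>. - F \<sigma> (Suc j) / of_int (int j))"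
  have main: "\<exists>C\<ge>0. \<forall>\<sigma>\<in>Bs. \<forall>x\<in>S R0. norm (L 0 r \<sigma> x - (\<Sum>j<N. G j \<sigma> / x ^ j)) \<le> C / norm x ^ N"
    if N: "1 \<le> N" for N
  proof -
    obtain C where C: "0 \<le> C" "\<And>\<sigma> x. \<sigma> \<in> Bs \<Longrightarrow> x \<in> S R0 \<Longrightarrow> norm (r \<sigma> x - (\<Sum>j<Suc N. F \<sigma> j / x ^ j)) \<le> C / norm x ^ Suc N"
      using asyD(3)[OF r, of "Suc N"] by blast
    define P where "P = (\<lambda>\<sigma> x. \<Sum>j<N. G j \<sigma> / x ^ j)"
    define DP where "DP = (\<lambda>\<sigma> x. \<Sum>j<Suc N. F \<sigma> j / x ^ j)"
    have DPh: "hol2 DP" unfolding DP_def hol2R_R0[symmetric]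
      by (intro hol2R_sum hol2R_monomial PQ_holomorphic asyD(2)[OF r])
    obtain B where B: "0 \<le> B" "\<And>\<sigma> j. \<sigma> \<in> Bs \<Longrightarrow> j < Suc N \<Longrightarrow> norm (F \<sigma> j) \<le> B" using asy_coeff_bound[OF r] by blast
    have DPb: "norm (DP \<sigma> x) \<le> (real (Suc N) * B) / norm x ^ 2" if "\<sigma> \<in> Bs" "x \<in> S R0" for \<sigma> x
    proof -
      have "norm (\<Sum>j<Suc N. F \<sigma> j / x ^ j) \<le> real (card {..<Suc N}) * (B / norm x ^ 2)"
      proof (rule sum_norm_bound)
        fix j assume j: "j \<in> {..<Suc N}"
        show "norm (F \<sigma> j / x ^ j) \<le> B / norm x ^ 2"
        proof (cases "j < 2")
          case True then show ?thesis using F B by simp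
        next
          case False
          then show ?thesis unfolding norm_divide norm_power
            using B that j S_ge1[OF order_refl that(2)] by (intro frac_le power_increasing) auto
        qed
      qed
      then show ?thesis unfolding DP_def by simp
    qed
    have admDP: "adm 0 DP" by (rule hol2_bounded_adm[OF DPh DPb]) auto
    define Q where "Q = (\<lambda>\<sigma> x. r \<sigma> x - DP \<sigma> x)"
    have Qh: "hol2 Q" unfolding Q_def using DPh asyD(1)[OF r] hol2R_diff by (auto simp: hol2R_R0[symmetric])
    have Qb: "norm (Q \<sigma> x) \<le> C / norm x ^ Suc N" if "\<sigma> \<in> Bs" "x \<in> S R0" for \<sigma> x
      using C(2)[OF that] by (simp add: Q_def DP_def)
    have admQ: "adm 0 Q" by (rule hol2_bounded_adm[OF Qh Qb]) (use N in auto)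
    have LP: "L 0 DP \<sigma> x = P \<sigma> x" if \<sigma>: "\<sigma> \<in> Bs" and x: "x \<in> S R0" for \<sigma> x
    proof (rule L_of_derivative[OF _ _ _ \<sigma> x])
      fix t assume t: "t \<in> S R0"
      have t0: "t \<noteq> 0" using S_nonzero[OF t] .
      show "(P \<sigma> has_field_derivative (\<Sum>j<N. - of_nat j * G j \<sigma> / t ^ Suc j)) (at t)"
        unfolding P_def by (rule has_field_derivative_inverse_powers[OF t0])
      have "(\<Sum>j<N. - of_nat j * G j \<sigma> / t ^ Suc j) = (\<Sum>j<N. F \<sigma> (Suc j) / t ^ Suc j)"
        by (intro sum.cong refl) (use F[of 1] in \<open>auto simp: G_def\<close>)
      also have "\<dots> = DP \<sigma> t" unfolding DP_def by (subst sum.lessThan_Suc_shift) (simp add: F)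
      finally show "DP \<sigma> t = (\<Sum>j<N. - of_nat j * G j \<sigma> / t ^ Suc j) + (of_int 0 + (of_int 0 * \<sigma> - of_int \<bar>0\<bar>) / t) * P \<sigma> t"
        by simp
      have "norm (P \<sigma> t) \<le> (\<Sum>j<N. norm (G j \<sigma>) / norm t)"
        unfolding P_def
      proof (rule sum_norm_le)
        fix j show "norm (G j \<sigma> / t ^ j) \<le> norm (G j \<sigma>) / norm t"
        proof (cases "j = 0")
          case True then show ?thesis using F[of 1] by (simp add: G_def)
        next
          case False
          then show ?thesis unfolding norm_divide norm_power
            using power_increasing[of 1 j "norm t"] S_ge1[OF order_refl t] by (intro frac_le) auto
        qed
      qed
      then show "norm (P \<sigma> t) \<le> (\<Sum>j<N. norm (G j \<sigma>)) / norm t ^ (if (0::int) = 0 then 1 else 0)"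
        by (simp add: sum_divide_distrib)
    qed
    have "norm (L 0 r \<sigma> x - (\<Sum>j<N. G j \<sigma> / x ^ j)) \<le> CL * C / norm x ^ N"
      if \<sigma>: "\<sigma> \<in> Bs" and x: "x \<in> S R0" for \<sigma> x
    proof -
      have "L 0 r \<sigma> x = L 0 (\<lambda>\<sigma> x. Q \<sigma> x + DP \<sigma> x) \<sigma> x" by (rule L_cong[OF _ x]) (simp add: Q_def)
      also have "\<dots> = L 0 Q \<sigma> x + P \<sigma> x" using L_add[OF admQ admDP \<sigma> x] LP[OF \<sigma> x] by simp
      finally show ?thesis using L_bound_nat[OF Qh Qb _ \<sigma> x, of 0] N by (simp add: P_def)
    qed
    then show ?thesis using CL_nonneg C(1) by (intro exI[of _ "CL * C"]) auto
  qed
  fix N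
  show "\<exists>C. \<forall>\<sigma>\<in>Bs. \<forall>x\<in>S R0. norm (L 0 r \<sigma> x - (\<Sum>j<N. (- F \<sigma> (Suc j) / of_int (int j)) / x ^ j)) \<le> C / norm x ^ N"
  proof (cases "N = 0")
    case False then show ?thesis using main[of N] by (auto simp: G_def)
  next
    \<comment> \<open>The argument above integrates a remainder of order N + 1, which must be at
      least 2; the bound of order 0 is therefore read off from that of order 1.\<close>
    case True
    obtain C where C: "0 \<le> C" "\<And>\<sigma> x. \<sigma> \<in> Bs \<Longrightarrow> x \<in> S R0 \<Longrightarrow> norm (L 0 r \<sigma> x - (\<Sum>j<1. G j \<sigma> / x ^ j)) \<le> C / norm x ^ 1"
      using main[of 1] by blast
    have "norm (L 0 r \<sigma> x) \<le> C" if "\<sigma> \<in> Bs" "x \<in> S R0" for \<sigma> x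
    proof -
      have "norm (L 0 r \<sigma> x) \<le> C / norm x" using C(2)[OF that] by (simp add: G_def)
      also have "\<dots> \<le> C / 1" using S_ge1[OF order_refl that(2)] C by (intro frac_le) auto
      finally show ?thesis by simp
    qed
    then show ?thesis using True by auto
  qed
qed

lemma Asy_L:
  assumes "n \<noteq> 0" "Asy R0 m r" shows "Asy R0 m (L n r)"
proof -
  obtain F where F: "asy R0 r F" "\<And>\<sigma> j. j < m \<Longrightarrow> F \<sigma> j = 0" using assms by (auto simp: Asy_def)
  have "Lc n F j \<sigma> = 0" if "j < m" for j \<sigma> using that by (induction j) (use F(2) in auto)
  then show ?thesis using asy_L[OF assms(1) F(1)] by (auto simp: Asy_def)
qed

lemma Asy_L0:
  assumes "2 \<le> m" "Asy R0 m r" shows "Asy R0 (m - 1) (L 0 r)"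
proof -
  obtain F where F: "asy R0 r F" "\<And>\<sigma> j. j < m \<Longrightarrow> F \<sigma> j = 0" using assms by (auto simp: Asy_def)
  then have "asy R0 (L 0 r) (\<lambda>\<sigma> j. - F \<sigma> (Suc j) / of_int (int j))" using assms by (intro asy_L0) auto
  then show ?thesis using F(2) by (auto simp: Asy_def)
qed

section \<open>Uniqueness, limits and leading terms of expansions\<close>

lemma inverse_power_coeffs_unique:
  fixes a :: "nat \<Rightarrow> complex"
  assumes b: "\<And>x. x \<in> S R \<Longrightarrow> norm (\<Sum>j<N. a j / x ^ j) \<le> C / norm x ^ N"
  shows "j < N \<Longrightarrow> a j = 0"
proof (induction j rule: less_induct)
  case (less j)
  \<comment> \<open>This is x^j times the sum at x = i t, the coefficients before \<open>a j\<close>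
    being zero by induction. It tends to \<open>a j\<close>, and by the assumed bound also to
    0.\<close>
  let ?f = "\<lambda>t::real. \<Sum>i\<in>{j..<N}. a i / (\<i> * of_real t) ^ (i - j)"
  have lim_inv: "((\<lambda>t::real. c / (\<i> * of_real t) ^ m) \<longlongrightarrow> 0) at_top" if "m > 0" for c m
  proof -
    have "((\<lambda>t::real. norm c * (inverse t) ^ m) \<longlongrightarrow> norm c * 0 ^ m) at_top"
      by (intro tendsto_intros tendsto_inverse_0_at_top filterlim_ident)
    then have "((\<lambda>t::real. norm c * (inverse t) ^ m) \<longlongrightarrow> 0) at_top" using that by (simp add: power_0_left)
    moreover have "\<forall>\<^sub>F t in at_top. norm (c / (\<i> * of_real t) ^ m) \<le> norm c * (inverse t) ^ m"
      using eventually_gt_at_top[of 0] by eventually_elim (auto simp: norm_divide norm_power norm_mult divide_inverse power_inverse norm_inverse power_mult_distrib)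
    ultimately show ?thesis by (rule Lim_null_comparison[rotated])
  qed
  have "(?f \<longlongrightarrow> (\<Sum>i\<in>{j..<N}. if i = j then a j else 0)) at_top"
  proof (rule tendsto_sum)
    fix i assume "i \<in> {j..<N}"
    then show "((\<lambda>t::real. a i / (\<i> * of_real t) ^ (i - j)) \<longlongrightarrow> (if i = j then a j else 0)) at_top"
      using lim_inv[of "i - j" "a i"] by (cases "i = j") auto
  qed
  then have l1: "(?f \<longlongrightarrow> a j) at_top" using less.prems by simp
  have l2: "(?f \<longlongrightarrow> 0) at_top"
  proof (rule Lim_null_comparison)
    have "((\<lambda>t::real. C * (inverse t) ^ (N - j)) \<longlongrightarrow> C * 0 ^ (N - j)) at_top"
      by (intro tendsto_intros tendsto_inverse_0_at_top filterlim_ident)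
    then show "((\<lambda>t::real. C * (inverse t) ^ (N - j)) \<longlongrightarrow> 0) at_top" using less.prems by (simp add: power_0_left)
    show "\<forall>\<^sub>F t in at_top. norm (?f t) \<le> C * (inverse t) ^ (N - j)"
      using eventually_gt_at_top[of "max 0 R"]
    proof eventually_elim
      case (elim t)
      \<comment> \<open>This places the positive imaginary axis, along which the limit is taken,
        inside the cone.\<close>
      have k1: "k < 1"
      proof (rule ccontr)
        assume "\<not> k < 1" then have "1 \<le> k\<^sup>2" by simp
        then show False using k_le by simp
      qed
      define x where "x = \<i> * complex_of_real t"
      have nx: "norm x = t" "x \<noteq> 0" using elim by (auto simp: x_def norm_mult)
      have "x \<in> S R" using elim k1 nx by (auto simp: S_def x_def norm_mult)
      from b[OF this] have b': "norm (\<Sum>i<N. a i / x ^ i) \<le> C / t ^ N" using nx by simp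
      have "(\<Sum>i<N. a i / x ^ i) = (\<Sum>i\<in>{j..<N}. a i / x ^ i)"
        by (rule sum.mono_neutral_right) (use less in auto)
      also have "\<dots> = (\<Sum>i\<in>{j..<N}. a i / x ^ (i - j)) / x ^ j"
        unfolding sum_divide_distrib by (intro sum.cong refl) (auto simp: power_add[symmetric])
      finally have "norm (?f t) / t ^ j \<le> C / t ^ N" using b' nx by (simp add: x_def[symmetric] norm_divide norm_power)
      then have "norm (?f t) \<le> C / t ^ N * t ^ j" using elim by (simp add: divide_le_eq)
      also have "\<dots> = C * (inverse t) ^ (N - j)" using elim less.prems by (simp add: power_diff divide_simps)
      finally show ?case .
    qed
  qed
  show ?case using tendsto_unique[OF _ l1 l2] by simp
qed

text \<open>The approximant of accuracy N determines the first N coefficients of h. By uniqueness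
  those of different approximants agree, so the diagonal \<open>F (Suc j) \<sigma> j\<close> is the
  expansion of h, with coefficients in the ring because each comes from some approximant.\<close>

lemma Asy_limit:
  assumes R: "R0 \<le> R" and h: "hol2R R h"
    and app: "\<And>N. \<exists>g C. Asy R0 m g \<and> (\<forall>\<sigma>\<in>Bs. \<forall>x\<in>S R. norm (h \<sigma> x - g \<sigma> x) \<le> C / norm x ^ N)"
  shows "Asy R m h"
proof -
  have "\<forall>N. \<exists>g C F. asy R0 g F \<and> (\<forall>\<sigma>. \<forall>j<m. F \<sigma> j = 0) \<and> (\<forall>\<sigma>\<in>Bs. \<forall>x\<in>S R. norm (h \<sigma> x - g \<sigma> x) \<le> C / norm x ^ N)"
    using app unfolding Asy_def by blast
  then obtain g C F where g: "\<And>N. asy R0 (g N) (F N)" and Fm: "\<And>N \<sigma> j. j < m \<Longrightarrow> F N \<sigma> j = 0"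
    and C: "\<And>N \<sigma> x. \<sigma> \<in> Bs \<Longrightarrow> x \<in> S R \<Longrightarrow> norm (h \<sigma> x - g N \<sigma> x) \<le> C N / norm x ^ N" by metis
  have "\<forall>N. \<exists>D. \<forall>\<sigma>\<in>Bs. \<forall>x\<in>S R. norm (h \<sigma> x - (\<Sum>j<N. F N \<sigma> j / x ^ j)) \<le> D / norm x ^ N"
  proof
    fix N
    obtain D where D: "\<And>\<sigma> x. \<sigma> \<in> Bs \<Longrightarrow> x \<in> S R0 \<Longrightarrow> norm (g N \<sigma> x - (\<Sum>j<N. F N \<sigma> j / x ^ j)) \<le> D / norm x ^ N"
      using asyD(3)[OF g] by blast
    have "norm (h \<sigma> x - (\<Sum>j<N. F N \<sigma> j / x ^ j)) \<le> (C N + D) / norm x ^ N" if "\<sigma> \<in> Bs" "x \<in> S R" for \<sigma> x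
    proof -
      have "x \<in> S R0" using that S_antimono[OF R] by auto
      from C[OF that, of N] D[OF that(1) this] show ?thesis
        using norm_triangle_ineq[of "h \<sigma> x - g N \<sigma> x" "g N \<sigma> x - (\<Sum>j<N. F N \<sigma> j / x ^ j)"]
        by (simp add: add_divide_distrib)
    qed
    then show "\<exists>D. \<forall>\<sigma>\<in>Bs. \<forall>x\<in>S R. norm (h \<sigma> x - (\<Sum>j<N. F N \<sigma> j / x ^ j)) \<le> D / norm x ^ N" by blast
  qed
  then obtain D where D: "\<And>N \<sigma> x. \<sigma> \<in> Bs \<Longrightarrow> x \<in> S R \<Longrightarrow> norm (h \<sigma> x - (\<Sum>j<N. F N \<sigma> j / x ^ j)) \<le> D N / norm x ^ N"
    by metis
  have F_Suc: "F (Suc N) \<sigma> j = F N \<sigma> j" if \<sigma>: "\<sigma> \<in> Bs" and j: "j < N" for \<sigma> N j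
  proof -
    obtain B where B: "\<And>\<sigma>. \<sigma> \<in> Bs \<Longrightarrow> norm (F (Suc N) \<sigma> N) \<le> B" using PQ_bounded[OF asyD(2)[OF g]] by metis
    have "norm (\<Sum>j<N. (F (Suc N) \<sigma> j - F N \<sigma> j) / x ^ j) \<le> (D N + \<bar>D (Suc N)\<bar> + B) / norm x ^ N" if x: "x \<in> S R" for x
    proof -
      have x1: "1 \<le> norm x" by (rule S_ge1[OF R x])
      have "(\<Sum>j<N. (F (Suc N) \<sigma> j - F N \<sigma> j) / x ^ j)
        = (h \<sigma> x - (\<Sum>j<N. F N \<sigma> j / x ^ j)) - (h \<sigma> x - (\<Sum>j<Suc N. F (Suc N) \<sigma> j / x ^ j)) - F (Suc N) \<sigma> N / x ^ N"
        by (simp add: sum_subtractf diff_divide_distrib)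
      moreover have "norm (F (Suc N) \<sigma> N / x ^ N) \<le> B / norm x ^ N"
        using B[OF \<sigma>] by (simp add: norm_divide norm_power divide_right_mono)
      moreover have "D (Suc N) / norm x ^ Suc N \<le> \<bar>D (Suc N)\<bar> / norm x ^ N"
        using x1 zero_less_power[of "norm x" N] by (intro frac_le power_increasing) auto
      ultimately show ?thesis
        using D[OF \<sigma> x, of N] D[OF \<sigma> x, of "Suc N"] norm_triangle_ineq4[of "h \<sigma> x - (\<Sum>j<N. F N \<sigma> j / x ^ j)" "h \<sigma> x - (\<Sum>j<Suc N. F (Suc N) \<sigma> j / x ^ j)"]
          norm_triangle_ineq4[of "(h \<sigma> x - (\<Sum>j<N. F N \<sigma> j / x ^ j)) - (h \<sigma> x - (\<Sum>j<Suc N. F (Suc N) \<sigma> j / x ^ j))" "F (Suc N) \<sigma> N / x ^ N"]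
        by (simp add: add_divide_distrib)
    qed
    from inverse_power_coeffs_unique[OF this j] show ?thesis by simp
  qed
  have F_eq: "F N \<sigma> j = F (Suc j) \<sigma> j" if "\<sigma> \<in> Bs" "j < N" for \<sigma> N j
    using that(2) by (induction N) (use F_Suc[OF that(1)] in \<open>auto simp: less_Suc_eq\<close>)
  define G where "G = (\<lambda>\<sigma> j. F (Suc j) \<sigma> j)"
  have "asy R h G"
    unfolding asy_def
  proof (intro conjI allI h)
    show "(\<lambda>\<sigma>. G \<sigma> j) \<in> PQ" for j using asyD(2)[OF g] by (simp add: G_def)
    fix N
    have "(\<Sum>j<N. G \<sigma> j / x ^ j) = (\<Sum>j<N. F N \<sigma> j / x ^ j)" if "\<sigma> \<in> Bs" for \<sigma> x
    proof (rule sum.cong)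
      fix j assume "j \<in> {..<N}"
      then have "F N \<sigma> j = F (Suc j) \<sigma> j" using F_eq[OF that] by blast
      then show "G \<sigma> j / x ^ j = F N \<sigma> j / x ^ j" by (simp only: G_def)
    qed simp
    then show "\<exists>C. \<forall>\<sigma>\<in>Bs. \<forall>x\<in>S R. norm (h \<sigma> x - (\<Sum>j<N. G \<sigma> j / x ^ j)) \<le> C / norm x ^ N"
      using D[of _ _ N] by (intro exI[of _ "D N"]) simp
  qed
  moreover have "\<forall>\<sigma>. \<forall>j<m. G \<sigma> j = 0" using Fm by (simp add: G_def)
  ultimately show ?thesis by (auto simp: Asy_def)
qed

text \<open>Splitting off a known leading term improves the order by one; the factor \<open>x ^ m\<close> moves the
  remainder to the normalised form \<open>[x\<^sup>-\<^sup>1]\<close>.\<close>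

lemma Asy_remainder:
  assumes R: "R0 \<le> R" and h: "Asy R m h" and e: "e > 0"
    and b: "\<And>\<sigma> x. \<sigma> \<in> Bs \<Longrightarrow> x \<in> S R \<Longrightarrow> norm (h \<sigma> x - f \<sigma> / x ^ m) \<le> C * norm x powr (- real m - e)"
  shows "Asy R 1 (\<lambda>\<sigma> x. x ^ m * h \<sigma> x - f \<sigma>)"
proof -
  obtain F where F: "asy R h F" "\<And>\<sigma> j. j < m \<Longrightarrow> F \<sigma> j = 0" using h by (auto simp: Asy_def)
  \<comment> \<open>Any gain e > 0 identifies the coefficient, by letting x tend to infinity on the
    imaginary axis; after that the expansion itself improves the gain to a full power.\<close>
  have Fm: "F \<sigma> m = f \<sigma>" if \<sigma>: "\<sigma> \<in> Bs" for \<sigma>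
  proof -
    obtain D where D: "0 \<le> D" "\<And>\<sigma> x. \<sigma> \<in> Bs \<Longrightarrow> x \<in> S R \<Longrightarrow> norm (h \<sigma> x - (\<Sum>j<Suc m. F \<sigma> j / x ^ j)) \<le> D / norm x ^ Suc m"
      using asyD(3)[OF F(1), of "Suc m"] by blast
    have b2: "norm (F \<sigma> m - f \<sigma>) \<le> D * norm x powr (-1) + C * norm x powr (- e)" if x: "x \<in> S R" for x
    proof -
      have x0: "norm x > 0" using S_nonzero[OF x] by simp
      have "(\<Sum>j<Suc m. F \<sigma> j / x ^ j) = F \<sigma> m / x ^ m" using F(2) by simp
      then have "norm ((F \<sigma> m - f \<sigma>) / x ^ m) \<le> D / norm x ^ Suc m + C * norm x powr (- real m - e)"
        using D(2)[OF \<sigma> x] b[OF \<sigma> x] norm_triangle_ineq4[of "h \<sigma> x - f \<sigma> / x ^ m" "h \<sigma> x - F \<sigma> m / x ^ m"]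
        by (simp add: diff_divide_distrib)
      then have "norm (F \<sigma> m - f \<sigma>) \<le> (D / norm x ^ Suc m + C * norm x powr (- real m - e)) * norm x ^ m"
        using x0 by (simp add: norm_divide norm_power divide_le_eq)
      also have "\<dots> = D * norm x powr (-1) + C * norm x powr (- e)"
        using x0 by (simp add: powr_minus powr_diff powr_realpow field_simps)
      finally show ?thesis .
    qed
    have "((\<lambda>t::real. D * t powr (-1) + C * t powr (- e)) \<longlongrightarrow> D * 0 + C * 0) at_top"
      using e by (intro tendsto_intros tendsto_neg_powr filterlim_ident) auto
    then have lim: "((\<lambda>t::real. D * t powr (-1) + C * t powr (- e)) \<longlongrightarrow> 0) at_top" by simp
    have k1: "k < 1"
    proof (rule ccontr)
      assume "\<not> k < 1" then have "1 \<le> k\<^sup>2" by simp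
      then show False using k_le by simp
    qed
    have "\<forall>\<^sub>F t in at_top. norm (F \<sigma> m - f \<sigma>) \<le> D * t powr (-1) + C * t powr (- e)"
      using eventually_gt_at_top[of "max 0 R"]
    proof eventually_elim
      case (elim t)
      have "\<i> * complex_of_real t \<in> S R" using elim k1 by (auto simp: S_def norm_mult)
      from b2[OF this] show ?case using elim by (simp add: norm_mult)
    qed
    then have "norm (F \<sigma> m - f \<sigma>) \<le> 0" by (intro tendsto_lowerbound[OF lim]) auto
    then show ?thesis by simp
  qed
  define G where "G = (\<lambda>\<sigma> j. if j = 0 then 0 else F \<sigma> (m + j))"
  have fh: "f holomorphic_on Bs"
    by (rule holomorphic_transform[OF PQ_holomorphic[OF asyD(2)[OF F(1), of m]] Fm])
  have "asy R (\<lambda>\<sigma> x. x ^ m * h \<sigma> x - f \<sigma>) G"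
    unfolding asy_def
  proof (intro conjI allI)
    have "hol2R R (\<lambda>\<sigma> x. x ^ m)" unfolding hol2R_def case_prod_unfold
      by (auto intro!: continuous_intros holomorphic_intros)
    then show "hol2R R (\<lambda>\<sigma> x. x ^ m * h \<sigma> x - f \<sigma>)"
      by (intro hol2R_diff hol2R_mult hol2R_sigma fh asyD(1)[OF F(1)])
    show "(\<lambda>\<sigma>. G \<sigma> j) \<in> PQ" for j using asyD(2)[OF F(1)] PQ_zero by (cases j) (auto simp: G_def)
    fix N
    obtain D where D: "\<And>\<sigma> x. \<sigma> \<in> Bs \<Longrightarrow> x \<in> S R \<Longrightarrow> norm (h \<sigma> x - (\<Sum>j<m + N. F \<sigma> j / x ^ j)) \<le> D / norm x ^ (m + N)"
      using asyD(3)[OF F(1), of "m + N"] by blast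
    obtain B where B: "0 \<le> B" "\<And>\<sigma>. \<sigma> \<in> Bs \<Longrightarrow> norm (F \<sigma> m) \<le> B" using PQ_bounded[OF asyD(2)[OF F(1)]] by metis
    have "norm (x ^ m * h \<sigma> x - f \<sigma> - (\<Sum>j<N. G \<sigma> j / x ^ j)) \<le> (\<bar>D\<bar> + B) / norm x ^ N" if \<sigma>: "\<sigma> \<in> Bs" and x: "x \<in> S R" for \<sigma> x
    proof -
      have x0: "x \<noteq> 0" using S_nonzero[OF x] .
      have "(\<Sum>j<m + N. F \<sigma> j / x ^ j) = (\<Sum>j<N. F \<sigma> (m + j) / x ^ (m + j))"
        using F(2) by (intro sum_lessThan_skip) simp
      also have "\<dots> = (\<Sum>j<N. F \<sigma> (m + j) / x ^ j) / x ^ m"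
        by (simp add: sum_divide_distrib power_add mult.commute)
      finally have eq: "x ^ m * h \<sigma> x - (\<Sum>j<N. F \<sigma> (m + j) / x ^ j) = x ^ m * (h \<sigma> x - (\<Sum>j<m + N. F \<sigma> j / x ^ j))"
        using x0 by (simp add: right_diff_distrib)
      have "norm (x ^ m * h \<sigma> x - (\<Sum>j<N. F \<sigma> (m + j) / x ^ j)) \<le> norm x ^ m * (D / norm x ^ (m + N))"
        unfolding eq norm_mult norm_power using D[OF \<sigma> x] by (intro mult_left_mono) auto
      also have "\<dots> = D / norm x ^ N" using x0 by (simp add: power_add)
      finally have 1: "norm (x ^ m * h \<sigma> x - (\<Sum>j<N. F \<sigma> (m + j) / x ^ j)) \<le> D / norm x ^ N" .
      show ?thesis
      proof (cases "N = 0")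
        case True
        then show ?thesis using 1 B(2)[OF \<sigma>] Fm[OF \<sigma>] norm_triangle_ineq4[of "x ^ m * h \<sigma> x" "f \<sigma>"] by simp
      next
        case False
        then obtain N' where N': "N = Suc N'" by (cases N) auto
        have "(\<Sum>j<N. F \<sigma> (m + j) / x ^ j) = f \<sigma> + (\<Sum>j<N. G \<sigma> j / x ^ j)"
          unfolding N' by (subst (1 2) sum.lessThan_Suc_shift) (simp add: G_def Fm[OF \<sigma>])
        then have eq2: "x ^ m * h \<sigma> x - f \<sigma> - (\<Sum>j<N. G \<sigma> j / x ^ j) = x ^ m * h \<sigma> x - (\<Sum>j<N. F \<sigma> (m + j) / x ^ j)" by simp
        have "norm (x ^ m * h \<sigma> x - f \<sigma> - (\<Sum>j<N. G \<sigma> j / x ^ j)) \<le> D / norm x ^ N" unfolding eq2 by (rule 1)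
        also have "\<dots> \<le> (\<bar>D\<bar> + B) / norm x ^ N" using B by (intro divide_right_mono) auto
        finally show ?thesis .
      qed
    qed
    then show "\<exists>C. \<forall>\<sigma>\<in>Bs. \<forall>x\<in>S R. norm (x ^ m * h \<sigma> x - f \<sigma> - (\<Sum>j<N. G \<sigma> j / x ^ j)) \<le> C / norm x ^ N" by blast
  qed
  then show ?thesis by (auto simp: Asy_def G_def)
qed

lemma Asy_brk:
  assumes h: "Asy R m h" and B: "open B0" "open Bx" and sub: "sector \<delta> xinf \<subseteq> S R" "open (sector \<delta> xinf)"
  shows "brk \<theta>0 \<theta>x \<theta>inf B0 Bx Bs \<delta> xinf m (\<lambda>c0 cx. h)"
proof -
  obtain F where F: "asy R h F" "\<And>\<sigma> j. j < m \<Longrightarrow> F \<sigma> j = 0" using h by (auto simp: Asy_def)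
  note hol = asyD(1)[OF F(1), unfolded hol2R_def]
  have "holomorphic4_on (\<lambda>c0 cx. h) (B0 \<times> Bx \<times> Bs \<times> sector \<delta> xinf)"
  proof (rule holomorphic4_onI)
    show op: "open (B0 \<times> Bx \<times> Bs \<times> sector \<delta> xinf)" using B sub Bs_open by (intro open_Times)
    have "continuous_on (B0 \<times> Bx \<times> Bs \<times> sector \<delta> xinf) (\<lambda>q. (\<lambda>(\<sigma>, x). h \<sigma> x) (snd (snd q)))"
      by (rule continuous_on_compose2[OF hol[THEN conjunct1]]) (use sub in \<open>auto intro!: continuous_intros\<close>)
    then show "continuous_on (B0 \<times> Bx \<times> Bs \<times> sector \<delta> xinf) (\<lambda>(c0, cx, \<sigma>, x). h \<sigma> x)"
      by (simp add: case_prod_unfold)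
    fix a b c d assume p: "(a, b, c, d) \<in> B0 \<times> Bx \<times> Bs \<times> sector \<delta> xinf"
    then have d: "d \<in> S R" and c: "c \<in> Bs" using sub by auto
    show "(\<lambda>c. h c d) field_differentiable at c"
      using hol d c Bs_open holomorphic_on_imp_differentiable_at by blast
    show "h c field_differentiable at d"
      using hol d c open_S holomorphic_on_imp_differentiable_at by blast
  qed auto
  moreover have "\<exists>f. (\<forall>j. f j \<in> Qstar \<theta>0 \<theta>x \<theta>inf) \<and>
        (\<forall>N. \<exists>C R. \<forall>c0\<in>B0. \<forall>cx\<in>Bx. \<forall>\<sigma>\<in>Bs. \<forall>x\<in>sector \<delta> xinf. norm x > R \<longrightarrow>
           norm (h \<sigma> x - (\<Sum>j<N. f j c0 cx \<sigma> / x ^ (m + j))) \<le> C / norm x ^ (m + N))"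
  proof (intro exI[of _ "\<lambda>j c0 cx \<sigma>. F \<sigma> (m + j)"] conjI allI)
    show "(\<lambda>c0 cx \<sigma>. F \<sigma> (m + j)) \<in> Qstar \<theta>0 \<theta>x \<theta>inf" for j
      using asyD(2)[OF F(1), of "m + j"] by (simp add: PQ_def)
    fix N
    obtain D where D: "\<And>\<sigma> x. \<sigma> \<in> Bs \<Longrightarrow> x \<in> S R \<Longrightarrow> norm (h \<sigma> x - (\<Sum>j<m + N. F \<sigma> j / x ^ j)) \<le> D / norm x ^ (m + N)"
      using asyD(3)[OF F(1), of "m + N"] by blast
    have "(\<Sum>j<m + N. F \<sigma> j / x ^ j) = (\<Sum>j<N. F \<sigma> (m + j) / x ^ (m + j))" for \<sigma> x
      using F(2) by (intro sum_lessThan_skip) simp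
    then show "\<exists>C R. \<forall>c0\<in>B0. \<forall>cx\<in>Bx. \<forall>\<sigma>\<in>Bs. \<forall>x\<in>sector \<delta> xinf. norm x > R \<longrightarrow>
           norm (h \<sigma> x - (\<Sum>j<N. F \<sigma> (m + j) / x ^ (m + j))) \<le> C / norm x ^ (m + N)"
      using D sub by (intro exI[of _ D]) auto
  qed
  ultimately show ?thesis by (simp add: brk_def)
qed

end

section \<open>The recursion for the coefficients\<close>

datatype kind = Ph | Fp | Gp | Fm | Gm

text \<open>The number of pairs of opposite \<gamma>s that merge when the monomials with exponents p
  and q are multiplied: 0 for equal signs, the smaller modulus for opposite ones.\<close>

definition mm :: "int \<Rightarrow> int \<Rightarrow> nat" where
  "mm p q = nat ((\<bar>p\<bar> + \<bar>q\<bar> - \<bar>p + q\<bar>) div 2)"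

text \<open>The number of factors X Y that arise in \<open>E s * E i * E j\<close>. It vanishes only
  if no two of the three indices have opposite signs.\<close>

definition m3 :: "int \<Rightarrow> int \<Rightarrow> int \<Rightarrow> nat" where
  "m3 s i j = nat ((\<bar>s\<bar> + \<bar>i\<bar> + \<bar>j\<bar> - \<bar>s + i + j\<bar>) div 2)"

fun al :: "kind \<Rightarrow> int" where
  "al Ph = 0" | "al Fp = 1" | "al Gp = 0" | "al Fm = -1" | "al Gm = 0"

fun be :: "kind \<Rightarrow> int" where
  "be Ph = 0" | "be Fp = 0" | "be Gp = 1" | "be Fm = 0" | "be Gm = -1"

text \<open>The side on which an off-diagonal series starts with coefficients that are not small:
  those at 0, \<open>sg q\<close> and \<open>2 * sg q\<close>. The same sign selects the exponential
  \<open>E (sg q)\<close> that couples q to \<open>bar q\<close>, whose side is the opposite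
  one.\<close>

fun sg :: "kind \<Rightarrow> int" where
  "sg Ph = 0" | "sg Fp = 1" | "sg Gp = -1" | "sg Fm = -1" | "sg Gm = 1"

fun bar :: "kind \<Rightarrow> kind" where
  "bar Ph = Ph" | "bar Fp = Gp" | "bar Gp = Fp" | "bar Fm = Gm" | "bar Gm = Fm"

text \<open>The orders of the brackets in the theorem, for an index oriented by \<open>sg\<close>;
  at m = 1 the truncation of \<open>nat\<close> yields 0. For \<phi> at index 0 the induction
  carries only order 1 (\<open>oP 0\<close>), because order 2 rests on a cancellation that is proved
  later.\<close>

definition o1 :: "int \<Rightarrow> nat" where "o1 m = (if m \<ge> 1 then nat (m - 2) else nat (- m))"
definition oP :: "int \<Rightarrow> nat" where "oP m = (if m = 0 then 1 else nat (\<bar>m\<bar> - 1))"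
definition oF :: "int \<Rightarrow> nat" where "oF m = (if m = 0 then 0 else nat (\<bar>m\<bar> - 1))"

definition ordk :: "kind \<Rightarrow> int \<Rightarrow> nat" where
  "ordk k n = (if k = Ph then oP n else o1 (sg k * n))"

section \<open>Arithmetic of the orders\<close>

lemma m3_eq: "2 * int (m3 s i j) = \<bar>s\<bar> + \<bar>i\<bar> + \<bar>j\<bar> - \<bar>s + i + j\<bar>"
proof -
  have "even (\<bar>s\<bar> + \<bar>i\<bar> + \<bar>j\<bar> - \<bar>s + i + j\<bar>)" by auto
  then show ?thesis unfolding m3_def by auto
qed

lemma m3_minus: "m3 (- s) (- i) (- j) = m3 s i j"
proof -
  have "\<bar>- s + - i + - j\<bar> = \<bar>s + i + j\<bar>" by linarith
  then show ?thesis by (simp add: m3_def)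
qed

lemma o1_eq: "int (o1 m) = (if m \<ge> 2 then m - 2 else if m = 1 then 0 else - m)"
  by (simp add: o1_def)

lemma oP_eq: "int (oP m) = (if m = 0 then 1 else \<bar>m\<bar> - 1)"
  by (simp add: oP_def)

lemma oF_eq: "int (oF m) = (if m = 0 then 0 else \<bar>m\<bar> - 1)"
  by (simp add: oF_def)

text \<open>This and the next two lemmas say that the prescribed orders reproduce themselves under
  the right-hand side. The 1 is the factor 1/x of the linear term, \<open>2 * m3\<close> the power
  of 1/x from X Y; at index 0 order 2 is demanded so that \<open>L 0\<close> is applicable.\<close>

lemma order_linear_term: "(if i + j = 0 then 2 else o1 (i + j)) \<le> oP i + o1 j + 1 + 2 * m3 0 i j"
proof -
  have "(if i + j = 0 then 2 else int (o1 (i + j))) \<le> int (oP i) + int (o1 j) + 1 + 2 * int (m3 0 i j)"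
    unfolding m3_eq o1_eq oP_eq by (auto simp: abs_if)
  then show ?thesis by (simp split: if_splits)
qed

lemma order_quadratic_term: "(if 1 + i + j = 0 then 2 else o1 (1 + i + j)) \<le> oF i + o1 (- j) + 2 * m3 1 i j"
proof -
  have "(if 1 + i + j = 0 then 2 else int (o1 (1 + i + j))) \<le> int (oF i) + int (o1 (- j)) + 2 * int (m3 1 i j)"
    unfolding m3_eq o1_eq oF_eq by (auto simp: abs_if)
  then show ?thesis by (simp split: if_splits)
qed

lemma order_phi_term: "(if 1 + i + j = 0 then 2 else oP (1 + i + j)) \<le> o1 (- i) + o1 (- j) + 2 * m3 1 i j"
proof -
  have "(if 1 + i + j = 0 then 2 else int (oP (1 + i + j))) \<le> int (o1 (-i)) + int (o1 (- j)) + 2 * int (m3 1 i j)"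
    unfolding m3_eq o1_eq oP_eq by (auto simp: abs_if)
  then show ?thesis by (simp split: if_splits)
qed

lemma sg_cases: "k \<noteq> Ph \<Longrightarrow> sg k = 1 \<or> sg k = -1"
  by (cases k) auto

lemma sg_bar [simp]: "sg (bar k) = - sg k"
  by (cases k) auto

lemma bar_Ph [simp]: "bar k = Ph \<longleftrightarrow> k = Ph"
  by (cases k) auto

lemma mm_shift_le: "\<bar>a\<bar> \<le> 1 \<Longrightarrow> \<bar>b\<bar> \<le> 1 \<Longrightarrow> mm (a + i) (b + j) \<le> m3 s i j + 2"
proof -
  assume ab: "\<bar>a\<bar> \<le> 1" "\<bar>b\<bar> \<le> 1"
  have "\<bar>a + i\<bar> + \<bar>b + j\<bar> - \<bar>(a + i) + (b + j)\<bar> \<le> 2 * int (m3 s i j) + 4"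
    unfolding m3_eq using ab by linarith
  then show ?thesis unfolding mm_def by linarith
qed

lemma al_be_le: "\<bar>al k\<bar> \<le> 1" "\<bar>be k\<bar> \<le> 1"
  by (cases k; simp)+

text \<open>Up to a constant, a pair of \<gamma>s merges only where a pair X Y does as well. The
  unbounded powers of \<open>kap0\<close> and \<open>kapx\<close> are therefore matched by powers of
  1/x; the 4 comes from the shifts by \<open>al\<close>, \<open>be\<close> and s.\<close>

lemma mm_cc_le: "mm (al k1 - i) (al k2 - j) + mm (be k1 + i) (be k2 + j) \<le> 2 * m3 s i j + 4"
  using mm_shift_le[of "al k1" "al k2" "- i" "- j" "- s"] mm_shift_le[of "be k1" "be k2" i j s] al_be_le
  by (simp add: m3_minus)

type_synonym coeffs = "int \<Rightarrow> complex \<Rightarrow> complex \<Rightarrow> complex"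

context painleve
begin

definition s0 :: "complex \<Rightarrow> complex" where "s0 \<sigma> = (\<sigma> - \<theta>inf) / 4"
definition t0 :: "complex \<Rightarrow> complex" where "t0 \<sigma> = (\<sigma> + \<theta>inf) / 4"
text \<open>Equal to \<theta>0^2 / 4 - s0^2, and \<open>kapx\<close> to \<theta>x^2 / 4 - t0^2; with
  these values the first integrals will turn out to be the squares of the eigenvalues.\<close>

definition kap0 :: "complex \<Rightarrow> complex" where "kap0 \<sigma> = (4 * \<theta>0\<^sup>2 - (\<sigma> - \<theta>inf)\<^sup>2) / 16"
definition kapx :: "complex \<Rightarrow> complex" where "kapx \<sigma> = (4 * \<theta>x\<^sup>2 - (\<sigma> + \<theta>inf)\<^sup>2) / 16"

fun tau :: "kind \<Rightarrow> complex \<Rightarrow> complex" where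
  "tau Ph \<sigma> = 0" | "tau Fp \<sigma> = s0 \<sigma>" | "tau Fm \<sigma> = s0 \<sigma>" | "tau Gp \<sigma> = t0 \<sigma>" | "tau Gm \<sigma> = t0 \<sigma>"

text \<open>The unknowns are expanded as \<open>\<Sum>n. z q n \<cdot> e q n\<close> over the integers with
  \<open>e q n = M\<^sub>0 (al q - n) M\<^sub>x (be q + n) E n\<close>, where \<open>M\<^sub>0 p\<close> is \<open>\<gamma>\<^sup>0\<^sub>+ ^ p\<close> or \<open>\<gamma>\<^sup>0\<^sub>- ^ \<bar>p\<bar>\<close> according to the
  sign of \<open>p\<close>, similarly for \<open>M\<^sub>x\<close>, and \<open>E n\<close> is a power of \<open>X\<close> or \<open>Y\<close>. The structure
  constants \<open>cc\<close> of the product arise from \<open>X Y = x\<^sup>-\<^sup>2\<close>, \<open>\<gamma>\<^sup>0\<^sub>+ \<gamma>\<^sup>0\<^sub>- = kap0\<close> and \<open>\<gamma>\<^sup>x\<^sub>+ \<gamma>\<^sup>x\<^sub>- = kapx\<close>;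
  in this form the powers of the \<open>\<gamma>\<close>s demanded by the theorem are built in.\<close>

definition cc :: "kind \<Rightarrow> kind \<Rightarrow> int \<Rightarrow> int \<Rightarrow> int \<Rightarrow> complex \<Rightarrow> complex \<Rightarrow> complex" where
  "cc k1 k2 s i j \<sigma> x = kap0 \<sigma> ^ mm (al k1 - i) (al k2 - j) * kapx \<sigma> ^ mm (be k1 + i) (be k2 + j) / x ^ (2 * m3 s i j)"

text \<open>The coefficient at n of the product of \<open>E s\<close> with two series. Summation
  over a finite window keeps all iterates finite; the window always contains the supports, so
  nothing is lost.\<close>

definition T :: "int \<Rightarrow> int \<Rightarrow> kind \<Rightarrow> kind \<Rightarrow> coeffs \<Rightarrow> coeffs \<Rightarrow> coeffs" where
  "T K s k1 k2 u v n \<sigma> x = (\<Sum>i\<in>{-K..K}. \<Sum>j\<in>{-K..K}.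
     if s + i + j = n then cc k1 k2 s i j \<sigma> x * u i \<sigma> x * v j \<sigma> x else 0)"

text \<open>The coefficients of \<phi> + \<open>tau q\<close>, which is f_0 in the equations of f_+
  and f_- and is - g_0 in those of g_+ and g_-.\<close>

definition fs :: "kind \<Rightarrow> (kind \<Rightarrow> coeffs) \<Rightarrow> coeffs" where
  "fs q z i \<sigma> x = z Ph i \<sigma> x + (if i = 0 then tau q \<sigma> else 0)"

definition rhs :: "int \<Rightarrow> (kind \<Rightarrow> coeffs) \<Rightarrow> kind \<Rightarrow> coeffs" where
  "rhs K z q n \<sigma> x =
    (if q = Ph then T K 1 Gp Fm (z Gp) (z Fm) n \<sigma> x - T K (-1) Gm Fp (z Gm) (z Fp) n \<sigma> x
     else - 2 * of_int (sg q) * (T K 0 Ph q (z Ph) (z q) n \<sigma> x / x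
       + T K (sg q) Ph (bar q) (fs q z) (z (bar q)) n \<sigma> x))"

definition init :: "kind \<Rightarrow> int \<Rightarrow> complex" where
  "init q n = (if q \<noteq> Ph \<and> n = 0 then 1 else 0)"

definition Phi :: "int \<Rightarrow> (kind \<Rightarrow> coeffs) \<Rightarrow> kind \<Rightarrow> coeffs" where
  "Phi K z q n \<sigma> x = init q n + L n (rhs K z q n) \<sigma> x"

text \<open>What the equations n z n = right-hand side determine when negative powers of x are
  dropped: from the value 1 of the off-diagonal coefficients at 0 follow \<phi> = 1 at index 1 and
  -1, then - 2 \<open>tau q\<close> at \<open>sg q\<close> and - 1 at
  \<open>2 * sg q\<close>.\<close>

definition z0 :: "kind \<Rightarrow> coeffs" where
  "z0 q n \<sigma> x = (if q = Ph then (if \<bar>n\<bar> = 1 then 1 else 0)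
     else if n = 0 then 1 else if n = sg q then - 2 * tau q \<sigma> else if n = 2 * sg q then -1 else 0)"

text \<open>A product doubles the support, and its exponential \<open>E s\<close> shifts it by at
  most 1.\<close>

primrec KK :: "nat \<Rightarrow> int" where
  "KK 0 = 2" | "KK (Suc N) = 2 * KK N + 1"

primrec zz :: "nat \<Rightarrow> kind \<Rightarrow> coeffs" where
  "zz 0 = z0" | "zz (Suc N) = Phi (KK N) (zz N)"

section \<open>Expansions of the iterates\<close>

lemma PQ_params: "s0 \<in> PQ" "t0 \<in> PQ" "kap0 \<in> PQ" "kapx \<in> PQ"
proof -
  have "(\<lambda>\<sigma>. (\<sigma> - \<theta>inf) / 4) \<in> PQ" "(\<lambda>\<sigma>. (\<sigma> + \<theta>inf) / 4) \<in> PQ"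
    by (intro PQ_divide_numeral PQ_diff PQ_add PQ_sigma PQ_const)+
  moreover have "(\<lambda>\<sigma>. (4 * \<theta>0\<^sup>2 - (\<sigma> - \<theta>inf)\<^sup>2) / 16) \<in> PQ" "(\<lambda>\<sigma>. (4 * \<theta>x\<^sup>2 - (\<sigma> + \<theta>inf)\<^sup>2) / 16) \<in> PQ"
    by (intro PQ_divide_numeral PQ_diff PQ_add PQ_mult PQ_power PQ_numeral PQ_sigma PQ_const)+
  ultimately show "s0 \<in> PQ" "t0 \<in> PQ" "kap0 \<in> PQ" "kapx \<in> PQ"
    by (simp_all add: s0_def [abs_def] t0_def [abs_def] kap0_def [abs_def] kapx_def [abs_def])
qed

lemma PQ_tau: "tau q \<in> PQ"
proof (cases q)
  case Ph then have "tau q = (\<lambda>\<sigma>. 0)" by (simp add: fun_eq_iff) then show ?thesis using PQ_zero by simp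
next
  case Fp then have "tau q = s0" by (simp add: fun_eq_iff) then show ?thesis using PQ_params by simp
next
  case Gp then have "tau q = t0" by (simp add: fun_eq_iff) then show ?thesis using PQ_params by simp
next
  case Fm then have "tau q = s0" by (simp add: fun_eq_iff) then show ?thesis using PQ_params by simp
next
  case Gm then have "tau q = t0" by (simp add: fun_eq_iff) then show ?thesis using PQ_params by simp
qed

lemma Asy_cc: "Asy R0 (2 * m3 s i j) (cc k1 k2 s i j)"
proof -
  have "(\<lambda>\<sigma>. kap0 \<sigma> ^ a * kapx \<sigma> ^ b) \<in> PQ" for a b by (intro PQ_mult PQ_power PQ_params)
  from Asy_cmult[OF order_refl this Asy_inverse_power[OF order_refl]] show ?thesis
    unfolding cc_def [abs_def] by simp
qed

lemma Asy_T:
  assumes "\<And>i. Asy R0 (a i) (u i)" "\<And>j. Asy R0 (b j) (v j)"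
    and "\<And>i j. s + i + j = n \<Longrightarrow> g \<le> a i + b j + 2 * m3 s i j"
  shows "Asy R0 g (T K s k1 k2 u v n)"
proof -
  have "Asy R0 g (\<lambda>\<sigma> x. if s + i + j = n then cc k1 k2 s i j \<sigma> x * u i \<sigma> x * v j \<sigma> x else 0)" for i j
  proof (cases "s + i + j = n")
    case True
    have "Asy R0 (2 * m3 s i j + a i + b j) (\<lambda>\<sigma> x. cc k1 k2 s i j \<sigma> x * u i \<sigma> x * v j \<sigma> x)"
      by (intro Asy_mult order_refl Asy_cc assms)
    from Asy_mono[OF this, of g] show ?thesis using True assms(3)[OF True] by simp
  qed (simp add: Asy_zero)
  then show ?thesis unfolding T_def [abs_def] by (intro Asy_sum)
qed

lemma Asy_fs: assumes "\<And>q n. Asy R0 (ordk q n) (z q n)" shows "Asy R0 (oF i) (fs q z i)"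
proof (cases "i = 0")
  case True
  have "Asy R0 0 (z Ph 0)" using assms Asy_mono by blast
  from Asy_add[OF this Asy_const[OF PQ_tau]] show ?thesis using True by (simp add: fs_def [abs_def] oF_def)
next
  case False
  then show ?thesis using assms[of Ph i] by (simp add: fs_def [abs_def] ordk_def oF_def oP_def)
qed

lemma Asy_rhs:
  assumes z: "\<And>q n. Asy R0 (ordk q n) (z q n)"
  shows "Asy R0 (if n = 0 then 2 else ordk q n) (rhs K z q n)"
proof (cases "q = Ph")
  case True
  have "Asy R0 (if n = 0 then 2 else ordk q n) (T K 1 Gp Fm (z Gp) (z Fm) n)"
  proof (rule Asy_T[OF z z])
    fix i j assume n: "1 + i + j = n"
    show "(if n = 0 then 2 else ordk q n) \<le> ordk Gp i + ordk Fm j + 2 * m3 1 i j"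
      unfolding n[symmetric] using order_phi_term[of i j] True by (simp add: ordk_def split: if_splits)
  qed
  moreover have "Asy R0 (if n = 0 then 2 else ordk q n) (T K (-1) Gm Fp (z Gm) (z Fp) n)"
  proof (rule Asy_T[OF z z])
    fix i j assume n: "-1 + i + j = n"
    \<comment> \<open>The reflection of all indices exchanges the two signs of \<open>sg\<close>, so
      that only the case of sign 1 has to be settled by arithmetic.\<close>
    have e: "1 + - i + - j = - n" using n by simp
    have "oP (- n) = oP n" by (simp add: oP_def)
    then show "(if n = 0 then 2 else ordk q n) \<le> ordk Gm i + ordk Fp j + 2 * m3 (-1) i j"
      using order_phi_term[of "- i" "- j", unfolded e] True m3_minus[of 1 "-i" "-j"]
      by (simp add: ordk_def split: if_splits)
  qed
  ultimately have "Asy R0 (if n = 0 then 2 else ordk q n)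
     (\<lambda>\<sigma> x. T K 1 Gp Fm (z Gp) (z Fm) n \<sigma> x + (-1) * T K (-1) Gm Fp (z Gm) (z Fp) n \<sigma> x)"
    using PQ_int[of "-1"] by (intro Asy_add Asy_cmult order_refl) auto
  then show ?thesis using True by (simp add: rhs_def [abs_def])
next
  case False
  then have s: "sg q = 1 \<or> sg q = -1" by (rule sg_cases)
  have "Asy R0 ((if n = 0 then 2 else ordk q n) - 1) (T K 0 Ph q (z Ph) (z q) n)"
  proof (rule Asy_T[OF z z])
    fix i j assume n: "0 + i + j = n"
    have "(if n = 0 then 2 else o1 (sg q * n)) \<le> oP i + o1 (sg q * j) + 1 + 2 * m3 0 i j"
      using s
    proof
      have e: "i + j = n" using n by simp
      assume "sg q = 1" then show ?thesis using order_linear_term[of i j, unfolded e] by (simp split: if_splits)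
    next
      assume s1: "sg q = -1"
      have "oP (- i) = oP i" by (simp add: oP_def)
      moreover have e: "- i + - j = - n" using n by simp
      ultimately show ?thesis using order_linear_term[of "- i" "- j", unfolded e] s1 m3_minus[of 0 i j]
        by (simp split: if_splits)
    qed
    then show "(if n = 0 then 2 else ordk q n) - 1 \<le> ordk Ph i + ordk q j + 2 * m3 0 i j"
      using False by (simp add: ordk_def split: if_splits)
  qed
  from Asy_mult[OF order_refl this Asy_inverse_power[OF order_refl, of 1]]
  have "Asy R0 (if n = 0 then 2 else ordk q n) (\<lambda>\<sigma> x. T K 0 Ph q (z Ph) (z q) n \<sigma> x / x)"
    using Asy_mono[where m' = "if n = 0 then 2 else ordk q n" and m = "(if n = 0 then 2 else ordk q n) - 1 + 1"] by simp
  moreover have "Asy R0 (if n = 0 then 2 else ordk q n) (T K (sg q) Ph (bar q) (fs q z) (z (bar q)) n)"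
  proof (rule Asy_T[OF Asy_fs[OF z] z])
    fix i j assume n: "sg q + i + j = n"
    have "(if n = 0 then 2 else o1 (sg q * n)) \<le> oF i + o1 (- sg q * j) + 2 * m3 (sg q) i j"
      using s
    proof
      assume s1: "sg q = 1"
      then have e: "1 + i + j = n" using n by simp
      show ?thesis using s1 order_quadratic_term[of i j, unfolded e] by (simp split: if_splits)
    next
      assume s1: "sg q = -1"
      have "oF (- i) = oF i" by (simp add: oF_def)
      moreover have e: "1 + - i + - j = - n" using n s1 by simp
      ultimately show ?thesis using order_quadratic_term[of "- i" "- j", unfolded e] s1 m3_minus[of "-1" i j]
        by (simp split: if_splits)
    qed
    then show "(if n = 0 then 2 else ordk q n) \<le> oF i + ordk (bar q) j + 2 * m3 (sg q) i j"
      using False by (simp add: ordk_def split: if_splits)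
  qed
  ultimately have "Asy R0 (if n = 0 then 2 else ordk q n) (\<lambda>\<sigma> x. of_int (- 2 * sg q) * (T K 0 Ph q (z Ph) (z q) n \<sigma> x / x
       + T K (sg q) Ph (bar q) (fs q z) (z (bar q)) n \<sigma> x))"
    by (intro Asy_cmult Asy_add order_refl PQ_int)
  then show ?thesis using False by (simp add: rhs_def [abs_def])
qed

lemma Asy_Phi:
  assumes z: "\<And>q n. Asy R0 (ordk q n) (z q n)"
  shows "Asy R0 (ordk q n) (Phi K z q n)"
proof (cases "n = 0")
  case True
  \<comment> \<open>Integration lowers the order from 2 to 1, which is all that \<open>ordk\<close>
    demands at index 0.\<close>
  have "Asy R0 1 (L 0 (rhs K z q 0))" using Asy_L0[of 2] Asy_rhs[OF z, of 0] by simp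
  then have L: "Asy R0 (ordk q 0) (L 0 (rhs K z q 0))" by (rule Asy_mono) (simp add: ordk_def oP_def o1_def)
  have "Asy R0 (ordk q 0) (\<lambda>\<sigma> x. init q 0)"
    using Asy_zero Asy_const[OF PQ_one] by (cases "q = Ph") (auto simp: init_def ordk_def o1_def)
  from Asy_add[OF this L] show ?thesis using True by (simp add: Phi_def [abs_def])
next
  case False
  then show ?thesis using Asy_L[OF False] Asy_rhs[OF z, of n] by (simp add: Phi_def [abs_def] init_def)
qed

lemma Asy_z0: "Asy R0 (ordk q n) (z0 q n)"
proof -
  have zero: "Asy R0 m (\<lambda>\<sigma> x. 0)" for m by (rule Asy_zero)
  have one: "Asy R0 0 (\<lambda>\<sigma> x. 1)" "Asy R0 0 (\<lambda>\<sigma> x. -1)" using Asy_const PQ_int[of 1] PQ_int[of "-1"] by auto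
  have ta: "Asy R0 0 (\<lambda>\<sigma> x. - (2 * tau q \<sigma>))" using Asy_const[OF PQ_minus[OF PQ_mult[OF PQ_numeral(1) PQ_tau]]] .
  show ?thesis
  proof (cases "q = Ph")
    case True
    then show ?thesis using zero one by (cases "\<bar>n\<bar> = 1") (auto simp: z0_def [abs_def] ordk_def oP_def)
  next
    case False
    note s = sg_cases[OF False]
    consider "n = 0" | "n = sg q" | "n = 2 * sg q" | "n \<noteq> 0" "n \<noteq> sg q" "n \<noteq> 2 * sg q" by blast
    then show ?thesis
      by cases (use s False zero one ta in \<open>auto simp: z0_def [abs_def] ordk_def o1_def\<close>)
  qed
qed

lemma Asy_zz: "Asy R0 (ordk q n) (zz N q n)"
proof (induction N arbitrary: q n)
  case 0 show ?case using Asy_z0 by simp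
next
  case (Suc N) show ?case using Asy_Phi[OF Suc.IH] by simp
qed

lemma KK_ge: "2 \<le> KK N"
  by (induction N) auto

lemma KK_mono: "N \<le> M \<Longrightarrow> KK N \<le> KK M"
proof (induction M)
  case (Suc M) then show ?case using KK_ge[of M] by (cases "N = Suc M") auto
qed simp

section \<open>Finite supports and weighted bounds\<close>

definition supp :: "int \<Rightarrow> coeffs \<Rightarrow> bool" where
  "supp K u \<longleftrightarrow> (\<forall>n. K < \<bar>n\<bar> \<longrightarrow> u n = (\<lambda>\<sigma> x. 0))"

lemma supp_T: "\<bar>s\<bar> \<le> 1 \<Longrightarrow> supp (2 * K + 1) (T K s k1 k2 u v)"
  unfolding supp_def
proof (intro allI impI ext)
  fix n \<sigma> x assume s: "\<bar>s\<bar> \<le> 1" and n: "2 * K + 1 < \<bar>n\<bar>"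
  have "s + i + j \<noteq> n" if "i \<in> {-K..K}" "j \<in> {-K..K}" for i j using that s n by auto
  then show "T K s k1 k2 u v n \<sigma> x = 0" unfolding T_def by (intro sum.neutral ballI) auto
qed

lemma sg_le: "\<bar>sg q\<bar> \<le> 1"
  by (cases q) auto

lemma supp_Phi: assumes "0 \<le> K" shows "supp (2 * K + 1) (Phi K z q)"
  unfolding supp_def
proof (intro allI impI)
  fix n :: int assume n: "2 * K + 1 < \<bar>n\<bar>"
  have "T K s k1 k2 u v n = (\<lambda>\<sigma> x. 0)" if "\<bar>s\<bar> \<le> 1" for s k1 k2 u v
    using supp_T[OF that] n unfolding supp_def by blast
  then have "rhs K z q n = (\<lambda>\<sigma> x. 0)" using sg_le by (simp add: rhs_def fun_eq_iff)
  moreover have "n \<noteq> 0" using n assms by auto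
  ultimately have "Phi K z q n \<sigma> x = 0" for \<sigma> x by (simp add: Phi_def init_def)
  then show "Phi K z q n = (\<lambda>\<sigma> x. 0)" by blast
qed

lemma supp_zz: "supp (KK N) (zz N q)"
proof (cases N)
  case 0
  then show ?thesis by (cases q) (auto simp: supp_def z0_def fun_eq_iff)
next
  case (Suc M) then show ?thesis using supp_Phi[of "KK M"] KK_ge[of M] by simp
qed

lemma T_window:
  assumes "supp K u" "supp K v" "K \<le> K'"
  shows "T K s k1 k2 u v = T K' s k1 k2 u v"
proof (intro ext)
  fix n \<sigma> x
  let ?f = "\<lambda>i j. if s + i + j = n then cc k1 k2 s i j \<sigma> x * u i \<sigma> x * v j \<sigma> x else 0"
  have u0: "u i \<sigma> x = 0" if "K < \<bar>i\<bar>" for i using assms that by (simp add: supp_def)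
  have v0: "v i \<sigma> x = 0" if "K < \<bar>i\<bar>" for i using assms that by (simp add: supp_def)
  have "(\<Sum>i\<in>{-K..K}. \<Sum>j\<in>{-K..K}. ?f i j) = (\<Sum>i\<in>{-K..K}. \<Sum>j\<in>{-K'..K'}. ?f i j)"
    by (intro sum.cong refl sum.mono_neutral_left) (use v0 assms(3) in auto)
  also have "\<dots> = (\<Sum>i\<in>{-K'..K'}. \<Sum>j\<in>{-K'..K'}. ?f i j)"
    by (intro sum.mono_neutral_left ballI sum.neutral) (use u0 assms(3) in auto)
  finally show "T K s k1 k2 u v n \<sigma> x = T K' s k1 k2 u v n \<sigma> x" unfolding T_def .
qed

text \<open>\<open>bd R K M e u\<close> is a weighted \<open>\<ell>\<^sup>1\<close> bound: the coefficients are dominated by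
  \<open>U i \<bar>x\<bar> powr (- e i)\<close> with a sequence \<open>U\<close> of total mass at most \<open>M\<close>.\<close>

definition bd :: "real \<Rightarrow> int \<Rightarrow> real \<Rightarrow> (int \<Rightarrow> real) \<Rightarrow> coeffs \<Rightarrow> bool" where
  "bd R K M e u \<longleftrightarrow> (\<exists>U. (\<forall>i. 0 \<le> U i) \<and> (\<forall>i. K < \<bar>i\<bar> \<longrightarrow> U i = 0) \<and> (\<Sum>i\<in>{-K..K}. U i) \<le> M \<and>
     (\<forall>i. \<forall>\<sigma>\<in>Bs. \<forall>x\<in>S R. norm (u i \<sigma> x) \<le> U i * norm x powr (- e i)))"

definition kb :: real where
  "kb = (SOME c. 1 \<le> c \<and> (\<forall>\<sigma>\<in>Bs. norm (kap0 \<sigma>) \<le> c \<and> norm (kapx \<sigma>) \<le> c \<and> norm (s0 \<sigma>) \<le> c \<and> norm (t0 \<sigma>) \<le> c))"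

text \<open>From here on a surplus factor \<open>kap0\<close> or \<open>kapx\<close> is outweighed
  by a surplus factor 1/x.\<close>

definition R1 :: real where "R1 = max R0 kb"

lemma kb: "1 \<le> kb" "\<sigma> \<in> Bs \<Longrightarrow> norm (kap0 \<sigma>) \<le> kb" "\<sigma> \<in> Bs \<Longrightarrow> norm (kapx \<sigma>) \<le> kb"
  "\<sigma> \<in> Bs \<Longrightarrow> norm (s0 \<sigma>) \<le> kb" "\<sigma> \<in> Bs \<Longrightarrow> norm (t0 \<sigma>) \<le> kb"
proof -
  obtain a b c d where "\<And>\<sigma>. \<sigma> \<in> Bs \<Longrightarrow> norm (kap0 \<sigma>) \<le> a" "\<And>\<sigma>. \<sigma> \<in> Bs \<Longrightarrow> norm (kapx \<sigma>) \<le> b"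
    "\<And>\<sigma>. \<sigma> \<in> Bs \<Longrightarrow> norm (s0 \<sigma>) \<le> c" "\<And>\<sigma>. \<sigma> \<in> Bs \<Longrightarrow> norm (t0 \<sigma>) \<le> d"
    using PQ_bounded PQ_params by metis
  then have le: "norm (kap0 \<sigma>) \<le> \<bar>a\<bar>" "norm (kapx \<sigma>) \<le> \<bar>b\<bar>" "norm (s0 \<sigma>) \<le> \<bar>c\<bar>" "norm (t0 \<sigma>) \<le> \<bar>d\<bar>"
    if "\<sigma> \<in> Bs" for \<sigma> using that by (meson abs_ge_self order_trans)+
  define P where "P = (\<lambda>c. 1 \<le> c \<and> (\<forall>\<sigma>\<in>Bs. norm (kap0 \<sigma>) \<le> c \<and> norm (kapx \<sigma>) \<le> c \<and> norm (s0 \<sigma>) \<le> c \<and> norm (t0 \<sigma>) \<le> c))"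
  have "P (1 + \<bar>a\<bar> + \<bar>b\<bar> + \<bar>c\<bar> + \<bar>d\<bar>)"
    unfolding P_def
  proof (intro conjI ballI)
    fix \<sigma> assume "\<sigma> \<in> Bs"
    note l = le[OF this]
    show "norm (kap0 \<sigma>) \<le> 1 + \<bar>a\<bar> + \<bar>b\<bar> + \<bar>c\<bar> + \<bar>d\<bar>" using l(1) by linarith
    show "norm (kapx \<sigma>) \<le> 1 + \<bar>a\<bar> + \<bar>b\<bar> + \<bar>c\<bar> + \<bar>d\<bar>" using l(2) by linarith
    show "norm (s0 \<sigma>) \<le> 1 + \<bar>a\<bar> + \<bar>b\<bar> + \<bar>c\<bar> + \<bar>d\<bar>" using l(3) by linarith
    show "norm (t0 \<sigma>) \<le> 1 + \<bar>a\<bar> + \<bar>b\<bar> + \<bar>c\<bar> + \<bar>d\<bar>" using l(4) by linarith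
  qed simp
  then have "P (SOME c. P c)" by (rule someI)
  moreover have "kb = (SOME c. P c)" by (simp add: kb_def P_def)
  ultimately have "P kb" by simp
  then show "1 \<le> kb" "\<sigma> \<in> Bs \<Longrightarrow> norm (kap0 \<sigma>) \<le> kb" "\<sigma> \<in> Bs \<Longrightarrow> norm (kapx \<sigma>) \<le> kb"
    "\<sigma> \<in> Bs \<Longrightarrow> norm (s0 \<sigma>) \<le> kb" "\<sigma> \<in> Bs \<Longrightarrow> norm (t0 \<sigma>) \<le> kb" by (auto simp: P_def)
qed

lemma tau_le: "\<sigma> \<in> Bs \<Longrightarrow> norm (tau q \<sigma>) \<le> kb"
  using kb by (cases q) (auto intro: order_trans[OF _ kb(1)])

text \<open>At most 2 m3 + 4 factors bounded by \<open>kb\<close> stand against |x|^(2 m3). Only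
  decay up to x^-4 is recorded and the surplus factors kb/|x| <= 1 are dropped, so the single
  constant kb^8, with 8 = 2 * 2 + 4, is good for all indices.\<close>

lemma cc_bound:
  assumes R: "R1 \<le> R" and \<sigma>: "\<sigma> \<in> Bs" and x: "x \<in> S R"
  shows "norm (cc k1 k2 s i j \<sigma> x) \<le> kb ^ 8 * norm x powr (- (2 * real (min (m3 s i j) 2)))"
proof -
  let ?m = "m3 s i j" and ?a = "mm (al k1 - i) (al k2 - j)" and ?b = "mm (be k1 + i) (be k2 + j)"
  have x1: "1 \<le> norm x" using S_ge1[OF _ x] R by (simp add: R1_def)
  have xk: "kb \<le> norm x" using S_norm[OF x] R by (simp add: R1_def)
  have k1: "1 \<le> kb" by (rule kb)
  have "norm (cc k1 k2 s i j \<sigma> x) = norm (kap0 \<sigma>) ^ ?a * norm (kapx \<sigma>) ^ ?b / norm x ^ (2 * ?m)"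
    by (simp add: cc_def norm_mult norm_divide norm_power)
  also have "\<dots> \<le> kb ^ ?a * kb ^ ?b / norm x ^ (2 * ?m)"
    using kb(2-5)[OF \<sigma>] k1 by (intro divide_right_mono mult_mono power_mono) auto
  also have "\<dots> \<le> kb ^ (2 * ?m + 4) / norm x ^ (2 * ?m)"
    unfolding power_add[symmetric] using mm_cc_le[of k1 i k2 j s] k1 x1
    by (intro divide_right_mono power_increasing) auto
  also have "\<dots> \<le> kb ^ 8 / norm x ^ (2 * min ?m 2)"
  proof (cases "?m \<le> 2")
    case True
    then have "kb ^ (2 * ?m + 4) \<le> kb ^ 8" using k1 by (intro power_increasing) auto
    then show ?thesis using True x1 by (simp add: min_absorb1 divide_right_mono)
  next
    case False
    then obtain d where d: "2 * ?m = 4 + d" using le_Suc_ex[of 4 "2 * ?m"] by auto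
    have "kb ^ (2 * ?m + 4) / norm x ^ (2 * ?m) = kb ^ 8 / norm x ^ 4 * (kb ^ d / norm x ^ d)"
      by (simp add: d power_add[symmetric])
    also have "\<dots> \<le> kb ^ 8 / norm x ^ 4 * 1"
      using k1 xk x1 by (intro mult_left_mono) (auto intro: power_mono)
    finally show ?thesis using False by (simp add: min_absorb2)
  qed
  also have "\<dots> = kb ^ 8 * norm x powr (- real (2 * min ?m 2))"
    by (simp only: powr_neg_nat[OF x]) simp
  finally show ?thesis by simp
qed

lemma bd_mono:
  assumes u: "bd R K M e u" and "R1 \<le> R" "K \<le> K'" "M \<le> M'" "\<And>i. \<bar>i\<bar> \<le> K \<Longrightarrow> e' i \<le> e i"
  shows "bd R K' M' e' u"
proof -
  obtain U where U: "\<And>i. 0 \<le> U i" "\<And>i. K < \<bar>i\<bar> \<Longrightarrow> U i = 0" "(\<Sum>i\<in>{-K..K}. U i) \<le> M"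
    "\<And>i \<sigma> x. \<sigma> \<in> Bs \<Longrightarrow> x \<in> S R \<Longrightarrow> norm (u i \<sigma> x) \<le> U i * norm x powr (- e i)"
    using u unfolding bd_def by blast
  have s: "(\<Sum>i\<in>{-K'..K'}. U i) = (\<Sum>i\<in>{-K..K}. U i)"
    by (rule sum.mono_neutral_right) (use U(2) assms(3) in auto)
  show ?thesis unfolding bd_def
  proof (intro exI[of _ U] conjI allI impI ballI)
    fix i \<sigma> x assume \<sigma>: "\<sigma> \<in> Bs" and x: "x \<in> S R"
    have x1: "1 \<le> norm x" using S_ge1[OF _ x] assms(2) by (simp add: R1_def)
    show "norm (u i \<sigma> x) \<le> U i * norm x powr (- e' i)"
    proof (cases "\<bar>i\<bar> \<le> K")
      case True
      have "U i * norm x powr (- e i) \<le> U i * norm x powr (- e' i)"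
        using U(1) assms(5)[OF True] x1 by (intro mult_left_mono powr_mono) auto
      then show ?thesis using U(4)[OF \<sigma> x, of i] by linarith
    next
      case False then show ?thesis using U(2)[of i] U(4)[OF \<sigma> x, of i] by simp
    qed
  qed (use U s assms in auto)
qed

lemma bd_add:
  assumes "bd R K M e u" "bd R K M' e v"
  shows "bd R K (M + M') e (\<lambda>i \<sigma> x. u i \<sigma> x + v i \<sigma> x)"
proof -
  obtain U where U: "\<And>i. 0 \<le> U i" "\<And>i. K < \<bar>i\<bar> \<Longrightarrow> U i = 0" "(\<Sum>i\<in>{-K..K}. U i) \<le> M"
    "\<And>i \<sigma> x. \<sigma> \<in> Bs \<Longrightarrow> x \<in> S R \<Longrightarrow> norm (u i \<sigma> x) \<le> U i * norm x powr (- e i)"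
    using assms(1) unfolding bd_def by blast
  obtain V where V: "\<And>i. 0 \<le> V i" "\<And>i. K < \<bar>i\<bar> \<Longrightarrow> V i = 0" "(\<Sum>i\<in>{-K..K}. V i) \<le> M'"
    "\<And>i \<sigma> x. \<sigma> \<in> Bs \<Longrightarrow> x \<in> S R \<Longrightarrow> norm (v i \<sigma> x) \<le> V i * norm x powr (- e i)"
    using assms(2) unfolding bd_def by blast
  show ?thesis unfolding bd_def
  proof (intro exI[of _ "\<lambda>i. U i + V i"] conjI allI impI ballI)
    fix i \<sigma> x assume "\<sigma> \<in> Bs" "x \<in> S R"
    then show "norm (u i \<sigma> x + v i \<sigma> x) \<le> (U i + V i) * norm x powr (- e i)"
      using U(4)[of \<sigma> x i] V(4)[of \<sigma> x i] norm_triangle_ineq[of "u i \<sigma> x" "v i \<sigma> x"] by (simp add: distrib_right)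
  qed (use U V in \<open>auto simp: sum.distrib\<close>)
qed

lemma bd_cmult:
  assumes u: "bd R K M e u" and c: "\<And>\<sigma>. \<sigma> \<in> Bs \<Longrightarrow> norm (c \<sigma>) \<le> C" and C: "0 \<le> C"
  shows "bd R K (C * M) e (\<lambda>i \<sigma> x. c \<sigma> * u i \<sigma> x)"
proof -
  obtain U where U: "\<And>i. 0 \<le> U i" "\<And>i. K < \<bar>i\<bar> \<Longrightarrow> U i = 0" "(\<Sum>i\<in>{-K..K}. U i) \<le> M"
    "\<And>i \<sigma> x. \<sigma> \<in> Bs \<Longrightarrow> x \<in> S R \<Longrightarrow> norm (u i \<sigma> x) \<le> U i * norm x powr (- e i)"
    using u unfolding bd_def by blast
  show ?thesis unfolding bd_def
  proof (intro exI[of _ "\<lambda>i. C * U i"] conjI allI impI ballI)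
    fix i \<sigma> x assume "\<sigma> \<in> Bs" "x \<in> S R"
    then show "norm (c \<sigma> * u i \<sigma> x) \<le> C * U i * norm x powr (- e i)"
      unfolding norm_mult using U(4)[of \<sigma> x i] c[of \<sigma>] C mult_mono[of "norm (c \<sigma>)" C "norm (u i \<sigma> x)" "U i * norm x powr (- e i)"]
      by (simp add: algebra_simps)
  next
    show "(\<Sum>i\<in>{-K..K}. C * U i) \<le> C * M" unfolding sum_distrib_left[symmetric] using U(3) C by (rule mult_left_mono)
  qed (use U C in auto)
qed

lemma bd_over_x:
  assumes u: "bd R K M e u"
  shows "bd R K M (\<lambda>i. e i + 1) (\<lambda>i \<sigma> x. u i \<sigma> x / x)"
proof -
  obtain U where U: "\<And>i. 0 \<le> U i" "\<And>i. K < \<bar>i\<bar> \<Longrightarrow> U i = 0" "(\<Sum>i\<in>{-K..K}. U i) \<le> M"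
    "\<And>i \<sigma> x. \<sigma> \<in> Bs \<Longrightarrow> x \<in> S R \<Longrightarrow> norm (u i \<sigma> x) \<le> U i * norm x powr (- e i)"
    using u unfolding bd_def by blast
  show ?thesis unfolding bd_def
  proof (intro exI[of _ U] conjI allI impI ballI)
    fix i \<sigma> x assume \<sigma>: "\<sigma> \<in> Bs" and x: "x \<in> S R"
    have x0: "norm x > 0" using S_nonzero[OF x] by simp
    have "norm (u i \<sigma> x / x) \<le> U i * norm x powr (- e i) / norm x"
      unfolding norm_divide using U(4)[OF \<sigma> x] x0 by (intro divide_right_mono) auto
    also have "\<dots> = U i * norm x powr (- (e i + 1))" using x0 by (simp add: powr_diff[of _ "- e i" 1, simplified] powr_minus powr_add divide_inverse)
    finally show "norm (u i \<sigma> x / x) \<le> U i * norm x powr (- (e i + 1))" .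
  qed (use U in auto)
qed

lemma bd_nonneg: "bd R K M e u \<Longrightarrow> 0 \<le> M"
  unfolding bd_def by (meson order_trans sum_nonneg)

text \<open>The convolution inequality for absolutely summable sequences. The exponent g has to be
  reached by every pair (i, j) that contributes to a given index, which is what the weight lemmas
  will verify.\<close>

lemma bd_T:
  assumes R: "R1 \<le> R" and s: "\<bar>s\<bar> \<le> 1" and u: "bd R K A a u" and v: "bd R K B b v"
    and g: "\<And>i j. g (s + i + j) \<le> a i + b j + 2 * real (min (m3 s i j) 2)"
  shows "bd R (2 * K + 1) (kb ^ 8 * A * B) g (T K s k1 k2 u v)"
proof -
  obtain U where U: "\<And>i. 0 \<le> U i" "\<And>i. K < \<bar>i\<bar> \<Longrightarrow> U i = 0" "(\<Sum>i\<in>{-K..K}. U i) \<le> A"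
    "\<And>i \<sigma> x. \<sigma> \<in> Bs \<Longrightarrow> x \<in> S R \<Longrightarrow> norm (u i \<sigma> x) \<le> U i * norm x powr (- a i)"
    using u unfolding bd_def by blast
  obtain V where V: "\<And>i. 0 \<le> V i" "\<And>i. K < \<bar>i\<bar> \<Longrightarrow> V i = 0" "(\<Sum>i\<in>{-K..K}. V i) \<le> B"
    "\<And>i \<sigma> x. \<sigma> \<in> Bs \<Longrightarrow> x \<in> S R \<Longrightarrow> norm (v i \<sigma> x) \<le> V i * norm x powr (- b i)"
    using v unfolding bd_def by blast
  have k1: "1 \<le> kb" by (rule kb)
  have A: "0 \<le> A" using U(1,3) by (meson order_trans sum_nonneg)
  define W where "W = (\<lambda>n. kb ^ 8 * (\<Sum>i\<in>{-K..K}. \<Sum>j\<in>{-K..K}. if s + i + j = n then U i * V j else 0))"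
  have W0: "0 \<le> W n" for n unfolding W_def using U(1) V(1) k1 by (intro mult_nonneg_nonneg sum_nonneg) auto
  show ?thesis unfolding bd_def
  proof (intro exI[of _ W] conjI allI impI ballI W0)
    fix n :: int assume n: "2 * K + 1 < \<bar>n\<bar>"
    have "s + i + j \<noteq> n" if "i \<in> {-K..K}" "j \<in> {-K..K}" for i j using that s n by auto
    then have "(\<Sum>i\<in>{-K..K}. \<Sum>j\<in>{-K..K}. if s + i + j = n then U i * V j else 0) = 0"
      by (intro sum.neutral ballI) auto
    then show "W n = 0" by (simp add: W_def)
  next
    have "(\<Sum>n\<in>{-(2 * K + 1)..2 * K + 1}. \<Sum>i\<in>{-K..K}. \<Sum>j\<in>{-K..K}. if s + i + j = n then U i * V j else 0)
       = (\<Sum>i\<in>{-K..K}. \<Sum>j\<in>{-K..K}. \<Sum>n\<in>{-(2 * K + 1)..2 * K + 1}. if s + i + j = n then U i * V j else 0)"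
      by (subst sum.swap, rule sum.cong[OF refl], rule sum.swap)
    also have "\<dots> \<le> (\<Sum>i\<in>{-K..K}. \<Sum>j\<in>{-K..K}. U i * V j)"
      using U(1) V(1) by (intro sum_mono) (simp add: sum.delta')
    also have "\<dots> = (\<Sum>i\<in>{-K..K}. U i) * (\<Sum>j\<in>{-K..K}. V j)" by (simp add: sum_product)
    also have "\<dots> \<le> A * B" using U(3) V(3) U(1) V(1) A by (intro mult_mono sum_nonneg) auto
    finally show "(\<Sum>n\<in>{-(2 * K + 1)..2 * K + 1}. W n) \<le> kb ^ 8 * A * B"
      unfolding W_def sum_distrib_left[symmetric] using k1 by (simp add: mult.assoc)
  next
    fix n \<sigma> x assume \<sigma>: "\<sigma> \<in> Bs" and x: "x \<in> S R"
    have x1: "1 \<le> norm x" using S_ge1[OF _ x] R by (simp add: R1_def)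
    have "norm (T K s k1 k2 u v n \<sigma> x) \<le> (\<Sum>i\<in>{-K..K}. \<Sum>j\<in>{-K..K}. if s + i + j = n then kb ^ 8 * (U i * V j) * norm x powr (- g n) else 0)"
      unfolding T_def
    proof (intro sum_norm_le)
      fix i j
      show "norm (if s + i + j = n then cc k1 k2 s i j \<sigma> x * u i \<sigma> x * v j \<sigma> x else 0)
        \<le> (if s + i + j = n then kb ^ 8 * (U i * V j) * norm x powr (- g n) else 0)"
      proof (cases "s + i + j = n")
        case True
        have "norm (cc k1 k2 s i j \<sigma> x * u i \<sigma> x * v j \<sigma> x)
          \<le> kb ^ 8 * norm x powr (- (2 * real (min (m3 s i j) 2))) * (U i * norm x powr (- a i)) * (V j * norm x powr (- b j))"
          unfolding norm_mult using cc_bound[OF R \<sigma> x] U(4)[OF \<sigma> x, of i] V(4)[OF \<sigma> x, of j] k1 U(1)[of i]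
          by (intro mult_mono) auto
        also have "\<dots> = kb ^ 8 * (U i * V j) * norm x powr (- (a i + b j + 2 * real (min (m3 s i j) 2)))"
          by (simp only: minus_add_distrib powr_add ac_simps)
        also have "\<dots> \<le> kb ^ 8 * (U i * V j) * norm x powr (- g n)"
          using g[of i j] True x1 U(1)[of i] V(1)[of j] k1 by (intro mult_left_mono powr_mono) auto
        finally show ?thesis using True by simp
      qed simp
    qed
    also have "\<dots> = W n * norm x powr (- g n)"
      unfolding W_def sum_distrib_left sum_distrib_right by (intro sum.cong refl) auto
    finally show "norm (T K s k1 k2 u v n \<sigma> x) \<le> W n * norm x powr (- g n)" .
  qed
qed

lemma bd_L:
  assumes R: "R1 \<le> R" and r: "bd R K M e r" and h: "\<And>n. hol2 (r n)"
    and e: "\<And>n. 0 \<le> e n" "2 \<le> e 0"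
  shows "bd R K (CL * M) (\<lambda>n. e n - (if n = 0 then 1 else 0)) (\<lambda>n. L n (r n))"
proof -
  have R0: "R0 \<le> R" using R by (simp add: R1_def)
  obtain U where U: "\<And>i. 0 \<le> U i" "\<And>i. K < \<bar>i\<bar> \<Longrightarrow> U i = 0" "(\<Sum>i\<in>{-K..K}. U i) \<le> M"
    "\<And>i \<sigma> x. \<sigma> \<in> Bs \<Longrightarrow> x \<in> S R \<Longrightarrow> norm (r i \<sigma> x) \<le> U i * norm x powr (- e i)"
    using r unfolding bd_def by blast
  show ?thesis unfolding bd_def
  proof (intro exI[of _ "\<lambda>i. CL * U i"] conjI allI impI ballI)
    show "0 \<le> CL * U i" for i using U(1) CL_nonneg by simp
    show "(\<Sum>i\<in>{-K..K}. CL * U i) \<le> CL * M"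
      unfolding sum_distrib_left[symmetric] using U(3) CL_nonneg by (rule mult_left_mono)
    fix n \<sigma> x assume \<sigma>: "\<sigma> \<in> Bs" and x: "x \<in> S R"
    have "norm (L n (r n) \<sigma> x) \<le> CL * U n * norm x powr (- e n + (if n = 0 then 1 else 0))"
      by (rule L_bound(2)[where R = R, OF h U(4)[OF \<sigma>] R0]) (use e \<sigma> x in auto)
    then show "norm (L n (r n) \<sigma> x) \<le> CL * U n * norm x powr (- (e n - (if n = 0 then 1 else 0)))"
      by (simp add: algebra_simps)
  qed (use U in auto)
qed

end

section \<open>Contraction estimates\<close>

text \<open>The values 0, - 1, - 2 descend along the chain of terms that gain no power of x:
  off-diagonal coefficients on the favourable side, \<phi> at nonzero index, off-diagonal
  coefficients on the other side. The value 1 of \<open>wP\<close> at 0 and the decay 1/x of \<phi>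
  at 0, expressed by \<open>vP\<close>, pay for the power lost in \<open>L 0\<close>.\<close>

definition w1 :: "int \<Rightarrow> int" where "w1 m = (if m \<le> 0 then 0 else -2)"
definition wP :: "int \<Rightarrow> int" where "wP n = (if n = 0 then 1 else -1)"
definition vP :: "int \<Rightarrow> int" where "vP n = (if n = 0 then 4 else 0)"

text \<open>Errors are measured in quarter powers of \<open>x\<close>: with the weights \<open>wO\<close> one application of the
  integral operator gains a factor \<open>\<bar>x\<bar> powr (- 1/4)\<close>.\<close>

definition wO :: "kind \<Rightarrow> int \<Rightarrow> int" where
  "wO q n = (if q = Ph then wP n else w1 (sg q * n))"

definition wV :: "kind \<Rightarrow> int \<Rightarrow> int" where
  "wV q n = (if q = Ph then vP n else 0)"

definition eO :: "kind \<Rightarrow> real \<Rightarrow> int \<Rightarrow> real" where "eO q E n = real_of_int (wO q n) / 4 + E"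
definition eV :: "kind \<Rightarrow> int \<Rightarrow> real" where "eV q n = real_of_int (wV q n) / 4"

text \<open>On the left stand the weight of the target, the gain 1 and, at index 0, the 4 quarters
  that \<open>L 0\<close> loses. On the right stand 8 quarters for each X Y, at most two of them
  being counted, 4 for the factor 1/x, and the weight of the factor in error. The first line has the
  error in \<phi>, the second in q, with \<phi> bounded according to \<open>vP\<close>.\<close>

lemma weight_linear_term:
  "w1 (i + j) + 1 + (if i + j = 0 then 4 else 0) \<le> 8 * min (int (m3 0 i j)) 2 + 4 + wP i"
  "w1 (i + j) + 1 + (if i + j = 0 then 4 else 0) \<le> 8 * min (int (m3 0 i j)) 2 + 4 + vP i + w1 j"
  using m3_eq[of 0 i j] by (auto simp: w1_def wP_def vP_def abs_if min_def split: if_splits)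

lemma weight_quadratic_term:
  "w1 (1 + i + j) + 1 + (if 1 + i + j = 0 then 4 else 0) \<le> 8 * min (int (m3 1 i j)) 2 + wP i"
  "w1 (1 + i + j) + 1 + (if 1 + i + j = 0 then 4 else 0) \<le> 8 * min (int (m3 1 i j)) 2 + w1 (- j)"
  using m3_eq[of 1 i j] by (auto simp: w1_def wP_def abs_if min_def split: if_splits)

lemma weight_phi_term:
  "wP (1 + i + j) + 1 + (if 1 + i + j = 0 then 4 else 0) \<le> 8 * min (int (m3 1 i j)) 2 + w1 (- i)"
  "wP (1 + i + j) + 1 + (if 1 + i + j = 0 then 4 else 0) \<le> 8 * min (int (m3 1 i j)) 2 + w1 (- j)"
  using m3_eq[of 1 i j] by (auto simp: w1_def wP_def abs_if min_def split: if_splits)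

lemma wP_minus: "wP (- n) = wP n" and vP_minus: "vP (- n) = vP n"
  by (auto simp: wP_def vP_def)

lemma wO_linear_term:
  assumes "q \<noteq> Ph"
  shows "wO q (0 + i + j) + 1 + (if 0 + i + j = 0 then 4 else 0) \<le> 8 * min (int (m3 0 i j)) 2 + 4 + wO Ph i"
    "wO q (0 + i + j) + 1 + (if 0 + i + j = 0 then 4 else 0) \<le> 8 * min (int (m3 0 i j)) 2 + 4 + wV Ph i + wO q j"
proof -
  have e: "- i + - j = - (i + j)" by simp
  have m: "m3 0 (- i) (- j) = m3 0 i j" using m3_minus[of 0 i j] by simp
  show "wO q (0 + i + j) + 1 + (if 0 + i + j = 0 then 4 else 0) \<le> 8 * min (int (m3 0 i j)) 2 + 4 + wO Ph i"
    "wO q (0 + i + j) + 1 + (if 0 + i + j = 0 then 4 else 0) \<le> 8 * min (int (m3 0 i j)) 2 + 4 + wV Ph i + wO q j"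
    using sg_cases[OF assms] weight_linear_term[of i j] weight_linear_term[of "- i" "- j", unfolded e m wP_minus vP_minus]
      assms by (auto simp: wO_def wV_def simp del: minus_add_distrib)
qed

lemma wO_quadratic_term:
  assumes "q \<noteq> Ph"
  shows "wO q (sg q + i + j) + 1 + (if sg q + i + j = 0 then 4 else 0) \<le> 8 * min (int (m3 (sg q) i j)) 2 + wO Ph i"
    "wO q (sg q + i + j) + 1 + (if sg q + i + j = 0 then 4 else 0) \<le> 8 * min (int (m3 (sg q) i j)) 2 + wO (bar q) j"
proof -
  have e: "1 + - i + - j = - (-1 + i + j)" by simp
  have m: "m3 1 (- i) (- j) = m3 (-1) i j" using m3_minus[of "-1" i j] by simp
  show "wO q (sg q + i + j) + 1 + (if sg q + i + j = 0 then 4 else 0) \<le> 8 * min (int (m3 (sg q) i j)) 2 + wO Ph i"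
    "wO q (sg q + i + j) + 1 + (if sg q + i + j = 0 then 4 else 0) \<le> 8 * min (int (m3 (sg q) i j)) 2 + wO (bar q) j"
    using sg_cases[OF assms] weight_quadratic_term[of i j] weight_quadratic_term[of "- i" "- j", unfolded e m wP_minus]
      assms by (auto simp: wO_def wV_def simp del: minus_add_distrib minus_diff_eq)
qed

lemma wO_phi_term:
  "wO Ph (1 + i + j) + 1 + (if 1 + i + j = 0 then 4 else 0) \<le> 8 * min (int (m3 1 i j)) 2 + wO Gp i"
  "wO Ph (1 + i + j) + 1 + (if 1 + i + j = 0 then 4 else 0) \<le> 8 * min (int (m3 1 i j)) 2 + wO Fm j"
  "wO Ph (-1 + i + j) + 1 + (if -1 + i + j = 0 then 4 else 0) \<le> 8 * min (int (m3 (-1) i j)) 2 + wO Gm i"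
  "wO Ph (-1 + i + j) + 1 + (if -1 + i + j = 0 then 4 else 0) \<le> 8 * min (int (m3 (-1) i j)) 2 + wO Fp j"
proof -
  have e: "1 + - i + - j = - (-1 + i + j)" by simp
  have m: "m3 1 (- i) (- j) = m3 (-1) i j" using m3_minus[of "-1" i j] by simp
  show "wO Ph (1 + i + j) + 1 + (if 1 + i + j = 0 then 4 else 0) \<le> 8 * min (int (m3 1 i j)) 2 + wO Gp i"
    "wO Ph (1 + i + j) + 1 + (if 1 + i + j = 0 then 4 else 0) \<le> 8 * min (int (m3 1 i j)) 2 + wO Fm j"
    using weight_phi_term[of i j] by (simp_all add: wO_def)
  show "wO Ph (-1 + i + j) + 1 + (if -1 + i + j = 0 then 4 else 0) \<le> 8 * min (int (m3 (-1) i j)) 2 + wO Gm i"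
    "wO Ph (-1 + i + j) + 1 + (if -1 + i + j = 0 then 4 else 0) \<le> 8 * min (int (m3 (-1) i j)) 2 + wO Fp j"
    using weight_phi_term[of "- i" "- j", unfolded e m wP_minus] by (auto simp: wO_def simp del: minus_add_distrib minus_diff_eq)
qed

context painleve
begin

section \<open>The Lipschitz estimate for one iteration\<close>

lemma T_diff:
  "T K s k1 k2 u v n \<sigma> x - T K s k1 k2 u' v' n \<sigma> x
    = T K s k1 k2 (\<lambda>n \<sigma> x. u n \<sigma> x - u' n \<sigma> x) v n \<sigma> x + T K s k1 k2 u' (\<lambda>n \<sigma> x. v n \<sigma> x - v' n \<sigma> x) n \<sigma> x"
  unfolding T_def sum_subtractf[symmetric] sum.distrib[symmetric]
  by (intro sum.cong refl) (simp add: algebra_simps)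

lemma T_zero [simp]:
  "T K s k1 k2 (\<lambda>n \<sigma> x. 0) v n \<sigma> x = 0" "T K s k1 k2 u (\<lambda>n \<sigma> x. 0) n \<sigma> x = 0"
  unfolding T_def by (intro sum.neutral ballI; simp)+

lemma L_diff:
  assumes "adm n r" "adm n r'" and \<sigma>: "\<sigma> \<in> Bs" and x: "x \<in> S R0"
  shows "L n (\<lambda>\<sigma> x. r \<sigma> x - r' \<sigma> x) \<sigma> x = L n r \<sigma> x - L n r' \<sigma> x"
proof -
  have "adm n (\<lambda>\<sigma> x. (-1) * r' \<sigma> x)"
    using assms(2) unfolding adm_def by (auto simp: hol2R_R0[symmetric] intro: hol2R_cmult[where f = "\<lambda>_. -1", simplified])
  from L_add[OF assms(1) this \<sigma> x] L_cmult[OF assms(2) \<sigma> x, of "\<lambda>_. -1"]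
  show ?thesis by simp
qed

lemma adm_rhs:
  assumes "\<And>q n. Asy R0 (ordk q n) (z q n)" shows "adm n (rhs K z q n)" "hol2 (rhs K z q n)"
proof -
  have "Asy R0 (if n = 0 then 2 else 0) (rhs K z q n)"
    by (rule Asy_mono[OF Asy_rhs[OF assms]]) simp
  then show "adm n (rhs K z q n)" by (rule Asy_adm)
  then show "hol2 (rhs K z q n)" by (simp add: adm_def)
qed

lemma bd_single:
  assumes "0 \<le> K" "\<And>\<sigma> x. \<sigma> \<in> Bs \<Longrightarrow> x \<in> S R \<Longrightarrow> norm (f \<sigma> x) \<le> C * norm x powr (- e m)" "\<bar>m\<bar> \<le> K" "0 \<le> C"
  shows "bd R K C e (\<lambda>i \<sigma> x. if i = m then f \<sigma> x else 0)"
  unfolding bd_def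
proof (intro exI[of _ "\<lambda>i. if i = m then C else 0"] conjI allI impI ballI)
  show "(\<Sum>i\<in>{-K..K}. if i = m then C else 0) \<le> C" using assms by (simp add: sum.delta)
qed (use assms in auto)

lemma bd_pointwise:
  assumes "0 \<le> K" "0 \<le> C" "\<And>n \<sigma> x. \<bar>n\<bar> \<le> K \<Longrightarrow> \<sigma> \<in> Bs \<Longrightarrow> x \<in> S R \<Longrightarrow> norm (u n \<sigma> x) \<le> C * norm x powr (- e n)"
    and "\<And>n \<sigma> x. K < \<bar>n\<bar> \<Longrightarrow> \<sigma> \<in> Bs \<Longrightarrow> x \<in> S R \<Longrightarrow> u n \<sigma> x = 0"
  shows "bd R K (of_int (2 * K + 1) * C) e u"
  unfolding bd_def
proof (intro exI[of _ "\<lambda>i. if \<bar>i\<bar> \<le> K then C else 0"] conjI allI impI ballI)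
  have "(\<Sum>i\<in>{-K..K}. if \<bar>i\<bar> \<le> K then C else 0) = (\<Sum>i\<in>{-K..K}. C)" by (intro sum.cong) auto
  then show "(\<Sum>i\<in>{-K..K}. if \<bar>i\<bar> \<le> K then C else 0) \<le> of_int (2 * K + 1) * C" using assms(1) by simp
  fix n \<sigma> x assume "\<sigma> \<in> Bs" "x \<in> S R"
  then show "norm (u n \<sigma> x) \<le> (if \<bar>n\<bar> \<le> K then C else 0) * norm x powr (- e n)"
    using assms(3,4)[of n \<sigma> x] by auto
qed (use assms in auto)

lemma bd_sum:
  assumes u: "bd R K M e u" and R: "R1 \<le> R" and F: "finite F" and e: "\<And>n. h \<le> e n" and \<sigma>: "\<sigma> \<in> Bs" and x: "x \<in> S R"
  shows "(\<Sum>n\<in>F. norm (u n \<sigma> x)) \<le> M * norm x powr (- h)"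
proof -
  obtain U where U: "\<And>i. 0 \<le> U i" "\<And>i. K < \<bar>i\<bar> \<Longrightarrow> U i = 0" "(\<Sum>i\<in>{-K..K}. U i) \<le> M"
    "\<And>i \<sigma> x. \<sigma> \<in> Bs \<Longrightarrow> x \<in> S R \<Longrightarrow> norm (u i \<sigma> x) \<le> U i * norm x powr (- e i)"
    using u unfolding bd_def by blast
  have x1: "1 \<le> norm x" using S_ge1[OF _ x] R by (simp add: R1_def)
  have "(\<Sum>n\<in>F. norm (u n \<sigma> x)) \<le> (\<Sum>n\<in>F. U n * norm x powr (- h))"
  proof (rule sum_mono)
    fix n
    have "U n * norm x powr (- e n) \<le> U n * norm x powr (- h)" using U(1) e x1 by (intro mult_left_mono powr_mono) auto
    then show "norm (u n \<sigma> x) \<le> U n * norm x powr (- h)" using U(4)[OF \<sigma> x, of n] by linarith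
  qed
  also have "\<dots> = (\<Sum>n\<in>F. U n) * norm x powr (- h)" by (simp add: sum_distrib_right)
  also have "(\<Sum>n\<in>F. U n) \<le> (\<Sum>n\<in>F \<union> {-K..K}. U n)" using U(1) F by (intro sum_mono2) auto
  also have "(\<Sum>n\<in>F \<union> {-K..K}. U n) = (\<Sum>n\<in>{-K..K}. U n)"
    by (rule sum.mono_neutral_right) (use F U(2) in auto)
  finally show ?thesis using U(3) by (meson mult_right_mono order_trans powr_ge_zero)
qed

lemma bd_gain:
  assumes u: "bd R K M (\<lambda>n. e n + h) u" and R: "R1 \<le> R" and h: "0 \<le> h"
  shows "bd R K (M * R powr (- h)) e u"
proof -
  obtain U where U: "\<And>i. 0 \<le> U i" "\<And>i. K < \<bar>i\<bar> \<Longrightarrow> U i = 0" "(\<Sum>i\<in>{-K..K}. U i) \<le> M"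
    "\<And>i \<sigma> x. \<sigma> \<in> Bs \<Longrightarrow> x \<in> S R \<Longrightarrow> norm (u i \<sigma> x) \<le> U i * norm x powr (- (e i + h))"
    using u unfolding bd_def by blast
  have R1: "1 \<le> R" using R R0_ge by (simp add: R1_def)
  show ?thesis unfolding bd_def
  proof (intro exI[of _ "\<lambda>i. U i * R powr (- h)"] conjI allI impI ballI)
    show "(\<Sum>i\<in>{-K..K}. U i * R powr (- h)) \<le> M * R powr (- h)"
      unfolding sum_distrib_right[symmetric] using U(3) by (rule mult_right_mono) simp
    fix n \<sigma> x assume \<sigma>: "\<sigma> \<in> Bs" and x: "x \<in> S R"
    have "norm x powr (- h) \<le> R powr (- h)" using S_norm[OF x] R1 h by (intro powr_mono2') auto
    then have "U n * norm x powr (- e n) * norm x powr (- h) \<le> U n * norm x powr (- e n) * R powr (- h)"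
      using U(1) by (intro mult_left_mono) auto
    then show "norm (u n \<sigma> x) \<le> U n * R powr (- h) * norm x powr (- e n)"
      using U(4)[OF \<sigma> x, of n] by (simp add: powr_add[symmetric] algebra_simps)
  qed (use U in auto)
qed

text \<open>Differences of products are split so that one factor is a difference and the other is
  bounded. The constant 8 M + 2 kb is the factor 2 of the equations times three bounds M and one
  bound M + kb, the last for \<phi> + \<open>tau q\<close>.\<close>

lemma rhs_lipschitz:
  assumes R: "R1 \<le> R" and K: "0 \<le> K"
    and zM: "\<And>q. bd R K M (eV q) (z q)" and zM': "\<And>q. bd R K M (eV q) (z' q)"
    and D: "\<And>q. bd R K D (eO q e) (\<lambda>n \<sigma> x. z q n \<sigma> x - z' q n \<sigma> x)"
  shows "bd R (2 * K + 1) (kb ^ 8 * (8 * M + 2 * kb) * D) (\<lambda>n. eO q (e + 1/4) n + (if n = 0 then 1 else 0))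
      (\<lambda>n \<sigma> x. rhs K z q n \<sigma> x - rhs K z' q n \<sigma> x)"
proof -
  have kb1: "1 \<le> kb" by (rule kb)
  have M0: "0 \<le> M" and D0: "0 \<le> D" using bd_nonneg zM D by blast+
  let ?g = "\<lambda>n. eO q (e + 1/4) n + (if n = 0 then 1 else 0)"
  let ?d = "\<lambda>q n \<sigma> x. z q n \<sigma> x - z' q n \<sigma> x"
  \<comment> \<open>Divides the integer inequalities of the weight lemmas by 4; the gain 1 there
    becomes the exponent 1/4 here.\<close>
  have conv: "eO q (e + 1/4) n + (if n = 0 then 1 else 0) \<le> real_of_int a / 4 + e + real_of_int b / 4 + 2 * real (min m 2)"
    if "wO q n + 1 + (if n = 0 then 4 else 0) \<le> 8 * min (int m) 2 + a + b" for n m a b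
  proof -
    have "real_of_int (wO q n + 1 + (if n = 0 then 4 else 0)) \<le> real_of_int (8 * min (int m) 2 + a + b)"
      using that by (simp only: of_int_le_iff)
    moreover have "real_of_int (8 * min (int m) 2) = 8 * real (min m 2)" by (simp add: min_def)
    ultimately show ?thesis by (simp add: eO_def split: if_splits)
  qed
  show ?thesis
  proof (cases "q = Ph")
    case True
    have z0: "bd R K M (\<lambda>n. 0) (z q')" "bd R K M (\<lambda>n. 0) (z' q')" for q'
      using bd_mono[OF zM R order_refl order_refl] bd_mono[OF zM' R order_refl order_refl]
      by (auto simp: eV_def wV_def vP_def)
    have 1: "bd R (2 * K + 1) (kb ^ 8 * D * M) ?g (T K 1 Gp Fm (?d Gp) (z Fm))"
      using wO_phi_term(1) True conv[of _ _ "wO Gp _" 0]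
      by (intro bd_T[OF R _ D z0(1)]) (auto simp: eO_def[of Gp])
    have 2: "bd R (2 * K + 1) (kb ^ 8 * M * D) ?g (T K 1 Gp Fm (z' Gp) (?d Fm))"
      using wO_phi_term(2) True conv[of _ _ "wO Fm _" 0]
      by (intro bd_T[OF R _ z0(2) D]) (auto simp: eO_def[of Fm])
    have 3: "bd R (2 * K + 1) (kb ^ 8 * D * M) ?g (T K (-1) Gm Fp (?d Gm) (z Fp))"
      using wO_phi_term(3) True conv[of _ _ "wO Gm _" 0]
      by (intro bd_T[OF R _ D z0(1)]) (auto simp: eO_def[of Gm])
    have 4: "bd R (2 * K + 1) (kb ^ 8 * M * D) ?g (T K (-1) Gm Fp (z' Gm) (?d Fp))"
      using wO_phi_term(4) True conv[of _ _ "wO Fp _" 0]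
      by (intro bd_T[OF R _ z0(2) D]) (auto simp: eO_def[of Fp])
    have 5: "bd R (2 * K + 1) (1 * (kb ^ 8 * D * M + kb ^ 8 * M * D)) ?g
       (\<lambda>n \<sigma> x. (-1) * (T K (-1) Gm Fp (?d Gm) (z Fp) n \<sigma> x + T K (-1) Gm Fp (z' Gm) (?d Fp) n \<sigma> x))"
      by (rule bd_cmult[OF bd_add[OF 3 4]]) auto
    have "(\<lambda>n \<sigma> x. rhs K z q n \<sigma> x - rhs K z' q n \<sigma> x)
      = (\<lambda>n \<sigma> x. (T K 1 Gp Fm (?d Gp) (z Fm) n \<sigma> x + T K 1 Gp Fm (z' Gp) (?d Fm) n \<sigma> x)
         + (-1) * (T K (-1) Gm Fp (?d Gm) (z Fp) n \<sigma> x + T K (-1) Gm Fp (z' Gm) (?d Fp) n \<sigma> x))"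
      unfolding T_diff[symmetric] using True by (simp add: rhs_def fun_eq_iff)
    moreover have "(kb ^ 8 * D * M + kb ^ 8 * M * D) + 1 * (kb ^ 8 * D * M + kb ^ 8 * M * D) \<le> kb ^ 8 * (8 * M + 2 * kb) * D"
      using kb1 M0 D0 by (simp add: algebra_simps)
    ultimately show ?thesis using bd_mono[OF bd_add[OF bd_add[OF 1 2] 5] R order_refl] by simp
  next
    case False
    have z0: "bd R K M (\<lambda>n. 0) (z q')" "bd R K M (\<lambda>n. 0) (z' q')" for q'
      using bd_mono[OF zM R order_refl order_refl] bd_mono[OF zM' R order_refl order_refl]
      by (auto simp: eV_def wV_def vP_def)
    have ta: "bd R K kb (\<lambda>n. 0) (\<lambda>i \<sigma> x. if i = 0 then tau q \<sigma> else 0)"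
      by (rule bd_single) (use K tau_le kb1 S_nonzero in auto)
    have f0: "bd R K (M + kb) (\<lambda>n. 0) (fs q z')"
      using bd_add[OF z0(2)[of Ph] ta] by (simp add: fs_def [abs_def])
    have fd: "(\<lambda>n \<sigma> x. fs q z n \<sigma> x - fs q z' n \<sigma> x) = ?d Ph" by (simp add: fs_def fun_eq_iff)
    have 1: "bd R (2 * K + 1) (kb ^ 8 * D * M) (\<lambda>n. ?g n - 1) (T K 0 Ph q (?d Ph) (z q))"
    proof (intro bd_T[OF R _ D z0(1)])
      show "?g (0 + i + j) - 1 \<le> eO Ph e i + 0 + 2 * real (min (m3 0 i j) 2)" for i j
        using conv[OF wO_linear_term(1)[OF False, of i j]] by (simp add: eO_def[of Ph])
    qed simp
    have 2: "bd R (2 * K + 1) (kb ^ 8 * M * D) (\<lambda>n. ?g n - 1) (T K 0 Ph q (z' Ph) (?d q))"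
    proof (intro bd_T[OF R _ zM' D])
      show "?g (0 + i + j) - 1 \<le> eV Ph i + eO q e j + 2 * real (min (m3 0 i j) 2)" for i j
      proof -
        have "?g (0 + i + j) \<le> real_of_int (4 + wV Ph i) / 4 + e + real_of_int (wO q j) / 4 + 2 * real (min (m3 0 i j) 2)"
          using wO_linear_term(2)[OF False, of i j] by (intro conv) (simp only: add.assoc)
        moreover have "real_of_int (4 + wV Ph i) / 4 = 1 + eV Ph i" by (simp add: eV_def)
        moreover have "eO q e j = real_of_int (wO q j) / 4 + e" by (simp add: eO_def)
        ultimately show ?thesis by linarith
      qed
    qed simp
    have 12: "bd R (2 * K + 1) (kb ^ 8 * D * M + kb ^ 8 * M * D) ?g
       (\<lambda>n \<sigma> x. (T K 0 Ph q (?d Ph) (z q) n \<sigma> x + T K 0 Ph q (z' Ph) (?d q) n \<sigma> x) / x)"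
      using bd_over_x[OF bd_add[OF 1 2]] by simp
    have 3: "bd R (2 * K + 1) (kb ^ 8 * D * M) ?g (T K (sg q) Ph (bar q) (?d Ph) (z (bar q)))"
      using wO_quadratic_term(1)[OF False] conv[of _ _ "wO Ph _" 0] sg_le
      by (intro bd_T[OF R _ D z0(1)]) (auto simp: eO_def[of Ph])
    have 4: "bd R (2 * K + 1) (kb ^ 8 * (M + kb) * D) ?g (T K (sg q) Ph (bar q) (fs q z') (?d (bar q)))"
      using wO_quadratic_term(2)[OF False] conv[of _ _ "wO (bar q) _" 0] sg_le
      by (intro bd_T[OF R _ f0 D]) (auto simp: eO_def[of "bar q"])
    have 5: "bd R (2 * K + 1) (2 * (kb ^ 8 * D * M + kb ^ 8 * M * D + (kb ^ 8 * D * M + kb ^ 8 * (M + kb) * D))) ?g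
       (\<lambda>n \<sigma> x. - 2 * of_int (sg q) * ((T K 0 Ph q (?d Ph) (z q) n \<sigma> x + T K 0 Ph q (z' Ph) (?d q) n \<sigma> x) / x
         + (T K (sg q) Ph (bar q) (?d Ph) (z (bar q)) n \<sigma> x + T K (sg q) Ph (bar q) (fs q z') (?d (bar q)) n \<sigma> x)))"
      by (rule bd_cmult[OF bd_add[OF 12 bd_add[OF 3 4]]]) (use sg_cases[OF False] in \<open>auto simp: norm_mult\<close>)
    have "(\<lambda>n \<sigma> x. rhs K z q n \<sigma> x - rhs K z' q n \<sigma> x)
      = (\<lambda>n \<sigma> x. - 2 * of_int (sg q) * ((T K 0 Ph q (?d Ph) (z q) n \<sigma> x + T K 0 Ph q (z' Ph) (?d q) n \<sigma> x) / x
         + (T K (sg q) Ph (bar q) (?d Ph) (z (bar q)) n \<sigma> x + T K (sg q) Ph (bar q) (fs q z') (?d (bar q)) n \<sigma> x)))"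
    proof (intro ext)
      fix n \<sigma> x
      have a1: "T K 0 Ph q (z Ph) (z q) n \<sigma> x - T K 0 Ph q (z' Ph) (z' q) n \<sigma> x
        = T K 0 Ph q (?d Ph) (z q) n \<sigma> x + T K 0 Ph q (z' Ph) (?d q) n \<sigma> x" by (rule T_diff)
      have a2: "T K (sg q) Ph (bar q) (fs q z) (z (bar q)) n \<sigma> x - T K (sg q) Ph (bar q) (fs q z') (z' (bar q)) n \<sigma> x
        = T K (sg q) Ph (bar q) (?d Ph) (z (bar q)) n \<sigma> x + T K (sg q) Ph (bar q) (fs q z') (?d (bar q)) n \<sigma> x"
        using T_diff[of K "sg q" Ph "bar q" "fs q z" "z (bar q)" n \<sigma> x "fs q z'" "z' (bar q)"] unfolding fd .
      have "rhs K z q n \<sigma> x - rhs K z' q n \<sigma> x = - 2 * of_int (sg q) *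
         ((T K 0 Ph q (z Ph) (z q) n \<sigma> x - T K 0 Ph q (z' Ph) (z' q) n \<sigma> x) / x
        + (T K (sg q) Ph (bar q) (fs q z) (z (bar q)) n \<sigma> x - T K (sg q) Ph (bar q) (fs q z') (z' (bar q)) n \<sigma> x))"
        using False by (simp add: rhs_def diff_divide_distrib) (simp add: algebra_simps)
      then show "rhs K z q n \<sigma> x - rhs K z' q n \<sigma> x = - 2 * of_int (sg q) *
         ((T K 0 Ph q (?d Ph) (z q) n \<sigma> x + T K 0 Ph q (z' Ph) (?d q) n \<sigma> x) / x
         + (T K (sg q) Ph (bar q) (?d Ph) (z (bar q)) n \<sigma> x + T K (sg q) Ph (bar q) (fs q z') (?d (bar q)) n \<sigma> x))"
        unfolding a1 a2 .
    qed
    moreover have "2 * (kb ^ 8 * D * M + kb ^ 8 * M * D + (kb ^ 8 * D * M + kb ^ 8 * (M + kb) * D)) \<le> kb ^ 8 * (8 * M + 2 * kb) * D"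
      by (simp add: algebra_simps)
    ultimately show ?thesis using bd_mono[OF 5 R order_refl] by simp
  qed
qed

text \<open>For the off-diagonal kinds \<open>3/4 \<le> e\<close> is exactly what makes the
  difference of the right-hand sides decay like x^-2 at index 0, the condition for
  \<open>L 0\<close>. The power lost there was already set aside in the exponent of
  \<open>rhs_lipschitz\<close>.\<close>

lemma Phi_lipschitz:
  assumes R: "R1 \<le> R" and K: "0 \<le> K" and e: "3/4 \<le> e"
    and zM: "\<And>q. bd R K M (eV q) (z q)" and zM': "\<And>q. bd R K M (eV q) (z' q)"
    and D: "\<And>q. bd R K D (eO q e) (\<lambda>n \<sigma> x. z q n \<sigma> x - z' q n \<sigma> x)"
    and A: "\<And>q n. Asy R0 (ordk q n) (z q n)" and A': "\<And>q n. Asy R0 (ordk q n) (z' q n)"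
  shows "bd R (2 * K + 1) (CL * (kb ^ 8 * (8 * M + 2 * kb)) * D) (eO q (e + 1/4))
      (\<lambda>n \<sigma> x. Phi K z q n \<sigma> x - Phi K z' q n \<sigma> x)"
proof -
  have h: "hol2 (\<lambda>\<sigma> x. rhs K z q n \<sigma> x - rhs K z' q n \<sigma> x)" for n
    using adm_rhs(2)[OF A] adm_rhs(2)[OF A'] hol2R_diff unfolding hol2R_R0[symmetric] by blast
  have "bd R (2 * K + 1) (CL * (kb ^ 8 * (8 * M + 2 * kb) * D)) (\<lambda>n. eO q (e + 1/4) n + (if n = 0 then 1 else 0) - (if n = 0 then 1 else 0))
      (\<lambda>n. L n (\<lambda>\<sigma> x. rhs K z q n \<sigma> x - rhs K z' q n \<sigma> x))"
    by (rule bd_L[OF R rhs_lipschitz[OF R K zM zM' D] h]) (use e in \<open>auto simp: eO_def wO_def w1_def wP_def\<close>)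
  then have b: "bd R (2 * K + 1) (CL * (kb ^ 8 * (8 * M + 2 * kb)) * D) (eO q (e + 1/4))
      (\<lambda>n. L n (\<lambda>\<sigma> x. rhs K z q n \<sigma> x - rhs K z' q n \<sigma> x))" by (simp add: mult.assoc)
  have eq: "Phi K z q n \<sigma> x - Phi K z' q n \<sigma> x = L n (\<lambda>\<sigma> x. rhs K z q n \<sigma> x - rhs K z' q n \<sigma> x) \<sigma> x"
    if "\<sigma> \<in> Bs" "x \<in> S R" for n \<sigma> x
  proof -
    have "x \<in> S R0" using that(2) S_antimono[of R0 R] R by (auto simp: R1_def)
    then show ?thesis using L_diff[OF adm_rhs(1)[OF A] adm_rhs(1)[OF A'] that(1)] by (simp add: Phi_def)
  qed
  show ?thesis using b eq unfolding bd_def by simp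
qed

section \<open>The first approximation and its residual\<close>

definition dl :: coeffs where "dl n \<sigma> x = (if n = 0 then 1 else 0)"

lemma T_delta_right:
  assumes "0 \<le> K"
  shows "T K s k1 k2 u dl n \<sigma> x = (if \<bar>n - s\<bar> \<le> K then cc k1 k2 s (n - s) 0 \<sigma> x * u (n - s) \<sigma> x else 0)"
proof -
  have "T K s k1 k2 u dl n \<sigma> x = (\<Sum>i\<in>{-K..K}. \<Sum>j\<in>{-K..K}. if j = 0 then (if s + i = n then cc k1 k2 s i 0 \<sigma> x * u i \<sigma> x else 0) else 0)"
    unfolding T_def by (intro sum.cong refl) (auto simp: dl_def)
  also have "\<dots> = (\<Sum>i\<in>{-K..K}. if s + i = n then cc k1 k2 s i 0 \<sigma> x * u i \<sigma> x else 0)"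
    using assms by (simp add: sum.delta)
  also have "\<dots> = (\<Sum>i\<in>{-K..K}. if i = n - s then cc k1 k2 s (n - s) 0 \<sigma> x * u (n - s) \<sigma> x else 0)"
    by (intro sum.cong refl) auto
  also have "\<dots> = (if \<bar>n - s\<bar> \<le> K then cc k1 k2 s (n - s) 0 \<sigma> x * u (n - s) \<sigma> x else 0)"
    by (simp add: sum.delta abs_le_iff)
  finally show ?thesis .
qed

lemma bd_dl: "0 \<le> K \<Longrightarrow> bd R K 1 (\<lambda>n. 0) dl"
  unfolding dl_def [abs_def] by (rule bd_single) (use S_nonzero in auto)

lemma bd_z0:
  obtains M where "\<And>q. bd R 2 M (eV q) (z0 q)"
    "\<And>q. q \<noteq> Ph \<Longrightarrow> bd R 2 M (\<lambda>n. if 1 \<le> sg q * n then 0 else 4) (\<lambda>n \<sigma> x. z0 q n \<sigma> x - dl n \<sigma> x)"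
proof
  have kb1: "1 \<le> kb" by (rule kb)
  have t: "norm (2 * tau q \<sigma>) \<le> 2 * kb" if "\<sigma> \<in> Bs" for q \<sigma> using tau_le[OF that] by (simp add: norm_mult)
  show "bd R 2 (of_int (2 * 2 + 1) * (2 * kb)) (eV q) (z0 q)" for q
  proof (rule bd_pointwise)
    fix n \<sigma> x assume \<sigma>: "\<sigma> \<in> Bs" and x: "x \<in> S R"
    then show "norm (z0 q n \<sigma> x) \<le> 2 * kb * norm x powr (- eV q n)"
      using t[OF \<sigma>, of q] kb1 S_nonzero[OF x] by (auto simp: z0_def eV_def wV_def vP_def norm_mult)
  next
    fix n \<sigma> x assume "2 < \<bar>n::int\<bar>"
    then show "z0 q n \<sigma> x = 0" using supp_zz[of 0 q] by (simp add: supp_def)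
  qed (use kb1 in auto)
  show "bd R 2 (of_int (2 * 2 + 1) * (2 * kb)) (\<lambda>n. if 1 \<le> sg q * n then 0 else 4) (\<lambda>n \<sigma> x. z0 q n \<sigma> x - dl n \<sigma> x)"
    if q: "q \<noteq> Ph" for q
  proof (rule bd_pointwise)
    fix n \<sigma> x assume \<sigma>: "\<sigma> \<in> Bs" and x: "x \<in> S R"
    show "norm (z0 q n \<sigma> x - dl n \<sigma> x) \<le> 2 * kb * norm x powr (- (if 1 \<le> sg q * n then 0 else 4))"
      using t[OF \<sigma>, of q] kb1 S_nonzero[OF x] q sg_cases[OF q] by (auto simp: z0_def dl_def norm_mult)
  next
    fix n \<sigma> x assume "2 < \<bar>n::int\<bar>"
    then show "z0 q n \<sigma> x - dl n \<sigma> x = 0" using supp_zz[of 0 q] by (auto simp: supp_def dl_def)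
  qed (use kb1 in auto)
qed

lemma bd_at: "bd R K M e u \<Longrightarrow> \<sigma> \<in> Bs \<Longrightarrow> x \<in> S R \<Longrightarrow> norm (u n \<sigma> x) \<le> M * norm x powr (- e n)"
proof -
  assume u: "bd R K M e u" and \<sigma>: "\<sigma> \<in> Bs" and x: "x \<in> S R"
  obtain U where U: "\<And>i. 0 \<le> U i" "\<And>i. K < \<bar>i\<bar> \<Longrightarrow> U i = 0" "(\<Sum>i\<in>{-K..K}. U i) \<le> M"
    "\<And>i \<sigma> x. \<sigma> \<in> Bs \<Longrightarrow> x \<in> S R \<Longrightarrow> norm (u i \<sigma> x) \<le> U i * norm x powr (- e i)"
    using u unfolding bd_def by blast
  have "U n \<le> M"
  proof (cases "\<bar>n\<bar> \<le> K")
    case True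
    then have "U n \<le> (\<Sum>i\<in>{-K..K}. U i)" using U(1) by (intro member_le_sum) auto
    then show ?thesis using U(3) by linarith
  next
    case False then show ?thesis using U(2)[of n] bd_nonneg[OF u] by simp
  qed
  then show ?thesis using U(4)[OF \<sigma> x, of n] by (meson mult_right_mono order_trans powr_ge_zero)
qed

lemma cc_leading:
  assumes "q \<noteq> Ph" shows "cc Ph (bar q) (sg q) 0 0 \<sigma> x = 1" "cc Ph (bar q) (sg q) (sg q) 0 \<sigma> x = 1"
    "cc Gp Fm 1 0 0 \<sigma> x = 1" "cc Gm Fp (-1) 0 0 \<sigma> x = 1"
  using assms by (cases q; simp add: cc_def mm_def m3_def)+

text \<open>Each off-diagonal part of \<open>z0\<close> is \<open>dl\<close> plus coefficients on
  its own side. In every product these lie on the side opposite to the shift s, so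
  \<open>m31\<close> gives a factor x^-2; what remains are products with \<open>dl\<close>, and they
  reproduce n \<open>z0\<close> by construction.\<close>

lemma rhs_z0:
  assumes R: "R1 \<le> R"
  shows "\<exists>C\<ge>0. \<forall>n. \<forall>\<sigma>\<in>Bs. \<forall>x\<in>S R. norm (rhs 2 z0 q n \<sigma> x - of_int n * z0 q n \<sigma> x)
           \<le> C * norm x powr (- (if n = 0 then 2 else 1))"
proof -
  have kb1: "1 \<le> kb" by (rule kb)
  obtain M where M: "\<And>q. bd R 2 M (eV q) (z0 q)"
    "\<And>q. q \<noteq> Ph \<Longrightarrow> bd R 2 M (\<lambda>n. if 1 \<le> sg q * n then 0 else 4) (\<lambda>n \<sigma> x. z0 q n \<sigma> x - dl n \<sigma> x)"
    using bd_z0[of R] by blast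
  have M0: "0 \<le> M" using bd_nonneg M by blast
  have z0: "bd R 2 M (\<lambda>n. 0) (z0 q')" for q'
    using bd_mono[OF M(1) R order_refl order_refl] by (auto simp: eV_def wV_def vP_def)
  have m31: "m3 s i j \<ge> 1" if "s * i \<le> -1 \<or> s * j \<le> -1" "s = 1 \<or> s = -1" for s i j
  proof -
    have "2 * int (m3 s i j) \<ge> 1" unfolding m3_eq using that by auto
    then show ?thesis by simp
  qed
  have le1: "norm x powr (- 2) \<le> norm x powr (- (if n = 0 then 2 else 1))" if "x \<in> S R" for x and n :: int
    using S_ge1[OF _ that] R by (intro powr_mono) (auto simp: R1_def)
  show ?thesis
  proof (cases "q = Ph")
    case True
    let ?d = "\<lambda>q n \<sigma> x. z0 q n \<sigma> x - dl n \<sigma> x"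
    have part: "norm (T 2 s k1 k2 (z0 k1) (z0 k2) n \<sigma> x - (if n = s then 1 else 0)) \<le> (kb ^ 8 * M * M + kb ^ 8 * M * 1) * norm x powr (- 2)"
      if k: "k1 \<noteq> Ph" "k2 \<noteq> Ph" "sg k1 = - s" "sg k2 = - s" and s: "s = 1 \<or> s = -1" and c: "cc k1 k2 s 0 0 \<sigma> x = 1"
        and \<sigma>: "\<sigma> \<in> Bs" and x: "x \<in> S R" for s k1 k2 n \<sigma> x
    proof -
      have 1: "bd R (2 * 2 + 1) (kb ^ 8 * M * M) (\<lambda>n. 2) (T 2 s k1 k2 (z0 k1) (?d k2))"
        using m31[of s] s k by (intro bd_T[OF R _ z0 M(2)]) auto
      have 2: "bd R (2 * 2 + 1) (kb ^ 8 * M * 1) (\<lambda>n. 2) (T 2 s k1 k2 (?d k1) dl)"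
        using m31[of s] s k by (intro bd_T[OF R _ M(2) bd_dl]) auto
      have "T 2 s k1 k2 (z0 k1) (z0 k2) n \<sigma> x - T 2 s k1 k2 (z0 k1) dl n \<sigma> x = T 2 s k1 k2 (z0 k1) (?d k2) n \<sigma> x"
        using T_diff[of 2 s k1 k2 "z0 k1" "z0 k2" n \<sigma> x "z0 k1" dl] by simp
      moreover have "T 2 s k1 k2 (z0 k1) dl n \<sigma> x - T 2 s k1 k2 dl dl n \<sigma> x = T 2 s k1 k2 (?d k1) dl n \<sigma> x"
        using T_diff[of 2 s k1 k2 "z0 k1" dl n \<sigma> x dl dl] by simp
      moreover have "T 2 s k1 k2 dl dl n \<sigma> x = (if n = s then 1 else 0)"
        using c by (simp add: T_delta_right dl_def)
      ultimately have "T 2 s k1 k2 (z0 k1) (z0 k2) n \<sigma> x - (if n = s then 1 else 0)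
        = T 2 s k1 k2 (z0 k1) (?d k2) n \<sigma> x + T 2 s k1 k2 (?d k1) dl n \<sigma> x" by (simp add: algebra_simps)
      then show ?thesis using bd_at[OF 1 \<sigma> x, of n] bd_at[OF 2 \<sigma> x, of n]
          norm_triangle_ineq[of "T 2 s k1 k2 (z0 k1) (?d k2) n \<sigma> x" "T 2 s k1 k2 (?d k1) dl n \<sigma> x"]
        by (simp add: algebra_simps)
    qed
    have "norm (rhs 2 z0 q n \<sigma> x - of_int n * z0 q n \<sigma> x) \<le> (2 * (kb ^ 8 * M * M + kb ^ 8 * M * 1)) * norm x powr (- (if n = 0 then 2 else 1))"
      if \<sigma>: "\<sigma> \<in> Bs" and x: "x \<in> S R" for n \<sigma> x
    proof -
      have "of_int n * z0 q n \<sigma> x = (if n = 1 then 1 else 0) - (if n = -1 then 1 else 0)"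
        using True by (auto simp: z0_def abs_if split: if_splits)
      then have eq: "rhs 2 z0 q n \<sigma> x - of_int n * z0 q n \<sigma> x = (T 2 1 Gp Fm (z0 Gp) (z0 Fm) n \<sigma> x - (if n = 1 then 1 else 0))
        - (T 2 (-1) Gm Fp (z0 Gm) (z0 Fp) n \<sigma> x - (if n = -1 then 1 else 0))"
        using True by (simp add: rhs_def)
      have "norm (rhs 2 z0 q n \<sigma> x - of_int n * z0 q n \<sigma> x)
          \<le> (kb ^ 8 * M * M + kb ^ 8 * M * 1) * norm x powr (- 2) + (kb ^ 8 * M * M + kb ^ 8 * M * 1) * norm x powr (- 2)"
        unfolding eq
        by (rule order_trans[OF norm_triangle_ineq4 add_mono[OF part part]]) (use \<sigma> x cc_leading(3,4)[of Fp \<sigma> x] in auto)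
      also have "\<dots> = (2 * (kb ^ 8 * M * M + kb ^ 8 * M * 1)) * norm x powr (- 2)" by simp
      also have "\<dots> \<le> (2 * (kb ^ 8 * M * M + kb ^ 8 * M * 1)) * norm x powr (- (if n = 0 then 2 else 1))"
        using le1[OF x] M0 kb1 by (intro mult_left_mono) auto
      finally show ?thesis .
    qed
    then show ?thesis using M0 kb1 by (intro exI[of _ "2 * (kb ^ 8 * M * M + kb ^ 8 * M * 1)"]) auto
  next
    case False
    note s = sg_cases[OF False]
    let ?d = "\<lambda>n \<sigma> x. z0 (bar q) n \<sigma> x - dl n \<sigma> x"
    have ta: "bd R 2 kb (\<lambda>n. 0) (\<lambda>i \<sigma> x. if i = 0 then tau q \<sigma> else 0)"
      by (rule bd_single) (use tau_le kb1 S_nonzero in auto)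
    have f0: "bd R 2 (M + kb) (\<lambda>n. 0) (fs q z0)"
      using bd_add[OF z0[of Ph] ta] by (simp add: fs_def [abs_def])
    have zP: "bd R 2 M (\<lambda>n. if n = 0 then 1 else 0) (z0 Ph)"
      using bd_mono[OF M(1)[of Ph] R order_refl order_refl] by (auto simp: eV_def wV_def vP_def)
    have m30: "m3 0 i j \<ge> 1" if "i + j = 0" "i \<noteq> 0" for i j
    proof -
      have "2 * int (m3 0 i j) \<ge> 1" unfolding m3_eq using that by auto
      then show ?thesis by simp
    qed
    have 1: "bd R (2 * 2 + 1) (kb ^ 8 * M * M) (\<lambda>n. (if n = 0 then 2 else 1) - 1) (T 2 0 Ph q (z0 Ph) (z0 q))"
    proof (intro bd_T[OF R _ zP z0])
      show "(if 0 + i + j = 0 then 2 else 1) - 1 \<le> (if i = 0 then 1 else 0) + 0 + 2 * real (min (m3 0 i j) 2)" for i j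
        using m30[of i j] by (cases "i = 0") auto
    qed simp
    have 2: "bd R (2 * 2 + 1) (kb ^ 8 * (M + kb) * M) (\<lambda>n. 2) (T 2 (sg q) Ph (bar q) (fs q z0) ?d)"
      using m31[of "sg q"] s False M(2)[of "bar q"] by (intro bd_T[OF R _ f0 M(2)]) auto
    \<comment> \<open>The constant \<open>tau q\<close> lands at index \<open>sg q\<close> and
      \<phi> at \<open>sg q\<close> lands at \<open>2 * sg q\<close>. The third contribution, \<phi>
      at \<open>- sg q\<close>, lands at 0 and carries a factor X Y.\<close>
    have lead: "norm (T 2 (sg q) Ph (bar q) (fs q z0) dl n \<sigma> x - (if n = sg q then tau q \<sigma> else if n = 2 * sg q then 1 else 0))
       \<le> kb ^ 8 * norm x powr (- 2)" if \<sigma>: "\<sigma> \<in> Bs" and x: "x \<in> S R" for n \<sigma> x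
    proof (cases "n = 0")
      case True
      have "m3 (sg q) (- sg q) 0 = 1" using s by (auto simp: m3_def)
      then have "norm (cc Ph (bar q) (sg q) (- sg q) 0 \<sigma> x) \<le> kb ^ 8 * norm x powr (- 2)"
        using cc_bound[OF R \<sigma> x, of Ph "bar q" "sg q" "- sg q" 0] by simp
      then show ?thesis using True s by (auto simp: T_delta_right fs_def z0_def)
    next
      case False
      consider "n = sg q" | "n = 2 * sg q" | "n \<noteq> sg q" "n \<noteq> 2 * sg q" by blast
      then have "T 2 (sg q) Ph (bar q) (fs q z0) dl n \<sigma> x = (if n = sg q then tau q \<sigma> else if n = 2 * sg q then 1 else 0)"
      proof cases
        case 1 then show ?thesis using cc_leading(1)[OF \<open>q \<noteq> Ph\<close>] s by (simp add: T_delta_right fs_def z0_def)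
      next
        case 2 then show ?thesis using cc_leading(2)[OF \<open>q \<noteq> Ph\<close>] s by (auto simp: T_delta_right fs_def z0_def)
      next
        case 3
        have "fs q z0 (n - sg q) \<sigma> x = 0" using 3 False s by (auto simp: fs_def z0_def abs_if split: if_splits)
        then show ?thesis using 3 by (simp add: T_delta_right)
      qed
      then show ?thesis using kb1 by simp
    qed
    let ?C = "2 * (kb ^ 8 * M * M + (kb ^ 8 * (M + kb) * M + kb ^ 8))"
    have "norm (rhs 2 z0 q n \<sigma> x - of_int n * z0 q n \<sigma> x) \<le> ?C * norm x powr (- (if n = 0 then 2 else 1))"
      if \<sigma>: "\<sigma> \<in> Bs" and x: "x \<in> S R" for n \<sigma> x
    proof -
      let ?l = "if n = sg q then tau q \<sigma> else if n = 2 * sg q then 1 else 0"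
      let ?T1 = "T 2 0 Ph q (z0 Ph) (z0 q) n \<sigma> x / x"
      let ?T2 = "T 2 (sg q) Ph (bar q) (fs q z0) ?d n \<sigma> x"
      let ?T3 = "T 2 (sg q) Ph (bar q) (fs q z0) dl n \<sigma> x - ?l"
      have "of_int n * z0 q n \<sigma> x = - 2 * of_int (sg q) * ?l"
        using False s by (auto simp: z0_def)
      moreover have "T 2 (sg q) Ph (bar q) (fs q z0) (z0 (bar q)) n \<sigma> x - T 2 (sg q) Ph (bar q) (fs q z0) dl n \<sigma> x = ?T2"
        using T_diff[of 2 "sg q" Ph "bar q" "fs q z0" "z0 (bar q)" n \<sigma> x "fs q z0" dl] by simp
      ultimately have "rhs 2 z0 q n \<sigma> x - of_int n * z0 q n \<sigma> x = - 2 * of_int (sg q) * (?T1 + (?T2 + ?T3))"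
        using False by (simp add: rhs_def algebra_simps)
      then have "norm (rhs 2 z0 q n \<sigma> x - of_int n * z0 q n \<sigma> x) = 2 * norm (?T1 + (?T2 + ?T3))"
        using s by (auto simp: norm_mult)
      also have "\<dots> \<le> 2 * (norm ?T1 + (norm ?T2 + norm ?T3))"
        by (intro mult_left_mono norm_triangle_mono norm_triangle_ineq order_refl) auto
      also have "\<dots> \<le> 2 * (kb ^ 8 * M * M * norm x powr (- (if n = 0 then 2 else 1))
          + (kb ^ 8 * (M + kb) * M * norm x powr (- 2) + kb ^ 8 * norm x powr (- 2)))"
        using bd_at[OF bd_over_x[OF 1] \<sigma> x, of n] bd_at[OF 2 \<sigma> x, of n] lead[OF \<sigma> x, of n]
        by (intro mult_left_mono add_mono) auto
      also have "\<dots> \<le> 2 * (kb ^ 8 * M * M * norm x powr (- (if n = 0 then 2 else 1))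
          + (kb ^ 8 * (M + kb) * M * norm x powr (- (if n = 0 then 2 else 1)) + kb ^ 8 * norm x powr (- (if n = 0 then 2 else 1))))"
        using le1[OF x, of n] M0 kb1 by (intro mult_left_mono add_mono order_refl) auto
      also have "\<dots> = ?C * norm x powr (- (if n = 0 then 2 else 1))" by (simp add: algebra_simps)
      finally show ?thesis .
    qed
    then show ?thesis using M0 kb1 by (intro exI[of _ ?C]) auto
  qed
qed

lemma PQ_z0: "(\<lambda>\<sigma>. z0 q n \<sigma> x) \<in> PQ"
proof -
  have "(\<lambda>\<sigma>. -1) \<in> PQ" "(\<lambda>\<sigma>. - (2 * tau q \<sigma>)) \<in> PQ"
    using PQ_int[of "-1"] PQ_minus[OF PQ_mult[OF PQ_numeral(1) PQ_tau]] by auto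
  then show ?thesis using PQ_zero PQ_one unfolding z0_def
    by (cases "q = Ph"; cases "\<bar>n\<bar> = 1"; cases "n = 0"; cases "n = sg q"; cases "n = 2 * sg q") simp_all
qed

text \<open>At nonzero n the coefficients of \<open>z0\<close> are constant in x, so
  \<open>L n\<close> recovers them from their own linear part, and zz 1 - zz 0 is \<open>L n\<close>
  of the residual \<open>res\<close>. At index 0 the order 2 of the residual becomes 1 = 1/4 + 3/4
  for \<phi>, which fixes the initial exponent 3/4.\<close>

lemma zz_residual:
  assumes R: "R1 \<le> R"
  shows "\<exists>D. \<forall>q. bd R 5 D (eO q (3/4)) (\<lambda>n \<sigma> x. zz 1 q n \<sigma> x - zz 0 q n \<sigma> x)"
proof -
  have R0R: "R0 \<le> R" using R by (simp add: R1_def)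
  define p where "p = (\<lambda>n \<sigma> x. (of_int n * \<sigma> - of_int \<bar>n\<bar>) / x :: complex)"
  have "\<exists>D. bd R 5 D (eO q (3/4)) (\<lambda>n \<sigma> x. zz 1 q n \<sigma> x - zz 0 q n \<sigma> x)" for q
  proof -
    obtain C where C: "0 \<le> C" "\<And>n \<sigma> x. \<sigma> \<in> Bs \<Longrightarrow> x \<in> S R \<Longrightarrow> norm (rhs 2 z0 q n \<sigma> x - of_int n * z0 q n \<sigma> x)
           \<le> C * norm x powr (- (if n = 0 then 2 else 1))"
      using rhs_z0[OF R] by metis
    obtain M where M: "bd R 2 M (eV q) (z0 q)" using bd_z0[of R] by metis
    have M0: "0 \<le> M" using bd_nonneg M by blast
    define res where "res = (\<lambda>n \<sigma> x. rhs 2 z0 q n \<sigma> x - (of_int n * z0 q n \<sigma> x + p n \<sigma> x * z0 q n \<sigma> x))"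
    define c where "c = (\<lambda>n \<sigma>. z0 q n \<sigma> 1)"
    have zc: "z0 q n \<sigma> x = c n \<sigma>" for n \<sigma> x by (simp add: c_def z0_def)
    have cPQ: "c n \<in> PQ" for n unfolding c_def by (rule PQ_z0)
    have zh: "c n holomorphic_on Bs" for n by (rule PQ_holomorphic[OF cPQ])
    have lin_h: "hol2 (\<lambda>\<sigma> x. of_int n * z0 q n \<sigma> x + p n \<sigma> x * z0 q n \<sigma> x)" for n
    proof -
      have "hol2R R0 (\<lambda>\<sigma> x. of_int n * c n \<sigma> + (((of_int n * \<sigma> - of_int \<bar>n\<bar>) * c n \<sigma>) / x ^ 1))"
        by (intro hol2R_add hol2R_sigma hol2R_monomial holomorphic_intros zh)
      then show ?thesis unfolding hol2R_R0 by (simp add: p_def zc)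
    qed
    have hres: "hol2 (res n)" for n
      unfolding res_def using adm_rhs(2)[OF Asy_z0] lin_h hol2R_diff unfolding hol2R_R0[symmetric] by blast
    have pz: "norm (p n \<sigma> x * z0 q n \<sigma> x) \<le> (2 * Bd + 2) * M * norm x powr (- (if n = 0 then 2 else 1))"
      if \<sigma>: "\<sigma> \<in> Bs" and x: "x \<in> S R" for n \<sigma> x
    proof (cases "n = 0 \<or> 2 < \<bar>n\<bar>")
      case True
      then have "p n \<sigma> x * z0 q n \<sigma> x = 0" using supp_zz[of 0 q] by (auto simp: p_def supp_def)
      then have "norm (p n \<sigma> x * z0 q n \<sigma> x) = 0" by (simp only: norm_zero)
      moreover have "0 \<le> (2 * Bd + 2) * M * norm x powr (- (if n = 0 then 2 else 1))" using M0 Bd_nonneg by simp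
      ultimately show ?thesis by linarith
    next
      case False
      have zM: "norm (z0 q n \<sigma> x) \<le> M"
        using bd_at[OF M \<sigma> x, of n] False S_nonzero[OF x] by (cases "q = Ph") (auto simp: eV_def wV_def vP_def)
      have "norm (of_int n * \<sigma> - of_int \<bar>n\<bar> :: complex) \<le> \<bar>of_int n\<bar> * norm \<sigma> + \<bar>of_int n\<bar>"
        using norm_triangle_ineq4[of "of_int n * \<sigma>" "of_int \<bar>n\<bar> :: complex"] by (simp add: norm_mult)
      also have "\<dots> \<le> 2 * Bd + 2" using Bd[OF \<sigma>] False by (intro add_mono mult_mono) auto
      finally have "norm (p n \<sigma> x * z0 q n \<sigma> x) \<le> (2 * Bd + 2) / norm x * M"
        unfolding norm_mult p_def norm_divide using zM Bd_nonneg
        by (intro mult_mono divide_right_mono) auto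
      then show ?thesis using False S_nonzero[OF x] by (simp add: powr_minus divide_inverse algebra_simps)
    qed
    have suppres: "res n \<sigma> x = 0" if "5 < \<bar>n\<bar>" for n \<sigma> x
    proof -
      have "T 2 s k1 k2 u v n = (\<lambda>\<sigma> x. 0)" if "\<bar>s\<bar> \<le> 1" for s k1 k2 u v
        using supp_T[OF that, of 2] \<open>5 < \<bar>n\<bar>\<close> unfolding supp_def by simp
      then have "rhs 2 z0 q n \<sigma> x = 0" using sg_le by (simp add: rhs_def)
      moreover have "z0 q n \<sigma> x = 0" using supp_zz[of 0 q] that by (simp add: supp_def)
      ultimately show ?thesis by (simp add: res_def)
    qed
    have "bd R 5 (of_int (2 * 5 + 1) * (C + (2 * Bd + 2) * M)) (\<lambda>n. if n = 0 then 2 else 1) res"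
    proof (rule bd_pointwise)
      fix n \<sigma> x assume \<sigma>: "\<sigma> \<in> Bs" and x: "x \<in> S R"
      have "res n \<sigma> x = (rhs 2 z0 q n \<sigma> x - of_int n * z0 q n \<sigma> x) - p n \<sigma> x * z0 q n \<sigma> x" by (simp add: res_def)
      then show "norm (res n \<sigma> x) \<le> (C + (2 * Bd + 2) * M) * norm x powr (- (if n = 0 then 2 else 1))"
        using C(2)[OF \<sigma> x, of n] pz[OF \<sigma> x, of n] norm_triangle_ineq4[of "rhs 2 z0 q n \<sigma> x - of_int n * z0 q n \<sigma> x" "p n \<sigma> x * z0 q n \<sigma> x"]
        by (simp add: distrib_right)
    qed (use suppres C M0 Bd_nonneg in auto)
    from bd_L[OF R this hres]
    have b: "bd R 5 (CL * (of_int (2 * 5 + 1) * (C + (2 * Bd + 2) * M)))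
        (\<lambda>n. (if n = 0 then 2 else 1) - (if n = 0 then 1 else 0)) (\<lambda>n. L n (res n))" by simp
    have eq: "zz 1 q n \<sigma> x - zz 0 q n \<sigma> x = L n (res n) \<sigma> x" if \<sigma>: "\<sigma> \<in> Bs" and xR: "x \<in> S R" for n \<sigma> x
    proof -
      have x: "x \<in> S R0" using xR S_antimono[OF R0R] by auto
      have "L n (\<lambda>\<sigma> x. of_int n * z0 q n \<sigma> x + p n \<sigma> x * z0 q n \<sigma> x) \<sigma> x = (if n = 0 then 0 else z0 q n \<sigma> x)"
      proof (cases "n = 0")
        case True then show ?thesis by (simp add: p_def)
      next
        case False
        have "L n (\<lambda>\<sigma> x. of_int n * z0 q n \<sigma> x + p n \<sigma> x * z0 q n \<sigma> x) \<sigma> x = (\<lambda>t. c n \<sigma>) x"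
        proof (rule L_of_derivative[OF _ _ _ \<sigma> x])
          show "((\<lambda>t. c n \<sigma>) has_field_derivative 0) (at t)" for t by simp
          show "norm (c n \<sigma>) \<le> norm (c n \<sigma>) / norm t ^ (if n = 0 then 1 else 0)" for t :: complex using False by simp
          show "of_int n * z0 q n \<sigma> t + p n \<sigma> t * z0 q n \<sigma> t = 0 + (of_int n + (of_int n * \<sigma> - of_int \<bar>n\<bar>) / t) * c n \<sigma>" for t
            by (simp add: p_def zc distrib_right)
        qed
        then show ?thesis using False zc by simp
      qed
      moreover have "L n (res n) \<sigma> x = L n (rhs 2 z0 q n) \<sigma> x - L n (\<lambda>\<sigma> x. of_int n * z0 q n \<sigma> x + p n \<sigma> x * z0 q n \<sigma> x) \<sigma> x"
        unfolding res_def
      proof (rule L_diff[OF adm_rhs(1)[OF Asy_z0] _ \<sigma> x])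
        have PQz: "c n \<in> PQ" by (rule cPQ)
        have "Asy R0 (if n = 0 then 2 else 0) (\<lambda>\<sigma> x. of_int n * c n \<sigma> + ((of_int n * \<sigma> - of_int \<bar>n\<bar>) * c n \<sigma>) * (1 / x ^ 1))"
        proof (cases "n = 0")
          case True then show ?thesis using Asy_zero by simp
        next
          case False
          have "Asy R0 0 (\<lambda>\<sigma> x. ((of_int n * \<sigma> - of_int \<bar>n\<bar>) * c n \<sigma>) * (1 / x ^ 1))"
            by (rule Asy_mono[OF Asy_cmult[OF order_refl _ Asy_inverse_power[OF order_refl, of 1]]])
              (intro PQ_mult PQ_diff PQ_int PQ_sigma PQz, simp)
          moreover have "Asy R0 0 (\<lambda>\<sigma> x. of_int n * c n \<sigma>)" by (intro Asy_const PQ_mult PQ_int PQz)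
          ultimately show ?thesis using False Asy_add by simp
        qed
        then have "adm n (\<lambda>\<sigma> x. of_int n * c n \<sigma> + ((of_int n * \<sigma> - of_int \<bar>n\<bar>) * c n \<sigma>) * (1 / x ^ 1))"
          by (rule Asy_adm)
        then show "adm n (\<lambda>\<sigma> x. of_int n * z0 q n \<sigma> x + p n \<sigma> x * z0 q n \<sigma> x)"
          by (simp add: p_def zc)
      qed
      moreover have "init q n - z0 q n \<sigma> x = - (if n = 0 then 0 else z0 q n \<sigma> x)"
        by (simp add: init_def z0_def)
      ultimately show ?thesis by (simp add: Phi_def algebra_simps split: if_splits)
    qed
    have "bd R 5 (CL * (of_int (2 * 5 + 1) * (C + (2 * Bd + 2) * M))) (eO q (3/4)) (\<lambda>n. L n (res n))"
      by (rule bd_mono[OF b R]) (auto simp: eO_def wO_def w1_def wP_def)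
    then show ?thesis using eq unfolding bd_def by (intro exI[of _ "CL * (of_int (2 * 5 + 1) * (C + (2 * Bd + 2) * M))"]) simp
  qed
  then have "\<forall>q. \<exists>D. bd R 5 D (eO q (3/4)) (\<lambda>n \<sigma> x. zz 1 q n \<sigma> x - zz 0 q n \<sigma> x)" by (rule allI)
  from choice[OF this] obtain D where D0: "\<forall>q. bd R 5 (D q) (eO q (3/4)) (\<lambda>n \<sigma> x. zz 1 q n \<sigma> x - zz 0 q n \<sigma> x)" ..
  note D = D0[rule_format]
  have nn: "0 \<le> D q" for q using bd_nonneg[OF D] .
  have le: "D q \<le> D Ph + D Fp + D Gp + D Fm + D Gm" for q
    using nn[of Ph] nn[of Fp] nn[of Gp] nn[of Fm] nn[of Gm] by (cases q) auto
  show ?thesis using bd_mono[OF D R order_refl le] by (intro exI[of _ "D Ph + D Fp + D Gp + D Fm + D Gm"]) auto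
qed

section \<open>Convergence of the coefficients\<close>

text \<open>The outcome of the iteration in the form used from here on. The last clause is stated
  for finite index sets F because that survives the passage to the limit and then yields absolute
  summability over all indices.\<close>

definition key :: "real \<Rightarrow> real \<Rightarrow> real \<Rightarrow> real \<Rightarrow> bool" where
  "key R M D C \<longleftrightarrow> R1 \<le> R \<and> 0 \<le> M \<and> 0 \<le> D \<and> 1 \<le> C \<and> C * R powr (- 1 / 4) \<le> 1 / 2 \<and>
     (\<forall>N q. bd R (KK N) M (eV q) (zz N q)) \<and>
     (\<forall>N M' F q. \<forall>\<sigma>\<in>Bs. \<forall>x\<in>S R. finite F \<longrightarrow> N \<le> M' \<longrightarrow>
        (\<Sum>n\<in>F. norm (zz M' q n \<sigma> x - zz N q n \<sigma> x)) \<le> D * C ^ N * norm x powr (- real (N + 1) / 4))"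

lemma bd_R_mono: "bd R K M e u \<Longrightarrow> R \<le> R' \<Longrightarrow> bd R' K M e u"
  unfolding bd_def using S_antimono by (meson subsetD)

lemma supp_fs: "0 \<le> K \<Longrightarrow> supp K (z Ph) \<Longrightarrow> supp K (fs q z)"
  by (auto simp: supp_def fs_def fun_eq_iff)

lemma Phi_window:
  assumes "\<And>q. supp K (z q)" "0 \<le> K" "K \<le> K'" shows "Phi K z q = Phi K' z q"
proof -
  have "rhs K z q n \<sigma> x = rhs K' z q n \<sigma> x" for n \<sigma> x
    using T_window[OF assms(1) assms(1) assms(3)] T_window[OF supp_fs[OF assms(2) assms(1)] assms(1) assms(3)]
    by (simp add: rhs_def)
  then have "rhs K z q n = rhs K' z q n" for n by (intro ext)
  then have "Phi K z q n \<sigma> x = Phi K' z q n \<sigma> x" for n \<sigma> x by (simp add: Phi_def)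
  then show ?thesis by (intro ext)
qed

text \<open>The constants are chosen without a circle: M anticipates increments that sum up like a
  geometric series of ratio 1/2, C is a Lipschitz constant belonging to this M, and only then R is
  raised to (2 C)^4 to make C R^(-1/4) <= 1/2. Raising R does not affect \<open>M0\<close> and
  \<open>D0\<close>, which hold on the larger domain.\<close>

lemma key_exists: "\<exists>R M D C. key R M D C"
proof -
  obtain D0 where D0: "\<And>q. bd R1 5 D0 (eO q (3/4)) (\<lambda>n \<sigma> x. zz 1 q n \<sigma> x - zz 0 q n \<sigma> x)"
    using zz_residual[OF order_refl] by blast
  obtain M0 where M0: "\<And>q. bd R1 2 M0 (eV q) (z0 q)" using bd_z0[of R1] by metis
  have nn: "0 \<le> D0" "0 \<le> M0" using bd_nonneg D0 M0 by blast+
  define M where "M = M0 + 2 * D0"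
  define C where "C = max 1 (CL * (kb ^ 8 * (8 * M + 2 * kb)))"
  define R where "R = max R1 ((2 * C) ^ 4)"
  have C1: "1 \<le> C" and R: "R1 \<le> R" by (auto simp: C_def R_def)
  have R_ge1: "1 \<le> R" using R R0_ge by (simp add: R1_def)
  have "(2 * C) ^ 4 \<le> R" by (simp add: R_def)
  then have "((2 * C) ^ 4) powr (1/4) \<le> R powr (1/4)" using C1 by (intro powr_mono2) auto
  moreover have "((2 * C) ^ 4) powr (1/4) = 2 * C"
  proof -
    have "(2 * C) ^ 4 = (2 * C) powr 4" using C1 powr_realpow[of "2 * C" 4] by simp
    then have "((2 * C) ^ 4) powr (1/4) = ((2 * C) powr 4) powr (1/4)" by (rule arg_cong)
    then show ?thesis using C1 by (simp only: powr_powr) simp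
  qed
  ultimately have "2 * C * R powr (- 1 / 4) \<le> R powr (1/4) * R powr (- 1 / 4)" by (intro mult_right_mono) auto
  also have "\<dots> = 1" using R_ge1 by (simp add: powr_add[symmetric])
  finally have half: "C * R powr (- 1 / 4) \<le> 1 / 2" by simp
  \<comment> \<open>The two claims support each other: boundedness by M makes the next step
    Lipschitz, and the decay of the increments, evaluated at |x| >= R, keeps the next iterate below
    M.\<close>
  have main: "(\<forall>q. bd R (KK N) (M0 + 2 * D0 * (1 - 1 / 2 ^ N)) (eV q) (zz N q)) \<and>
     (\<forall>q. bd R (KK (Suc N)) (D0 * C ^ N) (eO q (real (3 + N) / 4)) (\<lambda>n \<sigma> x. zz (Suc N) q n \<sigma> x - zz N q n \<sigma> x))" for N
  proof (induction N)
    case 0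
    show ?case using bd_R_mono[OF M0 R] bd_R_mono[OF D0 R] by simp
  next
    case (Suc N)
    have b1: "bd R (KK (Suc N)) (M0 + 2 * D0 * (1 - 1 / 2 ^ Suc N)) (eV q) (zz (Suc N) q)" for q
    proof -
      have inc: "bd R (KK (Suc N)) (D0 * C ^ N) (eO q (real (3 + N) / 4)) (\<lambda>n \<sigma> x. zz (Suc N) q n \<sigma> x - zz N q n \<sigma> x)"
        using Suc.IH by blast
      have "bd R (KK (Suc N)) (D0 * C ^ N) (\<lambda>n. eV q n + real N / 4) (\<lambda>n \<sigma> x. zz (Suc N) q n \<sigma> x - zz N q n \<sigma> x)"
        by (rule bd_mono[OF inc R order_refl order_refl])
          (auto simp: eV_def eO_def wV_def wO_def vP_def wP_def w1_def field_simps)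
      from bd_gain[OF this R]
      have g: "bd R (KK (Suc N)) (D0 * C ^ N * R powr (- (real N / 4))) (eV q) (\<lambda>n \<sigma> x. zz (Suc N) q n \<sigma> x - zz N q n \<sigma> x)" by simp
      have "C ^ N * R powr (- (real N / 4)) = (C * R powr (- 1 / 4)) ^ N"
        using R_ge1 powr_power[of R "- 1 / 4" N] by (simp add: power_mult_distrib)
      also have "\<dots> \<le> (1 / 2) ^ N" using half C1 by (intro power_mono) auto
      finally have le: "D0 * C ^ N * R powr (- (real N / 4)) \<le> D0 * (1 / 2) ^ N"
        using nn by (simp add: mult.assoc mult_left_mono)
      have z: "bd R (KK (Suc N)) (M0 + 2 * D0 * (1 - 1 / 2 ^ N)) (eV q) (zz N q)"
        by (rule bd_mono[OF _ R, of "KK N" "M0 + 2 * D0 * (1 - 1 / 2 ^ N)" "eV q"]) (use Suc.IH KK_mono[of N "Suc N"] in auto)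
      have "bd R (KK (Suc N)) (M0 + 2 * D0 * (1 - 1 / 2 ^ N) + D0 * (1 / 2) ^ N) (eV q)
          (\<lambda>n \<sigma> x. zz N q n \<sigma> x + (zz (Suc N) q n \<sigma> x - zz N q n \<sigma> x))"
        by (rule bd_add[OF z bd_mono[OF g R order_refl le order_refl]])
      moreover have "M0 + 2 * D0 * (1 - 1 / 2 ^ N) + D0 * (1 / 2) ^ N = M0 + 2 * D0 * (1 - 1 / 2 ^ Suc N)"
        by (simp add: field_simps)
      ultimately show ?thesis by simp
    qed
    have le_M: "M0 + 2 * D0 * (1 - 1 / 2 ^ j) \<le> M" for j
      unfolding M_def using nn by (simp add: mult_left_le)
    have K: "0 \<le> KK (Suc N)" "KK N \<le> KK (Suc N)" using KK_ge[of "Suc N"] KK_mono[of N "Suc N"] by auto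
    have zM: "bd R (KK (Suc N)) M (eV q) (zz (Suc N) q)" for q
      by (rule bd_mono[OF b1 R order_refl le_M order_refl])
    have zM': "bd R (KK (Suc N)) M (eV q) (zz N q)" for q
      by (rule bd_mono[OF _ R K(2) le_M order_refl]) (use Suc.IH in blast)
    have inc: "bd R (KK (Suc N)) (D0 * C ^ N) (eO q (real (3 + N) / 4)) (\<lambda>n \<sigma> x. zz (Suc N) q n \<sigma> x - zz N q n \<sigma> x)" for q
      using Suc.IH by blast
    \<comment> \<open>Both iterates must be images under the same map; the window of the earlier
      step may be enlarged, its supports being smaller.\<close>
    have Phi: "zz (Suc N) q = Phi (KK (Suc N)) (zz N) q" for q
      using Phi_window[OF supp_zz _ K(2)] KK_ge[of N] by simp
    have "bd R (2 * KK (Suc N) + 1) (CL * (kb ^ 8 * (8 * M + 2 * kb)) * (D0 * C ^ N)) (eO q (real (3 + N) / 4 + 1 / 4))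
      (\<lambda>n \<sigma> x. Phi (KK (Suc N)) (zz (Suc N)) q n \<sigma> x - Phi (KK (Suc N)) (zz N) q n \<sigma> x)" for q
      by (rule Phi_lipschitz[OF R K(1) _ zM zM' inc Asy_zz Asy_zz]) simp
    then have b: "bd R (KK (Suc (Suc N))) (CL * (kb ^ 8 * (8 * M + 2 * kb)) * (D0 * C ^ N)) (eO q (real (3 + Suc N) / 4))
      (\<lambda>n \<sigma> x. zz (Suc (Suc N)) q n \<sigma> x - zz (Suc N) q n \<sigma> x)" for q
      unfolding Phi[symmetric] by (simp add: add_divide_distrib algebra_simps)
    have le: "CL * (kb ^ 8 * (8 * M + 2 * kb)) * (D0 * C ^ N) \<le> D0 * C ^ Suc N"
    proof -
      have "CL * (kb ^ 8 * (8 * M + 2 * kb)) * (D0 * C ^ N) \<le> C * (D0 * C ^ N)"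
        using nn C1 by (intro mult_right_mono) (auto simp: C_def)
      then show ?thesis by (simp add: algebra_simps)
    qed
    show ?case using b1 bd_mono[OF b R order_refl le order_refl] by blast
  qed
  have le_M: "M0 + 2 * D0 * (1 - 1 / 2 ^ j) \<le> M" for j
    unfolding M_def using nn by (simp add: mult_left_le)
  have bM: "bd R (KK N) M (eV q) (zz N q)" for N q
    by (rule bd_mono[OF _ R order_refl le_M order_refl]) (use main in blast)
  \<comment> \<open>The weights cost at most half a power, hence (3 + N)/4 - 2/4 = (N + 1)/4. The
    later increments at least halve at each step, and the geometric series gives the factor
    2.\<close>
  have sums: "(\<Sum>n\<in>F. norm (zz M' q n \<sigma> x - zz N q n \<sigma> x)) \<le> 2 * D0 * C ^ N * norm x powr (- real (N + 1) / 4)"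
    if F: "finite F" and NM: "N \<le> M'" and \<sigma>: "\<sigma> \<in> Bs" and x: "x \<in> S R" for F M' N q \<sigma> x
  proof -
    have xR: "R < norm x" using S_norm[OF x] .
    define a where "a = (\<lambda>l. D0 * C ^ l * norm x powr (- real (l + 1) / 4))"
    have inc: "(\<Sum>n\<in>F. norm (zz (Suc l) q n \<sigma> x - zz l q n \<sigma> x)) \<le> a l" for l
    proof -
      have "(\<Sum>n\<in>F. norm (zz (Suc l) q n \<sigma> x - zz l q n \<sigma> x)) \<le> D0 * C ^ l * norm x powr (- (real (l + 1) / 4))"
        by (rule bd_sum[OF _ R F _ \<sigma> x, where e = "eO q (real (3 + l) / 4)"])
          (use main in \<open>auto simp: eO_def wO_def wP_def w1_def\<close>)
      then show ?thesis by (simp only: a_def minus_divide_left)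
    qed
    have dec: "2 * a (Suc l) \<le> a l" for l
    proof -
      have "C * norm x powr (- 1 / 4) \<le> C * R powr (- 1 / 4)"
        using xR R_ge1 C1 by (intro mult_left_mono powr_mono2') auto
      then have h: "2 * (C * norm x powr (- 1 / 4)) \<le> 1" using half by linarith
      have "- real (Suc l + 1) / 4 = - real (l + 1) / 4 + (- 1 / 4)" by (simp add: field_simps)
      then have "2 * a (Suc l) = a l * (2 * (C * norm x powr (- 1 / 4)))"
        by (simp only: a_def powr_add) (simp add: algebra_simps)
      also have "\<dots> \<le> a l * 1" using h nn C1 by (intro mult_left_mono) (auto simp: a_def)
      finally show ?thesis by simp
    qed
    have "(\<Sum>n\<in>F. norm (zz M' q n \<sigma> x - zz N q n \<sigma> x)) \<le> 2 * a N - 2 * a M'"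
      using NM
    proof (induction M' rule: dec_induct)
      case base show ?case by simp
    next
      case (step m)
      have "(\<Sum>n\<in>F. norm (zz (Suc m) q n \<sigma> x - zz N q n \<sigma> x))
        \<le> (\<Sum>n\<in>F. norm (zz (Suc m) q n \<sigma> x - zz m q n \<sigma> x) + norm (zz m q n \<sigma> x - zz N q n \<sigma> x))"
        by (intro sum_mono) (metis diff_add_cancel add_diff_eq norm_triangle_ineq)
      then show ?case using step.IH inc[of m] dec[of m] by (simp add: sum.distrib)
    qed
    moreover have "0 \<le> a M'" using nn C1 by (simp add: a_def)
    ultimately show ?thesis by (simp add: a_def)
  qed
  have "key R M (2 * D0) C"
    unfolding key_def using R C1 half bM sums nn by (auto simp: M_def)
  then show ?thesis by blast
qed

lemma key_mono:
  assumes k: "key R M D C" and R': "R \<le> R'" shows "key R' M D C"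
proof -
  have R: "1 \<le> R" using k R0_ge by (simp add: key_def R1_def)
  have "C * R' powr (- 1 / 4) \<le> C * R powr (- 1 / 4)"
    using k R R' by (intro mult_left_mono powr_mono2') (auto simp: key_def)
  moreover have "C * R powr (- 1 / 4) \<le> 1 / 2" using k by (simp only: key_def)
  ultimately have h: "C * R' powr (- 1 / 4) \<le> 1 / 2" by (rule order_trans)
  show ?thesis using k R' h bd_R_mono[OF _ R'] S_antimono[OF R'] unfolding key_def
    by (meson order_trans subsetD)
qed

definition zl :: "kind \<Rightarrow> coeffs" where
  "zl q n \<sigma> x = lim (\<lambda>N. zz N q n \<sigma> x)"

lemma key_half:
  assumes k: "key R M D C" and x: "x \<in> S R"
  shows "C ^ N * norm x powr (- real (N + 1) / 4) \<le> (1 / 2) ^ N"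
proof -
  have R: "R1 \<le> R" "1 \<le> C" "C * R powr (- 1 / 4) \<le> 1 / 2" using k by (auto simp: key_def)
  have R_ge1: "1 \<le> R" using R R0_ge by (simp add: R1_def)
  have xR: "R < norm x" using S_norm[OF x] .
  have "C * norm x powr (- 1 / 4) \<le> C * R powr (- 1 / 4)"
    using xR R_ge1 R by (intro mult_left_mono powr_mono2') auto
  then have "C * norm x powr (- 1 / 4) \<le> 1 / 2" using R(3) by (rule order_trans)
  then have "(C * norm x powr (- 1 / 4)) ^ N \<le> (1 / 2) ^ N" using R by (intro power_mono) auto
  moreover have "(C * norm x powr (- 1 / 4)) ^ N = C ^ N * norm x powr (- real N / 4)"
  proof -
    have "norm x \<noteq> 0" using xR R_ge1 by linarith
    then show ?thesis using powr_power[of "norm x" "- 1 / 4" N] by (simp add: power_mult_distrib del: norm_eq_zero)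
  qed
  moreover have "C ^ N * norm x powr (- real (N + 1) / 4) \<le> C ^ N * norm x powr (- real N / 4)"
    using xR R_ge1 R by (intro mult_left_mono powr_mono) auto
  ultimately show ?thesis by linarith
qed

lemma zz_tendsto:
  assumes k: "key R M D C" and \<sigma>: "\<sigma> \<in> Bs" and x: "x \<in> S R"
  shows "(\<lambda>N. zz N q n \<sigma> x) \<longlonglongrightarrow> zl q n \<sigma> x"
proof -
  have b: "norm (zz M' q n \<sigma> x - zz N q n \<sigma> x) \<le> D * (1 / 2) ^ N" if "N \<le> M'" for M' N
  proof -
    have "(\<Sum>n\<in>{n}. norm (zz M' q n \<sigma> x - zz N q n \<sigma> x)) \<le> D * C ^ N * norm x powr (- real (N + 1) / 4)"
      using k \<sigma> x that unfolding key_def by blast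
    also have "\<dots> \<le> D * (1 / 2) ^ N"
      using key_half[OF k x, of N] k by (simp add: key_def mult.assoc mult_left_mono)
    finally show ?thesis by simp
  qed
  have lim0: "(\<lambda>N. D * (1 / 2) ^ N) \<longlonglongrightarrow> 0" using tendsto_mult_right_zero[OF LIMSEQ_power_zero[of "1/2::real"]] by simp
  have "Cauchy (\<lambda>N. zz N q n \<sigma> x)"
  proof (rule metric_CauchyI)
    fix e :: real assume "0 < e"
    then obtain N0 where N0: "\<And>N. N \<ge> N0 \<Longrightarrow> \<bar>D * (1 / 2) ^ N\<bar> < e / 2"
      using LIMSEQ_D[OF lim0, of "e / 2"] by auto
    show "\<exists>N0. \<forall>m\<ge>N0. \<forall>n'\<ge>N0. dist (zz m q n \<sigma> x) (zz n' q n \<sigma> x) < e"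
    proof (intro exI[of _ N0] allI impI)
      fix m n' assume "N0 \<le> m" "N0 \<le> n'"
      then have "norm (zz m q n \<sigma> x - zz N0 q n \<sigma> x) < e / 2" "norm (zz n' q n \<sigma> x - zz N0 q n \<sigma> x) < e / 2"
        using b[of N0 m] b[of N0 n'] N0[of N0] by auto
      then show "dist (zz m q n \<sigma> x) (zz n' q n \<sigma> x) < e"
        unfolding dist_norm using norm_triangle_ineq4[of "zz m q n \<sigma> x - zz N0 q n \<sigma> x" "zz n' q n \<sigma> x - zz N0 q n \<sigma> x"] by simp
    qed
  qed
  then show ?thesis unfolding zl_def by (simp add: Cauchy_convergent_iff convergent_LIMSEQ_iff)
qed

lemma zl_approx:
  assumes k: "key R M D C" and \<sigma>: "\<sigma> \<in> Bs" and x: "x \<in> S R" and F: "finite F"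
  shows "(\<Sum>n\<in>F. norm (zl q n \<sigma> x - zz N q n \<sigma> x)) \<le> D * C ^ N * norm x powr (- real (N + 1) / 4)"
proof -
  have "(\<lambda>M'. \<Sum>n\<in>F. norm (zz M' q n \<sigma> x - zz N q n \<sigma> x)) \<longlonglongrightarrow> (\<Sum>n\<in>F. norm (zl q n \<sigma> x - zz N q n \<sigma> x))"
    by (intro tendsto_intros zz_tendsto[OF k \<sigma> x])
  moreover have "\<forall>M'\<ge>N. (\<Sum>n\<in>F. norm (zz M' q n \<sigma> x - zz N q n \<sigma> x)) \<le> D * C ^ N * norm x powr (- real (N + 1) / 4)"
    using k \<sigma> x F unfolding key_def by blast
  ultimately show ?thesis using LIMSEQ_le_const2 by blast
qed

lemma zl_approx1:
  assumes k: "key R M D C" and \<sigma>: "\<sigma> \<in> Bs" and x: "x \<in> S R"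
  shows "norm (zl q n \<sigma> x - zz N q n \<sigma> x) \<le> D * C ^ N * norm x powr (- real (N + 1) / 4)"
  using zl_approx[OF k \<sigma> x, of "{n}" q N] by simp

lemma zl_approx_half:
  assumes k: "key R M D C" and \<sigma>: "\<sigma> \<in> Bs" and x: "x \<in> S R" and F: "finite F"
  shows "(\<Sum>n\<in>F. norm (zl q n \<sigma> x - zz N q n \<sigma> x)) \<le> D * (1 / 2) ^ N"
proof -
  have "D * (C ^ N * norm x powr (- real (N + 1) / 4)) \<le> D * (1 / 2) ^ N"
    using key_half[OF k x, of N] k by (intro mult_left_mono) (auto simp: key_def)
  then show ?thesis using zl_approx[OF k \<sigma> x F, of q N] by (simp add: mult.assoc)
qed

lemma hol2R_uniform_limit:
  assumes g: "\<And>N. hol2R R (g N)" and c: "c \<longlonglongrightarrow> 0"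
    and b: "\<And>N \<sigma> x. \<sigma> \<in> Bs \<Longrightarrow> x \<in> S R \<Longrightarrow> norm (h \<sigma> x - g N \<sigma> x) \<le> c N"
  shows "hol2R R h"
proof -
  have ul: "uniform_limit (Bs \<times> S R) (\<lambda>N (\<sigma>, x). g N \<sigma> x) (\<lambda>(\<sigma>, x). h \<sigma> x) sequentially"
  proof (rule uniform_limitI)
    fix e :: real assume "e > 0"
    then have "\<forall>\<^sub>F N in sequentially. c N < e" using order_tendstoD(2)[OF c] by blast
    then show "\<forall>\<^sub>F N in sequentially. \<forall>q\<in>Bs \<times> S R. dist (case q of (\<sigma>, x) \<Rightarrow> g N \<sigma> x) (case q of (\<sigma>, x) \<Rightarrow> h \<sigma> x) < e"
    proof eventually_elim
      case (elim N)
      show ?case using b[of _ _ N] elim by (auto simp: dist_norm norm_minus_commute intro: le_less_trans)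
    qed
  qed
  show ?thesis unfolding hol2R_def
  proof (intro conjI ballI)
    show "continuous_on (Bs \<times> S R) (\<lambda>(\<sigma>, x). h \<sigma> x)"
      by (rule uniform_limit_theorem[OF _ ul]) (use g in \<open>auto simp: hol2R_def\<close>)
    fix \<sigma> assume \<sigma>: "\<sigma> \<in> Bs"
    have ul1: "uniform_limit (S R) (\<lambda>N x. g N \<sigma> x) (h \<sigma>) sequentially"
      using uniform_limit_compose'[OF ul, of "\<lambda>x. (\<sigma>, x)" "S R"] \<sigma> by simp
    show "h \<sigma> holomorphic_on S R"
    proof (rule holomorphic_uniform_sequence[OF open_S])
      show "(\<lambda>x. g N \<sigma> x) holomorphic_on S R" for N using g \<sigma> by (auto simp: hol2R_def)
      fix z assume "z \<in> S R"
      then obtain d where "d > 0" "cball z d \<subseteq> S R" using open_S[of R] open_contains_cball[of "S R"] by auto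
      then show "\<exists>d>0. cball z d \<subseteq> S R \<and> uniform_limit (cball z d) (\<lambda>N x. g N \<sigma> x) (h \<sigma>) sequentially"
        using uniform_limit_on_subset[OF ul1] by auto
    qed
  next
    fix x assume x: "x \<in> S R"
    have ul1: "uniform_limit Bs (\<lambda>N \<sigma>. g N \<sigma> x) (\<lambda>\<sigma>. h \<sigma> x) sequentially"
      using uniform_limit_compose'[OF ul, of "\<lambda>\<sigma>. (\<sigma>, x)" Bs] x by simp
    show "(\<lambda>\<sigma>. h \<sigma> x) holomorphic_on Bs"
    proof (rule holomorphic_uniform_sequence[OF Bs_open])
      show "(\<lambda>\<sigma>. g N \<sigma> x) holomorphic_on Bs" for N using g x by (auto simp: hol2R_def)
      fix z assume "z \<in> Bs"
      then obtain d where "d > 0" "cball z d \<subseteq> Bs" using Bs_open open_contains_cball[of Bs] by auto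
      then show "\<exists>d>0. cball z d \<subseteq> Bs \<and> uniform_limit (cball z d) (\<lambda>N \<sigma>. g N \<sigma> x) (\<lambda>\<sigma>. h \<sigma> x) sequentially"
        using uniform_limit_on_subset[OF ul1] by auto
    qed
  qed
qed

lemma Asy_restrict: assumes "Asy R m h" "R \<le> R'" shows "Asy R' m h"
  using assms hol2R_subset[OF _ assms(2)] S_antimono[OF assms(2)] unfolding Asy_def asy_def by (meson subsetD)

lemma hol2_zz: "hol2R R0 (zz N q n)"
  by (rule Asy_hol[OF Asy_zz])

text \<open>Four iterations gain one power of 1/x. The offset i makes consecutive iterates available
  at the same accuracy.\<close>

lemma zl_apx_power:
  assumes k: "key R M D C"
  shows "\<exists>B. \<forall>\<sigma>\<in>Bs. \<forall>x\<in>S R. norm (zl q n \<sigma> x - zz (4 * e + i) q n \<sigma> x) \<le> B / norm x ^ e"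
proof (intro exI[of _ "D * C ^ (4 * e + i)"] ballI)
  fix \<sigma> x assume \<sigma>: "\<sigma> \<in> Bs" and x: "x \<in> S R"
  have x1: "1 \<le> norm x" using S_ge1[OF _ x] k by (simp add: key_def R1_def)
  have "norm x powr (- real (4 * e + i + 1) / 4) \<le> norm x powr (- real e)"
    using x1 by (intro powr_mono) auto
  then have "D * C ^ (4 * e + i) * norm x powr (- real (4 * e + i + 1) / 4) \<le> D * C ^ (4 * e + i) * norm x powr (- real e)"
    using k by (intro mult_left_mono) (auto simp: key_def)
  then show "norm (zl q n \<sigma> x - zz (4 * e + i) q n \<sigma> x) \<le> D * C ^ (4 * e + i) / norm x ^ e"
    using zl_approx1[OF k \<sigma> x, of q n "4 * e + i"] powr_neg_nat[OF x, of e] by simp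
qed

lemma Asy_zl:
  assumes k: "key R M D C"
  shows "Asy R (ordk q n) (zl q n)"
proof (rule Asy_limit)
  show R: "R0 \<le> R" using k by (simp add: key_def R1_def)
  show "hol2R R (zl q n)"
  proof (rule hol2R_uniform_limit)
    show "hol2R R (zz N q n)" for N by (rule hol2R_subset[OF hol2_zz R])
    show "(\<lambda>N. D * (1 / 2) ^ N) \<longlonglongrightarrow> 0" using tendsto_mult_right_zero[OF LIMSEQ_power_zero[of "1/2::real"]] by simp
    show "norm (zl q n \<sigma> x - zz N q n \<sigma> x) \<le> D * (1 / 2) ^ N" if "\<sigma> \<in> Bs" "x \<in> S R" for N \<sigma> x
      using zl_approx_half[OF k that, of "{n}" q N] by simp
  qed
  show "\<exists>g C. Asy R0 (ordk q n) g \<and> (\<forall>\<sigma>\<in>Bs. \<forall>x\<in>S R. norm (zl q n \<sigma> x - g \<sigma> x) \<le> C / norm x ^ e)" for e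
    using zl_apx_power[OF k, of q n e 0] Asy_zz by blast
qed

text \<open>The initial sequence misses the limit by O(|x|^(-1/4)) only, but since the limit has an
  expansion in integral powers, this already fixes its constant term and the difference is of order
  1/x.\<close>

lemma zl_leading:
  assumes k: "key R M D C"
  shows "Asy R 1 (\<lambda>\<sigma> x. zl q n \<sigma> x - z0 q n \<sigma> x)"
proof -
  have R: "R0 \<le> R" using k by (simp add: key_def R1_def)
  have "Asy R 1 (\<lambda>\<sigma> x. x ^ 0 * zl q n \<sigma> x - z0 q n \<sigma> 1)"
  proof (rule Asy_remainder[OF R, where e = "1/4" and C = D])
    show "Asy R 0 (zl q n)" by (rule Asy_mono[OF Asy_zl[OF k]]) simp
    fix \<sigma> x assume \<sigma>: "\<sigma> \<in> Bs" and x: "x \<in> S R"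
    have "z0 q n \<sigma> 1 = z0 q n \<sigma> x" by (simp add: z0_def)
    then show "norm (zl q n \<sigma> x - z0 q n \<sigma> 1 / x ^ 0) \<le> D * norm x powr (- real 0 - 1 / 4)"
      using zl_approx1[OF k \<sigma> x, of q n 0] by simp
  qed simp
  then show ?thesis by (simp add: z0_def)
qed

section \<open>Uniform order estimates\<close>

definition BO :: "real \<Rightarrow> nat \<Rightarrow> (complex \<Rightarrow> complex \<Rightarrow> complex) \<Rightarrow> bool" where
  "BO R e h \<longleftrightarrow> (\<exists>C\<ge>0. \<forall>\<sigma>\<in>Bs. \<forall>x\<in>S R. norm (h \<sigma> x) \<le> C / norm x ^ e)"

lemma BO_I: "(\<And>\<sigma> x. \<sigma> \<in> Bs \<Longrightarrow> x \<in> S R \<Longrightarrow> norm (h \<sigma> x) \<le> C / norm x ^ e) \<Longrightarrow> BO R e h"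
  unfolding BO_def
proof (intro exI[of _ "\<bar>C\<bar>"] conjI ballI)
  fix \<sigma> x assume b: "\<And>\<sigma> x. \<sigma> \<in> Bs \<Longrightarrow> x \<in> S R \<Longrightarrow> norm (h \<sigma> x) \<le> C / norm x ^ e" and "\<sigma> \<in> Bs" "x \<in> S R"
  then have "norm (h \<sigma> x) \<le> C / norm x ^ e" by blast
  also have "\<dots> \<le> \<bar>C\<bar> / norm x ^ e" by (intro divide_right_mono) auto
  finally show "norm (h \<sigma> x) \<le> \<bar>C\<bar> / norm x ^ e" .
qed simp

lemma BO_Asy: "Asy R m h \<Longrightarrow> BO R m h"
  using Asy_bound unfolding BO_def by blast

lemma BO_PQ: "f \<in> PQ \<Longrightarrow> BO R 0 (\<lambda>\<sigma> x. f \<sigma>)"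
  by (rule BO_Asy[OF Asy_const])

lemma BO_inverse_power: "BO R m (\<lambda>\<sigma> x. 1 / x ^ m)"
  unfolding BO_def by (intro exI[of _ 1]) (auto simp: norm_divide norm_power)

lemma BO_cong: "BO R e h \<Longrightarrow> (\<And>\<sigma> x. \<sigma> \<in> Bs \<Longrightarrow> x \<in> S R \<Longrightarrow> g \<sigma> x = h \<sigma> x) \<Longrightarrow> BO R e g"
  unfolding BO_def by simp

lemma BO_add: assumes "BO R e h" "BO R e g" shows "BO R e (\<lambda>\<sigma> x. h \<sigma> x + g \<sigma> x)"
proof -
  obtain C D where "\<And>\<sigma> x. \<sigma> \<in> Bs \<Longrightarrow> x \<in> S R \<Longrightarrow> norm (h \<sigma> x) \<le> C / norm x ^ e"
    "\<And>\<sigma> x. \<sigma> \<in> Bs \<Longrightarrow> x \<in> S R \<Longrightarrow> norm (g \<sigma> x) \<le> D / norm x ^ e"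
    using assms unfolding BO_def by blast
  then have "\<And>\<sigma> x. \<sigma> \<in> Bs \<Longrightarrow> x \<in> S R \<Longrightarrow> norm (h \<sigma> x + g \<sigma> x) \<le> (C + D) / norm x ^ e"
    by (simp add: add_divide_distrib norm_triangle_mono)
  then show ?thesis by (rule BO_I)
qed

lemma BO_mult: assumes "BO R e h" "BO R e' g" shows "BO R (e + e') (\<lambda>\<sigma> x. h \<sigma> x * g \<sigma> x)"
proof -
  obtain C D where CD: "0 \<le> C" "\<And>\<sigma> x. \<sigma> \<in> Bs \<Longrightarrow> x \<in> S R \<Longrightarrow> norm (h \<sigma> x) \<le> C / norm x ^ e"
    "\<And>\<sigma> x. \<sigma> \<in> Bs \<Longrightarrow> x \<in> S R \<Longrightarrow> norm (g \<sigma> x) \<le> D / norm x ^ e'"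
    using assms unfolding BO_def by blast
  have "norm (h \<sigma> x * g \<sigma> x) \<le> (C * D) / norm x ^ (e + e')" if "\<sigma> \<in> Bs" "x \<in> S R" for \<sigma> x
  proof -
    have "norm (h \<sigma> x * g \<sigma> x) \<le> (C / norm x ^ e) * (D / norm x ^ e')"
      unfolding norm_mult using CD that by (intro mult_mono) auto
    then show ?thesis by (simp add: power_add)
  qed
  then show ?thesis by (rule BO_I)
qed

lemma BO_cmult: "f \<in> PQ \<Longrightarrow> BO R e g \<Longrightarrow> BO R e (\<lambda>\<sigma> x. f \<sigma> * g \<sigma> x)"
  using BO_mult[OF BO_PQ, of f R e g] by simp

lemma BO_minus: "BO R e g \<Longrightarrow> BO R e (\<lambda>\<sigma> x. - g \<sigma> x)"
  unfolding BO_def by simp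

lemma BO_diff: "BO R e h \<Longrightarrow> BO R e g \<Longrightarrow> BO R e (\<lambda>\<sigma> x. h \<sigma> x - g \<sigma> x)"
  using BO_add[OF _ BO_minus] by simp

lemma BO_divide: "BO R e h \<Longrightarrow> BO R (e + m) (\<lambda>\<sigma> x. h \<sigma> x / x ^ m)"
  using BO_mult[OF _ BO_inverse_power] by simp

lemma BO_mono: assumes R: "R0 \<le> R" and h: "BO R e h" and e: "e' \<le> e" shows "BO R e' h"
proof -
  obtain C where C: "0 \<le> C" "\<And>\<sigma> x. \<sigma> \<in> Bs \<Longrightarrow> x \<in> S R \<Longrightarrow> norm (h \<sigma> x) \<le> C / norm x ^ e"
    using h unfolding BO_def by blast
  have "norm (h \<sigma> x) \<le> C / norm x ^ e'" if "\<sigma> \<in> Bs" "x \<in> S R" for \<sigma> x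
  proof -
    have "C / norm x ^ e \<le> C / norm x ^ e'"
      using C(1) e S_ge1[OF R that(2)] by (intro divide_left_mono power_increasing) auto
    then show ?thesis using C(2)[OF that] by linarith
  qed
  then show ?thesis by (rule BO_I)
qed

lemma BO_L:
  assumes R: "R0 \<le> R" and r: "hol2 r" and b: "BO R e r" and e: "n = 0 \<Longrightarrow> 2 \<le> e"
  shows "BO R (if n = 0 then e - 1 else e) (L n r)"
proof -
  obtain C where C: "\<And>\<sigma> x. \<sigma> \<in> Bs \<Longrightarrow> x \<in> S R \<Longrightarrow> norm (r \<sigma> x) \<le> C / norm x ^ e"
    using b unfolding BO_def by blast
  have "norm (L n r \<sigma> x) \<le> CL * C / norm x ^ (if n = 0 then e - 1 else e)" if \<sigma>: "\<sigma> \<in> Bs" and x: "x \<in> S R" for \<sigma> x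
  proof -
    have b': "norm (r \<sigma> t) \<le> C * norm t powr (- real e)" if "t \<in> S R" for t
      using C[OF \<sigma> that] powr_neg_nat[OF that] by simp
    have "norm (L n r \<sigma> x) \<le> CL * C * norm x powr (- real e + (if n = 0 then 1 else 0))"
      by (rule L_bound(2)[OF r b' R]) (use e \<sigma> x in auto)
    also have "- real e + (if n = 0 then 1 else 0) = - real (if n = 0 then e - 1 else e)" using e by auto
    finally show ?thesis using powr_neg_nat[OF x] by simp
  qed
  then show ?thesis by (rule BO_I)
qed

text \<open>Isolates the few pairs P of low order from a product. All the others are estimated at
  once by the product of the two sums of norms, so that the constant involves M but not the size of
  the window.\<close>

lemma T_split:
  assumes R: "R1 \<le> R" and u: "bd R K M (\<lambda>n. 0) u" and v: "bd R K M (\<lambda>n. 0) v"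
    and P: "P \<subseteq> {-K..K} \<times> {-K..K}" "\<And>i j. (i, j) \<in> P \<Longrightarrow> s + i + j = n"
    and g: "\<And>i j. s + i + j = n \<Longrightarrow> (i, j) \<notin> P \<Longrightarrow> e \<le> 2 * min (m3 s i j) 2"
  shows "BO R e (\<lambda>\<sigma> x. T K s k1 k2 u v n \<sigma> x - (\<Sum>(i, j)\<in>P. cc k1 k2 s i j \<sigma> x * u i \<sigma> x * v j \<sigma> x))"
proof (rule BO_I)
  fix \<sigma> x assume \<sigma>: "\<sigma> \<in> Bs" and x: "x \<in> S R"
  have x1: "1 \<le> norm x" using S_ge1[OF _ x] R by (simp add: R1_def)
  have c: "0 \<le> kb ^ 8 / norm x ^ e" using kb(1) by simp
  let ?W = "{-K..K} \<times> {-K..K}"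
  let ?f = "\<lambda>i j. if s + i + j = n then cc k1 k2 s i j \<sigma> x * u i \<sigma> x * v j \<sigma> x else 0"
  have "T K s k1 k2 u v n \<sigma> x = (\<Sum>(i, j)\<in>?W. ?f i j)"
    unfolding T_def by (rule sum.cartesian_product)
  also have "\<dots> = (\<Sum>(i, j)\<in>?W - P. ?f i j) + (\<Sum>(i, j)\<in>P. ?f i j)"
    by (rule sum.subset_diff[OF P(1)]) simp
  also have "(\<Sum>(i, j)\<in>P. ?f i j) = (\<Sum>(i, j)\<in>P. cc k1 k2 s i j \<sigma> x * u i \<sigma> x * v j \<sigma> x)"
    by (rule sum.cong) (use P(2) in auto)
  finally have e1: "T K s k1 k2 u v n \<sigma> x - (\<Sum>(i, j)\<in>P. cc k1 k2 s i j \<sigma> x * u i \<sigma> x * v j \<sigma> x) = (\<Sum>(i, j)\<in>?W - P. ?f i j)" by simp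
  have n1: "norm (\<Sum>(i, j)\<in>?W - P. ?f i j) \<le> (\<Sum>(i, j)\<in>?W - P. kb ^ 8 / norm x ^ e * (norm (u i \<sigma> x) * norm (v j \<sigma> x)))"
  proof (rule sum_norm_le)
    fix p assume "p \<in> ?W - P"
    then obtain i j where p: "p = (i, j)" "(i, j) \<notin> P" by (cases p) auto
    have "norm (?f i j) \<le> kb ^ 8 / norm x ^ e * (norm (u i \<sigma> x) * norm (v j \<sigma> x))"
    proof (cases "s + i + j = n")
      case True
      have "norm (cc k1 k2 s i j \<sigma> x) \<le> kb ^ 8 * norm x powr (- real (2 * min (m3 s i j) 2))"
        using cc_bound[OF R \<sigma> x] by simp
      also have "\<dots> = kb ^ 8 / norm x ^ (2 * min (m3 s i j) 2)" by (simp only: powr_neg_nat[OF x]) simp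
      also have "\<dots> \<le> kb ^ 8 / norm x ^ e"
        using g[OF True p(2)] x1 kb(1) by (intro divide_left_mono power_increasing) auto
      finally have "norm (cc k1 k2 s i j \<sigma> x) * (norm (u i \<sigma> x) * norm (v j \<sigma> x)) \<le> kb ^ 8 / norm x ^ e * (norm (u i \<sigma> x) * norm (v j \<sigma> x))"
        by (rule mult_right_mono) simp
      then show ?thesis using True by (simp add: norm_mult mult.assoc)
    qed (use kb(1) in simp)
    then show "norm (case p of (i, j) \<Rightarrow> ?f i j) \<le> (case p of (i, j) \<Rightarrow> kb ^ 8 / norm x ^ e * (norm (u i \<sigma> x) * norm (v j \<sigma> x)))"
      using p by simp
  qed
  have n2: "(\<Sum>(i, j)\<in>?W - P. kb ^ 8 / norm x ^ e * (norm (u i \<sigma> x) * norm (v j \<sigma> x))) \<le> (\<Sum>(i, j)\<in>?W. kb ^ 8 / norm x ^ e * (norm (u i \<sigma> x) * norm (v j \<sigma> x)))"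
  proof (rule sum_mono2)
    show "0 \<le> (case p of (i, j) \<Rightarrow> kb ^ 8 / norm x ^ e * (norm (u i \<sigma> x) * norm (v j \<sigma> x)))" for p
      unfolding case_prod_beta by (rule mult_nonneg_nonneg[OF c mult_nonneg_nonneg[OF norm_ge_zero norm_ge_zero]])
    show "?W - P \<subseteq> ?W" by (rule Diff_subset)
    show "finite ?W" by (rule finite_cartesian_product) (rule finite_atLeastAtMost_int)+
  qed
  have n3: "(\<Sum>(i, j)\<in>?W. kb ^ 8 / norm x ^ e * (norm (u i \<sigma> x) * norm (v j \<sigma> x))) = kb ^ 8 / norm x ^ e * ((\<Sum>i\<in>{-K..K}. norm (u i \<sigma> x)) * (\<Sum>j\<in>{-K..K}. norm (v j \<sigma> x)))"
    by (subst sum_product) (simp only: sum_distrib_left sum.cartesian_product case_prod_unfold)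
  have n4: "kb ^ 8 / norm x ^ e * ((\<Sum>i\<in>{-K..K}. norm (u i \<sigma> x)) * (\<Sum>j\<in>{-K..K}. norm (v j \<sigma> x))) \<le> kb ^ 8 / norm x ^ e * (M * M)"
  proof -
    have "(\<Sum>i\<in>{-K..K}. norm (u i \<sigma> x)) \<le> M" "(\<Sum>i\<in>{-K..K}. norm (v i \<sigma> x)) \<le> M"
      using bd_sum[OF u R _ _ \<sigma> x, of "{-K..K}" 0] bd_sum[OF v R _ _ \<sigma> x, of "{-K..K}" 0] S_nonzero[OF x] by auto
    then show ?thesis
      using bd_nonneg[OF u] by (intro mult_left_mono[OF _ c] mult_mono sum_nonneg norm_ge_zero)
  qed
  show "norm (T K s k1 k2 u v n \<sigma> x - (\<Sum>(i, j)\<in>P. cc k1 k2 s i j \<sigma> x * u i \<sigma> x * v j \<sigma> x)) \<le> (kb ^ 8 * (M * M)) / norm x ^ e"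
    using order_trans[OF n1 order_trans[OF n2[unfolded n3] n4]] unfolding e1 by simp
qed

section \<open>Leading coefficients\<close>

lemma Asy_cong:
  assumes h: "Asy R m h" and eq: "\<And>\<sigma> x. \<sigma> \<in> Bs \<Longrightarrow> x \<in> S R \<Longrightarrow> g \<sigma> x = h \<sigma> x"
  shows "Asy R m g"
proof -
  have "hol2R R g" if "hol2R R h"
    unfolding hol2R_def
  proof (intro conjI ballI)
    show "continuous_on (Bs \<times> S R) (\<lambda>(\<sigma>, x). g \<sigma> x)"
      using that eq by (subst continuous_on_cong[OF refl, where g = "\<lambda>(\<sigma>, x). h \<sigma> x"]) (auto simp: hol2R_def)
    fix \<sigma> assume "\<sigma> \<in> Bs" then show "g \<sigma> holomorphic_on S R"
      using that eq by (subst holomorphic_cong[OF refl, where g = "h \<sigma>"]) (auto simp: hol2R_def)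
  next
    fix x assume "x \<in> S R" then show "(\<lambda>\<sigma>. g \<sigma> x) holomorphic_on Bs"
      using that eq by (subst holomorphic_cong[OF refl, where g = "\<lambda>\<sigma>. h \<sigma> x"]) (auto simp: hol2R_def)
  qed
  then show ?thesis using h eq unfolding Asy_def asy_def by auto
qed

text \<open>If y solves the equation up to an error O(x^-e), then \<open>L n r\<close> agrees with y
  to the same order, or to order e - 1 when n = 0: \<open>L_of_derivative\<close> recovers y
  exactly, and the error passes through \<open>L n\<close>.\<close>

lemma L_leading:
  assumes R: "R0 \<le> R" and r: "adm n r"
    and y: "\<And>\<sigma> t. \<sigma> \<in> Bs \<Longrightarrow> t \<in> S R0 \<Longrightarrow> (y \<sigma> has_field_derivative y' \<sigma> t) (at t)"
    and Ay: "Asy R0 (if n = 0 then 1 else 0) y" and Ay': "Asy R0 (if n = 0 then 2 else 0) y'"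
    and b: "BO R e (\<lambda>\<sigma> x. r \<sigma> x - (y' \<sigma> x + (of_int n + (of_int n * \<sigma> - of_int \<bar>n\<bar>) / x) * y \<sigma> x))"
    and e: "n = 0 \<Longrightarrow> 2 \<le> e"
  shows "BO R (if n = 0 then e - 1 else e) (\<lambda>\<sigma> x. L n r \<sigma> x - y \<sigma> x)"
proof -
  define r0 where "r0 = (\<lambda>\<sigma> x. y' \<sigma> x + (of_int n + (of_int n * \<sigma> - of_int \<bar>n\<bar>) / x) * y \<sigma> x)"
  have r0: "adm n r0"
  proof (rule Asy_adm)
    show "Asy R0 (if n = 0 then 2 else 0) r0"
    proof (cases "n = 0")
      case True then show ?thesis using Ay' by (simp add: r0_def)
    next
      case False
      have "Asy R0 0 (\<lambda>\<sigma> x. (of_int n * \<sigma> - of_int \<bar>n\<bar>) * (1 / x ^ 1))"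
        by (rule Asy_mono[OF Asy_cmult[OF order_refl _ Asy_inverse_power[OF order_refl]]])
          (auto intro!: PQ_diff PQ_mult PQ_int PQ_sigma)
      from Asy_add[OF Asy_const[OF PQ_int] this]
      have "Asy R0 0 (\<lambda>\<sigma> x. of_int n + (of_int n * \<sigma> - of_int \<bar>n\<bar>) * (1 / x ^ 1))" .
      from Asy_mult[OF order_refl this Ay] False
      have "Asy R0 0 (\<lambda>\<sigma> x. (of_int n + (of_int n * \<sigma> - of_int \<bar>n\<bar>) * (1 / x ^ 1)) * y \<sigma> x)" by simp
      from Asy_add[OF _ this] Ay' False show ?thesis by (simp add: r0_def)
    qed
  qed
  obtain C where C: "\<And>\<sigma> x. \<sigma> \<in> Bs \<Longrightarrow> x \<in> S R0 \<Longrightarrow> norm (y \<sigma> x) \<le> C / norm x ^ (if n = 0 then 1 else 0)"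
    using Asy_bound[OF Ay] by blast
  have h: "hol2 (\<lambda>\<sigma> x. r \<sigma> x - r0 \<sigma> x)"
    using r r0 hol2R_diff[of R0 r r0] by (simp add: adm_def hol2R_R0)
  have "BO R (if n = 0 then e - 1 else e) (L n (\<lambda>\<sigma> x. r \<sigma> x - r0 \<sigma> x))"
    by (rule BO_L[OF R h _ e]) (use b in \<open>simp add: r0_def\<close>)
  then show ?thesis
  proof (rule BO_cong)
    fix \<sigma> x assume \<sigma>: "\<sigma> \<in> Bs" and "x \<in> S R"
    then have x: "x \<in> S R0" using S_antimono[OF R] by blast
    have "L n r0 \<sigma> x = y \<sigma> x"
      by (rule L_of_derivative[OF y[OF \<sigma>] C[OF \<sigma>] _ \<sigma> x]) (simp_all add: r0_def)
    then show "L n r \<sigma> x - y \<sigma> x = L n (\<lambda>\<sigma> x. r \<sigma> x - r0 \<sigma> x) \<sigma> x"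
      using L_diff[OF r r0 \<sigma> x] by simp
  qed
qed

lemma key_R: "key R M D C \<Longrightarrow> R0 \<le> R" "key R M D C \<Longrightarrow> R1 \<le> R"
  by (auto simp: key_def R1_def)

text \<open>Sixteen iterations, four for each power, agree with the limit up to x^-4, the highest
  order that the leading terms require. The right-hand side has a finite window, so the computations
  are made with these iterates instead of the limit.\<close>

lemma zz_BO:
  assumes k: "key R M D C" shows "BO R 4 (\<lambda>\<sigma> x. zl q n \<sigma> x - zz (16 + i) q n \<sigma> x)"
proof -
  obtain B where "\<And>\<sigma> x. \<sigma> \<in> Bs \<Longrightarrow> x \<in> S R \<Longrightarrow> norm (zl q n \<sigma> x - zz (4 * 4 + i) q n \<sigma> x) \<le> B / norm x ^ 4"
    using zl_apx_power[OF k, of q n 4 i] by blast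
  then show ?thesis by (intro BO_I[where C = B]) (simp del: zz.simps)
qed

lemma zz_ord: "key R M D C \<Longrightarrow> BO R (ordk q n) (zz N q n)"
  by (rule BO_Asy[OF Asy_restrict[OF Asy_zz key_R(1)]])

lemma zz_lead:
  assumes k: "key R M D C" shows "BO R 1 (\<lambda>\<sigma> x. zz (16 + i) q n \<sigma> x - z0 q n \<sigma> x)"
  using BO_diff[OF BO_Asy[OF zl_leading[OF k, of q n]] BO_mono[OF key_R(1)[OF k] zz_BO[OF k, of q n i], of 1]] by simp

lemma key_bd:
  assumes k: "key R M D C"
  obtains M' where "\<And>q. bd R (KK N) M' (\<lambda>n. 0) (zz N q)" "\<And>q. bd R (KK N) M' (\<lambda>n. 0) (fs q (zz N))"
proof -
  have b: "bd R (KK N) M (\<lambda>n. 0) (zz N q)" for q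
    by (rule bd_mono[of R "KK N" M "eV q"]) (use k in \<open>auto simp: key_def eV_def wV_def vP_def\<close>)
  have t: "bd R (KK N) kb (\<lambda>n. 0) (\<lambda>i \<sigma> x. if i = 0 then tau q \<sigma> else 0)" for q
    by (rule bd_single) (use KK_ge[of N] tau_le kb(1) S_nonzero in auto)
  have f: "bd R (KK N) (M + kb) (\<lambda>n. 0) (fs q (zz N))" for q
    using bd_add[OF b t, of Ph q] unfolding fs_def[abs_def] .
  have "0 \<le> kb" using kb(1) by simp
  then have "bd R (KK N) (M + kb) (\<lambda>n. 0) (zz N q)" for q
    by (intro bd_mono[OF b key_R(2)[OF k]]) auto
  then show ?thesis using that f by blast
qed

lemma BO_cc: "R0 \<le> R \<Longrightarrow> BO R 0 (cc k1 k2 s i j)"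
  using BO_mono[OF _ BO_Asy[OF Asy_restrict[OF Asy_cc]]] by blast

lemma BO_mult_lead:
  assumes R: "R0 \<le> R" and "BO R 1 (\<lambda>\<sigma> x. u \<sigma> x - f \<sigma>)" "BO R 1 (\<lambda>\<sigma> x. v \<sigma> x - g \<sigma>)" "f \<in> PQ" "g \<in> PQ"
  shows "BO R 1 (\<lambda>\<sigma> x. u \<sigma> x * v \<sigma> x - f \<sigma> * g \<sigma>)"
proof -
  have "BO R 1 (\<lambda>\<sigma> x. (u \<sigma> x - f \<sigma>) * (v \<sigma> x - g \<sigma>) + (f \<sigma> * (v \<sigma> x - g \<sigma>) + g \<sigma> * (u \<sigma> x - f \<sigma>)))"
    using BO_mono[OF R BO_mult[OF assms(2,3)], of 1] assms by (intro BO_add BO_cmult) auto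
  then show ?thesis by (rule BO_cong) (simp add: algebra_simps)
qed

lemma zz_1_lead:
  assumes k: "key R M D C" "q \<noteq> Ph" shows "BO R 1 (\<lambda>\<sigma> x. zz (16 + i) q 0 \<sigma> x - 1)"
  using zz_lead[OF k(1), of i q 0] k(2) by (simp add: z0_def)

lemma zz_s_lead:
  assumes k: "key R M D C" "q \<noteq> Ph" shows "BO R 1 (\<lambda>\<sigma> x. zz (16 + i) q (sg q) \<sigma> x - (- 2 * tau q \<sigma>))"
  using zz_lead[OF k(1), of i q "sg q"] k(2) sg_cases[OF k(2)] by (auto simp: z0_def)

lemma zz_Ph_lead:
  assumes k: "key R M D C" "\<bar>n\<bar> = 1" shows "BO R 1 (\<lambda>\<sigma> x. zz (16 + i) Ph n \<sigma> x - 1)"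
  using zz_lead[OF k(1), of i Ph n] k(2) by (simp add: z0_def)

lemma zz_Ph_0: "key R M D C \<Longrightarrow> BO R 1 (zz N Ph 0)"
  using zz_ord[of R M D C Ph 0 N] by (simp add: ordk_def oP_def)

lemma zz_minus_s: "key R M D C \<Longrightarrow> q \<noteq> Ph \<Longrightarrow> BO R 1 (zz N q (- sg q))"
  using zz_ord[of R M D C q "- sg q" N] sg_cases[of q] by (auto simp: ordk_def o1_def)

lemma zz_Suc: "zz (Suc N) q n \<sigma> x = init q n + L n (rhs (KK N) (zz N) q n) \<sigma> x"
  by (simp add: Phi_def)

lemma adm_rhs_zz: "adm n (rhs K (zz N) q n)"
  by (rule adm_rhs[OF Asy_zz])

text \<open>The iterate after number 16 + i is \<open>L n\<close> of its right-hand side, and the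
  limit and all iterates from 16 on coincide up to x^-4; so an estimate obtained for one of them
  holds for all.\<close>

lemma zl_BO_of_L:
  assumes k: "key R M D C" and e: "e \<le> 4" and i: "init q n = 0"
    and b: "BO R e (\<lambda>\<sigma> x. L n (rhs (KK (16 + i)) (zz (16 + i)) q n) \<sigma> x - y \<sigma> x)"
  shows "BO R e (\<lambda>\<sigma> x. zl q n \<sigma> x - y \<sigma> x)" "BO R e (\<lambda>\<sigma> x. zz (16 + j) q n \<sigma> x - y \<sigma> x)"
proof -
  note R = key_R(1)[OF k]
  have "BO R e (\<lambda>\<sigma> x. zz (16 + Suc i) q n \<sigma> x - y \<sigma> x)"
    using b i zz_Suc[of "16 + i" q n] by (simp add: add_Suc_right del: zz.simps add_Suc)
  from BO_add[OF BO_mono[OF R zz_BO[OF k, of q n "Suc i"] e] this] show z: "BO R e (\<lambda>\<sigma> x. zl q n \<sigma> x - y \<sigma> x)" by simp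
  from BO_diff[OF this BO_mono[OF R zz_BO[OF k, of q n j] e]] show "BO R e (\<lambda>\<sigma> x. zz (16 + j) q n \<sigma> x - y \<sigma> x)" by simp
qed

text \<open>Pairs other than (t, 0) and (0, t) have a factor X Y, and the second of these contains
  \<phi> at index 0, which is O(1/x). There remains \<phi> at t times q at 0, both close to 1, with
  the structure constant c: one pair of \<gamma>s merges if \<open>t = sg q\<close>, none if
  \<open>t = - sg q\<close>.\<close>

lemma T0_lead:
  assumes k: "key R M D C" and q: "q \<noteq> Ph" and t: "t = sg q \<or> t = - sg q"
    and c: "c = (if t = sg q then (if q = Fp \<or> q = Fm then kap0 else kapx) else (\<lambda>\<sigma>. 1))"
  shows "BO R 1 (\<lambda>\<sigma> x. T (KK (16 + l)) 0 Ph q (zz (16 + l) Ph) (zz (16 + l) q) t \<sigma> x - c \<sigma>)"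
proof -
  note R = key_R[OF k]
  have t1: "\<bar>t\<bar> = 1" using t sg_cases[OF q] by auto
  have cP: "c \<in> PQ" using PQ_params PQ_one by (simp add: c)
  obtain M' where b: "\<And>q. bd R (KK (16 + l)) M' (\<lambda>n. 0) (zz (16 + l) q)" using key_bd[OF k] by blast
  have cc: "cc Ph q 0 t 0 \<sigma> x = c \<sigma>" for \<sigma> x
    using t q by (cases q) (auto simp: c cc_def mm_def m3_def)
  have "BO R 2 (\<lambda>\<sigma> x. T (KK (16 + l)) 0 Ph q (zz (16 + l) Ph) (zz (16 + l) q) t \<sigma> x
     - (\<Sum>(i, j)\<in>{(t, 0), (0, t)}. cc Ph q 0 i j \<sigma> x * zz (16 + l) Ph i \<sigma> x * zz (16 + l) q j \<sigma> x))"
  proof (rule T_split[OF R(2) b b])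
    show "{(t, 0), (0, t)} \<subseteq> {- KK (16 + l)..KK (16 + l)} \<times> {- KK (16 + l)..KK (16 + l)}"
      using t1 KK_ge[of "16 + l"] by auto
    fix i j assume n: "0 + i + j = t" "(i, j) \<notin> {(t, 0), (0, t)}"
    then have "3 \<le> \<bar>i\<bar> + \<bar>j\<bar>" using t1 by auto
    then have "2 \<le> 2 * int (m3 0 i j)" unfolding m3_eq n(1) using t1 by simp
    then show "2 \<le> 2 * min (m3 0 i j) 2" by simp
  qed auto
  moreover have "BO R 2 (\<lambda>\<sigma> x. cc Ph q 0 0 t \<sigma> x * (zz (16 + l) Ph 0 \<sigma> x * zz (16 + l) q t \<sigma> x) + 0)" if "t = - sg q"
    using BO_mult[OF BO_cc[OF R(1)] BO_mult[OF zz_Ph_0[OF k] zz_minus_s[OF k q]]] that by (simp add: numeral_2_eq_2)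
  moreover have "BO R 1 (\<lambda>\<sigma> x. cc Ph q 0 0 t \<sigma> x * (zz (16 + l) Ph 0 \<sigma> x * zz (16 + l) q t \<sigma> x))"
  proof -
    have "BO R 0 (zz (16 + l) q t)" by (rule BO_mono[OF R(1) zz_ord[OF k]]) simp
    from BO_mult[OF BO_cc[OF R(1)] BO_mult[OF zz_Ph_0[OF k] this]] show ?thesis by simp
  qed
  moreover have "BO R 1 (\<lambda>\<sigma> x. c \<sigma> * (zz (16 + l) Ph t \<sigma> x * zz (16 + l) q 0 \<sigma> x - 1 * 1))"
    by (intro BO_cmult cP BO_mult_lead R PQ_one zz_Ph_lead[OF k t1] zz_1_lead[OF k q])
  ultimately have "BO R 1 (\<lambda>\<sigma> x. (T (KK (16 + l)) 0 Ph q (zz (16 + l) Ph) (zz (16 + l) q) t \<sigma> x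
     - (\<Sum>(i, j)\<in>{(t, 0), (0, t)}. cc Ph q 0 i j \<sigma> x * zz (16 + l) Ph i \<sigma> x * zz (16 + l) q j \<sigma> x))
     + cc Ph q 0 0 t \<sigma> x * (zz (16 + l) Ph 0 \<sigma> x * zz (16 + l) q t \<sigma> x)
     + c \<sigma> * (zz (16 + l) Ph t \<sigma> x * zz (16 + l) q 0 \<sigma> x - 1 * 1))"
    by (intro BO_add) (auto intro: BO_mono[OF R(1)])
  then show ?thesis
    by (rule BO_cong) (use t1 in \<open>auto simp: cc algebra_simps simp del: zz.simps\<close>)
qed

text \<open>At index - s the quadratic term is O(x^-2) and the linear one is 1/x to leading order,
  so that - s z = - 2 s / x. This is the source of the factor 2 in front of the terms e^x
  x^(\<sigma>-2) and e^(-x) x^(-\<sigma>-2).\<close>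

lemma zl_minus_s:
  assumes k: "key R M D C" and q: "q \<noteq> Ph"
  shows "Asy R 1 (\<lambda>\<sigma> x. x * zl q (- sg q) \<sigma> x - 2)"
proof -
  note R = key_R[OF k]
  define s where "s = sg q"
  have s: "s = 1 \<or> s = - 1" using sg_cases[OF q] by (simp add: s_def)
  let ?z = "zz 16" and ?K = "KK 16"
  let ?T0 = "\<lambda>\<sigma> x. T ?K 0 Ph q (?z Ph) (?z q) (- s) \<sigma> x" and ?T2 = "\<lambda>\<sigma> x. T ?K s Ph (bar q) (fs q ?z) (?z (bar q)) (- s) \<sigma> x"
  obtain M' where b: "\<And>q. bd R ?K M' (\<lambda>n. 0) (?z q)" "\<And>q. bd R ?K M' (\<lambda>n. 0) (fs q ?z)" using key_bd[OF k, of 16] by blast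
  have T0: "BO R 1 (\<lambda>\<sigma> x. ?T0 \<sigma> x - 1)"
    using T0_lead[OF k q _ refl, of "- s" 0] s by (auto simp: s_def simp del: zz.simps KK.simps)
  have T2: "BO R 2 (\<lambda>\<sigma> x. ?T2 \<sigma> x - (\<Sum>(i, j)\<in>{}. cc Ph (bar q) s i j \<sigma> x * fs q ?z i \<sigma> x * ?z (bar q) j \<sigma> x))"
  proof (rule T_split[OF R(2) b(2) b(1)])
    fix i j assume n: "s + i + j = - s"
    then have "2 \<le> \<bar>i\<bar> + \<bar>j\<bar>" using s by auto
    then have "2 \<le> 2 * int (m3 s i j)" unfolding m3_eq n(1) using s by auto
    then show "2 \<le> 2 * min (m3 s i j) 2" by simp
  qed auto
  have d: "((\<lambda>x. 2 / x) has_field_derivative - 2 / x ^ 2) (at x)" if "x \<in> S R0" for x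
    using S_nonzero[OF that] by (auto intro!: derivative_eq_intros simp: field_simps power2_eq_square)
  have "BO R (if - s = 0 then 2 - 1 else 2) (\<lambda>\<sigma> x. L (- s) (rhs ?K ?z q (- s)) \<sigma> x - 2 / x)"
  proof (rule L_leading[OF R(1) adm_rhs_zz d])
    show "Asy R0 (if - s = 0 then 1 else 0) (\<lambda>\<sigma> x. 2 / x)"
      using Asy_mono[OF Asy_cmult[OF order_refl PQ_numeral(1)[of "num.Bit0 num.One"] Asy_inverse_power[OF order_refl, of 1]], of 0] s by auto
    show "Asy R0 (if - s = 0 then 2 else 0) (\<lambda>\<sigma> x. - 2 / x ^ 2)"
      using Asy_mono[OF Asy_cmult[OF order_refl PQ_int[of "-2"] Asy_inverse_power[OF order_refl, of 2]], of 0] s by auto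
    have P: "(\<lambda>\<sigma>. 4 + 2 * of_int s * \<sigma>) \<in> PQ" by (intro PQ_add PQ_mult PQ_sigma PQ_int PQ_numeral(1))
    have "BO R 2 (\<lambda>\<sigma> x. of_int (- 2 * s) * ((?T0 \<sigma> x - 1) / x ^ 1)
       + of_int (- 2 * s) * ?T2 \<sigma> x + (4 + 2 * of_int s * \<sigma>) * (1 / x ^ 2))"
      using BO_divide[OF T0, of 1] T2 by (intro BO_add BO_cmult PQ_int P BO_inverse_power) (auto simp: numeral_2_eq_2 simp del: zz.simps KK.simps)
    then show "BO R 2 (\<lambda>\<sigma> x. rhs ?K ?z q (- s) \<sigma> x - (- 2 / x\<^sup>2 + (of_int (- s) + (of_int (- s) * \<sigma> - of_int \<bar>- s\<bar>) / x) * (2 / x)))"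
    proof (rule BO_cong)
      fix \<sigma> x assume "x \<in> S R"
      then have "x \<noteq> 0" by (rule S_nonzero)
      then show "rhs ?K ?z q (- s) \<sigma> x - (- 2 / x\<^sup>2 + (of_int (- s) + (of_int (- s) * \<sigma> - of_int \<bar>- s\<bar>) / x) * (2 / x))
        = of_int (- 2 * s) * ((?T0 \<sigma> x - 1) / x ^ 1)
       + of_int (- 2 * s) * ?T2 \<sigma> x + (4 + 2 * of_int s * \<sigma>) * (1 / x ^ 2)"
        using s q unfolding rhs_def s_def[symmetric]
        by (auto simp: field_simps power2_eq_square simp del: zz.simps KK.simps)
    qed
  qed (use s in auto)
  then have "BO R 2 (\<lambda>\<sigma> x. zl q (- s) \<sigma> x - 2 / x)"
    using zl_BO_of_L(1)[OF k, where e = 2 and q = q and n = "- s" and i = 0 and y = "\<lambda>\<sigma> x. 2 / x"] s by (auto simp: init_def simp del: zz.simps KK.simps)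
  then obtain B where B: "\<And>\<sigma> x. \<sigma> \<in> Bs \<Longrightarrow> x \<in> S R \<Longrightarrow> norm (zl q (- s) \<sigma> x - 2 / x) \<le> B / norm x ^ 2"
    unfolding BO_def by blast
  have "Asy R 1 (\<lambda>\<sigma> x. x ^ 1 * zl q (- s) \<sigma> x - 2)"
  proof (rule Asy_remainder[OF R(1), where e = 1 and C = B])
    show "Asy R 1 (zl q (- s))" using Asy_zl[OF k, of q "- s"] q s by (auto simp: ordk_def o1_def s_def)
    show "norm (zl q (- s) \<sigma> x - 2 / x ^ 1) \<le> B * norm x powr (- real 1 - 1)" if "\<sigma> \<in> Bs" "x \<in> S R" for \<sigma> x
      using B[OF that] powr_neg_nat[OF that(2), of 2] by simp
  qed simp
  then show ?thesis by (simp add: s_def)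
qed

text \<open>Reaching index 0 from the shift 1 or - 1 takes at least one X Y. The four pairs
  displayed have exactly one, all others at least two; grouped by \<open>kapx\<close> and
  \<open>kap0\<close> they form two brackets, in which a cancellation will show.\<close>

lemma rhs_Ph_0:
  assumes k: "key R M D C" and z_def: "z = zz (16 + l)"
  shows "BO R 4 (\<lambda>\<sigma> x. rhs (KK (16 + l)) z Ph 0 \<sigma> x
    - (kapx \<sigma> * ((z Gp 0 \<sigma> x * z Fm (-1) \<sigma> x - z Gm 0 \<sigma> x * z Fp 1 \<sigma> x) / x ^ 2)
     + kap0 \<sigma> * ((z Fm 0 \<sigma> x * z Gp (-1) \<sigma> x - z Fp 0 \<sigma> x * z Gm 1 \<sigma> x) / x ^ 2)))"
proof -
  note R = key_R[OF k]
  let ?K = "KK (16 + l)"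
  have K: "2 \<le> ?K" using KK_ge[of "16 + l"] by simp
  obtain M' where b: "\<And>q. bd R ?K M' (\<lambda>n. 0) (z q)" unfolding z_def using key_bd[OF k] by blast
  have T1: "BO R 4 (\<lambda>\<sigma> x. T ?K 1 Gp Fm (z Gp) (z Fm) 0 \<sigma> x - (\<Sum>(i, j)\<in>{(0, -1), (-1, 0)}. cc Gp Fm 1 i j \<sigma> x * z Gp i \<sigma> x * z Fm j \<sigma> x))"
  proof (rule T_split[OF R(2) b b])
    show "{(0, -1), (-1, 0)} \<subseteq> {- ?K..?K} \<times> {- ?K..?K}" using K by auto
    fix i j :: int assume n: "1 + i + j = 0" "(i, j) \<notin> {(0, -1), (-1, 0)}"
    then have "3 \<le> \<bar>i\<bar> + \<bar>j\<bar>" by auto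
    then have "4 \<le> 2 * int (m3 1 i j)" unfolding m3_eq n(1) by simp
    then show "4 \<le> 2 * min (m3 1 i j) 2" by simp
  qed auto
  have T2: "BO R 4 (\<lambda>\<sigma> x. T ?K (-1) Gm Fp (z Gm) (z Fp) 0 \<sigma> x - (\<Sum>(i, j)\<in>{(0, 1), (1, 0)}. cc Gm Fp (-1) i j \<sigma> x * z Gm i \<sigma> x * z Fp j \<sigma> x))"
  proof (rule T_split[OF R(2) b b])
    show "{(0, 1), (1, 0)} \<subseteq> {- ?K..?K} \<times> {- ?K..?K}" using K by auto
    fix i j :: int assume n: "-1 + i + j = 0" "(i, j) \<notin> {(0, 1), (1, 0)}"
    then have "3 \<le> \<bar>i\<bar> + \<bar>j\<bar>" by auto
    then have "4 \<le> 2 * int (m3 (-1) i j)" unfolding m3_eq n(1) by simp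
    then show "4 \<le> 2 * min (m3 (-1) i j) 2" by simp
  qed auto
  from BO_diff[OF T1 T2] show ?thesis
    by (rule BO_cong) (simp add: rhs_def cc_def mm_def m3_def algebra_simps add_divide_distrib diff_divide_distrib power2_eq_square)
qed

definition kq :: "kind \<Rightarrow> complex \<Rightarrow> complex" where
  "kq q = (if q = Fp \<or> q = Fm then kap0 else kapx)"

lemma PQ_kq: "kq q \<in> PQ" using PQ_params by (simp add: kq_def)

text \<open>The leading terms cancel because \<open>tau\<close> has the same value for the two
  members of an entry pair. With the factor x^-2 in front the right-hand side is O(x^-3), which
  makes \<phi> at index 0 of order x^-2, one better than \<open>ordk\<close> records.\<close>

lemma bracket_lead:
  assumes k: "key R M D C" and pq: "(p, q) = (Fm, Fp) \<or> (p, q) = (Gp, Gm)"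
  shows "BO R 1 (\<lambda>\<sigma> x. zz (16 + l) (bar q) 0 \<sigma> x * zz (16 + l) p (-1) \<sigma> x - zz (16 + l) (bar p) 0 \<sigma> x * zz (16 + l) q 1 \<sigma> x)"
proof -
  note R = key_R[OF k]
  have p: "p \<noteq> Ph" "q \<noteq> Ph" "sg p = -1" "sg q = 1" "tau p = tau q" using pq by auto
  have P: "(\<lambda>\<sigma>. - 2 * tau p \<sigma>) \<in> PQ" for p by (intro PQ_mult PQ_tau PQ_minus PQ_numeral(1))
  have "BO R 1 (\<lambda>\<sigma> x. zz (16 + l) (bar q) 0 \<sigma> x * zz (16 + l) p (sg p) \<sigma> x - 1 * (- 2 * tau p \<sigma>))"
    using p by (intro BO_mult_lead R PQ_one P zz_1_lead[OF k] zz_s_lead[OF k]) auto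
  moreover have "BO R 1 (\<lambda>\<sigma> x. zz (16 + l) (bar p) 0 \<sigma> x * zz (16 + l) q (sg q) \<sigma> x - 1 * (- 2 * tau q \<sigma>))"
    using p by (intro BO_mult_lead R PQ_one P zz_1_lead[OF k] zz_s_lead[OF k]) auto
  ultimately show ?thesis using BO_diff p by (force simp del: zz.simps)
qed

lemma zl_Ph_0_rough:
  assumes k: "key R M D C" shows "BO R 2 (zl Ph 0)" "BO R 2 (zz (16 + j) Ph 0)"
proof -
  note R = key_R[OF k]
  let ?z = "zz (16 + 0)" and ?K = "KK (16 + 0)"
  let ?u = "\<lambda>\<sigma> x. ?z Gp 0 \<sigma> x * ?z Fm (-1) \<sigma> x - ?z Gm 0 \<sigma> x * ?z Fp 1 \<sigma> x"
    and ?v = "\<lambda>\<sigma> x. ?z Fm 0 \<sigma> x * ?z Gp (-1) \<sigma> x - ?z Fp 0 \<sigma> x * ?z Gm 1 \<sigma> x"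
  have b: "BO R 1 (\<lambda>\<sigma> x. ?u \<sigma> x)"
    "BO R 1 (\<lambda>\<sigma> x. ?v \<sigma> x)"
    using bracket_lead[OF k, of Fm Fp 0] bracket_lead[OF k, of Gp Gm 0] by simp_all
  have "BO R 3 (\<lambda>\<sigma> x. (rhs ?K ?z Ph 0 \<sigma> x
    - (kapx \<sigma> * ((?u \<sigma> x) / x ^ 2)
     + kap0 \<sigma> * ((?v \<sigma> x) / x ^ 2)))
    + (kapx \<sigma> * ((?u \<sigma> x) / x ^ 2)
     + kap0 \<sigma> * ((?v \<sigma> x) / x ^ 2)))"
    using BO_divide[OF b(1), of 2] BO_divide[OF b(2), of 2] BO_mono[OF R(1) rhs_Ph_0[OF k refl, of 0], of 3]
    by (intro BO_add BO_cmult PQ_params) (simp_all add: numeral_3_eq_3)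
  then have "BO R 3 (rhs ?K ?z Ph 0)" by simp
  from BO_L[OF R(1) _ this, of 0] have L: "BO R 2 (L 0 (rhs ?K ?z Ph 0))"
    using adm_rhs_zz[of 0 ?K 16 Ph] by (simp add: adm_def del: zz.simps KK.simps)
  show "BO R 2 (zl Ph 0)" "BO R 2 (zz (16 + j) Ph 0)"
    using zl_BO_of_L(1)[OF k, where e = 2 and q = Ph and n = 0 and i = 0 and y = "\<lambda>\<sigma> x. 0"]
      zl_BO_of_L(2)[OF k, where e = 2 and q = Ph and n = 0 and i = 0 and y = "\<lambda>\<sigma> x. 0" and j = j] L by (simp_all add: init_def del: zz.simps KK.simps)
qed

text \<open>The second term of the coefficient at \<open>sg q\<close>. The coefficient of
  \<open>bar q\<close> at index 0 is deliberately left unexpanded: in \<open>bracket_refined\<close>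
  it cancels as a function, and its own term of order 1/x never has to be known.\<close>

lemma z_s_refined:
  assumes k: "key R M D C" and q: "q \<noteq> Ph" and s_def: "s = sg q"
  shows "BO R 2 (\<lambda>\<sigma> x. zz 16 q s \<sigma> x -
     (- 2 * kq q \<sigma> * (1 / x) + - 2 * tau q \<sigma> * zz 16 (bar q) 0 \<sigma> x + 2 * tau q \<sigma> * (\<sigma> - of_int s) * (1 / x)))"
proof -
  note R = key_R[OF k]
  have s: "s = 1 \<or> s = - 1" using sg_cases[OF q] by (simp add: s_def)
  let ?z = "zz 16" and ?K = "KK 16" and ?w = "zz 16 (bar q) 0" and ?w' = "rhs (KK 15) (zz 15) (bar q) 0"
  let ?T0 = "\<lambda>\<sigma> x. T ?K 0 Ph q (?z Ph) (?z q) s \<sigma> x" and ?T2 = "\<lambda>\<sigma> x. T ?K s Ph (bar q) (fs q ?z) (?z (bar q)) s \<sigma> x"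
  let ?c = "\<lambda>\<sigma>. - 2 * kq q \<sigma> + 2 * tau q \<sigma> * (\<sigma> - of_int s)" and ?b = "\<lambda>\<sigma>. - 2 * tau q \<sigma>"
  have P: "?c \<in> PQ" "?b \<in> PQ" by (intro PQ_add PQ_mult PQ_kq PQ_tau PQ_minus PQ_numeral(1) PQ_diff PQ_sigma PQ_int)+
  obtain M' where b: "\<And>q. bd R ?K M' (\<lambda>n. 0) (?z q)" "\<And>q. bd R ?K M' (\<lambda>n. 0) (fs q ?z)" using key_bd[OF k, of 16] by blast
  have T0: "BO R 1 (\<lambda>\<sigma> x. ?T0 \<sigma> x - kq q \<sigma>)"
    using T0_lead[OF k q _ refl, of s 0] s by (auto simp: s_def kq_def simp del: zz.simps KK.simps)
  have T2: "BO R 2 (\<lambda>\<sigma> x. ?T2 \<sigma> x - (\<Sum>(i, j)\<in>{(0, 0)}. cc Ph (bar q) s i j \<sigma> x * fs q ?z i \<sigma> x * ?z (bar q) j \<sigma> x))"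
  proof (rule T_split[OF R(2) b(2) b(1)])
    show "{(0, 0)} \<subseteq> {- ?K..?K} \<times> {- ?K..?K}" using KK_ge[of 16] by (auto simp del: KK.simps)
    fix i j assume n: "s + i + j = s" "(i, j) \<notin> {(0, 0)}"
    then have "2 \<le> \<bar>i\<bar> + \<bar>j\<bar>" by auto
    then have "2 \<le> 2 * int (m3 s i j)" unfolding m3_eq n(1) using s by auto
    then show "2 \<le> 2 * min (m3 s i j) 2" by simp
  qed auto
  have "cc Ph (bar q) s 0 0 \<sigma> x = 1" for \<sigma> x by (simp add: cc_def mm_def m3_def)
  then have T2': "BO R 2 (\<lambda>\<sigma> x. ?T2 \<sigma> x - (?z Ph 0 \<sigma> x + tau q \<sigma>) * ?w \<sigma> x)"
    using T2 by (simp add: fs_def del: zz.simps KK.simps)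
  have w1: "BO R 1 (\<lambda>\<sigma> x. ?w \<sigma> x - 1)" using zz_1_lead[OF k, of "bar q" 0] q by (simp del: zz.simps)
  have w0: "BO R 0 ?w" by (rule BO_mono[OF R(1) zz_ord[OF k]]) simp
  have T3: "BO R 2 (\<lambda>\<sigma> x. ?z Ph 0 \<sigma> x * ?w \<sigma> x)" using BO_mult[OF zl_Ph_0_rough(2)[OF k, of 0] w0] by (simp del: zz.simps)
  have Aw: "Asy R0 2 ?w'" using Asy_rhs[OF Asy_zz[where N = 15], where n = 0 and K = "KK 15" and q = "bar q"] by (simp del: zz.simps KK.simps)
  have Bw: "BO R 2 ?w'" by (rule BO_Asy[OF Asy_restrict[OF Aw R(1)]])
  \<comment> \<open>The function \<open>?w\<close> is 1 plus a value of \<open>L 0\<close>; its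
    derivative is the right-hand side of the previous iterate, and this is O(x^-2) and disappears in
    the error.\<close>
  have d: "((\<lambda>x. ?c \<sigma> * (1 / x) + ?b \<sigma> * ?w \<sigma> x) has_field_derivative - ?c \<sigma> * (1 / x ^ 2) + ?b \<sigma> * ?w' \<sigma> x) (at x)"
    if \<sigma>: "\<sigma> \<in> Bs" and x: "x \<in> S R0" for \<sigma> x
  proof -
    have "(?w \<sigma> has_field_derivative ?w' \<sigma> x) (at x)"
    proof -
      have e: "?w \<sigma> = (\<lambda>x. init (bar q) 0 + L 0 ?w' \<sigma> x)"
        using zz_Suc[of 15 "bar q" 0] by (simp add: fun_eq_iff del: zz.simps KK.simps)
      show ?thesis unfolding e using L_has_field_derivative[OF adm_rhs_zz \<sigma> x, of 0 "KK 15" 15 "bar q"]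
        by (auto intro!: derivative_eq_intros simp del: zz.simps KK.simps)
    qed
    then show ?thesis using S_nonzero[OF x]
      by (auto intro!: derivative_eq_intros simp: power2_eq_square simp del: zz.simps KK.simps)
  qed
  have "BO R (if s = 0 then 2 - 1 else 2) (\<lambda>\<sigma> x. L s (rhs ?K ?z q s) \<sigma> x - (?c \<sigma> * (1 / x) + ?b \<sigma> * ?w \<sigma> x))"
  proof (rule L_leading[OF R(1) adm_rhs_zz d])
    have A: "Asy R0 0 (\<lambda>\<sigma> x. ?c \<sigma> * (1 / x ^ m))" for m
      by (rule Asy_mono[OF Asy_cmult[OF order_refl P(1) Asy_inverse_power[OF order_refl]]]) simp
    have "Asy R0 0 (\<lambda>\<sigma> x. ?c \<sigma> * (1 / x ^ 1) + ?b \<sigma> * ?w \<sigma> x)"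
      by (intro Asy_add A Asy_cmult[OF order_refl P(2)] Asy_mono[OF Asy_zz]) simp
    then show "Asy R0 (if s = 0 then 1 else 0) (\<lambda>\<sigma> x. ?c \<sigma> * (1 / x) + ?b \<sigma> * ?w \<sigma> x)" using s by auto
    have A': "Asy R0 0 (\<lambda>\<sigma> x. - ?c \<sigma> * (1 / x ^ 2))"
      by (rule Asy_mono[OF Asy_cmult[OF order_refl PQ_minus[OF P(1)] Asy_inverse_power[OF order_refl]]]) simp
    have "Asy R0 0 (\<lambda>\<sigma> x. - ?c \<sigma> * (1 / x ^ 2) + ?b \<sigma> * ?w' \<sigma> x)"
      by (intro Asy_add A' Asy_cmult[OF order_refl P(2)] Asy_mono[OF Aw]) simp
    then show "Asy R0 (if s = 0 then 2 else 0) (\<lambda>\<sigma> x. - ?c \<sigma> * (1 / x ^ 2) + ?b \<sigma> * ?w' \<sigma> x)" using s by auto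
    let ?d = "\<lambda>\<sigma>. ?c \<sigma> - (of_int s * \<sigma> - 1) * ?c \<sigma>" and ?e = "\<lambda>\<sigma>. - (of_int s * \<sigma> - 1) * ?b \<sigma>"
    have P': "?d \<in> PQ" "?e \<in> PQ" "(\<lambda>\<sigma>. - ?b \<sigma>) \<in> PQ" "(\<lambda>\<sigma>. of_int (- 2 * s) * 1) \<in> PQ"
      by (intro PQ_mult PQ_minus PQ_diff P PQ_int PQ_sigma PQ_one)+
    have "BO R 2 (\<lambda>\<sigma> x. of_int (- 2 * s) * ((?T0 \<sigma> x - kq q \<sigma>) / x ^ 1)
       + of_int (- 2 * s) * ((?T2 \<sigma> x - (?z Ph 0 \<sigma> x + tau q \<sigma>) * ?w \<sigma> x) + ?z Ph 0 \<sigma> x * ?w \<sigma> x)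
       + ?d \<sigma> * (1 / x ^ 2) + - ?b \<sigma> * ?w' \<sigma> x + ?e \<sigma> * ((?w \<sigma> x - 1) / x ^ 1))"
      using BO_divide[OF T0, of 1] BO_divide[OF w1, of 1]
      by (intro BO_add BO_cmult PQ_int P' BO_inverse_power T2' T3 Bw) (auto simp: numeral_2_eq_2 simp del: zz.simps KK.simps)
    then show "BO R 2 (\<lambda>\<sigma> x. rhs ?K ?z q s \<sigma> x - (- ?c \<sigma> * (1 / x ^ 2) + ?b \<sigma> * ?w' \<sigma> x
      + (of_int s + (of_int s * \<sigma> - of_int \<bar>s\<bar>) / x) * (?c \<sigma> * (1 / x) + ?b \<sigma> * ?w \<sigma> x)))"
    proof (rule BO_cong)
      fix \<sigma> x assume "x \<in> S R"
      then have x0: "x \<noteq> 0" by (rule S_nonzero)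
      define t0 t2 ph w w' ka ta where "t0 = ?T0 \<sigma> x"
        and "t2 = ?T2 \<sigma> x"
        and "ph = ?z Ph 0 \<sigma> x" and "w = ?w \<sigma> x" and "w' = ?w' \<sigma> x" and "ka = kq q \<sigma>" and "ta = tau q \<sigma>"
      note fd = this
      have r: "rhs ?K ?z q s \<sigma> x = - 2 * of_int s * (t0 / x + t2)" using q by (simp add: rhs_def fd s_def)
      show "rhs ?K ?z q s \<sigma> x - (- ?c \<sigma> * (1 / x ^ 2) + ?b \<sigma> * ?w' \<sigma> x
      + (of_int s + (of_int s * \<sigma> - of_int \<bar>s\<bar>) / x) * (?c \<sigma> * (1 / x) + ?b \<sigma> * ?w \<sigma> x))
        = of_int (- 2 * s) * ((?T0 \<sigma> x - kq q \<sigma>) / x ^ 1)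
       + of_int (- 2 * s) * ((?T2 \<sigma> x - (?z Ph 0 \<sigma> x + tau q \<sigma>) * ?w \<sigma> x) + ?z Ph 0 \<sigma> x * ?w \<sigma> x)
       + ?d \<sigma> * (1 / x ^ 2) + - ?b \<sigma> * ?w' \<sigma> x + ?e \<sigma> * ((?w \<sigma> x - 1) / x ^ 1)"
        unfolding r fd[symmetric] using s x0 by (auto simp: field_simps power2_eq_square)
    qed
  qed (use s in auto)
  then have "BO R 2 (\<lambda>\<sigma> x. zz 16 q s \<sigma> x - (?c \<sigma> * (1 / x) + ?b \<sigma> * ?w \<sigma> x))"
    using zl_BO_of_L(2)[OF k, where e = 2 and q = q and n = s and i = 0 and y = "\<lambda>\<sigma> x. ?c \<sigma> * (1 / x) + ?b \<sigma> * ?w \<sigma> x" and j = 0] s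
    by (auto simp: init_def simp del: zz.simps KK.simps)
  then show ?thesis by (rule BO_cong) (simp only: distrib_right distrib_left, simp add: algebra_simps)
qed

text \<open>With a and b the two coefficients at index 0, the terms a (- 2 \<tau> b) and b (- 2
  \<tau> a) cancel identically and those with \<open>kq\<close> to leading order; 2 \<tau> (\<sigma>
  + 1) - 2 \<tau> (\<sigma> - 1) = 4 \<tau> survives over x, where \<tau> is
  \<open>tau q\<close>.\<close>

lemma bracket_refined:
  assumes k: "key R M D C" and pq: "(p, q) = (Fm, Fp) \<or> (p, q) = (Gp, Gm)"
  shows "BO R 2 (\<lambda>\<sigma> x. zz 16 (bar q) 0 \<sigma> x * zz 16 p (-1) \<sigma> x - zz 16 (bar p) 0 \<sigma> x * zz 16 q 1 \<sigma> x - 4 * tau q \<sigma> / x)"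
proof -
  note R = key_R[OF k]
  have p: "p \<noteq> Ph" "q \<noteq> Ph" "sg p = -1" "sg q = 1" "tau p = tau q" "kq p = kq q" using pq by (auto simp: kq_def)
  let ?a = "zz 16 (bar q) 0" and ?b = "zz 16 (bar p) 0"
  let ?c = "\<lambda>\<sigma>. - 2 * kq q \<sigma> + 2 * tau q \<sigma> * (\<sigma> + 1)" and ?d = "\<lambda>\<sigma>. - (- 2 * kq q \<sigma> + 2 * tau q \<sigma> * (\<sigma> - 1))"
  have P: "?c \<in> PQ" "?d \<in> PQ" by (intro PQ_add PQ_mult PQ_kq PQ_tau PQ_minus PQ_numeral(1) PQ_diff PQ_sigma PQ_one)+
  define r where "r = (\<lambda>\<sigma> x. zz 16 p (-1) \<sigma> x - (- 2 * kq q \<sigma> * (1 / x) + - 2 * tau q \<sigma> * ?b \<sigma> x + 2 * tau q \<sigma> * (\<sigma> + 1) * (1 / x)))"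
  define r' where "r' = (\<lambda>\<sigma> x. zz 16 q 1 \<sigma> x - (- 2 * kq q \<sigma> * (1 / x) + - 2 * tau q \<sigma> * ?a \<sigma> x + 2 * tau q \<sigma> * (\<sigma> - 1) * (1 / x)))"
  have r: "BO R 2 r" "BO R 2 r'"
    using z_s_refined[OF k p(1) refl] z_s_refined[OF k p(2) refl] p by (simp_all add: r_def r'_def del: zz.simps)
  have ab: "BO R 1 (\<lambda>\<sigma> x. ?a \<sigma> x - 1)" "BO R 1 (\<lambda>\<sigma> x. ?b \<sigma> x - 1)"
    using zz_1_lead[OF k, of "bar q" 0] zz_1_lead[OF k, of "bar p" 0] p by (simp_all del: zz.simps)
  have ab0: "BO R 0 ?a" "BO R 0 ?b" by (rule BO_mono[OF R(1) zz_ord[OF k]], simp)+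
  have "BO R 2 (\<lambda>\<sigma> x. ?c \<sigma> * ((?a \<sigma> x - 1) / x ^ 1) + ?d \<sigma> * ((?b \<sigma> x - 1) / x ^ 1) + (?a \<sigma> x * r \<sigma> x - ?b \<sigma> x * r' \<sigma> x))"
    using BO_divide[OF ab(1), of 1] BO_divide[OF ab(2), of 1] BO_mult[OF ab0(1) r(1)] BO_mult[OF ab0(2) r(2)]
    by (intro BO_add BO_diff BO_cmult P) (auto simp: numeral_2_eq_2 simp del: zz.simps)
  then show ?thesis
  proof (rule BO_cong)
    fix \<sigma> x assume "x \<in> S R"
    then have x0: "x \<noteq> 0" by (rule S_nonzero)
    define a b ka ta where "a = ?a \<sigma> x" and "b = ?b \<sigma> x" and "ka = kq q \<sigma>" and "ta = tau q \<sigma>"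
    note fd = this
    have e: "zz 16 p (-1) \<sigma> x = r \<sigma> x + (- 2 * ka * (1 / x) + - 2 * ta * b + 2 * ta * (\<sigma> + 1) * (1 / x))"
      "zz 16 q 1 \<sigma> x = r' \<sigma> x + (- 2 * ka * (1 / x) + - 2 * ta * a + 2 * ta * (\<sigma> - 1) * (1 / x))"
      by (simp_all add: r_def r'_def fd)
    show "?a \<sigma> x * zz 16 p (-1) \<sigma> x - ?b \<sigma> x * zz 16 q 1 \<sigma> x - 4 * tau q \<sigma> / x
      = ?c \<sigma> * ((?a \<sigma> x - 1) / x ^ 1) + ?d \<sigma> * ((?b \<sigma> x - 1) / x ^ 1) + (?a \<sigma> x * r \<sigma> x - ?b \<sigma> x * r' \<sigma> x)"
      unfolding e fd[symmetric] using x0 by (simp add: field_simps)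
  qed
qed

text \<open>The refined brackets give the derivative 4 (s0 kapx + t0 kap0) / x^3 + O(x^-4), and
  integration from infinity produces the coefficient of x^-2 that the theorem displays.\<close>

lemma zl_Ph_0:
  assumes k: "key R M D C"
  shows "Asy R 3 (\<lambda>\<sigma> x. zl Ph 0 \<sigma> x + 2 * (s0 \<sigma> * kapx \<sigma> + t0 \<sigma> * kap0 \<sigma>) / x ^ 2)"
proof -
  note R = key_R[OF k]
  let ?z = "zz 16" and ?K = "KK 16"
  let ?u = "\<lambda>\<sigma> x. ?z Gp 0 \<sigma> x * ?z Fm (-1) \<sigma> x - ?z Gm 0 \<sigma> x * ?z Fp 1 \<sigma> x"
    and ?v = "\<lambda>\<sigma> x. ?z Fm 0 \<sigma> x * ?z Gp (-1) \<sigma> x - ?z Fp 0 \<sigma> x * ?z Gm 1 \<sigma> x"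
  define c where "c = (\<lambda>\<sigma>. - 2 * (s0 \<sigma> * kapx \<sigma> + t0 \<sigma> * kap0 \<sigma>))"
  have cP: "c \<in> PQ" unfolding c_def by (intro PQ_add PQ_mult PQ_params PQ_minus PQ_numeral(1))
  have b: "BO R 2 (\<lambda>\<sigma> x. ?u \<sigma> x - 4 * s0 \<sigma> / x)"
    "BO R 2 (\<lambda>\<sigma> x. ?v \<sigma> x - 4 * t0 \<sigma> / x)"
    using bracket_refined[OF k, of Fm Fp] bracket_refined[OF k, of Gp Gm] by (simp_all del: zz.simps)
  have d: "((\<lambda>x. c \<sigma> * (1 / x ^ 2)) has_field_derivative - 2 * c \<sigma> * (1 / x ^ 3)) (at x)" if "x \<in> S R0" for \<sigma> x
    using S_nonzero[OF that] by (auto intro!: derivative_eq_intros simp: field_simps power2_eq_square power3_eq_cube)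
  have "BO R (if (0::int) = 0 then 4 - 1 else 4) (\<lambda>\<sigma> x. L 0 (rhs ?K ?z Ph 0) \<sigma> x - c \<sigma> * (1 / x ^ 2))"
  proof (rule L_leading[OF R(1) adm_rhs_zz d])
    show "Asy R0 (if (0::int) = 0 then 1 else 0) (\<lambda>\<sigma> x. c \<sigma> * (1 / x ^ 2))"
      by (rule Asy_mono[OF Asy_cmult[OF order_refl cP Asy_inverse_power[OF order_refl]]]) simp
    have "(\<lambda>\<sigma>. - 2 * c \<sigma>) \<in> PQ" by (intro PQ_mult cP PQ_minus PQ_numeral(1))
    then show "Asy R0 (if (0::int) = 0 then 2 else 0) (\<lambda>\<sigma> x. - 2 * c \<sigma> * (1 / x ^ 3))"
      by (intro Asy_mono[OF Asy_cmult[OF order_refl _ Asy_inverse_power[OF order_refl]]]) auto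
    have "BO R 4 (\<lambda>\<sigma> x. (rhs ?K ?z Ph 0 \<sigma> x
      - (kapx \<sigma> * ((?u \<sigma> x) / x ^ 2)
       + kap0 \<sigma> * ((?v \<sigma> x) / x ^ 2)))
      + (kapx \<sigma> * ((?u \<sigma> x - 4 * s0 \<sigma> / x) / x ^ 2)
       + kap0 \<sigma> * ((?v \<sigma> x - 4 * t0 \<sigma> / x) / x ^ 2)))"
      using BO_divide[OF b(1), of 2] BO_divide[OF b(2), of 2] rhs_Ph_0[OF k, of ?z 0]
      by (intro BO_add BO_cmult PQ_params) (simp_all del: zz.simps KK.simps)
    then show "BO R 4 (\<lambda>\<sigma> x. rhs ?K ?z Ph 0 \<sigma> x - (- 2 * c \<sigma> * (1 / x ^ 3) + (of_int 0 + (of_int 0 * \<sigma> - of_int \<bar>0\<bar>) / x) * (c \<sigma> * (1 / x ^ 2))))"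
    proof (rule BO_cong)
      fix \<sigma> x assume "x \<in> S R"
      then have x0: "x \<noteq> 0" by (rule S_nonzero)
      define u v where "u = ?z Gp 0 \<sigma> x * ?z Fm (-1) \<sigma> x - ?z Gm 0 \<sigma> x * ?z Fp 1 \<sigma> x"
        and "v = ?z Fm 0 \<sigma> x * ?z Gp (-1) \<sigma> x - ?z Fp 0 \<sigma> x * ?z Gm 1 \<sigma> x"
      note fd = this
      show "rhs ?K ?z Ph 0 \<sigma> x - (- 2 * c \<sigma> * (1 / x ^ 3) + (of_int 0 + (of_int 0 * \<sigma> - of_int \<bar>0\<bar>) / x) * (c \<sigma> * (1 / x ^ 2)))
       = (rhs ?K ?z Ph 0 \<sigma> x
      - (kapx \<sigma> * ((?u \<sigma> x) / x ^ 2)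
       + kap0 \<sigma> * ((?v \<sigma> x) / x ^ 2)))
      + (kapx \<sigma> * ((?u \<sigma> x - 4 * s0 \<sigma> / x) / x ^ 2)
       + kap0 \<sigma> * ((?v \<sigma> x - 4 * t0 \<sigma> / x) / x ^ 2))"
        unfolding fd[symmetric] using x0 by (simp add: c_def field_simps power2_eq_square power3_eq_cube)
    qed
  qed simp_all
  then have "BO R 3 (\<lambda>\<sigma> x. zl Ph 0 \<sigma> x - c \<sigma> * (1 / x ^ 2))"
    using zl_BO_of_L(1)[OF k, where e = 3 and q = Ph and n = 0 and i = 0 and y = "\<lambda>\<sigma> x. c \<sigma> * (1 / x ^ 2)"] by (simp add: init_def del: zz.simps KK.simps)
  then obtain B where B: "\<And>\<sigma> x. \<sigma> \<in> Bs \<Longrightarrow> x \<in> S R \<Longrightarrow> norm (zl Ph 0 \<sigma> x - c \<sigma> / x ^ 2) \<le> B / norm x ^ 3"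
    unfolding BO_def by auto
  obtain B2 where B2: "\<And>\<sigma> x. \<sigma> \<in> Bs \<Longrightarrow> x \<in> S R \<Longrightarrow> norm (zl Ph 0 \<sigma> x) \<le> B2 / norm x ^ 2"
    using zl_Ph_0_rough(1)[OF k] unfolding BO_def by blast
  \<comment> \<open>The expansion is only known to start at order 1, so two rounds are needed: the
    first shows that the coefficient of 1/x is 0, the second (\<open>A2\<close>) splits off that of
    x^-2.\<close>
  have A1: "Asy R 1 (\<lambda>\<sigma> x. x ^ 1 * zl Ph 0 \<sigma> x - 0)"
  proof (rule Asy_remainder[OF R(1), where e = 1 and C = B2])
    show "Asy R 1 (zl Ph 0)" using Asy_zl[OF k, of Ph 0] by (simp add: ordk_def oP_def)
    show "norm (zl Ph 0 \<sigma> x - 0 / x ^ 1) \<le> B2 * norm x powr (- real 1 - 1)" if "\<sigma> \<in> Bs" "x \<in> S R" for \<sigma> x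
      using B2[OF that] powr_neg_nat[OF that(2), of 2] by simp
  qed simp
  have A2: "Asy R 1 (\<lambda>\<sigma> x. x ^ 1 * (x * zl Ph 0 \<sigma> x) - c \<sigma>)"
  proof (rule Asy_remainder[OF R(1), where e = 1 and C = B])
    show "Asy R 1 (\<lambda>\<sigma> x. x * zl Ph 0 \<sigma> x)" using A1 by simp
    show "norm (x * zl Ph 0 \<sigma> x - c \<sigma> / x ^ 1) \<le> B * norm x powr (- real 1 - 1)" if "\<sigma> \<in> Bs" "x \<in> S R" for \<sigma> x
    proof -
      have x0: "x \<noteq> 0" using S_nonzero[OF that(2)] .
      then have "x * zl Ph 0 \<sigma> x - c \<sigma> / x ^ 1 = x * (zl Ph 0 \<sigma> x - c \<sigma> / x ^ 2)"
        by (simp add: field_simps power2_eq_square)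
      then have "norm (x * zl Ph 0 \<sigma> x - c \<sigma> / x ^ 1) \<le> norm x * (B / norm x ^ 3)"
        using mult_left_mono[OF B[OF that], of "norm x"] by (simp add: norm_mult)
      also have "\<dots> = B / norm x ^ 2" using x0 by (simp add: field_simps power2_eq_square power3_eq_cube)
      finally show ?thesis using powr_neg_nat[OF that(2), of 2] by simp
    qed
  qed simp
  from Asy_mult[OF R(1) A2 Asy_inverse_power[OF R(1), of 2]]
  have A3: "Asy R 3 (\<lambda>\<sigma> x. (x ^ 1 * (x * zl Ph 0 \<sigma> x) - c \<sigma>) * (1 / x ^ 2))" by (simp add: numeral_3_eq_3)
  show ?thesis
    by (rule Asy_cong[OF A3]) (use S_nonzero in \<open>auto simp: c_def field_simps power2_eq_square\<close>)
qed

end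

section \<open>The solutions\<close>

definition mp :: "complex \<Rightarrow> complex \<Rightarrow> int \<Rightarrow> complex" where
  "mp A a p = (if 0 \<le> p then A ^ nat p else a ^ nat (- p))"

lemma mp_mult: "mp A a p * mp A a q = (A * a) ^ mm p q * mp A a (p + q)"
proof -
  have *: "mp A a p * mp A a q = (A * a) ^ mm p q * mp A a (p + q)" if p: "0 \<le> p" and q: "q < 0" for p q
  proof (cases "0 \<le> p + q")
    case True
    then have "nat p = nat (- q) + nat (p + q)" "mm p q = nat (- q)" using p q by (auto simp: mm_def abs_if)
    then show ?thesis using True p q by (simp add: mp_def power_add power_mult_distrib)
  next
    case False
    then have "nat (- q) = nat p + nat (- (p + q))" "mm p q = nat p" using p q by (auto simp: mm_def abs_if)
    then show ?thesis using False p q by (simp add: mp_def power_add power_mult_distrib)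
  qed
  have sym: "mm p q = mm q p" by (simp add: mm_def add.commute)
  consider "0 \<le> p" "0 \<le> q" | "0 \<le> p" "q < 0" | "p < 0" "0 \<le> q" | "p < 0" "q < 0" by linarith
  then show ?thesis
  proof cases
    case 1 then show ?thesis by (simp add: mp_def mm_def power_add nat_add_distrib)
  next
    case 2 then show ?thesis by (rule *)
  next
    case 3 then show ?thesis using *[of q p] by (simp add: sym ac_simps)
  next
    case 4
    then have "nat (- (p + q)) = nat (- p) + nat (- q)" "mm p q = 0" by (auto simp: mm_def)
    then show ?thesis using 4 by (simp add: mp_def power_add)
  qed
qed

lemma norm_mp_le:
  assumes "norm A \<le> G" "norm a \<le> G" "1 \<le> G" "\<bar>p\<bar> \<le> int m" shows "norm (mp A a p) \<le> G ^ m"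
proof -
  have "norm (mp A a p) \<le> G ^ nat \<bar>p\<bar>"
    using assms by (auto simp: mp_def norm_power intro!: power_mono)
  also have "\<dots> \<le> G ^ m" using assms by (intro power_increasing) auto
  finally show ?thesis .
qed

section \<open>Holomorphic functions of four variables\<close>

lemma holomorphic4_on_mult:
  assumes "holomorphic4_on f S" "holomorphic4_on g S"
  shows "holomorphic4_on (\<lambda>a b c d. f a b c d * g a b c d) S"
  unfolding holomorphic4_on_def
proof
  fix p assume "p \<in> S"
  then obtain a1 a2 a3 a4 b1 b2 b3 b4 where
    d: "((\<lambda>(c0, cx, \<sigma>, x). f c0 cx \<sigma> x) has_derivative (\<lambda>(h1, h2, h3, h4). a1 * h1 + a2 * h2 + a3 * h3 + a4 * h4)) (at p)"
    "((\<lambda>(c0, cx, \<sigma>, x). g c0 cx \<sigma> x) has_derivative (\<lambda>(h1, h2, h3, h4). b1 * h1 + b2 * h2 + b3 * h3 + b4 * h4)) (at p)"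
    using assms unfolding holomorphic4_on_def by meson
  obtain a b c e where p: "p = (a, b, c, e)" using prod_cases4 by blast
  have "((\<lambda>(c0, cx, \<sigma>, x). f c0 cx \<sigma> x * g c0 cx \<sigma> x) has_derivative
     (\<lambda>(h1, h2, h3, h4). (f a b c e * b1 + a1 * g a b c e) * h1 + (f a b c e * b2 + a2 * g a b c e) * h2
       + (f a b c e * b3 + a3 * g a b c e) * h3 + (f a b c e * b4 + a4 * g a b c e) * h4)) (at p)"
    using has_derivative_mult[OF d] unfolding case_prod_unfold p by (simp add: algebra_simps)
  then show "\<exists>a1 a2 a3 a4. ((\<lambda>(c0, cx, \<sigma>, x). f c0 cx \<sigma> x * g c0 cx \<sigma> x) has_derivative
      (\<lambda>(h1, h2, h3, h4). a1 * h1 + a2 * h2 + a3 * h3 + a4 * h4)) (at p)" by blast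
qed

lemma holomorphic4_on_add:
  assumes "holomorphic4_on f S" "holomorphic4_on g S"
  shows "holomorphic4_on (\<lambda>a b c d. f a b c d + g a b c d) S"
  unfolding holomorphic4_on_def
proof
  fix p assume "p \<in> S"
  then obtain a1 a2 a3 a4 b1 b2 b3 b4 where
    d: "((\<lambda>(c0, cx, \<sigma>, x). f c0 cx \<sigma> x) has_derivative (\<lambda>(h1, h2, h3, h4). a1 * h1 + a2 * h2 + a3 * h3 + a4 * h4)) (at p)"
    "((\<lambda>(c0, cx, \<sigma>, x). g c0 cx \<sigma> x) has_derivative (\<lambda>(h1, h2, h3, h4). b1 * h1 + b2 * h2 + b3 * h3 + b4 * h4)) (at p)"
    using assms unfolding holomorphic4_on_def by meson
  have "((\<lambda>(c0, cx, \<sigma>, x). f c0 cx \<sigma> x + g c0 cx \<sigma> x) has_derivative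
     (\<lambda>(h1, h2, h3, h4). (a1 + b1) * h1 + (a2 + b2) * h2 + (a3 + b3) * h3 + (a4 + b4) * h4)) (at p)"
    using has_derivative_add[OF d] unfolding case_prod_unfold by (simp add: algebra_simps)
  then show "\<exists>a1 a2 a3 a4. ((\<lambda>(c0, cx, \<sigma>, x). f c0 cx \<sigma> x + g c0 cx \<sigma> x) has_derivative
      (\<lambda>(h1, h2, h3, h4). a1 * h1 + a2 * h2 + a3 * h3 + a4 * h4)) (at p)" by blast
qed

lemma holomorphic4_on_const: "holomorphic4_on (\<lambda>a b c d. z) S"
  unfolding holomorphic4_on_def
  by (intro ballI exI[of _ 0]) (simp add: case_prod_unfold)

lemma holomorphic4_on_sum:
  "(\<And>i. i \<in> I \<Longrightarrow> holomorphic4_on (f i) S) \<Longrightarrow> holomorphic4_on (\<lambda>a b c d. \<Sum>i\<in>I. f i a b c d) S"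
  by (induction I rule: infinite_finite_induct) (auto intro: holomorphic4_on_add holomorphic4_on_const)

lemma holomorphic4_on_power:
  "holomorphic4_on f S \<Longrightarrow> holomorphic4_on (\<lambda>a b c d. f a b c d ^ n) S"
  by (induction n) (auto intro: holomorphic4_on_mult holomorphic4_on_const)

lemma holomorphic4_on_mp:
  "holomorphic4_on f S \<Longrightarrow> holomorphic4_on g S \<Longrightarrow> holomorphic4_on (\<lambda>a b c d. mp (f a b c d) (g a b c d) p) S"
  by (cases "0 \<le> p") (auto simp: mp_def intro: holomorphic4_on_power)

lemma holomorphic4_on_continuous:
  assumes "holomorphic4_on f S" shows "continuous_on S (\<lambda>(a, b, c, d). f a b c d)"
  using assms unfolding holomorphic4_on_def
  by (intro continuous_at_imp_continuous_on ballI) (meson has_derivative_continuous)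

lemma holomorphic4_on_slices:
  assumes f: "holomorphic4_on f S" and p: "(a, b, c, d) \<in> S"
  shows "(\<lambda>a. f a b c d) field_differentiable (at a)" "(\<lambda>b. f a b c d) field_differentiable (at b)"
    "(\<lambda>c. f a b c d) field_differentiable (at c)" "(\<lambda>d. f a b c d) field_differentiable (at d)"
proof -
  obtain a1 a2 a3 a4 where
    D: "((\<lambda>(c0, cx, \<sigma>, x). f c0 cx \<sigma> x) has_derivative (\<lambda>(h1, h2, h3, h4). a1 * h1 + a2 * h2 + a3 * h3 + a4 * h4)) (at (a, b, c, d))"
    using f p unfolding holomorphic4_on_def by meson
  have *: "(\<lambda>t. (\<lambda>(c0, cx, \<sigma>, x). f c0 cx \<sigma> x) (g t)) field_differentiable (at t)"
    if g: "(g has_derivative g') (at t)" "g t = (a, b, c, d)" "(\<lambda>(h1, h2, h3, h4). a1 * h1 + a2 * h2 + a3 * h3 + a4 * h4) \<circ> g' = (*) m" for g g' t m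
    using has_derivative_compose[OF g(1), of "\<lambda>(c0, cx, \<sigma>, x). f c0 cx \<sigma> x" "\<lambda>(h1, h2, h3, h4). a1 * h1 + a2 * h2 + a3 * h3 + a4 * h4"] D g(2,3)
    unfolding field_differentiable_def has_field_derivative_def comp_def by auto
  show "(\<lambda>a. f a b c d) field_differentiable (at a)"
  proof -
    have "((\<lambda>t. (t, b, c, d)) has_derivative (\<lambda>h. (h, 0, 0, 0))) (at a)"
      by (intro has_derivative_Pair has_derivative_ident has_derivative_const)
    from *[OF this, of a1] show ?thesis by (simp add: comp_def)
  qed
  show "(\<lambda>b. f a b c d) field_differentiable (at b)"
  proof -
    have "((\<lambda>t. (a, t, c, d)) has_derivative (\<lambda>h. (0, h, 0, 0))) (at b)"
      by (intro has_derivative_Pair has_derivative_ident has_derivative_const)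
    from *[OF this, of a2] show ?thesis by (simp add: comp_def)
  qed
  show "(\<lambda>c. f a b c d) field_differentiable (at c)"
  proof -
    have "((\<lambda>t. (a, b, t, d)) has_derivative (\<lambda>h. (0, 0, h, 0))) (at c)"
      by (intro has_derivative_Pair has_derivative_ident has_derivative_const)
    from *[OF this, of a3] show ?thesis by (simp add: comp_def)
  qed
  show "(\<lambda>d. f a b c d) field_differentiable (at d)"
  proof -
    have "((\<lambda>t. (a, b, c, t)) has_derivative (\<lambda>h. (0, 0, 0, h))) (at d)"
      by (intro has_derivative_Pair has_derivative_ident has_derivative_const)
    from *[OF this, of a4] show ?thesis by (simp add: comp_def)
  qed
qed

lemma field_differentiable_uniform_limit:
  fixes f :: "nat \<Rightarrow> complex \<Rightarrow> complex"
  assumes S: "open S" and f: "\<And>N z. z \<in> S \<Longrightarrow> f N field_differentiable (at z)"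
    and u: "uniform_limit S f g sequentially" and z: "z \<in> S"
  shows "g field_differentiable (at z)"
proof -
  have "g holomorphic_on S"
  proof (rule holomorphic_uniform_sequence[OF S])
    show "f N holomorphic_on S" for N unfolding holomorphic_on_def using f field_differentiable_at_within by blast
    fix w assume "w \<in> S"
    then obtain d where "d > 0" "cball w d \<subseteq> S" using S open_contains_cball by blast
    then show "\<exists>d>0. cball w d \<subseteq> S \<and> uniform_limit (cball w d) f g sequentially"
      using uniform_limit_on_subset[OF u] by blast
  qed
  then show ?thesis using S z holomorphic_on_imp_differentiable_at by blast
qed

text \<open>Weierstrass's theorem on each coordinate line together with continuity of the limit;
  Osgood's lemma assembles the lines.\<close>

lemma holomorphic4_on_uniform_limit:
  assumes S: "open S" and f: "\<And>N. holomorphic4_on (f N) S"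
    and u: "uniform_limit S (\<lambda>N (a, b, c, d). f N a b c d) (\<lambda>(a, b, c, d). g a b c d) sequentially"
  shows "holomorphic4_on g S"
proof (rule holomorphic4_onI[OF S])
  show "continuous_on S (\<lambda>(a, b, c, d). g a b c d)"
    by (rule uniform_limit_theorem[OF _ u]) (auto intro!: always_eventually holomorphic4_on_continuous f)
  have pre: "open {t. h t \<in> S}" "uniform_limit {t. h t \<in> S} (\<lambda>N t. (\<lambda>(a, b, c, d). f N a b c d) (h t)) (\<lambda>t. (\<lambda>(a, b, c, d). g a b c d) (h t)) sequentially"
    if "continuous_on UNIV h" for h :: "complex \<Rightarrow> complex \<times> complex \<times> complex \<times> complex"
  proof -
    have "{t. h t \<in> S} = h -` S" by auto
    then show "open {t. h t \<in> S}" using open_vimage[OF S that] by simp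
    show "uniform_limit {t. h t \<in> S} (\<lambda>N t. (\<lambda>(a, b, c, d). f N a b c d) (h t)) (\<lambda>t. (\<lambda>(a, b, c, d). g a b c d) (h t)) sequentially"
      by (rule uniform_limit_compose'[OF u]) auto
  qed
  fix a b c d assume p: "(a, b, c, d) \<in> S"
  have 1: "continuous_on UNIV (\<lambda>t. (t, b, c, d))" "continuous_on UNIV (\<lambda>t. (a, t, c, d))"
    "continuous_on UNIV (\<lambda>t. (a, b, t, d))" "continuous_on UNIV (\<lambda>t. (a, b, c, t))"
    by (intro continuous_intros)+
  show "(\<lambda>a. g a b c d) field_differentiable (at a)"
    by (rule field_differentiable_uniform_limit[OF pre(1)[OF 1(1)] _ pre(2)[OF 1(1), simplified]])
      (use p holomorphic4_on_slices(1)[OF f] in auto)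
  show "(\<lambda>b. g a b c d) field_differentiable (at b)"
    by (rule field_differentiable_uniform_limit[OF pre(1)[OF 1(2)] _ pre(2)[OF 1(2), simplified]])
      (use p holomorphic4_on_slices(2)[OF f] in auto)
  show "(\<lambda>c. g a b c d) field_differentiable (at c)"
    by (rule field_differentiable_uniform_limit[OF pre(1)[OF 1(3)] _ pre(2)[OF 1(3), simplified]])
      (use p holomorphic4_on_slices(3)[OF f] in auto)
  show "(\<lambda>d. g a b c d) field_differentiable (at d)"
    by (rule field_differentiable_uniform_limit[OF pre(1)[OF 1(4)] _ pre(2)[OF 1(4), simplified]])
      (use p holomorphic4_on_slices(4)[OF f] in auto)
qed

section \<open>Monomials in the \<gamma>s and the exponentials\<close>

context sectorial
begin

lemma E_mult3:
  assumes "x \<in> S R"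
  shows "E s \<sigma> x * E i \<sigma> x * E j \<sigma> x = E (s + i + j) \<sigma> x / x ^ (2 * m3 s i j)"
proof -
  have x0: "x \<noteq> 0" using S_nonzero[OF assms] .
  have m: "(of_int \<bar>s\<bar> + of_int \<bar>i\<bar> + of_int \<bar>j\<bar> :: complex) = of_int \<bar>s + i + j\<bar> + of_nat (2 * m3 s i j)"
  proof -
    have "\<bar>s\<bar> + \<bar>i\<bar> + \<bar>j\<bar> = \<bar>s + i + j\<bar> + int (2 * m3 s i j)" using m3_eq[of s i j] by simp
    from arg_cong[OF this, of "of_int :: int \<Rightarrow> complex"] show ?thesis by (simp only: of_int_add of_int_of_nat_eq)
  qed
  have "x ^ (2 * m3 s i j) = exp (of_nat (2 * m3 s i j) * Ln x)"
    by (simp only: exp_of_nat_mult exp_Ln[OF x0])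
  then have "E (s + i + j) \<sigma> x / x ^ (2 * m3 s i j)
    = exp (of_int (s + i + j) * x + (of_int (s + i + j) * \<sigma> - of_int \<bar>s + i + j\<bar>) * Ln x - of_nat (2 * m3 s i j) * Ln x)"
    by (simp only: E_def exp_diff)
  also have "\<dots> = exp (of_int (s + i + j) * x + (of_int (s + i + j) * \<sigma> - (of_int \<bar>s + i + j\<bar> + of_nat (2 * m3 s i j))) * Ln x)"
    by (simp add: algebra_simps)
  also have "\<dots> = exp ((of_int s * x + (of_int s * \<sigma> - of_int \<bar>s\<bar>) * Ln x) + (of_int i * x + (of_int i * \<sigma> - of_int \<bar>i\<bar>) * Ln x) + (of_int j * x + (of_int j * \<sigma> - of_int \<bar>j\<bar>) * Ln x))"
    unfolding m[symmetric] by (simp add: algebra_simps)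
  finally show ?thesis by (simp only: E_def exp_add)
qed

lemma E_power: "E (int m) \<sigma> x = E 1 \<sigma> x ^ m" "E (- int m) \<sigma> x = E (- 1) \<sigma> x ^ m"
  by (auto simp: E_def exp_of_nat_mult[symmetric] algebra_simps)

lemma norm_E_le:
  assumes "norm (E 1 \<sigma> x) \<le> \<eta>" "norm (E (- 1) \<sigma> x) \<le> \<eta>" shows "norm (E n \<sigma> x) \<le> \<eta> ^ nat \<bar>n\<bar>"
proof (cases "0 \<le> n")
  case True
  then have "E n \<sigma> x = E 1 \<sigma> x ^ nat \<bar>n\<bar>" using E_power(1)[of "nat n"] by simp
  then show ?thesis using assms by (simp add: norm_power power_mono)
next
  case False
  then have "E n \<sigma> x = E (- 1) \<sigma> x ^ nat \<bar>n\<bar>" using E_power(2)[of "nat (- n)"] by simp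
  then show ?thesis using assms by (simp add: norm_power power_mono)
qed

definition ee :: "complex \<Rightarrow> complex \<Rightarrow> complex \<Rightarrow> complex \<Rightarrow> kind \<Rightarrow> int \<Rightarrow> complex \<Rightarrow> complex \<Rightarrow> complex" where
  "ee A a B b q n \<sigma> x = mp A a (al q - n) * mp B b (be q + n) * E n \<sigma> x"

text \<open>The exponents of the \<gamma>s are at most |n| + 1 in modulus, which gives G^(2 |n| +
  2). Hence \<eta> = 1 / G^2 is a radius at which all monomials stay below G^2.\<close>

lemma norm_ee_le:
  assumes g: "norm A \<le> G" "norm a \<le> G" "norm B \<le> G" "norm b \<le> G" "1 \<le> G"
    and E: "norm (E 1 \<sigma> x) \<le> \<eta>" "norm (E (- 1) \<sigma> x) \<le> \<eta>"
  shows "norm (ee A a B b q n \<sigma> x) \<le> G\<^sup>2 * (G\<^sup>2 * \<eta>) ^ nat \<bar>n\<bar>"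
proof -
  have e: "0 \<le> \<eta>" using E(1) norm_ge_zero order_trans by blast
  have "norm (ee A a B b q n \<sigma> x) \<le> G ^ (nat \<bar>n\<bar> + 1) * G ^ (nat \<bar>n\<bar> + 1) * \<eta> ^ nat \<bar>n\<bar>"
    unfolding ee_def norm_mult using al_be_le[of q] e g
    by (intro mult_mono norm_mp_le norm_E_le[OF E]) auto
  then show ?thesis by (simp add: power_mult_distrib power2_eq_square algebra_simps)
qed

end

text \<open>The parameters are frozen, A, a, B, b being the four \<gamma>s; only their two products
  and the common bound G matter. The condition on R makes points with |X| = |Y| = 1/|x| admissible
  beyond R.\<close>

locale pt = painleve +
  fixes A a B b \<sigma> :: complex and G R M D C :: real
  assumes sigma: "\<sigma> \<in> Bs" and Aa: "A * a = kap0 \<sigma>" and Bb: "B * b = kapx \<sigma>"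
    and bounds: "norm A \<le> G" "norm a \<le> G" "norm B \<le> G" "norm b \<le> G" and G1: "1 \<le> G"
    and key: "key R M D C" and RG: "G\<^sup>2 \<le> R"
begin

abbreviation e :: "kind \<Rightarrow> int \<Rightarrow> complex \<Rightarrow> complex" where "e q n x \<equiv> ee A a B b q n \<sigma> x"

definition U :: "complex set" where
  "U = {x \<in> S R. norm (E 1 \<sigma> x) < 1 / G\<^sup>2 \<and> norm (E (-1) \<sigma> x) < 1 / G\<^sup>2}"

lemma open_U: "open U"
proof -
  have "open {x \<in> S R. norm (E n \<sigma> x) < 1 / G\<^sup>2}" for n
  proof -
    have "continuous_on (S R) (\<lambda>x. norm (E n \<sigma> x))"
      by (intro continuous_on_norm holomorphic_on_imp_continuous_on E_holomorphic)
    from open_Collect_less[OF _ _] continuous_on_open_vimage[OF open_S] have "open ((\<lambda>x. norm (E n \<sigma> x)) -` {..<1 / G\<^sup>2} \<inter> S R)"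
      using \<open>continuous_on (S R) (\<lambda>x. norm (E n \<sigma> x))\<close> by (metis open_lessThan continuous_on_open_vimage[OF open_S])
    moreover have "{x \<in> S R. norm (E n \<sigma> x) < 1 / G\<^sup>2} = (\<lambda>x. norm (E n \<sigma> x)) -` {..<1 / G\<^sup>2} \<inter> S R" by auto
    ultimately show ?thesis by simp
  qed
  moreover have "U = {x \<in> S R. norm (E 1 \<sigma> x) < 1 / G\<^sup>2} \<inter> {x \<in> S R. norm (E (-1) \<sigma> x) < 1 / G\<^sup>2}" by (auto simp: U_def)
  ultimately show ?thesis by auto
qed

lemma U_S: "x \<in> U \<Longrightarrow> x \<in> S R"
  by (simp add: U_def)

lemma S_R0: "x \<in> S R \<Longrightarrow> x \<in> S R0"
  using S_antimono[OF key_R(1)[OF key]] by blast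

lemma norm_e_le: assumes "x \<in> U" shows "norm (e q n x) \<le> G\<^sup>2"
proof -
  have "norm (e q n x) \<le> G\<^sup>2 * (G\<^sup>2 * (1 / G\<^sup>2)) ^ nat \<bar>n\<bar>"
    using assms by (intro norm_ee_le bounds G1) (auto simp: U_def)
  then show ?thesis using G1 by simp
qed

text \<open>The structure constants were made for this: summation over n turns \<open>T\<close> into
  the product of the sums. The equations for \<open>al\<close> and \<open>be\<close> express that
  the exponents of the \<gamma>s are additive, \<open>E s\<close> counting as one more
  factor.\<close>

lemma T_eval:
  assumes s: "\<bar>s\<bar> \<le> 1" and K: "0 \<le> K" and q: "al q = al k1 + al k2 + s" "be q = be k1 + be k2 - s" and x: "x \<in> S R"
  shows "(\<Sum>n\<in>{-(2 * K + 1)..2 * K + 1}. T K s k1 k2 u v n \<sigma> x * e q n x)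
    = E s \<sigma> x * (\<Sum>i\<in>{-K..K}. u i \<sigma> x * e k1 i x) * (\<Sum>j\<in>{-K..K}. v j \<sigma> x * e k2 j x)"
proof -
  let ?W = "{-(2 * K + 1)..2 * K + 1}" and ?I = "{-K..K}"
  have cc: "cc k1 k2 s i j \<sigma> x * e q (s + i + j) x = E s \<sigma> x * e k1 i x * e k2 j x" for i j
  proof -
    have "E s \<sigma> x * e k1 i x * e k2 j x = (mp A a (al k1 - i) * mp A a (al k2 - j)) * (mp B b (be k1 + i) * mp B b (be k2 + j))
        * (E s \<sigma> x * E i \<sigma> x * E j \<sigma> x)"
      by (simp add: ee_def)
    also have "\<dots> = cc k1 k2 s i j \<sigma> x * (mp A a (al k1 - i + (al k2 - j)) * mp B b (be k1 + i + (be k2 + j)) * E (s + i + j) \<sigma> x)"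
      unfolding mp_mult E_mult3[OF x] Aa Bb cc_def by simp
    finally have m: "E s \<sigma> x * e k1 i x * e k2 j x = cc k1 k2 s i j \<sigma> x * (mp A a (al k1 - i + (al k2 - j)) * mp B b (be k1 + i + (be k2 + j)) * E (s + i + j) \<sigma> x)" .
    have e1: "al k1 - i + (al k2 - j) = al q - (s + i + j)" and e2: "be k1 + i + (be k2 + j) = be q + (s + i + j)" using q by auto
    show ?thesis using m unfolding e1 e2 by (simp only: ee_def[of A a B b q])
  qed
  have "(\<Sum>n\<in>?W. T K s k1 k2 u v n \<sigma> x * e q n x)
    = (\<Sum>n\<in>?W. \<Sum>i\<in>?I. \<Sum>j\<in>?I. if s + i + j = n then cc k1 k2 s i j \<sigma> x * u i \<sigma> x * v j \<sigma> x * e q n x else 0)"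
    unfolding T_def sum_distrib_right by (intro sum.cong refl) auto
  also have "\<dots> = (\<Sum>i\<in>?I. \<Sum>j\<in>?I. \<Sum>n\<in>?W. if s + i + j = n then cc k1 k2 s i j \<sigma> x * u i \<sigma> x * v j \<sigma> x * e q n x else 0)"
    by (subst sum.swap, rule sum.cong[OF refl], rule sum.swap)
  also have "\<dots> = (\<Sum>i\<in>?I. \<Sum>j\<in>?I. E s \<sigma> x * (u i \<sigma> x * e k1 i x) * (v j \<sigma> x * e k2 j x))"
  proof (intro sum.cong refl)
    fix i j assume "i \<in> ?I" "j \<in> ?I"
    then have "s + i + j \<in> ?W" using s by auto
    then have "(\<Sum>n\<in>?W. if s + i + j = n then cc k1 k2 s i j \<sigma> x * u i \<sigma> x * v j \<sigma> x * e q n x else 0)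
      = cc k1 k2 s i j \<sigma> x * u i \<sigma> x * v j \<sigma> x * e q (s + i + j) x" by (simp add: sum.delta)
    also have "\<dots> = (cc k1 k2 s i j \<sigma> x * e q (s + i + j) x) * u i \<sigma> x * v j \<sigma> x" by (simp only: ac_simps)
    also have "\<dots> = E s \<sigma> x * (u i \<sigma> x * e k1 i x) * (v j \<sigma> x * e k2 j x)" unfolding cc by (simp only: ac_simps)
    finally show "(\<Sum>n\<in>?W. if s + i + j = n then cc k1 k2 s i j \<sigma> x * u i \<sigma> x * v j \<sigma> x * e q n x else 0)
      = E s \<sigma> x * (u i \<sigma> x * e k1 i x) * (v j \<sigma> x * e k2 j x)" .
  qed
  also have "\<dots> = E s \<sigma> x * (\<Sum>i\<in>?I. u i \<sigma> x * e k1 i x) * (\<Sum>j\<in>?I. v j \<sigma> x * e k2 j x)"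
    by (simp only: mult.assoc sum_product) (simp only: sum_distrib_left ac_simps)
  finally show ?thesis .
qed

definition ev :: "kind \<Rightarrow> nat \<Rightarrow> complex \<Rightarrow> complex" where
  "ev q N x = (\<Sum>n\<in>{-KK N..KK N}. zz N q n \<sigma> x * e q n x)"

definition FR :: "(kind \<Rightarrow> complex) \<Rightarrow> kind \<Rightarrow> complex \<Rightarrow> complex" where
  "FR y q x = (if q = Ph then E 1 \<sigma> x * y Gp * y Fm - E (-1) \<sigma> x * y Gm * y Fp
     else - 2 * of_int (sg q) * (y Ph * y q / x + E (sg q) \<sigma> x * (y Ph + tau q \<sigma>) * y (bar q)))"

lemma rhs_eval:
  assumes x: "x \<in> S R"
  shows "(\<Sum>n\<in>{-KK (Suc N)..KK (Suc N)}. rhs (KK N) (zz N) q n \<sigma> x * e q n x) = FR (\<lambda>q. ev q N x) q x"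
proof -
  have K: "0 \<le> KK N" using KK_ge[of N] by simp
  note te = T_eval[OF _ K _ _ x]
  show ?thesis
  proof (cases "q = Ph")
    case True
    have "(\<Sum>n\<in>{-KK (Suc N)..KK (Suc N)}. rhs (KK N) (zz N) q n \<sigma> x * e q n x)
      = (\<Sum>n\<in>{-KK (Suc N)..KK (Suc N)}. T (KK N) 1 Gp Fm (zz N Gp) (zz N Fm) n \<sigma> x * e Ph n x)
       - (\<Sum>n\<in>{-KK (Suc N)..KK (Suc N)}. T (KK N) (-1) Gm Fp (zz N Gm) (zz N Fp) n \<sigma> x * e Ph n x)"
      using True by (simp add: rhs_def left_diff_distrib sum_subtractf)
    then show ?thesis using True te[of 1 Ph Gp Fm "zz N Gp" "zz N Fm"] te[of "-1" Ph Gm Fp "zz N Gm" "zz N Fp"]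
      by (simp add: FR_def ev_def)
  next
    case False
    have K0: "(0::int) \<in> {-KK N..KK N}" using K by simp
    have "(\<Sum>i\<in>{-KK N..KK N}. fs q (zz N) i \<sigma> x * e Ph i x) = ev Ph N x + (\<Sum>i\<in>{-KK N..KK N}. if i = 0 then tau q \<sigma> * e Ph 0 x else 0)"
      unfolding ev_def sum.distrib[symmetric] by (intro sum.cong refl) (auto simp: fs_def distrib_right)
    also have "\<dots> = ev Ph N x + tau q \<sigma>" using K0 by (simp add: sum.delta ee_def mp_def)
    finally have f: "(\<Sum>i\<in>{-KK N..KK N}. fs q (zz N) i \<sigma> x * e Ph i x) = ev Ph N x + tau q \<sigma>" .
    have "(\<Sum>n\<in>{-KK (Suc N)..KK (Suc N)}. rhs (KK N) (zz N) q n \<sigma> x * e q n x)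
      = - 2 * of_int (sg q) * ((\<Sum>n\<in>{-KK (Suc N)..KK (Suc N)}. T (KK N) 0 Ph q (zz N Ph) (zz N q) n \<sigma> x * e q n x) / x
       + (\<Sum>n\<in>{-KK (Suc N)..KK (Suc N)}. T (KK N) (sg q) Ph (bar q) (fs q (zz N)) (zz N (bar q)) n \<sigma> x * e q n x))"
      using False unfolding sum_divide_distrib sum.distrib[symmetric] sum_distrib_left
      by (intro sum.cong refl) (simp add: rhs_def algebra_simps)
    moreover have "(\<Sum>n\<in>{-KK (Suc N)..KK (Suc N)}. T (KK N) 0 Ph q (zz N Ph) (zz N q) n \<sigma> x * e q n x) = ev Ph N x * ev q N x"
      using te[of 0 q Ph q "zz N Ph" "zz N q"] by (simp add: ev_def)
    moreover have "(\<Sum>n\<in>{-KK (Suc N)..KK (Suc N)}. T (KK N) (sg q) Ph (bar q) (fs q (zz N)) (zz N (bar q)) n \<sigma> x * e q n x)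
      = E (sg q) \<sigma> x * (ev Ph N x + tau q \<sigma>) * ev (bar q) N x"
    proof -
      have "\<bar>sg q\<bar> \<le> 1" "al q = al Ph + al (bar q) + sg q" "be q = be Ph + be (bar q) - sg q"
        using False by (cases q; simp)+
      from te[OF this, of "fs q (zz N)" "zz N (bar q)"] f show ?thesis by (simp add: ev_def)
    qed
    ultimately show ?thesis using False by (simp add: FR_def)
  qed
qed

text \<open>The derivative of the monomial cancels the zero-order part of the operator that
  \<open>L n\<close> inverts, and the constant \<open>init\<close> sits at n = 0, where this part
  vanishes. The resulting equation expresses the derivative of one iterate through the preceding
  iterate.\<close>

lemma ev_has_field_derivative:
  assumes x: "x \<in> S R"
  shows "(ev q (Suc N) has_field_derivative FR (\<lambda>q. ev q N x) q x) (at x)"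
proof -
  have "((\<lambda>x. zz (Suc N) q n \<sigma> x * e q n x) has_field_derivative rhs (KK N) (zz N) q n \<sigma> x * e q n x) (at x)" for n
  proof -
    let ?p = "of_int n + (of_int n * \<sigma> - of_int \<bar>n\<bar>) / x" and ?r = "rhs (KK N) (zz N) q n"
    have "((\<lambda>x. init q n + L n ?r \<sigma> x) has_field_derivative ?r \<sigma> x - ?p * L n ?r \<sigma> x) (at x)"
      using L_has_field_derivative[OF adm_rhs_zz sigma S_R0[OF x], of n "KK N" N q]
      by (auto intro!: derivative_eq_intros)
    moreover have "(e q n has_field_derivative e q n x * ?p) (at x)"
      unfolding ee_def [abs_def] using E_has_field_derivative[OF x, of n \<sigma>]
      by (auto intro!: derivative_eq_intros)
    ultimately have "((\<lambda>x. (init q n + L n ?r \<sigma> x) * e q n x) has_field_derivative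
      (init q n + L n ?r \<sigma> x) * (e q n x * ?p) + (?r \<sigma> x - ?p * L n ?r \<sigma> x) * e q n x) (at x)"
      by (rule DERIV_mult')
    moreover have "(init q n + L n ?r \<sigma> x) * (e q n x * ?p) + (?r \<sigma> x - ?p * L n ?r \<sigma> x) * e q n x = ?r \<sigma> x * e q n x"
      by (cases "n = 0") (simp_all add: init_def algebra_simps)
    ultimately show ?thesis by (simp add: Phi_def)
  qed
  then have "((\<lambda>x. \<Sum>n\<in>{-KK (Suc N)..KK (Suc N)}. zz (Suc N) q n \<sigma> x * e q n x) has_field_derivative
     (\<Sum>n\<in>{-KK (Suc N)..KK (Suc N)}. rhs (KK N) (zz N) q n \<sigma> x * e q n x)) (at x)"
    by (rule DERIV_sum)
  then show ?thesis unfolding rhs_eval[OF x] by (simp only: ev_def [abs_def])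
qed

end

lemma has_derivative_pnt: "((\<lambda>\<theta>. of_real \<rho> * cis \<theta>) has_derivative (\<lambda>h. of_real \<rho> * (of_real h * (\<i> * cis \<theta>)))) (at \<theta> within S)"
proof -
  have "((\<lambda>\<theta>. exp (\<i> * of_real \<theta>)) has_derivative (\<lambda>h. exp (\<i> * of_real \<theta>) * (\<i> * of_real h))) (at \<theta> within S)"
    by (rule has_derivative_compose[OF _ DERIV_exp[unfolded has_field_derivative_def], of "\<lambda>\<theta>. \<i> * of_real \<theta>", simplified])
      (auto intro!: derivative_eq_intros)
  from has_derivative_mult_right[OF this, of "of_real \<rho>"] show ?thesis by (simp add: cis_conv_exp algebra_simps)
qed

lemma sin_interval:
  assumes "0 < a" "a \<le> t" "t \<le> b" "b < pi" "k < sin a" "k < sin b" shows "k < sin t"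
proof (cases "t \<le> pi / 2")
  case True
  then have "sin a \<le> sin t" using assms by (intro sin_monotone_2pi_le) auto
  then show ?thesis using assms by simp
next
  case False
  then have "sin (pi - b) \<le> sin (pi - t)" using assms by (intro sin_monotone_2pi_le) auto
  then show ?thesis using assms by simp
qed

context painleve
begin

definition ZF :: "complex \<Rightarrow> complex \<Rightarrow> complex \<Rightarrow> complex \<Rightarrow> kind \<Rightarrow> complex \<Rightarrow> complex \<Rightarrow> complex" where
  "ZF A a B b q \<sigma> x = (\<Sum>\<^sub>\<infinity>n\<in>UNIV. zl q n \<sigma> x * ee A a B b q n \<sigma> x)"

lemma zl_sum_le:
  assumes k: "key R M D C" and \<sigma>: "\<sigma> \<in> Bs" and x: "x \<in> S R" and F: "finite F"
  shows "(\<Sum>n\<in>F. norm (zl q n \<sigma> x)) \<le> M + D"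
proof -
  have b: "bd R (KK 0) M (eV q) (zz 0 q)" using k unfolding key_def by blast
  have "(\<Sum>n\<in>F. norm (zz 0 q n \<sigma> x)) \<le> M * norm x powr (- 0)"
    by (rule bd_sum[OF b key_R(2)[OF k] F _ \<sigma> x]) (simp add: eV_def wV_def vP_def)
  then have 1: "(\<Sum>n\<in>F. norm (zz 0 q n \<sigma> x)) \<le> M" using S_nonzero[OF x] by simp
  have 2: "(\<Sum>n\<in>F. norm (zl q n \<sigma> x - zz 0 q n \<sigma> x)) \<le> D" using zl_approx_half[OF k \<sigma> x F, of q 0] by simp
  have "(\<Sum>n\<in>F. norm (zl q n \<sigma> x)) \<le> (\<Sum>n\<in>F. norm (zl q n \<sigma> x - zz 0 q n \<sigma> x) + norm (zz 0 q n \<sigma> x))"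
    by (intro sum_mono) (metis diff_add_cancel norm_triangle_ineq)
  then show ?thesis using 1 2 by (simp add: sum.distrib)
qed

end

lemma sum_norm_mult_le:
  fixes f g :: "'i \<Rightarrow> complex"
  assumes "(\<Sum>n\<in>F. norm (f n)) \<le> c" "\<And>n. n \<in> F \<Longrightarrow> norm (g n) \<le> d" "0 \<le> d"
  shows "(\<Sum>n\<in>F. norm (f n * g n)) \<le> c * d"
proof -
  have "(\<Sum>n\<in>F. norm (f n * g n)) \<le> (\<Sum>n\<in>F. norm (f n) * d)"
    using assms by (intro sum_mono) (simp add: norm_mult mult_left_mono)
  also have "\<dots> = (\<Sum>n\<in>F. norm (f n)) * d" by (simp add: sum_distrib_right)
  also have "\<dots> \<le> c * d" using assms by (intro mult_right_mono)
  finally show ?thesis .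
qed

lemma infsum_norm_le:
  fixes f :: "'i \<Rightarrow> complex"
  assumes "\<And>F. finite F \<Longrightarrow> F \<subseteq> A \<Longrightarrow> (\<Sum>n\<in>F. norm (f n)) \<le> c"
  shows "(\<lambda>x. norm (f x)) summable_on A" "norm (infsum f A) \<le> c"
proof -
  show s: "(\<lambda>x. norm (f x)) summable_on A" unfolding abs_summable_iff_bdd_above using assms by (auto intro!: bdd_aboveI2)
  have "infsum (\<lambda>x. norm (f x)) A \<le> c" by (rule infsum_le_finite_sums[OF s assms])
  then show "norm (infsum f A) \<le> c" using norm_infsum_bound[OF s] by linarith
qed

text \<open>With \<open>RH\<close> the term \<rho> / 2 dominates Re \<sigma> ln \<rho> - Im \<sigma>
  \<theta> for angles up to 3; hence every large circle carries a point where |X| = |Y|.\<close>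

locale pt' = pt +
  assumes RH: "\<And>\<rho>. R < \<rho> \<Longrightarrow> Bd * (ln \<rho> + 3) < \<rho> / 2"
begin

abbreviation y :: "kind \<Rightarrow> complex \<Rightarrow> complex" where "y q \<equiv> ZF A a B b q \<sigma>"

section \<open>The summed series, its first integrals and their values\<close>

lemma zl_e_summable:
  assumes x: "x \<in> U" shows "(\<lambda>n. norm (zl q n \<sigma> x * e q n x)) summable_on X"
  by (rule infsum_norm_le[OF sum_norm_mult_le[OF zl_sum_le[OF key sigma U_S[OF x]] norm_e_le[OF x]]]) auto

text \<open>The coefficients converge in the sum of moduli and the monomials are bounded by G^2 on
  \<open>U\<close>, so the sums converge uniformly there with a geometric rate.\<close>

lemma ZF_approx:
  assumes x: "x \<in> U" shows "norm (y q x - ev q N x) \<le> G\<^sup>2 * D * (1 / 2) ^ N"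
proof -
  let ?W = "{-KK N..KK N}"
  have z0: "zz N q n \<sigma> x = 0" if "n \<notin> ?W" for n
    using supp_zz[of N q] that unfolding supp_def by (metis abs_le_iff atLeastAtMost_iff minus_le_iff not_le)
  have ev: "((\<lambda>n. zz N q n \<sigma> x * e q n x) has_sum ev q N x) UNIV"
  proof -
    have "((\<lambda>n. zz N q n \<sigma> x * e q n x) has_sum ev q N x) ?W"
      unfolding ev_def by (rule has_sum_finite) simp
    then show ?thesis by (subst has_sum_cong_neutral[where T = ?W and g = "\<lambda>n. zz N q n \<sigma> x * e q n x"]) (auto simp: z0)
  qed
  have "((\<lambda>n. zl q n \<sigma> x * e q n x) has_sum y q x) UNIV"
    unfolding ZF_def by (rule has_sum_infsum[OF abs_summable_summable[OF zl_e_summable[OF x]]])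
  moreover have "((\<lambda>n. - (zz N q n \<sigma> x * e q n x)) has_sum - ev q N x) UNIV"
    using ev by (simp add: has_sum_uminus)
  ultimately have "((\<lambda>n. zl q n \<sigma> x * e q n x + - (zz N q n \<sigma> x * e q n x)) has_sum (y q x + - ev q N x)) UNIV"
    by (rule has_sum_add)
  then have "((\<lambda>n. (zl q n \<sigma> x - zz N q n \<sigma> x) * e q n x) has_sum (y q x - ev q N x)) UNIV"
    by (simp add: left_diff_distrib)
  then have eq: "(\<Sum>\<^sub>\<infinity>n. (zl q n \<sigma> x - zz N q n \<sigma> x) * e q n x) = y q x - ev q N x" by (rule infsumI)
  have "norm (\<Sum>\<^sub>\<infinity>n. (zl q n \<sigma> x - zz N q n \<sigma> x) * e q n x) \<le> D * (1 / 2) ^ N * G\<^sup>2"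
    by (rule infsum_norm_le(2)[OF sum_norm_mult_le[OF zl_approx_half[OF key sigma U_S[OF x]] norm_e_le[OF x]]]) auto
  then show ?thesis unfolding eq by (simp add: algebra_simps)
qed

lemma ev_uniform: "uniform_limit U (\<lambda>N. ev q (N + i)) (y q) sequentially"
proof (rule uniform_limitI)
  fix \<epsilon> :: real assume "\<epsilon> > 0"
  have "(\<lambda>N. G\<^sup>2 * D * (1 / 2) ^ N) \<longlonglongrightarrow> 0" using tendsto_mult_right_zero[OF LIMSEQ_power_zero[of "1/2::real"]] by simp
  then have "(\<lambda>N. G\<^sup>2 * D * (1 / 2) ^ (N + i)) \<longlonglongrightarrow> 0" by (rule LIMSEQ_ignore_initial_segment)
  then have "\<forall>\<^sub>F N in sequentially. G\<^sup>2 * D * (1 / 2) ^ (N + i) < \<epsilon>" using order_tendstoD(2) \<open>\<epsilon> > 0\<close> by blast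
  then show "\<forall>\<^sub>F N in sequentially. \<forall>x\<in>U. dist (ev q (N + i) x) (y q x) < \<epsilon>"
  proof eventually_elim
    case (elim N)
    show ?case
    proof
      fix x assume "x \<in> U"
      from ZF_approx[OF this, of q "N + i"] elim show "dist (ev q (N + i) x) (y q x) < \<epsilon>"
        by (simp add: dist_norm norm_minus_commute)
    qed
  qed
qed

lemma y_has_field_derivative:
  assumes x: "x \<in> U" shows "(y q has_field_derivative FR (\<lambda>q. y q x) q x) (at x)"
proof -
  have "\<exists>g'. \<forall>x\<in>U. (y q has_field_derivative g' x) (at x) \<and> (\<lambda>N. FR (\<lambda>q. ev q N x) q x) \<longlonglongrightarrow> g' x"
  proof (rule has_complex_derivative_uniform_sequence[OF open_U])
    show "(ev q (Suc N) has_field_derivative FR (\<lambda>q. ev q N x) q x) (at x)" if "x \<in> U" for N x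
      by (rule ev_has_field_derivative[OF U_S[OF that]])
    fix x assume "x \<in> U"
    then obtain d where "0 < d" "cball x d \<subseteq> U" using open_U open_contains_cball by blast
    then show "\<exists>d. 0 < d \<and> cball x d \<subseteq> U \<and> uniform_limit (cball x d) (\<lambda>N. ev q (Suc N)) (y q) sequentially"
      using uniform_limit_on_subset[OF ev_uniform[of q 1]] by auto
  qed
  then obtain g' where g': "(y q has_field_derivative g' x) (at x)" "(\<lambda>N. FR (\<lambda>q. ev q N x) q x) \<longlonglongrightarrow> g' x"
    using x by blast
  have t: "(\<lambda>N. ev q N x) \<longlonglongrightarrow> y q x" for q
    using tendsto_uniform_limitI[OF ev_uniform[of q 0] x] by simp
  have "(\<lambda>N. FR (\<lambda>q. ev q N x) q x) \<longlonglongrightarrow> FR (\<lambda>q. y q x) q x"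
    using S_nonzero[OF U_S[OF x]] unfolding FR_def by (auto intro!: tendsto_intros t)
  with g' show ?thesis using LIMSEQ_unique by metis
qed

text \<open>Both equations of the system are of commutator form and preserve determinants. In the
  product of an upper and a lower entry the stripped factors are inverse to each other, so the
  invariants keep their shape.\<close>

lemma first_integrals:
  assumes x: "x \<in> U"
  shows "((\<lambda>x. (s0 \<sigma> + y Ph x)\<^sup>2 + y Fp x * y Fm x) has_field_derivative 0) (at x)"
    "((\<lambda>x. (t0 \<sigma> + y Ph x)\<^sup>2 + y Gp x * y Gm x) has_field_derivative 0) (at x)"
  using S_nonzero[OF U_S[OF x]]
  by (auto intro!: derivative_eq_intros y_has_field_derivative[OF x] simp: FR_def field_simps power2_eq_square)

text \<open>The real part of x + \<sigma> Ln x in polar coordinates: on the circle of radius \<rho>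
  it is the logarithm of |X| \<rho> and of 1 / (|Y| \<rho>).\<close>

definition hh :: "real \<Rightarrow> real \<Rightarrow> real" where "hh \<rho> \<theta> = \<rho> * cos \<theta> + Re \<sigma> * ln \<rho> - Im \<sigma> * \<theta>"

definition pnt :: "real \<Rightarrow> real \<Rightarrow> complex" where "pnt \<rho> \<theta> = of_real \<rho> * cis \<theta>"

definition Th :: "real \<Rightarrow> real set" where
  "Th \<rho> = {\<theta>. 0 < \<theta> \<and> \<theta> < pi \<and> k < sin \<theta> \<and> \<bar>hh \<rho> \<theta>\<bar> < ln \<rho> - ln (G\<^sup>2)}"

lemma R_pos: "1 \<le> R" using key_R(1)[OF key] R0_ge by linarith

lemma norm_E_pnt:
  assumes \<rho>: "0 < \<rho>" and \<theta>: "0 < \<theta>" "\<theta> < pi"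
  shows "norm (E 1 \<sigma> (pnt \<rho> \<theta>)) = exp (hh \<rho> \<theta> - ln \<rho>)" "norm (E (-1) \<sigma> (pnt \<rho> \<theta>)) = exp (- hh \<rho> \<theta> - ln \<rho>)"
proof -
  have "pnt \<rho> \<theta> = exp (Complex (ln \<rho>) \<theta>)" using \<rho> by (simp add: pnt_def exp_eq_polar)
  then have "Ln (pnt \<rho> \<theta>) = Complex (ln \<rho>) \<theta>" using \<theta> by simp
  then show "norm (E 1 \<sigma> (pnt \<rho> \<theta>)) = exp (hh \<rho> \<theta> - ln \<rho>)" "norm (E (-1) \<sigma> (pnt \<rho> \<theta>)) = exp (- hh \<rho> \<theta> - ln \<rho>)"
    by (simp_all add: E_def hh_def pnt_def algebra_simps)
qed

lemma norm_pnt: "0 < \<rho> \<Longrightarrow> norm (pnt \<rho> \<theta>) = \<rho>" by (simp add: pnt_def norm_mult)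

lemma pnt_in_U:
  assumes \<rho>: "R < \<rho>" and \<theta>: "0 < \<theta>" "\<theta> < pi" shows "pnt \<rho> \<theta> \<in> U \<longleftrightarrow> \<theta> \<in> Th \<rho>"
proof -
  have \<rho>0: "0 < \<rho>" using R_pos \<rho> by linarith
  have g: "0 < G\<^sup>2" using G1 by simp
  have l: "exp (c - ln \<rho>) < 1 / G\<^sup>2 \<longleftrightarrow> c < ln \<rho> - ln (G\<^sup>2)" for c
  proof -
    have "1 / G\<^sup>2 = exp (- ln (G\<^sup>2))" using g by (simp add: exp_minus inverse_eq_divide)
    then have "exp (c - ln \<rho>) < 1 / G\<^sup>2 \<longleftrightarrow> c - ln \<rho> < - ln (G\<^sup>2)" by (simp only: exp_less_cancel_iff)
    then show ?thesis by linarith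
  qed
  have "pnt \<rho> \<theta> \<in> S R \<longleftrightarrow> k < sin \<theta>" using \<rho> \<rho>0 norm_pnt[OF \<rho>0, of \<theta>] by (simp add: S_def pnt_def mult.commute)
  then show ?thesis unfolding U_def Th_def norm_E_pnt[OF \<rho>0 \<theta>] mem_Collect_eq l using \<theta> by auto
qed

lemma U_polar:
  assumes "x \<in> U" obtains \<theta> where "R < norm x" "\<theta> \<in> Th (norm x)" "x = pnt (norm x) \<theta>"
proof
  have x: "x \<in> S R" by (rule U_S[OF assms])
  then show n: "R < norm x" by (rule S_norm)
  have a: "0 < Arg x \<and> Arg x < pi" using S_Im[OF x] Arg_lt_pi by blast
  show p: "x = pnt (norm x) (Arg x)" using Arg_eq[of x] S_nonzero[OF x] by (simp add: pnt_def cis_conv_exp)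
  show "Arg x \<in> Th (norm x)" using pnt_in_U[OF n, of "Arg x"] a assms p by simp
qed

text \<open>The derivative in \<theta> is - \<rho> sin \<theta> - Im \<sigma>. Inside the cone sin
  \<theta> > k, and \<rho> k exceeds 2 (Bd + 1) by the choice of \<open>R0\<close>, so the first
  term dominates.\<close>

lemma hh_decreasing:
  assumes \<rho>: "R < \<rho>" and a: "0 < \<alpha>" "\<alpha> < \<beta>" "\<beta> < pi" "k < sin \<alpha>" "k < sin \<beta>"
  shows "hh \<rho> \<beta> < hh \<rho> \<alpha>"
proof (rule DERIV_neg_imp_decreasing[OF a(2)])
  fix t assume t: "\<alpha> \<le> t" "t \<le> \<beta>"
  have \<rho>0: "0 < \<rho>" using R_pos \<rho> by linarith
  have st: "k < sin t" by (rule sin_interval[OF a(1) t a(3-5)])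
  have "2 * (Bd + 1) / k < \<rho>" using R0_ge(2) key_R(1)[OF key] \<rho> by linarith
  then have "2 * (Bd + 1) < \<rho> * k" using k_pos by (simp add: field_simps)
  also have "\<dots> \<le> \<rho> * sin t" using st \<rho>0 by (intro mult_left_mono) auto
  finally have "2 * (Bd + 1) < \<rho> * sin t" .
  moreover have "\<bar>Im \<sigma>\<bar> \<le> Bd" by (rule order_trans[OF abs_Im_le_cmod Bd[OF sigma]])
  ultimately have "\<bar>Im \<sigma>\<bar> < \<rho> * sin t" using Bd_nonneg by (auto simp: algebra_simps)
  then have "- (\<rho> * sin t) - Im \<sigma> < 0" by linarith
  moreover have "(hh \<rho> has_real_derivative - (\<rho> * sin t) - Im \<sigma>) (at t)"
    unfolding hh_def [abs_def] by (auto intro!: derivative_eq_intros)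
  ultimately show "\<exists>d. (hh \<rho> has_real_derivative d) (at t) \<and> d < 0" by blast
qed

lemma convex_Th: assumes \<rho>: "R < \<rho>" shows "convex (Th \<rho>)"
  unfolding is_interval_convex_1[symmetric] is_interval_1
proof (intro ballI allI impI)
  fix \<alpha> \<beta> t assume a: "\<alpha> \<in> Th \<rho>" and b: "\<beta> \<in> Th \<rho>" and t: "\<alpha> \<le> t \<and> t \<le> \<beta>"
  have a': "0 < \<alpha>" "k < sin \<alpha>" "\<bar>hh \<rho> \<alpha>\<bar> < ln \<rho> - ln (G\<^sup>2)" and b': "\<beta> < pi" "k < sin \<beta>" "\<bar>hh \<rho> \<beta>\<bar> < ln \<rho> - ln (G\<^sup>2)"
    using a b by (auto simp: Th_def)
  have t': "0 < t" "t < pi" "k < sin t" using sin_interval[of \<alpha> t \<beta> k] a' b' t by auto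
  have "hh \<rho> t \<le> hh \<rho> \<alpha>" using hh_decreasing[OF \<rho> a'(1), of t] a' t t' by (cases "\<alpha> = t") auto
  moreover have "hh \<rho> \<beta> \<le> hh \<rho> t" using hh_decreasing[OF \<rho> t'(1), of \<beta>] b' t t' by (cases "t = \<beta>") auto
  ultimately show "t \<in> Th \<rho>" using a' b' t' by (auto simp: Th_def)
qed

text \<open>The cosine is 1/2 at pi / 3 and - 1/2 at 2 pi / 3, so \<open>hh\<close> changes sign
  between these angles. Both lie in the cone because k < sqrt 3 / 2.\<close>

lemma Th_zero:
  assumes \<rho>: "R < \<rho>" shows "\<exists>\<theta>\<in>Th \<rho>. hh \<rho> \<theta> = 0"
proof -
  have \<rho>1: "1 < \<rho>" using R_pos \<rho> by linarith
  have lnp: "0 \<le> ln \<rho>" using \<rho>1 by simp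
  have b: "\<bar>Re \<sigma> * ln \<rho> - Im \<sigma> * t\<bar> \<le> Bd * (ln \<rho> + 3)" if "0 \<le> t" "t \<le> 3" for t
  proof -
    have "\<bar>Re \<sigma> * ln \<rho>\<bar> \<le> Bd * ln \<rho>" unfolding abs_mult using abs_Re_le_cmod[of \<sigma>] Bd[OF sigma] lnp by (intro mult_mono) auto
    moreover have "\<bar>Im \<sigma> * t\<bar> \<le> Bd * 3" unfolding abs_mult using abs_Im_le_cmod[of \<sigma>] Bd[OF sigma] Bd_nonneg that by (intro mult_mono) auto
    ultimately show ?thesis by (simp add: algebra_simps)
  qed
  have p: "2 * pi / 3 \<le> 3" using pi_less_4 by simp
  have c: "cos (pi / 3) = 1 / 2" "cos (2 * pi / 3) = - 1 / 2" using cos_60 cos_120 by (auto simp: algebra_simps)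
  have s: "sin (pi / 3) = sqrt 3 / 2" "sin (2 * pi / 3) = sqrt 3 / 2" using sin_60 sin_120 by (auto simp: algebra_simps)
  have ks: "k < sqrt 3 / 2"
  proof (rule power2_less_imp_less)
    show "k\<^sup>2 < (sqrt 3 / 2)\<^sup>2" using k_le by (simp add: power_divide)
  qed simp
  have "\<exists>\<theta>\<ge>pi / 3. \<theta> \<le> 2 * pi / 3 \<and> hh \<rho> \<theta> = 0"
  proof (rule IVT2)
    show "0 \<le> hh \<rho> (pi / 3)" using b[of "pi / 3"] RH[OF \<rho>] p by (simp add: hh_def c)
    show "hh \<rho> (2 * pi / 3) \<le> 0" using b[of "2 * pi / 3"] RH[OF \<rho>] p by (simp add: hh_def c)
    show "\<forall>x. pi / 3 \<le> x \<and> x \<le> 2 * pi / 3 \<longrightarrow> isCont (hh \<rho>) x" unfolding hh_def [abs_def] by (intro allI impI continuous_intros)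
  qed simp
  then obtain \<theta> where \<theta>: "pi / 3 \<le> \<theta>" "\<theta> \<le> 2 * pi / 3" "hh \<rho> \<theta> = 0" by blast
  have "k < sin \<theta>" by (rule sin_interval[of "pi / 3" _ "2 * pi / 3"]) (use \<theta> s ks in auto)
  moreover have "ln (G\<^sup>2) < ln \<rho>" using RG \<rho> G1 \<rho>1 by (subst ln_less_cancel_iff) auto
  moreover have "0 < \<theta>" "\<theta> < pi" using \<theta> pi_gt_zero by linarith+
  ultimately have "\<theta> \<in> Th \<rho>" using \<theta> unfolding Th_def by auto
  then show ?thesis using \<theta>(3) by blast
qed

text \<open>On the circle of radius \<rho> the point with |X| = |Y| = 1 / \<rho>; as \<rho> grows it
  runs to infinity with X and Y tending to 0.\<close>

definition ww :: "real \<Rightarrow> complex" where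
  "ww \<rho> = pnt \<rho> (SOME \<theta>. \<theta> \<in> Th \<rho> \<and> hh \<rho> \<theta> = 0)"

lemma ww:
  assumes \<rho>: "R < \<rho>"
  obtains \<theta> where "\<theta> \<in> Th \<rho>" "hh \<rho> \<theta> = 0" "ww \<rho> = pnt \<rho> \<theta>" "0 < \<theta>" "\<theta> < pi"
proof -
  have "\<exists>\<theta>. \<theta> \<in> Th \<rho> \<and> hh \<rho> \<theta> = 0" using Th_zero[OF \<rho>] by blast
  from someI_ex[OF this] show ?thesis by (intro that[of "SOME \<theta>. \<theta> \<in> Th \<rho> \<and> hh \<rho> \<theta> = 0"]) (auto simp: ww_def Th_def)
qed

lemma ww_U:
  assumes \<rho>: "R < \<rho>"
  shows "ww \<rho> \<in> U" "norm (ww \<rho>) = \<rho>" "norm (E 1 \<sigma> (ww \<rho>)) = 1 / \<rho>" "norm (E (-1) \<sigma> (ww \<rho>)) = 1 / \<rho>"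
proof -
  have \<rho>0: "0 < \<rho>" using R_pos \<rho> by linarith
  obtain \<theta> where \<theta>: "\<theta> \<in> Th \<rho>" "hh \<rho> \<theta> = 0" "ww \<rho> = pnt \<rho> \<theta>" "0 < \<theta>" "\<theta> < pi" using ww[OF \<rho>] by blast
  show "ww \<rho> \<in> U" using pnt_in_U[OF \<rho> \<theta>(4,5)] \<theta> by simp
  show "norm (ww \<rho>) = \<rho>" using norm_pnt[OF \<rho>0] \<theta> by simp
  show "norm (E 1 \<sigma> (ww \<rho>)) = 1 / \<rho>" "norm (E (-1) \<sigma> (ww \<rho>)) = 1 / \<rho>"
    using norm_E_pnt[OF \<rho>0 \<theta>(4,5)] \<theta> \<rho>0 by (simp_all add: exp_minus inverse_eq_divide)
qed

text \<open>Every circle \<open>\<bar>x\<bar> = \<rho>\<close> meets the domain in an arc, because \<open>hh \<rho>\<close> is decreasing; hence a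
  locally constant function on the domain depends on \<open>\<bar>x\<bar>\<close> only, and is constant.\<close>
lemma locally_constant_on_U:
  assumes Q: "\<And>x. x \<in> U \<Longrightarrow> (Q has_field_derivative 0) (at x)" and x: "x \<in> U" and \<rho>: "R < \<rho>"
  shows "Q x = Q (ww \<rho>)"
proof -
  have arc: "Q (pnt r \<alpha>) = Q (pnt r \<beta>)" if r: "R < r" and ab: "\<alpha> \<in> Th r" "\<beta> \<in> Th r" for r \<alpha> \<beta>
  proof -
    have "\<exists>c. \<forall>t\<in>Th r. (\<lambda>t. Q (pnt r t)) t = c"
    proof (rule has_derivative_zero_constant[OF convex_Th[OF r]])
      fix t assume t: "t \<in> Th r"
      then have "pnt r t \<in> U" using pnt_in_U[OF r] by (auto simp: Th_def)
      from Q[OF this] have "(Q has_derivative (\<lambda>h. 0)) (at (pnt r t))" by (simp add: has_field_derivative_def lambda_zero)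
      moreover have "(pnt r has_derivative (\<lambda>h. of_real r * (of_real h * (\<i> * cis t)))) (at t within Th r)"
        unfolding pnt_def [abs_def] by (rule has_derivative_pnt)
      ultimately show "((\<lambda>t. Q (pnt r t)) has_derivative (\<lambda>h. 0)) (at t within Th r)"
        using has_derivative_compose by fastforce
    qed
    then show ?thesis using ab by metis
  qed
  have to_ww: "Q z = Q (ww (norm z))" if z: "z \<in> U" for z
  proof -
    obtain \<theta> where \<theta>: "R < norm z" "\<theta> \<in> Th (norm z)" "z = pnt (norm z) \<theta>" using U_polar[OF z] by blast
    obtain \<theta>' where "\<theta>' \<in> Th (norm z)" "ww (norm z) = pnt (norm z) \<theta>'" using ww[OF \<theta>(1)] by blast
    then show ?thesis using arc[OF \<theta>(1,2)] \<theta>(3) by metis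
  qed
  \<comment> \<open>No continuity of \<open>ww\<close> is required: a neighbouring circle is entered
    at the same angle, within a ball on which Q is constant, and from there its arc leads to the
    value of \<open>ww\<close>.\<close>
  have "Q (ww (norm x)) = Q (ww \<rho>)"
  proof (rule connected_local_const[of "{R<..}" "norm x" \<rho> "\<lambda>r. Q (ww r)"])
    show "connected {R<..}" "norm x \<in> {R<..}" "\<rho> \<in> {R<..}" using \<rho> S_norm[OF U_S[OF x]] by auto
    show "\<forall>r\<in>{R<..}. \<forall>\<^sub>F s in at r within {R<..}. Q (ww r) = Q (ww s)"
    proof
      fix r assume "r \<in> {R<..}"
      then have r: "R < r" by simp
      obtain \<theta> where \<theta>: "ww r = pnt r \<theta>" using ww[OF r] by blast
      obtain d where d: "0 < d" "ball (ww r) d \<subseteq> U" using open_U ww_U(1)[OF r] open_contains_ball by blast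
      obtain c where c: "\<And>z. z \<in> ball (ww r) d \<Longrightarrow> Q z = c"
        using has_field_derivative_zero_constant[OF convex_ball, of "ww r" d Q] Q d(2) has_field_derivative_at_within by blast
      have "\<forall>\<^sub>F s in at r within {R<..}. s \<in> {R<..} \<and> dist s r < d"
        unfolding eventually_at using d(1) by auto
      then show "\<forall>\<^sub>F s in at r within {R<..}. Q (ww r) = Q (ww s)"
      proof eventually_elim
        case (elim s)
        then have s: "0 < s" using R_pos by auto
        have "pnt r \<theta> - pnt s \<theta> = of_real (r - s) * cis \<theta>" by (simp add: pnt_def algebra_simps)
        then have "dist (ww r) (pnt s \<theta>) = \<bar>r - s\<bar>" unfolding \<theta> dist_norm by (simp only: norm_mult norm_of_real norm_cis) simp
        then have b: "pnt s \<theta> \<in> ball (ww r) d" using elim by (simp add: dist_real_def abs_minus_commute)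
        then have "Q (ww r) = Q (pnt s \<theta>)" using c d(1) by simp
        also have "\<dots> = Q (ww s)" using to_ww[of "pnt s \<theta>"] b d(2) norm_pnt[OF s] by auto
        finally show ?case .
      qed
    qed
  qed
  then show ?thesis using to_ww[OF x] by simp
qed

text \<open>On this curve every monomial with nonzero n is at most G^4 / \<rho>, while the
  coefficient at 0 approaches \<open>init q 0\<close>; the error is O(1/\<rho>). The monomial at n =
  0 is constant in x, so it may be written with argument 0.\<close>

lemma y_limit: "((\<lambda>\<rho>. y q (ww \<rho>)) \<longlongrightarrow> init q 0 * e q 0 0) at_top"
proof -
  obtain c0 where c0: "\<And>x. x \<in> S R \<Longrightarrow> norm (zl q 0 \<sigma> x - z0 q 0 \<sigma> x) \<le> c0 / norm x ^ 1"
    using Asy_bound[OF zl_leading[OF key, of q 0]] sigma by blast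
  define c where "c = (M + D) * G ^ 4 + c0 * G\<^sup>2"
  have "((\<lambda>\<rho>. y q (ww \<rho>) - init q 0 * e q 0 0) \<longlongrightarrow> 0) at_top"
  proof (rule Lim_null_comparison)
    show "((\<lambda>\<rho>. c / \<rho>) \<longlongrightarrow> 0) at_top"
      by (rule tendsto_divide_0[OF tendsto_const]) (rule filterlim_at_top_imp_at_infinity[OF filterlim_ident])
    show "\<forall>\<^sub>F \<rho> in at_top. norm (y q (ww \<rho>) - init q 0 * e q 0 0) \<le> c / \<rho>"
      using eventually_gt_at_top[of R]
    proof eventually_elim
      case (elim \<rho>)
      note w = ww_U[OF elim]
      have \<rho>: "0 < \<rho>" "G\<^sup>2 \<le> \<rho>" using elim R_pos RG by auto
      let ?f = "\<lambda>n. zl q n \<sigma> (ww \<rho>) * e q n (ww \<rho>)"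
      have en: "norm (e q n (ww \<rho>)) \<le> G ^ 4 / \<rho>" if "n \<noteq> 0" for n
      proof -
        have "norm (e q n (ww \<rho>)) \<le> G\<^sup>2 * (G\<^sup>2 * (1 / \<rho>)) ^ nat \<bar>n\<bar>"
          using w by (intro norm_ee_le bounds G1) auto
        also have "(G\<^sup>2 * (1 / \<rho>)) ^ nat \<bar>n\<bar> \<le> (G\<^sup>2 * (1 / \<rho>)) ^ 1"
          using \<rho> that G1 by (intro power_decreasing) (auto simp: field_simps)
        finally show ?thesis by (simp add: mult_left_mono power2_eq_square power4_eq_xxxx)
      qed
      have s: "(\<lambda>n. norm (?f n)) summable_on X" for X by (rule zl_e_summable[OF w(1)])
      have "y q (ww \<rho>) = infsum ?f {0} + infsum ?f (- {0})"
        unfolding ZF_def by (subst infsum_Un_disjoint[symmetric]) (auto intro: abs_summable_summable[OF s])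
      then have 1: "y q (ww \<rho>) = zl q 0 \<sigma> (ww \<rho>) * e q 0 (ww \<rho>) + infsum ?f (- {0})" by simp
      have 2: "norm (infsum ?f (- {0})) \<le> (M + D) * (G ^ 4 / \<rho>)"
      proof (rule infsum_norm_le(2))
        fix F :: "int set" assume F: "finite F" "F \<subseteq> - {0}"
        have en': "norm (e q n (ww \<rho>)) \<le> G ^ 4 / \<rho>" if "n \<in> F" for n using en[of n] F(2) that by blast
        show "(\<Sum>n\<in>F. norm (?f n)) \<le> (M + D) * (G ^ 4 / \<rho>)"
          using en' \<rho> by (intro sum_norm_mult_le[OF zl_sum_le[OF key sigma U_S[OF w(1)] F(1)]]) auto
      qed
      have z: "z0 q 0 \<sigma> (ww \<rho>) = init q 0" by (simp add: z0_def init_def)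
      have e0: "e q 0 0 = e q 0 (ww \<rho>)" by (simp add: ee_def)
      have 3: "norm ((zl q 0 \<sigma> (ww \<rho>) - init q 0) * e q 0 (ww \<rho>)) \<le> c0 / \<rho> * G\<^sup>2"
        unfolding norm_mult using c0[OF U_S[OF w(1)]] norm_e_le[OF w(1)] w(2) z
        by (intro mult_mono) (auto intro: order_trans[OF norm_ge_zero])
      have "y q (ww \<rho>) - init q 0 * e q 0 0 = (zl q 0 \<sigma> (ww \<rho>) - init q 0) * e q 0 (ww \<rho>) + infsum ?f (- {0})"
        unfolding 1 e0 by (simp add: algebra_simps)
      then have "norm (y q (ww \<rho>) - init q 0 * e q 0 0) \<le> c0 / \<rho> * G\<^sup>2 + (M + D) * (G ^ 4 / \<rho>)"
        using norm_triangle_mono[OF 3 2] by simp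
      also have "\<dots> = c / \<rho>" by (simp add: c_def add_divide_distrib)
      finally show ?case .
    qed
  qed
  then show ?thesis by (rule LIM_zero_cancel)
qed

text \<open>The limits along \<open>ww\<close> are s0^2 + A a and t0^2 + B b. As A a = kap0 and B b
  = kapx, the definitions of these constants give the squares of \<theta>0 / 2 and \<theta>x /
  2.\<close>

lemma first_integral_values:
  assumes x: "x \<in> U"
  shows "(s0 \<sigma> + y Ph x)\<^sup>2 + y Fp x * y Fm x = (\<theta>0 / 2)\<^sup>2" "(t0 \<sigma> + y Ph x)\<^sup>2 + y Gp x * y Gm x = (\<theta>x / 2)\<^sup>2"
proof -
  have *: "Q x = l" if Q: "\<And>x. x \<in> U \<Longrightarrow> (Q has_field_derivative 0) (at x)" and l: "((\<lambda>\<rho>. Q (ww \<rho>)) \<longlongrightarrow> l) at_top" for Q l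
  proof (rule tendsto_unique[OF _ _ l])
    have "\<forall>\<^sub>F \<rho> in at_top. Q (ww \<rho>) = Q x"
      using eventually_gt_at_top[of R] by eventually_elim (use locally_constant_on_U[OF Q x] in simp)
    then show "((\<lambda>\<rho>. Q (ww \<rho>)) \<longlongrightarrow> Q x) at_top" by (rule tendsto_eventually)
  qed simp
  note t = y_limit[of Ph] y_limit[of Fp] y_limit[of Fm] y_limit[of Gp] y_limit[of Gm]
  have "((\<lambda>\<rho>. (s0 \<sigma> + y Ph (ww \<rho>))\<^sup>2 + y Fp (ww \<rho>) * y Fm (ww \<rho>)) \<longlongrightarrow>
      (s0 \<sigma> + init Ph 0 * e Ph 0 0)\<^sup>2 + init Fp 0 * e Fp 0 0 * (init Fm 0 * e Fm 0 0)) at_top"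
    by (intro tendsto_intros t)
  moreover have "(s0 \<sigma> + init Ph 0 * e Ph 0 0)\<^sup>2 + init Fp 0 * e Fp 0 0 * (init Fm 0 * e Fm 0 0) = (\<theta>0 / 2)\<^sup>2"
    using Aa by (simp add: init_def ee_def mp_def s0_def kap0_def power2_eq_square field_simps)
  ultimately show "(s0 \<sigma> + y Ph x)\<^sup>2 + y Fp x * y Fm x = (\<theta>0 / 2)\<^sup>2"
    using *[OF first_integrals(1)] by simp
  have "((\<lambda>\<rho>. (t0 \<sigma> + y Ph (ww \<rho>))\<^sup>2 + y Gp (ww \<rho>) * y Gm (ww \<rho>)) \<longlongrightarrow>
      (t0 \<sigma> + init Ph 0 * e Ph 0 0)\<^sup>2 + init Gp 0 * e Gp 0 0 * (init Gm 0 * e Gm 0 0)) at_top"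
    by (intro tendsto_intros t)
  moreover have "(t0 \<sigma> + init Ph 0 * e Ph 0 0)\<^sup>2 + init Gp 0 * e Gp 0 0 * (init Gm 0 * e Gm 0 0) = (\<theta>x / 2)\<^sup>2"
    using Bb by (simp add: init_def ee_def mp_def t0_def kapx_def power2_eq_square field_simps)
  ultimately show "(t0 \<sigma> + y Ph x)\<^sup>2 + y Gp x * y Gm x = (\<theta>x / 2)\<^sup>2"
    using *[OF first_integrals(2)] by simp
qed

end

section \<open>The matrix system, the spectrum and the sector\<close>

lemma mat2_entries:
  fixes a b c :: complex and N :: mat2
  defines "N \<equiv> cscale a J + cscale b Delta_plus + cscale c Delta_minus"
  shows "N $ 1 $ 1 = a" "N $ 1 $ 2 = b" "N $ 2 $ 1 = c" "N $ 2 $ 2 = - a"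
  by (simp_all add: N_def cscale_def map_matrix_def J_def Delta_plus_def Delta_minus_def)

text \<open>The square of the matrix is the scalar l^2. Conversely a root m of m^2 = l^2 has the
  eigenvector (b, m - a) or (m + a, c), unless the matrix is diagonal.\<close>

lemma eigenvalues_traceless:
  fixes a b c l :: complex
  assumes l: "a\<^sup>2 + b * c = l\<^sup>2"
  shows "eigenvalues (cscale a J + cscale b Delta_plus + cscale c Delta_minus) = {l, - l}"
proof -
  let ?N = "cscale a J + cscale b Delta_plus + cscale c Delta_minus"
  have N: "?N *v v = m *s (v :: complex^2) \<longleftrightarrow> a * v $ 1 + b * v $ 2 = m * v $ 1 \<and> c * v $ 1 - a * v $ 2 = m * v $ 2" for v m
    unfolding vec_eq_iff forall_2 matrix_vector_mult_def vector_scalar_mult_def vec_lambda_beta sum_2 mat2_entries by simp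
  have v0: "v \<noteq> 0 \<longleftrightarrow> v $ 1 \<noteq> 0 \<or> v $ 2 \<noteq> 0" for v :: "complex ^ 2" unfolding vec_eq_iff forall_2 by simp
  have "m \<in> eigenvalues ?N \<longleftrightarrow> m\<^sup>2 = l\<^sup>2" for m
  proof
    assume "m \<in> eigenvalues ?N"
    then obtain v :: "complex^2" where v: "v $ 1 \<noteq> 0 \<or> v $ 2 \<noteq> 0" "a * v $ 1 + b * v $ 2 = m * v $ 1" "c * v $ 1 - a * v $ 2 = m * v $ 2"
      unfolding eigenvalues_def N v0 by blast
    have "(m\<^sup>2 - (a\<^sup>2 + b * c)) * v $ 1 = 0" "(m\<^sup>2 - (a\<^sup>2 + b * c)) * v $ 2 = 0" using v(2,3) by algebra+
    then show "m\<^sup>2 = l\<^sup>2" using v(1) l by auto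
  next
    assume m: "m\<^sup>2 = l\<^sup>2"
    then have m': "m\<^sup>2 = a\<^sup>2 + b * c" using l by simp
    have ex: "m \<in> eigenvalues ?N" if "p \<noteq> 0 \<or> q \<noteq> 0" "a * p + b * q = m * p" "c * p - a * q = m * q" for p q
      unfolding eigenvalues_def mem_Collect_eq N v0 by (rule exI[of _ "vector [p, q]"]) (use that in simp)
    consider "b \<noteq> 0" | "c \<noteq> 0" | "b = 0" "c = 0" by blast
    then show "m \<in> eigenvalues ?N"
    proof cases
      case 1 show ?thesis by (rule ex[of b "m - a"]) (use 1 m' in \<open>auto simp: algebra_simps power2_eq_square\<close>)
    next
      case 2 show ?thesis by (rule ex[of "m + a" c]) (use 2 m' in \<open>auto simp: algebra_simps power2_eq_square\<close>)
    next
      case 3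
      then have "m = a \<or> m = - a" using m' by (simp add: power2_eq_iff)
      then show ?thesis using ex[of 1 0] ex[of 0 1] 3 by auto
    qed
  qed
  then show ?thesis by (auto simp: power2_eq_iff)
qed

text \<open>The commutators written out in the basis J, Delta_plus, Delta_minus; the summands gp and
  - gm are the contribution of J.\<close>

lemma solves_systemI:
  fixes f0 fp fm g0 gp gm :: "complex \<Rightarrow> complex"
  assumes "\<And>x. x \<in> X \<Longrightarrow> x \<noteq> 0"
    and "\<And>x. x \<in> X \<Longrightarrow> (f0 has_field_derivative (gp x * fm x - fp x * gm x) / x) (at x)"
    and "\<And>x. x \<in> X \<Longrightarrow> (fp has_field_derivative 2 * (g0 x * fp x - f0 x * gp x) / x) (at x)"
    and "\<And>x. x \<in> X \<Longrightarrow> (fm has_field_derivative 2 * (f0 x * gm x - g0 x * fm x) / x) (at x)"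
    and "\<And>x. x \<in> X \<Longrightarrow> (g0 has_field_derivative - (gp x * fm x - fp x * gm x) / x) (at x)"
    and "\<And>x. x \<in> X \<Longrightarrow> (gp has_field_derivative - (2 * (g0 x * fp x - f0 x * gp x)) / x + gp x) (at x)"
    and "\<And>x. x \<in> X \<Longrightarrow> (gm has_field_derivative - (2 * (f0 x * gm x - g0 x * fm x)) / x - gm x) (at x)"
  shows "solves_system (\<lambda>x. cscale (f0 x) J + cscale (fp x) Delta_plus + cscale (fm x) Delta_minus)
     (\<lambda>x. cscale (g0 x) J + cscale (gp x) Delta_plus + cscale (gm x) Delta_minus) X"
  unfolding solves_system_def
proof
  fix x assume x: "x \<in> X"
  let ?N = "\<lambda>a b c. cscale a J + cscale b Delta_plus + cscale c Delta_minus"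
  let ?u = "gp x * fm x - fp x * gm x" and ?v = "g0 x * fp x - f0 x * gp x" and ?w = "f0 x * gm x - g0 x * fm x"
  have d: "has_matrix_derivative (\<lambda>x. ?N (a x) (b x) (c x)) (?N a' b' c') x"
    if "(a has_field_derivative a') (at x)" "(b has_field_derivative b') (at x)" "(c has_field_derivative c') (at x)" for a b c a' b' c'
    unfolding has_matrix_derivative_def forall_2 mat2_entries using that DERIV_minus by blast
  have c1: "cscale x (?N (?u / x) (2 * ?v / x) (2 * ?w / x)) = commutator (?N (g0 x) (gp x) (gm x)) (?N (f0 x) (fp x) (fm x))"
    using assms(1)[OF x] unfolding vec_eq_iff forall_2 commutator_def matrix_matrix_mult_def
    by (simp add: sum_2 cscale_def map_matrix_def J_def Delta_plus_def Delta_minus_def field_simps)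
  have c2: "cscale x (?N (- ?u / x) (- (2 * ?v) / x + gp x) (- (2 * ?w) / x - gm x))
     = commutator (?N (f0 x) (fp x) (fm x)) (?N (g0 x) (gp x) (gm x)) + cscale (x / 2) (commutator J (?N (g0 x) (gp x) (gm x)))"
    using assms(1)[OF x] unfolding vec_eq_iff forall_2 commutator_def matrix_matrix_mult_def
    by (simp add: sum_2 cscale_def map_matrix_def J_def Delta_plus_def Delta_minus_def field_simps)
  show "\<exists>A0' Ax'. has_matrix_derivative (\<lambda>x. ?N (f0 x) (fp x) (fm x)) A0' x \<and> has_matrix_derivative (\<lambda>x. ?N (g0 x) (gp x) (gm x)) Ax' x \<and>
      cscale x A0' = commutator (?N (g0 x) (gp x) (gm x)) (?N (f0 x) (fp x) (fm x)) \<and>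
      cscale x Ax' = commutator (?N (f0 x) (fp x) (fm x)) (?N (g0 x) (gp x) (gm x)) + cscale (x / 2) (commutator J (?N (g0 x) (gp x) (gm x)))"
    using d[OF assms(2-4)[OF x]] d[OF assms(5-7)[OF x]] c1 c2 by blast
qed

text \<open>In the upper half plane Im x = |x| sin (Arg x), and on (0, pi) the sine exceeds sin
  \<delta> exactly between \<delta> and pi - \<delta>; elsewhere both conditions fail. The algebraic
  form shows openness and the inclusion in the cone \<open>S\<close>.\<close>

lemma sector_eq:
  assumes "0 < \<delta>" "\<delta> < pi / 2" "0 \<le> R"
  shows "sector \<delta> R = {x. sin \<delta> * norm x < Im x \<and> R < norm x}"
proof (rule set_eqI)
  fix x
  show "x \<in> sector \<delta> R \<longleftrightarrow> x \<in> {x. sin \<delta> * norm x < Im x \<and> R < norm x}"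
  proof (cases "R < norm x \<and> 0 < Im x")
    case True
    then have x0: "x \<noteq> 0" "0 < norm x" by auto
    have a: "0 < Arg x" "Arg x < pi" using True Arg_lt_pi by blast+
    have "Im x = norm x * sin (Arg x)" using arg_cong[OF Arg_eq[OF x0(1)], of Im] by (simp add: Im_exp)
    then have "sin \<delta> * norm x < Im x \<longleftrightarrow> sin \<delta> < sin (Arg x)" using x0 by (simp add: mult.commute)
    also have "\<dots> \<longleftrightarrow> \<delta> < Arg x \<and> Arg x < pi - \<delta>"
    proof
      assume s: "sin \<delta> < sin (Arg x)"
      have "sin (Arg x) \<le> sin \<delta>" if "Arg x \<le> \<delta>" using that a assms by (intro sin_monotone_2pi_le) auto
      moreover have "sin (pi - Arg x) \<le> sin \<delta>" if "pi - \<delta> \<le> Arg x" using that a assms by (intro sin_monotone_2pi_le) auto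
      ultimately show "\<delta> < Arg x \<and> Arg x < pi - \<delta>" using s by (auto simp: not_le[symmetric])
    next
      assume s: "\<delta> < Arg x \<and> Arg x < pi - \<delta>"
      show "sin \<delta> < sin (Arg x)"
      proof (cases "Arg x \<le> pi / 2")
        case True
        then show ?thesis using s assms by (intro sin_monotone_2pi) auto
      next
        case False
        then have "sin \<delta> < sin (pi - Arg x)" using s assms by (intro sin_monotone_2pi) auto
        then show ?thesis by simp
      qed
    qed
    finally show ?thesis using True by (auto simp: sector_def abs_less_iff)
  next
    case False
    have "\<not> \<bar>Arg x - pi / 2\<bar> < pi / 2 - \<delta>" if "R < norm x"
    proof
      assume "\<bar>Arg x - pi / 2\<bar> < pi / 2 - \<delta>"
      then have "0 < Arg x" "Arg x < pi" using assms by (auto simp: abs_less_iff)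
      then show False using False that Arg_lt_pi by blast
    qed
    moreover have "0 \<le> sin \<delta> * norm x" using assms sin_gt_zero[of \<delta>] by auto
    ultimately show ?thesis using False by (auto simp: sector_def)
  qed
qed

lemma holomorphic4_on_coord:
  "holomorphic4_on (\<lambda>a b c d. a) S" "holomorphic4_on (\<lambda>a b c d. b) S"
proof -
  show "holomorphic4_on (\<lambda>a b c d. a) S" unfolding holomorphic4_on_def case_prod_unfold
    by (intro ballI exI[of _ 1] exI[of _ 0]) (auto intro!: derivative_eq_intros)
  have "\<exists>a1 a2 a3 a4. ((\<lambda>q. fst (snd q)) has_derivative (\<lambda>q. a1 * fst q + a2 * fst (snd q) + a3 * fst (snd (snd q)) + a4 * snd (snd (snd q)))) (at p)"
    for p :: "complex \<times> complex \<times> complex \<times> complex"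
    by (rule exI[of _ 0], rule exI[of _ 1], rule exI[of _ 0], rule exI[of _ 0]) (auto intro!: derivative_eq_intros)
  then show "holomorphic4_on (\<lambda>a b c d. b) S" unfolding holomorphic4_on_def case_prod_unfold by blast
qed

lemma holomorphic4_on_inverse:
  assumes f: "holomorphic4_on f S" and nz: "\<And>a b c d. (a, b, c, d) \<in> S \<Longrightarrow> f a b c d \<noteq> 0"
  shows "holomorphic4_on (\<lambda>a b c d. inverse (f a b c d)) S"
  unfolding holomorphic4_on_def
proof
  fix p assume p: "p \<in> S"
  obtain a b c e where pe: "p = (a, b, c, e)" using prod_cases4 by blast
  obtain a1 a2 a3 a4 where
    d: "((\<lambda>(c0, cx, \<sigma>, x). f c0 cx \<sigma> x) has_derivative (\<lambda>(h1, h2, h3, h4). a1 * h1 + a2 * h2 + a3 * h3 + a4 * h4)) (at p)"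
    using f p unfolding holomorphic4_on_def by meson
  let ?m = "- (inverse (f a b c e) * inverse (f a b c e))"
  have "((\<lambda>(c0, cx, \<sigma>, x). inverse (f c0 cx \<sigma> x)) has_derivative
     (\<lambda>(h1, h2, h3, h4). (?m * a1) * h1 + (?m * a2) * h2 + (?m * a3) * h3 + (?m * a4) * h4)) (at p)"
    using Deriv.has_derivative_inverse[OF _ d] nz[of a b c e] p unfolding case_prod_unfold pe by (simp add: algebra_simps)
  then show "\<exists>a1 a2 a3 a4. ((\<lambda>(c0, cx, \<sigma>, x). inverse (f c0 cx \<sigma> x)) has_derivative
      (\<lambda>(h1, h2, h3, h4). a1 * h1 + a2 * h2 + a3 * h3 + a4 * h4)) (at p)" by blast
qed

text \<open>Separates the powers of X from those of Y and, on each side, the terms that the theorem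
  displays individually from the tail. The maximum with 1 keeps the partition valid for a = 0 or b =
  0.\<close>

lemma infsum_int_split:
  fixes f :: "int \<Rightarrow> complex"
  assumes f: "\<And>X. (\<lambda>n. norm (f n)) summable_on X"
  shows "infsum f UNIV = f 0 + (\<Sum>n\<in>{1..<a}. f (int n)) + (\<Sum>\<^sub>\<infinity>n\<in>{max 1 a..}. f (int n))
     + (\<Sum>n\<in>{1..<b}. f (- int n)) + (\<Sum>\<^sub>\<infinity>n\<in>{max 1 b..}. f (- int n))"
    and "(\<lambda>n. f (int n)) summable_on N" and "(\<lambda>n. f (- int n)) summable_on N"
proof -
  have s: "f summable_on X" for X by (rule abs_summable_summable[OF f])
  have i: "inj_on int N" "inj_on (\<lambda>n. - int n) N" for N by (auto simp: inj_on_def)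
  show sp: "(\<lambda>n. f (int n)) summable_on N" for N
    using s[of "int ` N"] summable_on_reindex[OF i(1), of f N] by (simp add: comp_def)
  show sn: "(\<lambda>n. f (- int n)) summable_on N" for N
    using s[of "(\<lambda>n. - int n) ` N"] summable_on_reindex[OF i(2), of f N] by (simp add: comp_def)
  have half: "infsum g {1..} = (\<Sum>n\<in>{1..<m}. g n) + infsum g {max 1 m..}"
    if "\<And>X. g summable_on X" for g :: "nat \<Rightarrow> complex" and m
  proof -
    have "{1..} = {1..<m} \<union> {max 1 m..}" by auto
    then have "infsum g {1..} = infsum g {1..<m} + infsum g {max 1 m..}"
      by (simp only:) (rule infsum_Un_disjoint, auto intro: that)
    then show ?thesis by simp
  qed
  have U: "(UNIV :: int set) = {0} \<union> (int ` {1..} \<union> (\<lambda>n. - int n) ` {1..})"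
  proof (rule set_eqI)
    fix n :: int
    have "n = 0 \<or> n = int (nat n) \<and> 1 \<le> nat n \<or> n = - int (nat (- n)) \<and> 1 \<le> nat (- n)" by linarith
    then show "n \<in> UNIV \<longleftrightarrow> n \<in> {0} \<union> (int ` {1..} \<union> (\<lambda>n. - int n) ` {1..})" by blast
  qed
  have "infsum f UNIV = f 0 + infsum f (int ` {1..} \<union> (\<lambda>n. - int n) ` {1..})"
    unfolding U by (subst infsum_Un_disjoint) (auto intro: s)
  also have "infsum f (int ` {1..} \<union> (\<lambda>n. - int n) ` {1..}) = infsum f (int ` {1..}) + infsum f ((\<lambda>n. - int n) ` {1..})"
    by (rule infsum_Un_disjoint) (auto intro: s)
  also have "infsum f (int ` {1..}) = infsum (\<lambda>n. f (int n)) {1..}" using infsum_reindex[OF i(1), of f] by (simp add: comp_def)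
  also have "infsum f ((\<lambda>n. - int n) ` {1..}) = infsum (\<lambda>n. f (- int n)) {1..}" using infsum_reindex[OF i(2), of f] by (simp add: comp_def)
  finally show "infsum f UNIV = f 0 + (\<Sum>n\<in>{1..<a}. f (int n)) + (\<Sum>\<^sub>\<infinity>n\<in>{max 1 a..}. f (int n))
     + (\<Sum>n\<in>{1..<b}. f (- int n)) + (\<Sum>\<^sub>\<infinity>n\<in>{max 1 b..}. f (- int n))"
    unfolding half[OF sp, of a] half[OF sn, of b] by (simp only: add.assoc)
qed

context painleve
begin

lemma hol2R_holomorphic4:
  assumes h: "hol2R R h" and Z: "open Z" "\<And>a b c d. (a, b, c, d) \<in> Z \<Longrightarrow> c \<in> Bs \<and> d \<in> S R"
  shows "holomorphic4_on (\<lambda>a b. h) Z"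
proof (rule holomorphic4_onI[OF Z(1)])
  note hol = h[unfolded hol2R_def]
  have "continuous_on Z (\<lambda>q. (\<lambda>(\<sigma>, x). h \<sigma> x) (snd (snd q)))"
    by (rule continuous_on_compose2[OF hol[THEN conjunct1]]) (use Z(2) in \<open>auto intro!: continuous_intros\<close>)
  then show "continuous_on Z (\<lambda>(a, b, c, d). h c d)" by (simp add: case_prod_unfold)
  fix a b c d assume "(a, b, c, d) \<in> Z"
  then have d: "d \<in> S R" and c: "c \<in> Bs" using Z(2) by auto
  show "(\<lambda>c. h c d) field_differentiable at c"
    using hol d c Bs_open holomorphic_on_imp_differentiable_at by blast
  show "h c field_differentiable at d"
    using hol d c open_S holomorphic_on_imp_differentiable_at by blast
qed auto

lemma hol2R_exp:
  assumes "c \<in> PQ" shows "hol2R R (\<lambda>\<sigma> x. exp (of_int m * x + c \<sigma> * Ln x))"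
  unfolding hol2R_def case_prod_unfold
proof (intro conjI ballI)
  have c: "c holomorphic_on Bs" by (rule PQ_holomorphic[OF assms])
  have "continuous_on (Bs \<times> S R) (\<lambda>q. c (fst q))"
    by (rule continuous_on_compose2[OF holomorphic_on_imp_continuous_on[OF c]]) (auto intro!: continuous_intros)
  then show "continuous_on (Bs \<times> S R) (\<lambda>q. exp (of_int m * snd q + c (fst q) * Ln (snd q)))"
    by (intro continuous_intros) (use S_not_nonpos in auto)
  show "(\<lambda>x. exp (of_int m * x + c \<sigma> * Ln x)) holomorphic_on S R" for \<sigma>
    using S_not_nonpos by (intro holomorphic_intros) auto
  show "(\<lambda>\<sigma>. exp (of_int m * x + c \<sigma> * Ln x)) holomorphic_on Bs" for x by (intro holomorphic_intros c)
qed

lemma hol2R_E: "hol2R R (E n)"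
proof -
  have "(\<lambda>\<sigma>. of_int n * \<sigma> - of_int \<bar>n\<bar>) \<in> PQ" by (intro PQ_diff PQ_mult PQ_int PQ_sigma)
  from hol2R_exp[OF this] show ?thesis unfolding E_def [abs_def] .
qed

end

section \<open>The family of solutions\<close>

lemma mp_simps:
  "mp A a 0 = 1" "mp A a 1 = A" "mp A a (- 1) = a"
  "mp A a (int n) = A ^ n" "mp A a (- int n) = a ^ n" "mp A a (1 + int n) = A ^ (n + 1)" "mp A a (- 1 - int n) = a ^ (n + 1)"
  "1 \<le> n \<Longrightarrow> mp A a (1 - int n) = a ^ (n - 1)" "1 \<le> n \<Longrightarrow> mp A a (int n - 1) = A ^ (n - 1)"
proof -
  have "nat (1 + int n) = n + 1" for n by simp
  then show "mp A a (1 + int n) = A ^ (n + 1)" "mp A a (- 1 - int n) = a ^ (n + 1)" by (auto simp: mp_def add.commute)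
  have *: "nat (int n - 1) = n - 1" by simp
  show "1 \<le> n \<Longrightarrow> mp A a (1 - int n) = a ^ (n - 1)" using * by (cases "n = 1") (auto simp: mp_def)
  show "1 \<le> n \<Longrightarrow> mp A a (int n - 1) = A ^ (n - 1)" using * by (auto simp: mp_def)
qed (auto simp: mp_def)

context sectorial
begin

lemma ee_0:
  "ee A a B b Ph 0 \<sigma> x = 1" "ee A a B b Fp 0 \<sigma> x = A" "ee A a B b Gp 0 \<sigma> x = B" "ee A a B b Fm 0 \<sigma> x = a" "ee A a B b Gm 0 \<sigma> x = b"
  by (simp_all add: ee_def mp_simps)

lemma ee_int:
  assumes "1 \<le> n"
  shows "ee A a B b Ph (int n) \<sigma> x = a ^ n * B ^ n * E 1 \<sigma> x ^ n" "ee A a B b Fp (int n) \<sigma> x = a ^ (n - 1) * B ^ n * E 1 \<sigma> x ^ n"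
    "ee A a B b Gp (int n) \<sigma> x = a ^ n * B ^ (n + 1) * E 1 \<sigma> x ^ n" "ee A a B b Fm (int n) \<sigma> x = a ^ (n + 1) * B ^ n * E 1 \<sigma> x ^ n"
    "ee A a B b Gm (int n) \<sigma> x = a ^ n * B ^ (n - 1) * E 1 \<sigma> x ^ n"
    and "ee A a B b Ph (- int n) \<sigma> x = A ^ n * b ^ n * E (-1) \<sigma> x ^ n" "ee A a B b Fp (- int n) \<sigma> x = A ^ (n + 1) * b ^ n * E (-1) \<sigma> x ^ n"
    "ee A a B b Gp (- int n) \<sigma> x = A ^ n * b ^ (n - 1) * E (-1) \<sigma> x ^ n" "ee A a B b Fm (- int n) \<sigma> x = A ^ (n - 1) * b ^ n * E (-1) \<sigma> x ^ n"
    "ee A a B b Gm (- int n) \<sigma> x = A ^ n * b ^ (n + 1) * E (-1) \<sigma> x ^ n"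
  unfolding ee_def E_power using assms by (simp_all add: mp_simps del: power_Suc add_uminus_conv_diff flip: diff_conv_add_uminus)

end

text \<open>Now the parameters vary. The constants of \<open>key\<close>, the bound G and R are
  common to all of them, so 1 / G^2 and R can serve as \<epsilon> and x_inf; G^2 < R is the
  condition 1 / \<epsilon> < x_inf.\<close>

locale family = painleve +
  fixes B0 Bx :: "complex set" and \<delta> G R M D C :: real
  assumes B: "open B0" "open Bx" and nz: "\<And>c0. c0 \<in> B0 \<Longrightarrow> c0 \<noteq> 0" "\<And>cx. cx \<in> Bx \<Longrightarrow> cx \<noteq> 0"
    and gam: "\<And>c0 \<sigma>. c0 \<in> B0 \<Longrightarrow> \<sigma> \<in> Bs \<Longrightarrow> norm (gam0p \<theta>0 \<theta>inf c0 \<sigma>) \<le> G"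
      "\<And>c0 \<sigma>. c0 \<in> B0 \<Longrightarrow> \<sigma> \<in> Bs \<Longrightarrow> norm (gam0m \<theta>0 \<theta>inf c0 \<sigma>) \<le> G"
      "\<And>cx \<sigma>. cx \<in> Bx \<Longrightarrow> \<sigma> \<in> Bs \<Longrightarrow> norm (gamxp \<theta>x \<theta>inf cx \<sigma>) \<le> G"
      "\<And>cx \<sigma>. cx \<in> Bx \<Longrightarrow> \<sigma> \<in> Bs \<Longrightarrow> norm (gamxm \<theta>x \<theta>inf cx \<sigma>) \<le> G"
    and G1: "1 \<le> G" and key: "key R M D C" and RG: "G\<^sup>2 < R"
    and RH: "\<And>\<rho>. R < \<rho> \<Longrightarrow> Bd * (ln \<rho> + 3) < \<rho> / 2"
    and sec: "sector \<delta> R \<subseteq> S R" "open (sector \<delta> R)"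
begin

abbreviation g0p :: "complex \<Rightarrow> complex \<Rightarrow> complex" where "g0p \<equiv> gam0p \<theta>0 \<theta>inf"
abbreviation g0m :: "complex \<Rightarrow> complex \<Rightarrow> complex" where "g0m \<equiv> gam0m \<theta>0 \<theta>inf"
abbreviation gxp :: "complex \<Rightarrow> complex \<Rightarrow> complex" where "gxp \<equiv> gamxp \<theta>x \<theta>inf"
abbreviation gxm :: "complex \<Rightarrow> complex \<Rightarrow> complex" where "gxm \<equiv> gamxm \<theta>x \<theta>inf"

abbreviation ec :: "complex \<Rightarrow> complex \<Rightarrow> kind \<Rightarrow> int \<Rightarrow> complex \<Rightarrow> complex \<Rightarrow> complex" where
  "ec c0 cx q n \<sigma> x \<equiv> ee (g0p c0 \<sigma>) (g0m c0 \<sigma>) (gxp cx \<sigma>) (gxm cx \<sigma>) q n \<sigma> x"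

abbreviation Dom :: "complex \<Rightarrow> complex set" where "Dom \<sigma> \<equiv> Sigma_dom \<sigma> (1 / G\<^sup>2) R \<delta>"
abbreviation DD :: "(complex \<times> complex) set" where "DD \<equiv> D_dom Bs (1 / G\<^sup>2) R \<delta>"

definition Y :: "kind \<Rightarrow> fun4" where
  "Y q c0 cx \<sigma> x = ZF (g0p c0 \<sigma>) (g0m c0 \<sigma>) (gxp cx \<sigma>) (gxm cx \<sigma>) q \<sigma> x"

lemma R_R0: "R0 \<le> R" by (rule key_R(1)[OF key])

lemma powr_eq: "x \<in> S R \<Longrightarrow> x powr c = exp (c * Ln x)"
  using S_nonzero by (simp add: powr_def)

lemma XY_eq:
  assumes "x \<in> S R"
  shows "exp x * x powr (\<sigma> - 1) = E 1 \<sigma> x" "exp (- x) * x powr (- \<sigma> - 1) = E (-1) \<sigma> x"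
    "exp x * x powr (\<sigma> - 2) = E 1 \<sigma> x / x" "exp (- x) * x powr (- \<sigma> - 2) = E (-1) \<sigma> x / x"
proof -
  have x: "exp (Ln x) = x" using S_nonzero[OF assms] by simp
  show "exp x * x powr (\<sigma> - 1) = E 1 \<sigma> x" "exp (- x) * x powr (- \<sigma> - 1) = E (-1) \<sigma> x"
    by (simp_all add: powr_eq[OF assms] E_def exp_add[symmetric])
  have "exp x * x powr (\<sigma> - 2) = E 1 \<sigma> x / exp (Ln x)" "exp (- x) * x powr (- \<sigma> - 2) = E (-1) \<sigma> x / exp (Ln x)"
    unfolding powr_eq[OF assms] E_def exp_diff[symmetric] exp_add[symmetric] by (simp_all add: algebra_simps)
  then show "exp x * x powr (\<sigma> - 2) = E 1 \<sigma> x / x" "exp (- x) * x powr (- \<sigma> - 2) = E (-1) \<sigma> x / x" by (simp_all only: x)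
qed

lemma Dom_iff: "x \<in> Dom \<sigma> \<longleftrightarrow> x \<in> sector \<delta> R \<and> norm (E 1 \<sigma> x) < 1 / G\<^sup>2 \<and> norm (E (-1) \<sigma> x) < 1 / G\<^sup>2"
proof (cases "x \<in> sector \<delta> R")
  case True
  then have "x \<in> S R" using sec by blast
  from XY_eq[OF this] True show ?thesis by (auto simp: Sigma_dom_def sector_def)
qed (auto simp: Sigma_dom_def sector_def)

lemma Dom_S: "x \<in> Dom \<sigma> \<Longrightarrow> x \<in> S R" using Dom_iff sec by blast

lemma DD_iff: "(\<sigma>, x) \<in> DD \<longleftrightarrow> \<sigma> \<in> Bs \<and> x \<in> Dom \<sigma>"
  by (auto simp: D_dom_def)

lemma gam_mult:
  assumes "c0 \<in> B0" "cx \<in> Bx"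
  shows "g0p c0 \<sigma> * g0m c0 \<sigma> = kap0 \<sigma>" "gxp cx \<sigma> * gxm cx \<sigma> = kapx \<sigma>"
  using nz[of c0] nz[of cx] assms by (auto simp: gam0p_def gam0m_def gamxp_def gamxm_def kap0_def kapx_def field_simps power2_eq_square)

lemma at_point:
  assumes "c0 \<in> B0" "cx \<in> Bx" "\<sigma> \<in> Bs"
  shows "pt' k Bd Bs \<theta>0 \<theta>x \<theta>inf (g0p c0 \<sigma>) (g0m c0 \<sigma>) (gxp cx \<sigma>) (gxm cx \<sigma>) \<sigma> G R M D C"
  by unfold_locales (use assms gam gam_mult[of c0 cx \<sigma>] G1 key RG RH in auto)

context
  fixes c0 cx \<sigma> x :: complex
  assumes c: "c0 \<in> B0" "cx \<in> Bx" and \<sigma>: "\<sigma> \<in> Bs" and x: "x \<in> Dom \<sigma>"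
begin

interpretation p: pt' k Bd Bs \<theta>0 \<theta>x \<theta>inf "g0p c0 \<sigma>" "g0m c0 \<sigma>" "gxp cx \<sigma>" "gxm cx \<sigma>" \<sigma> G R M D C
  by (rule at_point[OF c \<sigma>])

lemma x_in_U: "x \<in> p.U"
  using x Dom_S[OF x] by (simp add: p.U_def Dom_iff)

lemma Y_has_field_derivative:
  "(Y Ph c0 cx \<sigma> has_field_derivative E 1 \<sigma> x * Y Gp c0 cx \<sigma> x * Y Fm c0 cx \<sigma> x - E (-1) \<sigma> x * Y Gm c0 cx \<sigma> x * Y Fp c0 cx \<sigma> x) (at x)"
  "(Y Fp c0 cx \<sigma> has_field_derivative - 2 * (Y Ph c0 cx \<sigma> x * Y Fp c0 cx \<sigma> x / x + E 1 \<sigma> x * (Y Ph c0 cx \<sigma> x + s0 \<sigma>) * Y Gp c0 cx \<sigma> x)) (at x)"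
  "(Y Gp c0 cx \<sigma> has_field_derivative 2 * (Y Ph c0 cx \<sigma> x * Y Gp c0 cx \<sigma> x / x + E (-1) \<sigma> x * (Y Ph c0 cx \<sigma> x + t0 \<sigma>) * Y Fp c0 cx \<sigma> x)) (at x)"
  "(Y Fm c0 cx \<sigma> has_field_derivative 2 * (Y Ph c0 cx \<sigma> x * Y Fm c0 cx \<sigma> x / x + E (-1) \<sigma> x * (Y Ph c0 cx \<sigma> x + s0 \<sigma>) * Y Gm c0 cx \<sigma> x)) (at x)"
  "(Y Gm c0 cx \<sigma> has_field_derivative - 2 * (Y Ph c0 cx \<sigma> x * Y Gm c0 cx \<sigma> x / x + E 1 \<sigma> x * (Y Ph c0 cx \<sigma> x + t0 \<sigma>) * Y Fm c0 cx \<sigma> x)) (at x)"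
  using p.y_has_field_derivative[OF x_in_U, of Ph] p.y_has_field_derivative[OF x_in_U, of Fp]
    p.y_has_field_derivative[OF x_in_U, of Gp] p.y_has_field_derivative[OF x_in_U, of Fm] p.y_has_field_derivative[OF x_in_U, of Gm]
  unfolding p.FR_def Y_def [abs_def] by simp_all

lemma Y_integrals:
  "(s0 \<sigma> + Y Ph c0 cx \<sigma> x)\<^sup>2 + Y Fp c0 cx \<sigma> x * Y Fm c0 cx \<sigma> x = (\<theta>0 / 2)\<^sup>2"
  "(t0 \<sigma> + Y Ph c0 cx \<sigma> x)\<^sup>2 + Y Gp c0 cx \<sigma> x * Y Gm c0 cx \<sigma> x = (\<theta>x / 2)\<^sup>2"
  using p.first_integral_values[OF x_in_U] by (simp_all add: Y_def)

lemma Y_split: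
  fixes a b :: nat
  defines "e \<equiv> ee (g0p c0 \<sigma>) (g0m c0 \<sigma>) (gxp cx \<sigma>) (gxm cx \<sigma>)"
  shows "Y q c0 cx \<sigma> x = zl q 0 \<sigma> x * e q 0 \<sigma> x + (\<Sum>n\<in>{1..<a}. zl q (int n) \<sigma> x * e q (int n) \<sigma> x)
     + (\<Sum>\<^sub>\<infinity>n\<in>{max 1 a..}. zl q (int n) \<sigma> x * e q (int n) \<sigma> x)
     + (\<Sum>n\<in>{1..<b}. zl q (- int n) \<sigma> x * e q (- int n) \<sigma> x) + (\<Sum>\<^sub>\<infinity>n\<in>{max 1 b..}. zl q (- int n) \<sigma> x * e q (- int n) \<sigma> x)"
    and "(\<lambda>n. zl q (int n) \<sigma> x * e q (int n) \<sigma> x) summable_on N" and "(\<lambda>n. zl q (- int n) \<sigma> x * e q (- int n) \<sigma> x) summable_on N"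
  using infsum_int_split[OF p.zl_e_summable[OF x_in_U, of q]] unfolding e_def Y_def ZF_def by auto

lemma Y_approx:
  "norm (Y q c0 cx \<sigma> x - (\<Sum>n\<in>{-KK N..KK N}. zz N q n \<sigma> x * ec c0 cx q n \<sigma> x))
     \<le> G\<^sup>2 * D * (1 / 2) ^ N"
  using p.ZF_approx[OF x_in_U, of q N] by (simp add: Y_def p.ev_def)

end

text \<open>The exponent of x in the stripped factor: - (\<sigma> + \<theta>inf) / 2 for f_+ and
  (\<sigma> - \<theta>inf) / 2 for g_+, with opposite signs for the lower entries; e^x or e^(-x) is
  added in \<open>pf\<close> through \<open>be\<close>.\<close>

definition pc :: "kind \<Rightarrow> complex \<Rightarrow> complex" where
  "pc q \<sigma> = of_int (- 2 * al q) * t0 \<sigma> + of_int (2 * be q) * s0 \<sigma>"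

definition pf :: "kind \<Rightarrow> complex \<Rightarrow> complex \<Rightarrow> complex" where
  "pf q \<sigma> x = exp (of_int (be q) * x + pc q \<sigma> * Ln x)"

definition W :: "kind \<Rightarrow> fun4" where "W q c0 cx \<sigma> x = pf q \<sigma> x * Y q c0 cx \<sigma> x"

definition F0 :: fun4 where "F0 c0 cx \<sigma> x = s0 \<sigma> + Y Ph c0 cx \<sigma> x"

definition G0 :: fun4 where "G0 c0 cx \<sigma> x = - \<theta>inf / 2 - F0 c0 cx \<sigma> x"

lemma st: "2 * s0 \<sigma> + 2 * t0 \<sigma> = \<sigma>" "- \<theta>inf / 2 - s0 \<sigma> = - t0 \<sigma>" "2 * s0 \<sigma> = (\<sigma> - \<theta>inf) / 2" "2 * t0 \<sigma> = (\<sigma> + \<theta>inf) / 2"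
  by (simp_all add: s0_def t0_def field_simps)

lemma pf_has_field_derivative:
  assumes "x \<in> S R"
  shows "(pf q \<sigma> has_field_derivative pf q \<sigma> x * (of_int (be q) + pc q \<sigma> / x)) (at x)"
  unfolding pf_def [abs_def] using S_not_nonpos[OF assms] S_nonzero[OF assms]
  by (auto intro!: derivative_eq_intros simp: divide_simps)

text \<open>These relations, all due to 2 s0 + 2 t0 = \<sigma>, are the reason why after stripping
  the exponentials occur as X and Y only.\<close>

lemma pf_rel:
  assumes "x \<in> S R"
  shows "pf Gp \<sigma> x * pf Fm \<sigma> x = x * E 1 \<sigma> x" "pf Gm \<sigma> x * pf Fp \<sigma> x = x * E (-1) \<sigma> x"
    "x * (pf Fp \<sigma> x * E 1 \<sigma> x) = pf Gp \<sigma> x" "x * (pf Gp \<sigma> x * E (-1) \<sigma> x) = pf Fp \<sigma> x"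
    "x * (pf Fm \<sigma> x * E (-1) \<sigma> x) = pf Gm \<sigma> x" "x * (pf Gm \<sigma> x * E 1 \<sigma> x) = pf Fm \<sigma> x"
    "pf Fp \<sigma> x * pf Fm \<sigma> x = 1" "pf Gp \<sigma> x * pf Gm \<sigma> x = 1"
proof -
  have x: "exp (Ln x) = x" using S_nonzero[OF assms] by simp
  have s: "s0 \<sigma> = \<sigma> / 2 - t0 \<sigma>" using st(1)[of \<sigma>] by (simp add: field_simps)
  have "pf Gp \<sigma> x * pf Fm \<sigma> x = exp (Ln x) * E 1 \<sigma> x" "pf Gm \<sigma> x * pf Fp \<sigma> x = exp (Ln x) * E (-1) \<sigma> x"
    "exp (Ln x) * (pf Fp \<sigma> x * E 1 \<sigma> x) = pf Gp \<sigma> x" "exp (Ln x) * (pf Gp \<sigma> x * E (-1) \<sigma> x) = pf Fp \<sigma> x"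
    "exp (Ln x) * (pf Fm \<sigma> x * E (-1) \<sigma> x) = pf Gm \<sigma> x" "exp (Ln x) * (pf Gm \<sigma> x * E 1 \<sigma> x) = pf Fm \<sigma> x"
    "pf Fp \<sigma> x * pf Fm \<sigma> x = exp 0" "pf Gp \<sigma> x * pf Gm \<sigma> x = exp 0"
    unfolding pf_def pc_def E_def exp_add[symmetric] s by (intro arg_cong[of _ _ exp]; simp add: algebra_simps)+
  then show "pf Gp \<sigma> x * pf Fm \<sigma> x = x * E 1 \<sigma> x" "pf Gm \<sigma> x * pf Fp \<sigma> x = x * E (-1) \<sigma> x"
    "x * (pf Fp \<sigma> x * E 1 \<sigma> x) = pf Gp \<sigma> x" "x * (pf Gp \<sigma> x * E (-1) \<sigma> x) = pf Fp \<sigma> x"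
    "x * (pf Fm \<sigma> x * E (-1) \<sigma> x) = pf Gm \<sigma> x" "x * (pf Gm \<sigma> x * E 1 \<sigma> x) = pf Fm \<sigma> x"
    "pf Fp \<sigma> x * pf Fm \<sigma> x = 1" "pf Gp \<sigma> x * pf Gm \<sigma> x = 1" unfolding x by simp_all
qed

lemma system:
  assumes c: "c0 \<in> B0" "cx \<in> Bx" and \<sigma>: "\<sigma> \<in> Bs"
  shows "solves_system (\<lambda>x. cscale (F0 c0 cx \<sigma> x) J + cscale (W Fp c0 cx \<sigma> x) Delta_plus + cscale (W Fm c0 cx \<sigma> x) Delta_minus)
     (\<lambda>x. cscale (G0 c0 cx \<sigma> x) J + cscale (W Gp c0 cx \<sigma> x) Delta_plus + cscale (W Gm c0 cx \<sigma> x) Delta_minus) (Dom \<sigma>)"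
proof (rule solves_systemI)
  fix x assume x: "x \<in> Dom \<sigma>"
  note xS = Dom_S[OF x]
  show x0: "x \<noteq> 0" by (rule S_nonzero[OF xS])
  note Yd = Y_has_field_derivative[OF c \<sigma> x]
  note rel = pf_rel[OF xS, of \<sigma>]
  let ?y = "\<lambda>q. Y q c0 cx \<sigma> x" and ?p = "\<lambda>q. pf q \<sigma> x"
  have u: "W Gp c0 cx \<sigma> x * W Fm c0 cx \<sigma> x - W Fp c0 cx \<sigma> x * W Gm c0 cx \<sigma> x
     = x * (E 1 \<sigma> x * ?y Gp * ?y Fm - E (-1) \<sigma> x * ?y Gm * ?y Fp)"
  proof -
    have "W Gp c0 cx \<sigma> x * W Fm c0 cx \<sigma> x - W Fp c0 cx \<sigma> x * W Gm c0 cx \<sigma> x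
      = (?p Gp * ?p Fm) * (?y Gp * ?y Fm) - (?p Gm * ?p Fp) * (?y Gm * ?y Fp)" by (simp add: W_def)
    then show ?thesis unfolding rel by (simp add: algebra_simps)
  qed
  have g: "G0 c0 cx \<sigma> x = - (t0 \<sigma> + ?y Ph)" using st(2)[of \<sigma>] by (simp add: G0_def F0_def algebra_simps)
  have dF0: "(F0 c0 cx \<sigma> has_field_derivative (E 1 \<sigma> x * ?y Gp * ?y Fm - E (-1) \<sigma> x * ?y Gm * ?y Fp)) (at x)"
    unfolding F0_def [abs_def] using Yd(1) by (auto intro!: derivative_eq_intros)
  then show "(F0 c0 cx \<sigma> has_field_derivative (W Gp c0 cx \<sigma> x * W Fm c0 cx \<sigma> x - W Fp c0 cx \<sigma> x * W Gm c0 cx \<sigma> x) / x) (at x)"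
    unfolding u using x0 by simp
  show "(G0 c0 cx \<sigma> has_field_derivative - (W Gp c0 cx \<sigma> x * W Fm c0 cx \<sigma> x - W Fp c0 cx \<sigma> x * W Gm c0 cx \<sigma> x) / x) (at x)"
    unfolding u G0_def [abs_def] using x0 dF0 by (auto intro!: derivative_eq_intros)
  have dW: "(W q c0 cx \<sigma> has_field_derivative ?p q * d + ?p q * (of_int (be q) + pc q \<sigma> / x) * ?y q) (at x)"
    if "(Y q c0 cx \<sigma> has_field_derivative d) (at x)" for q d
    unfolding W_def [abs_def] by (rule DERIV_mult'[OF pf_has_field_derivative[OF xS] that])
  \<comment> \<open>In this and the three analogous identities \<open>pc q / x\<close> restores the
    constant part s0 or t0 of the diagonal entry that multiplies the unknown itself, and
    \<open>be q\<close> the term from J.\<close>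
  have "?p Fp * (- 2 * (?y Ph * ?y Fp / x + E 1 \<sigma> x * (?y Ph + s0 \<sigma>) * ?y Gp)) + ?p Fp * (of_int (be Fp) + pc Fp \<sigma> / x) * ?y Fp
    = 2 * (G0 c0 cx \<sigma> x * W Fp c0 cx \<sigma> x - F0 c0 cx \<sigma> x * W Gp c0 cx \<sigma> x) / x"
    unfolding g W_def F0_def rel(3)[symmetric] using x0 by (simp add: pc_def field_simps)
  with dW[OF Yd(2)] show "(W Fp c0 cx \<sigma> has_field_derivative 2 * (G0 c0 cx \<sigma> x * W Fp c0 cx \<sigma> x - F0 c0 cx \<sigma> x * W Gp c0 cx \<sigma> x) / x) (at x)"
    by (simp only:)
  have "?p Fm * (2 * (?y Ph * ?y Fm / x + E (-1) \<sigma> x * (?y Ph + s0 \<sigma>) * ?y Gm)) + ?p Fm * (of_int (be Fm) + pc Fm \<sigma> / x) * ?y Fm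
    = 2 * (F0 c0 cx \<sigma> x * W Gm c0 cx \<sigma> x - G0 c0 cx \<sigma> x * W Fm c0 cx \<sigma> x) / x"
    unfolding g W_def F0_def rel(5)[symmetric] using x0 by (simp add: pc_def field_simps)
  with dW[OF Yd(4)] show "(W Fm c0 cx \<sigma> has_field_derivative 2 * (F0 c0 cx \<sigma> x * W Gm c0 cx \<sigma> x - G0 c0 cx \<sigma> x * W Fm c0 cx \<sigma> x) / x) (at x)"
    by (simp only:)
  have "?p Gp * (2 * (?y Ph * ?y Gp / x + E (-1) \<sigma> x * (?y Ph + t0 \<sigma>) * ?y Fp)) + ?p Gp * (of_int (be Gp) + pc Gp \<sigma> / x) * ?y Gp
    = - (2 * (G0 c0 cx \<sigma> x * W Fp c0 cx \<sigma> x - F0 c0 cx \<sigma> x * W Gp c0 cx \<sigma> x)) / x + W Gp c0 cx \<sigma> x"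
    unfolding g W_def F0_def rel(4)[symmetric] using x0 by (simp add: pc_def field_simps)
  with dW[OF Yd(3)] show "(W Gp c0 cx \<sigma> has_field_derivative - (2 * (G0 c0 cx \<sigma> x * W Fp c0 cx \<sigma> x - F0 c0 cx \<sigma> x * W Gp c0 cx \<sigma> x)) / x + W Gp c0 cx \<sigma> x) (at x)"
    by (simp only:)
  have "?p Gm * (- 2 * (?y Ph * ?y Gm / x + E 1 \<sigma> x * (?y Ph + t0 \<sigma>) * ?y Fm)) + ?p Gm * (of_int (be Gm) + pc Gm \<sigma> / x) * ?y Gm
    = - (2 * (F0 c0 cx \<sigma> x * W Gm c0 cx \<sigma> x - G0 c0 cx \<sigma> x * W Fm c0 cx \<sigma> x)) / x - W Gm c0 cx \<sigma> x"
    unfolding g W_def F0_def rel(6)[symmetric] using x0 by (simp add: pc_def field_simps)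
  with dW[OF Yd(5)] show "(W Gm c0 cx \<sigma> has_field_derivative - (2 * (F0 c0 cx \<sigma> x * W Gm c0 cx \<sigma> x - G0 c0 cx \<sigma> x * W Fm c0 cx \<sigma> x)) / x - W Gm c0 cx \<sigma> x) (at x)"
    by (simp only:)
qed

lemma integrals:
  assumes c: "c0 \<in> B0" "cx \<in> Bx" and \<sigma>: "\<sigma> \<in> Bs" and x: "x \<in> Dom \<sigma>"
  shows "(F0 c0 cx \<sigma> x)\<^sup>2 + W Fp c0 cx \<sigma> x * W Fm c0 cx \<sigma> x = (\<theta>0 / 2)\<^sup>2"
    "(G0 c0 cx \<sigma> x)\<^sup>2 + W Gp c0 cx \<sigma> x * W Gm c0 cx \<sigma> x = (\<theta>x / 2)\<^sup>2"
proof -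
  note rel = pf_rel[OF Dom_S[OF x], of \<sigma>] and I = Y_integrals[OF c \<sigma> x]
  have "W Fp c0 cx \<sigma> x * W Fm c0 cx \<sigma> x = (pf Fp \<sigma> x * pf Fm \<sigma> x) * (Y Fp c0 cx \<sigma> x * Y Fm c0 cx \<sigma> x)" by (simp add: W_def)
  then show "(F0 c0 cx \<sigma> x)\<^sup>2 + W Fp c0 cx \<sigma> x * W Fm c0 cx \<sigma> x = (\<theta>0 / 2)\<^sup>2" using I by (simp only: rel F0_def mult_1)
  have "W Gp c0 cx \<sigma> x * W Gm c0 cx \<sigma> x = (pf Gp \<sigma> x * pf Gm \<sigma> x) * (Y Gp c0 cx \<sigma> x * Y Gm c0 cx \<sigma> x)" by (simp add: W_def)
  moreover have "(G0 c0 cx \<sigma> x)\<^sup>2 = (t0 \<sigma> + Y Ph c0 cx \<sigma> x)\<^sup>2"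
    using st(2)[of \<sigma>] unfolding G0_def F0_def diff_diff_add[symmetric] by (simp add: power2_eq_square algebra_simps)
  ultimately show "(G0 c0 cx \<sigma> x)\<^sup>2 + W Gp c0 cx \<sigma> x * W Gm c0 cx \<sigma> x = (\<theta>x / 2)\<^sup>2" using I by (simp only: rel mult_1)
qed

section \<open>Joint holomorphy of the entries\<close>

abbreviation D4 :: "(complex \<times> complex \<times> complex \<times> complex) set" where "D4 \<equiv> B0 \<times> Bx \<times> DD"

lemma open_D4: "open D4"
proof -
  have "open {q \<in> Bs \<times> S R. norm ((\<lambda>(\<sigma>, x). E n \<sigma> x) q) < 1 / G\<^sup>2}" for n
  proof -
    have c: "continuous_on (Bs \<times> S R) (\<lambda>q. norm ((\<lambda>(\<sigma>, x). E n \<sigma> x) q))"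
      using hol2R_E[of R n] unfolding hol2R_def by (intro continuous_on_norm) blast
    have o: "open (Bs \<times> S R)" by (intro open_Times Bs_open open_S)
    have "{q \<in> Bs \<times> S R. norm ((\<lambda>(\<sigma>, x). E n \<sigma> x) q) < 1 / G\<^sup>2} = (\<lambda>q. norm ((\<lambda>(\<sigma>, x). E n \<sigma> x) q)) -` {..<1 / G\<^sup>2} \<inter> (Bs \<times> S R)" by auto
    then show ?thesis using c continuous_on_open_vimage[OF o] by (metis open_lessThan)
  qed
  moreover have "DD = {q \<in> Bs \<times> S R. norm ((\<lambda>(\<sigma>, x). E 1 \<sigma> x) q) < 1 / G\<^sup>2} \<inter> {q \<in> Bs \<times> S R. norm ((\<lambda>(\<sigma>, x). E (-1) \<sigma> x) q) < 1 / G\<^sup>2}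
     \<inter> (UNIV \<times> sector \<delta> R)"
    using DD_iff Dom_iff sec by auto
  ultimately have "open DD" using sec by (auto intro!: open_Int open_Times)
  then show ?thesis using B by (intro open_Times)
qed

lemma D4_D: "(a, b, c, d) \<in> D4 \<Longrightarrow> a \<in> B0 \<and> b \<in> Bx \<and> c \<in> Bs \<and> d \<in> Dom c \<and> d \<in> S R"
  using DD_iff Dom_S by blast

lemma hol4: assumes "hol2R R h" shows "holomorphic4_on (\<lambda>a b. h) D4"
  by (rule hol2R_holomorphic4[OF assms open_D4]) (use D4_D in blast)

text \<open>The finite partial sums are visibly holomorphic in all four variables, and the rate in
  \<open>Y_approx\<close> is the same for all parameters, so they converge uniformly on the whole
  domain.\<close>

lemma holomorphic4_Y: "holomorphic4_on (Y q) D4"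
proof (rule holomorphic4_on_uniform_limit[OF open_D4])
  let ?e = "\<lambda>N c0 cx \<sigma> x. \<Sum>n\<in>{-KK N..KK N}. zz N q n \<sigma> x * ec c0 cx q n \<sigma> x"
  have s: "f \<in> PQ \<Longrightarrow> holomorphic4_on (\<lambda>c0 cx \<sigma> x. f \<sigma>) D4" for f by (rule hol4[OF hol2R_sigma[OF PQ_holomorphic]])
  have i0: "holomorphic4_on (\<lambda>c0 cx \<sigma> x. inverse c0) D4" by (rule holomorphic4_on_inverse[OF holomorphic4_on_coord(1)]) (use D4_D nz in blast)
  have ix: "holomorphic4_on (\<lambda>c0 cx \<sigma> x. inverse cx) D4" by (rule holomorphic4_on_inverse[OF holomorphic4_on_coord(2)]) (use D4_D nz in blast)
  have P: "(\<lambda>\<sigma>. 1 / 4 * (\<sigma> + 2 * \<theta>0 - \<theta>inf)) \<in> PQ" "(\<lambda>\<sigma>. 1 / 4 * (- \<sigma> + 2 * \<theta>0 + \<theta>inf)) \<in> PQ"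
    "(\<lambda>\<sigma>. 1 / 4 * (- \<sigma> + 2 * \<theta>x - \<theta>inf)) \<in> PQ" "(\<lambda>\<sigma>. 1 / 4 * (\<sigma> + 2 * \<theta>x + \<theta>inf)) \<in> PQ"
    by (intro PQ_add PQ_diff PQ_mult PQ_minus PQ_sigma PQ_const PQ_numeral)+
  have g: "holomorphic4_on (\<lambda>c0 cx \<sigma> x. g0p c0 \<sigma>) D4" "holomorphic4_on (\<lambda>c0 cx \<sigma> x. g0m c0 \<sigma>) D4"
    "holomorphic4_on (\<lambda>c0 cx \<sigma> x. gxp cx \<sigma>) D4" "holomorphic4_on (\<lambda>c0 cx \<sigma> x. gxm cx \<sigma>) D4"
    using holomorphic4_on_mult[OF holomorphic4_on_coord(1) s[OF P(1)]] holomorphic4_on_mult[OF i0 s[OF P(2)]]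
      holomorphic4_on_mult[OF holomorphic4_on_coord(2) s[OF P(3)]] holomorphic4_on_mult[OF ix s[OF P(4)]]
    by (simp_all add: gam0p_def gam0m_def gamxp_def gamxm_def)
  show "holomorphic4_on (?e N) D4" for N
    unfolding ee_def by (intro holomorphic4_on_sum holomorphic4_on_mult holomorphic4_on_mp g hol4 hol2R_E hol2R_subset[OF hol2_zz R_R0])
  show "uniform_limit D4 (\<lambda>N (a, b, c, d). ?e N a b c d) (\<lambda>(a, b, c, d). Y q a b c d) sequentially"
  proof (rule uniform_limitI)
    fix \<epsilon> :: real assume "\<epsilon> > 0"
    have "(\<lambda>N. G\<^sup>2 * D * (1 / 2) ^ N) \<longlonglongrightarrow> 0" using tendsto_mult_right_zero[OF LIMSEQ_power_zero[of "1/2::real"]] by simp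
    then have "\<forall>\<^sub>F N in sequentially. G\<^sup>2 * D * (1 / 2) ^ N < \<epsilon>" using order_tendstoD(2) \<open>\<epsilon> > 0\<close> by blast
    then show "\<forall>\<^sub>F N in sequentially. \<forall>p\<in>D4. dist (case p of (a, b, c, d) \<Rightarrow> ?e N a b c d) (case p of (a, b, c, d) \<Rightarrow> Y q a b c d) < \<epsilon>"
    proof eventually_elim
      case (elim N)
      show ?case
      proof
        fix p assume "p \<in> D4"
        moreover obtain a b c d where p: "p = (a, b, c, d)" using prod_cases4 by blast
        ultimately have "a \<in> B0" "b \<in> Bx" "c \<in> Bs" "d \<in> Dom c" using D4_D by blast+
        from Y_approx[OF this, of q N] elim have "dist (?e N a b c d) (Y q a b c d) < \<epsilon>" by (simp add: dist_norm norm_minus_commute)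
        then show "dist (case p of (a, b, c, d) \<Rightarrow> ?e N a b c d) (case p of (a, b, c, d) \<Rightarrow> Y q a b c d) < \<epsilon>" by (simp only: p prod.case)
      qed
    qed
  qed
qed

lemma PQ_pc: "pc q \<in> PQ"
  unfolding pc_def [abs_def] by (intro PQ_add PQ_mult PQ_int PQ_params)

lemma holomorphic4_all: "\<forall>h\<in>{F0, W Fp, W Fm, G0, W Gp, W Gm}. holomorphic4_on h D4"
proof -
  have W: "holomorphic4_on (W q) D4" for q
  proof -
    have "hol2R R (pf q)" unfolding pf_def [abs_def] by (rule hol2R_exp[OF PQ_pc])
    from holomorphic4_on_mult[OF hol4[OF this] holomorphic4_Y[of q]] show ?thesis unfolding W_def [abs_def] .
  qed
  have F: "holomorphic4_on F0 D4"
    unfolding F0_def [abs_def] by (intro holomorphic4_on_add holomorphic4_Y hol4 hol2R_sigma PQ_holomorphic PQ_params)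
  have "holomorphic4_on G0 D4"
    using holomorphic4_on_add[OF holomorphic4_on_const[of "- \<theta>inf / 2"] holomorphic4_on_mult[OF holomorphic4_on_const[of "-1"] F]]
    unfolding G0_def [abs_def] by simp
  then show ?thesis using W F by blast
qed

section \<open>The bracket symbols and the series of the theorem\<close>

lemma br: "Asy R m h \<Longrightarrow> brk \<theta>0 \<theta>x \<theta>inf B0 Bx Bs \<delta> R m (\<lambda>c0 cx. h)"
  by (rule Asy_brk[OF _ B sec])

lemma br_zl: "ordk q n = m \<Longrightarrow> brk \<theta>0 \<theta>x \<theta>inf B0 Bx Bs \<delta> R m (\<lambda>c0 cx. zl q n)"
  using br[OF Asy_zl[OF key, of q n]] by simp

lemma br_0: "q \<noteq> Ph \<Longrightarrow> brk \<theta>0 \<theta>x \<theta>inf B0 Bx Bs \<delta> R 1 (\<lambda>c0 cx \<sigma> x. zl q 0 \<sigma> x - 1)"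
  using br[OF zl_leading[OF key, of q 0]] by (simp add: z0_def)

lemma br_Ph: "\<bar>n\<bar> = 1 \<Longrightarrow> brk \<theta>0 \<theta>x \<theta>inf B0 Bx Bs \<delta> R 1 (\<lambda>c0 cx \<sigma> x. zl Ph n \<sigma> x - 1)"
  using br[OF zl_leading[OF key, of Ph n]] by (simp add: z0_def)

lemma br_s:
  assumes q: "q \<noteq> Ph" and s: "s = sg q"
  shows "brk \<theta>0 \<theta>x \<theta>inf B0 Bx Bs \<delta> R 1 (\<lambda>c0 cx \<sigma> x. - zl q s \<sigma> x - 2 * tau q \<sigma>)"
proof -
  have "Asy R 1 (\<lambda>\<sigma> x. of_int (-1) * (zl q s \<sigma> x - z0 q s \<sigma> x))"
    by (intro Asy_cmult PQ_int R_R0 zl_leading[OF key])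
  then have "Asy R 1 (\<lambda>\<sigma> x. - zl q s \<sigma> x - 2 * tau q \<sigma>)"
    by (rule Asy_cong) (use q sg_cases[OF q] in \<open>auto simp: z0_def s\<close>)
  then show ?thesis by (rule br)
qed

lemma br_2s:
  assumes q: "q \<noteq> Ph" and s: "s = 2 * sg q"
  shows "brk \<theta>0 \<theta>x \<theta>inf B0 Bx Bs \<delta> R 1 (\<lambda>c0 cx \<sigma> x. - zl q s \<sigma> x - 1)"
proof -
  have "Asy R 1 (\<lambda>\<sigma> x. of_int (-1) * (zl q s \<sigma> x - z0 q s \<sigma> x))"
    by (intro Asy_cmult PQ_int R_R0 zl_leading[OF key])
  then have "Asy R 1 (\<lambda>\<sigma> x. - zl q s \<sigma> x - 1)"
    by (rule Asy_cong) (use q sg_cases[OF q] in \<open>auto simp: z0_def s\<close>)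
  then show ?thesis by (rule br)
qed

text \<open>In the theorem this coefficient appears as 2 (1 + [x^-1]) in front of X / x or Y / x,
  whence the multiplication by x / 2.\<close>

lemma br_minus_s:
  assumes q: "q \<noteq> Ph" and s: "s = - sg q"
  shows "brk \<theta>0 \<theta>x \<theta>inf B0 Bx Bs \<delta> R 1 (\<lambda>c0 cx \<sigma> x. x * zl q s \<sigma> x / 2 - 1)"
proof -
  have "Asy R 1 (\<lambda>\<sigma> x. 1 / 2 * (x * zl q (- sg q) \<sigma> x - 2))"
    by (intro Asy_cmult[where f = "\<lambda>\<sigma>. 1 / 2"] PQ_numeral(2) R_R0 zl_minus_s[OF key q])
  then have "Asy R 1 (\<lambda>\<sigma> x. x * zl q s \<sigma> x / 2 - 1)" by (simp add: s algebra_simps)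
  then show ?thesis by (rule br)
qed

lemma br_Ph_0:
  "brk \<theta>0 \<theta>x \<theta>inf B0 Bx Bs \<delta> R 3
     (\<lambda>c0 cx \<sigma> x. zl Ph 0 \<sigma> x + 1 / 2 * ((\<sigma> + \<theta>inf) * kap0 \<sigma> + (\<sigma> - \<theta>inf) * kapx \<sigma>) / x ^ 2)"
proof -
  have "1 / 2 * ((\<sigma> + \<theta>inf) * kap0 \<sigma> + (\<sigma> - \<theta>inf) * kapx \<sigma>) = 2 * (s0 \<sigma> * kapx \<sigma> + t0 \<sigma> * kap0 \<sigma>)" for \<sigma>
    by (simp add: s0_def t0_def field_simps)
  then show ?thesis using br[OF zl_Ph_0[OF key]] by (simp only:)
qed

lemma sums_12: "(\<Sum>n\<in>{Suc 0..<3}. f n) = f 1 + f (2::nat)" "(\<Sum>n\<in>{Suc 0..<2}. f n) = f (1::nat)" for f :: "nat \<Rightarrow> complex"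
  by (simp_all add: numeral_eq_Suc)

text \<open>The common frame of the five series: a and b are the indices at which the tails in X and
  Y start, z is a constant split off beforehand, and \<open>eq\<close> leaves only a finite
  rearrangement to be checked.\<close>

lemma Y_series:
  assumes c: "c0 \<in> B0" "cx \<in> Bx" and \<sigma>: "\<sigma> \<in> Bs" and x: "x \<in> Dom \<sigma>" and ab: "1 \<le> a" "1 \<le> b"
    and U: "\<And>n. a \<le> n \<Longrightarrow> U n = zl q (int n) \<sigma> x * ec c0 cx q (int n) \<sigma> x"
    and V: "\<And>n. b \<le> n \<Longrightarrow> V n = zl q (- int n) \<sigma> x * ec c0 cx q (- int n) \<sigma> x"
    and y: "y = z + Y q c0 cx \<sigma> x"
    and eq: "z + (zl q 0 \<sigma> x * ec c0 cx q 0 \<sigma> x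
       + (\<Sum>n\<in>{1..<a}. zl q (int n) \<sigma> x * ec c0 cx q (int n) \<sigma> x) + infsum U {a..}
       + (\<Sum>n\<in>{1..<b}. zl q (- int n) \<sigma> x * ec c0 cx q (- int n) \<sigma> x) + infsum V {b..}) = r"
  shows "U summable_on {a..} \<and> V summable_on {b..} \<and> y = r"
proof -
  note Y = Y_split[OF c \<sigma> x, where q = q] and U' = U[OF iffD1[OF atLeast_iff]] and V' = V[OF iffD1[OF atLeast_iff]]
  have m: "max 1 a = a" "max 1 b = b" using ab by simp_all
  have "infsum U {a..} = (\<Sum>\<^sub>\<infinity>n\<in>{a..}. zl q (int n) \<sigma> x * ec c0 cx q (int n) \<sigma> x)"
    "infsum V {b..} = (\<Sum>\<^sub>\<infinity>n\<in>{b..}. zl q (- int n) \<sigma> x * ec c0 cx q (- int n) \<sigma> x)"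
    by (rule infsum_cong, rule U', assumption) (rule infsum_cong, rule V', assumption)
  then have "y = r"
    unfolding eq[symmetric] y using Y(1)[of a b, unfolded m] by (simp only:)
  moreover have "U summable_on {a..}" "V summable_on {b..}"
    by (rule iffD2[OF summable_on_cong Y(2)], rule U', assumption) (rule iffD2[OF summable_on_cong Y(3)], rule V', assumption)
  ultimately show ?thesis by blast
qed

lemma W_powr:
  assumes "x \<in> S R"
  shows "x powr ((\<sigma> + \<theta>inf) / 2) * W Fp c0 cx \<sigma> x = Y Fp c0 cx \<sigma> x"
    "exp (- x) * x powr (- (\<sigma> - \<theta>inf) / 2) * W Gp c0 cx \<sigma> x = Y Gp c0 cx \<sigma> x"
    "x powr (- (\<sigma> + \<theta>inf) / 2) * W Fm c0 cx \<sigma> x = Y Fm c0 cx \<sigma> x"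
    "exp x * x powr ((\<sigma> - \<theta>inf) / 2) * W Gm c0 cx \<sigma> x = Y Gm c0 cx \<sigma> x"
proof -
  have 1: "exp u * (exp v * y) = y" if "u + v = 0" for u v y :: complex
    using that by (simp add: mult.assoc[symmetric] exp_add[symmetric])
  show "x powr ((\<sigma> + \<theta>inf) / 2) * W Fp c0 cx \<sigma> x = Y Fp c0 cx \<sigma> x"
    "x powr (- (\<sigma> + \<theta>inf) / 2) * W Fm c0 cx \<sigma> x = Y Fm c0 cx \<sigma> x"
    unfolding powr_eq[OF assms] W_def pf_def by (rule 1, simp add: pc_def s0_def t0_def field_simps)+
  show "exp (- x) * x powr (- (\<sigma> - \<theta>inf) / 2) * W Gp c0 cx \<sigma> x = Y Gp c0 cx \<sigma> x"
    "exp x * x powr ((\<sigma> - \<theta>inf) / 2) * W Gm c0 cx \<sigma> x = Y Gm c0 cx \<sigma> x"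
    unfolding powr_eq[OF assms] W_def pf_def exp_add[symmetric] by (rule 1, simp add: pc_def s0_def t0_def field_simps)+
qed

text \<open>The witness for w is written with \<open>kap0\<close> and \<open>kapx\<close>, so that
  it depends on \<sigma> and x alone as \<open>Asy\<close> requires; \<open>gam_mult\<close>
  identifies them with the products of \<gamma>s.\<close>

lemma series_F0: "f0_series \<theta>0 \<theta>x \<theta>inf B0 Bx Bs \<delta> (1 / G\<^sup>2) R F0"
  unfolding f0_series_def Let_def
proof (rule exI[of _ "\<lambda>c0 cx \<sigma> x. zl Ph 0 \<sigma> x + 1 / 2 * ((\<sigma> + \<theta>inf) * kap0 \<sigma> + (\<sigma> - \<theta>inf) * kapx \<sigma>) / x ^ 2"],
    rule exI[of _ "\<lambda>c0 cx \<sigma> x. zl Ph 1 \<sigma> x - 1"],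
    rule exI[of _ "\<lambda>c0 cx \<sigma> x. zl Ph (- 1) \<sigma> x - 1"],
    rule exI[of _ "\<lambda>n c0 cx. zl Ph (int n)"], rule exI[of _ "\<lambda>n c0 cx. zl Ph (- int n)"], intro conjI allI impI ballI)
  fix c0 cx p assume c: "c0 \<in> B0" "cx \<in> Bx" and p: "p \<in> DD"
  obtain \<sigma> x where p': "p = (\<sigma>, x)" by (cases p)
  have \<sigma>: "\<sigma> \<in> Bs" and x: "x \<in> Dom \<sigma>" using p DD_iff by (auto simp: p')
  note x0 = S_nonzero[OF Dom_S[OF x]]
  show "case p of (\<sigma>, x) \<Rightarrow>
      (\<lambda>n. (g0m c0 \<sigma> * gxp cx \<sigma>) ^ n * zl Ph (int n) \<sigma> x * (exp x * x powr (\<sigma> - 1)) ^ n) summable_on {2..} \<and>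
      (\<lambda>n. (g0p c0 \<sigma> * gxm cx \<sigma>) ^ n * zl Ph (- int n) \<sigma> x * (exp (- x) * x powr (- \<sigma> - 1)) ^ n) summable_on {2..} \<and>
      F0 c0 cx \<sigma> x =
        (\<sigma> - \<theta>inf) / 4 - 1 / 2 * ((\<sigma> + \<theta>inf) * g0p c0 \<sigma> * g0m c0 \<sigma> + (\<sigma> - \<theta>inf) * gxp cx \<sigma> * gxm cx \<sigma>) / x ^ 2
        + (zl Ph 0 \<sigma> x + 1 / 2 * ((\<sigma> + \<theta>inf) * kap0 \<sigma> + (\<sigma> - \<theta>inf) * kapx \<sigma>) / x ^ 2)
        + g0m c0 \<sigma> * gxp cx \<sigma> * (1 + (zl Ph 1 \<sigma> x - 1)) * (exp x * x powr (\<sigma> - 1))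
        + (\<Sum>\<^sub>\<infinity>n\<in>{2..}. (g0m c0 \<sigma> * gxp cx \<sigma>) ^ n * zl Ph (int n) \<sigma> x * (exp x * x powr (\<sigma> - 1)) ^ n)
        + g0p c0 \<sigma> * gxm cx \<sigma> * (1 + (zl Ph (- 1) \<sigma> x - 1)) * (exp (- x) * x powr (- \<sigma> - 1))
        + (\<Sum>\<^sub>\<infinity>n\<in>{2..}. (g0p c0 \<sigma> * gxm cx \<sigma>) ^ n * zl Ph (- int n) \<sigma> x * (exp (- x) * x powr (- \<sigma> - 1)) ^ n)"
    unfolding p' prod.case XY_eq[OF Dom_S[OF x]]
  proof (rule Y_series[OF c \<sigma> x, where q = Ph and z = "s0 \<sigma>"])
    fix n :: nat assume "2 \<le> n"
    then have n: "n = Suc (n - 1)" "1 \<le> n" by auto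
    show "(g0m c0 \<sigma> * gxp cx \<sigma>) ^ n * zl Ph (int n) \<sigma> x * E 1 \<sigma> x ^ n = zl Ph (int n) \<sigma> x * ec c0 cx Ph (int n) \<sigma> x"
      unfolding ee_int[OF n(2)] by (subst (1 2 3 4) n(1)) (simp add: power_mult_distrib)
  next
    fix n :: nat assume "2 \<le> n"
    then have n: "n = Suc (n - 1)" "1 \<le> n" by auto
    show "(g0p c0 \<sigma> * gxm cx \<sigma>) ^ n * zl Ph (- int n) \<sigma> x * E (- 1) \<sigma> x ^ n = zl Ph (- int n) \<sigma> x * ec c0 cx Ph (- int n) \<sigma> x"
      unfolding ee_int[OF n(2)] by (subst (1 2 3 4) n(1)) (simp add: power_mult_distrib)
  qed (use x0 in \<open>simp_all add: sums_12 ee_0 ee_int[of 1, simplified] ee_int[of 2, simplified] F0_def s0_def gam_mult[OF c, of \<sigma>, symmetric] algebra_simps add_divide_distrib diff_divide_distrib\<close>)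
qed (rule br_Ph_0 br_Ph br_zl; simp add: ordk_def o1_def oP_def)+

text \<open>The coefficients at \<open>sg q\<close> and \<open>2 * sg q\<close> stand behind a minus
  sign in the theorem, hence the negated witnesses. The other three off-diagonal series follow the
  same pattern, with X and Y exchanged when \<open>sg q\<close> is - 1.\<close>

lemma series_Fp: "fp_series \<theta>0 \<theta>x \<theta>inf B0 Bx Bs \<delta> (1 / G\<^sup>2) R (W Fp)"
  unfolding fp_series_def Let_def
proof (rule exI[of _ "\<lambda>c0 cx \<sigma> x. zl Fp 0 \<sigma> x - 1"],
    rule exI[of _ "\<lambda>c0 cx \<sigma> x. - zl Fp 1 \<sigma> x - 2 * tau Fp \<sigma>"],
    rule exI[of _ "\<lambda>c0 cx \<sigma> x. - zl Fp 2 \<sigma> x - 1"],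
    rule exI[of _ "\<lambda>c0 cx \<sigma> x. x * zl Fp (- 1) \<sigma> x / 2 - 1"],
    rule exI[of _ "\<lambda>n c0 cx. zl Fp (int n)"], rule exI[of _ "\<lambda>n c0 cx. zl Fp (- int n)"], intro conjI allI impI ballI)
  fix c0 cx p assume c: "c0 \<in> B0" "cx \<in> Bx" and p: "p \<in> DD"
  obtain \<sigma> x where p': "p = (\<sigma>, x)" by (cases p)
  have \<sigma>: "\<sigma> \<in> Bs" and x: "x \<in> Dom \<sigma>" using p DD_iff by (auto simp: p')
  note x0 = S_nonzero[OF Dom_S[OF x]]
  show "case p of (\<sigma>, x) \<Rightarrow>
      (\<lambda>n. gxp cx \<sigma> * (g0m c0 \<sigma> * gxp cx \<sigma>) ^ (n - 1) * zl Fp (int n) \<sigma> x * (exp x * x powr (\<sigma> - 1)) ^ n) summable_on {3..} \<and>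
      (\<lambda>n. g0p c0 \<sigma> * (g0p c0 \<sigma> * gxm cx \<sigma>) ^ n * zl Fp (- int n) \<sigma> x * (exp (- x) * x powr (- \<sigma> - 1)) ^ n) summable_on {2..} \<and>
      x powr ((\<sigma> + \<theta>inf) / 2) * W Fp c0 cx \<sigma> x = g0p c0 \<sigma> * (1 + (zl Fp 0 \<sigma> x - 1))
        - gxp cx \<sigma> * ((\<sigma> - \<theta>inf) / 2 + (- zl Fp 1 \<sigma> x - 2 * tau Fp \<sigma>)) * (exp x * x powr (\<sigma> - 1))
        - g0m c0 \<sigma> * gxp cx \<sigma> ^ 2 * (1 + (- zl Fp 2 \<sigma> x - 1)) * (exp x * x powr (\<sigma> - 1)) ^ 2
        + (\<Sum>\<^sub>\<infinity>n\<in>{3..}. gxp cx \<sigma> * (g0m c0 \<sigma> * gxp cx \<sigma>) ^ (n - 1) * zl Fp (int n) \<sigma> x * (exp x * x powr (\<sigma> - 1)) ^ n)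
        + 2 * g0p c0 \<sigma> ^ 2 * gxm cx \<sigma> * (1 + (x * zl Fp (- 1) \<sigma> x / 2 - 1)) * (exp (- x) * x powr (- \<sigma> - 2))
        + (\<Sum>\<^sub>\<infinity>n\<in>{2..}. g0p c0 \<sigma> * (g0p c0 \<sigma> * gxm cx \<sigma>) ^ n * zl Fp (- int n) \<sigma> x * (exp (- x) * x powr (- \<sigma> - 1)) ^ n)"
    unfolding p' prod.case W_powr[OF Dom_S[OF x]] XY_eq[OF Dom_S[OF x]]
  proof (rule Y_series[OF c \<sigma> x, where q = Fp and z = 0])
    fix n :: nat assume "3 \<le> n"
    \<comment> \<open>Makes the exponents n and n - 1 comparable: the monomial has one factor
      \<open>g0m\<close> less than \<open>gxp\<close>.\<close>
    then have n: "n = Suc (n - 1)" "1 \<le> n" by auto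
    show "gxp cx \<sigma> * (g0m c0 \<sigma> * gxp cx \<sigma>) ^ (n - 1) * zl Fp (int n) \<sigma> x * E 1 \<sigma> x ^ n = zl Fp (int n) \<sigma> x * ec c0 cx Fp (int n) \<sigma> x"
      unfolding ee_int[OF n(2)] by (subst (1 2 3 4) n(1)) (simp add: power_mult_distrib)
  next
    fix n :: nat assume "2 \<le> n"
    then have n: "n = Suc (n - 1)" "1 \<le> n" by auto
    show "g0p c0 \<sigma> * (g0p c0 \<sigma> * gxm cx \<sigma>) ^ n * zl Fp (- int n) \<sigma> x * E (- 1) \<sigma> x ^ n = zl Fp (- int n) \<sigma> x * ec c0 cx Fp (- int n) \<sigma> x"
      unfolding ee_int[OF n(2)] by (subst (1 2 3 4) n(1)) (simp add: power_mult_distrib)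
  qed (use x0 in \<open>simp_all add: sums_12 ee_0 ee_int[of 1, simplified] ee_int[of 2, simplified] s0_def t0_def field_simps power2_eq_square\<close>)
qed (rule br_0 br_s br_2s br_minus_s br_zl; simp add: ordk_def o1_def oP_def)+

lemma series_Gp: "gp_series \<theta>0 \<theta>x \<theta>inf B0 Bx Bs \<delta> (1 / G\<^sup>2) R (W Gp)"
  unfolding gp_series_def Let_def
proof (rule exI[of _ "\<lambda>c0 cx \<sigma> x. zl Gp 0 \<sigma> x - 1"],
    rule exI[of _ "\<lambda>c0 cx \<sigma> x. x * zl Gp 1 \<sigma> x / 2 - 1"],
    rule exI[of _ "\<lambda>c0 cx \<sigma> x. - zl Gp (- 1) \<sigma> x - 2 * tau Gp \<sigma>"],
    rule exI[of _ "\<lambda>c0 cx \<sigma> x. - zl Gp (- 2) \<sigma> x - 1"],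
    rule exI[of _ "\<lambda>n c0 cx. zl Gp (int n)"], rule exI[of _ "\<lambda>n c0 cx. zl Gp (- int n)"], intro conjI allI impI ballI)
  fix c0 cx p assume c: "c0 \<in> B0" "cx \<in> Bx" and p: "p \<in> DD"
  obtain \<sigma> x where p': "p = (\<sigma>, x)" by (cases p)
  have \<sigma>: "\<sigma> \<in> Bs" and x: "x \<in> Dom \<sigma>" using p DD_iff by (auto simp: p')
  note x0 = S_nonzero[OF Dom_S[OF x]]
  show "case p of (\<sigma>, x) \<Rightarrow>
      (\<lambda>n. gxp cx \<sigma> * (g0m c0 \<sigma> * gxp cx \<sigma>) ^ n * zl Gp (int n) \<sigma> x * (exp x * x powr (\<sigma> - 1)) ^ n) summable_on {2..} \<and>
      (\<lambda>n. g0p c0 \<sigma> * (g0p c0 \<sigma> * gxm cx \<sigma>) ^ (n - 1) * zl Gp (- int n) \<sigma> x * (exp (- x) * x powr (- \<sigma> - 1)) ^ n) summable_on {3..} \<and>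
      exp (- x) * x powr (- (\<sigma> - \<theta>inf) / 2) * W Gp c0 cx \<sigma> x = gxp cx \<sigma> * (1 + (zl Gp 0 \<sigma> x - 1))
        + 2 * g0m c0 \<sigma> * gxp cx \<sigma> ^ 2 * (1 + (x * zl Gp 1 \<sigma> x / 2 - 1)) * (exp x * x powr (\<sigma> - 2))
        + (\<Sum>\<^sub>\<infinity>n\<in>{2..}. gxp cx \<sigma> * (g0m c0 \<sigma> * gxp cx \<sigma>) ^ n * zl Gp (int n) \<sigma> x * (exp x * x powr (\<sigma> - 1)) ^ n)
        - g0p c0 \<sigma> * ((\<sigma> + \<theta>inf) / 2 + (- zl Gp (- 1) \<sigma> x - 2 * tau Gp \<sigma>)) * (exp (- x) * x powr (- \<sigma> - 1))
        - g0p c0 \<sigma> ^ 2 * gxm cx \<sigma> * (1 + (- zl Gp (- 2) \<sigma> x - 1)) * (exp (- x) * x powr (- \<sigma> - 1)) ^ 2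
        + (\<Sum>\<^sub>\<infinity>n\<in>{3..}. g0p c0 \<sigma> * (g0p c0 \<sigma> * gxm cx \<sigma>) ^ (n - 1) * zl Gp (- int n) \<sigma> x * (exp (- x) * x powr (- \<sigma> - 1)) ^ n)"
    unfolding p' prod.case W_powr[OF Dom_S[OF x]] XY_eq[OF Dom_S[OF x]]
  proof (rule Y_series[OF c \<sigma> x, where q = Gp and z = 0])
    fix n :: nat assume "2 \<le> n"
    then have n: "n = Suc (n - 1)" "1 \<le> n" by auto
    show "gxp cx \<sigma> * (g0m c0 \<sigma> * gxp cx \<sigma>) ^ n * zl Gp (int n) \<sigma> x * E 1 \<sigma> x ^ n = zl Gp (int n) \<sigma> x * ec c0 cx Gp (int n) \<sigma> x"
      unfolding ee_int[OF n(2)] by (subst (1 2 3 4) n(1)) (simp add: power_mult_distrib)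
  next
    fix n :: nat assume "3 \<le> n"
    then have n: "n = Suc (n - 1)" "1 \<le> n" by auto
    show "g0p c0 \<sigma> * (g0p c0 \<sigma> * gxm cx \<sigma>) ^ (n - 1) * zl Gp (- int n) \<sigma> x * E (- 1) \<sigma> x ^ n = zl Gp (- int n) \<sigma> x * ec c0 cx Gp (- int n) \<sigma> x"
      unfolding ee_int[OF n(2)] by (subst (1 2 3 4) n(1)) (simp add: power_mult_distrib)
  qed (use x0 in \<open>simp_all add: sums_12 ee_0 ee_int[of 1, simplified] ee_int[of 2, simplified] s0_def t0_def field_simps power2_eq_square\<close>)
qed (rule br_0 br_s br_2s br_minus_s br_zl; simp add: ordk_def o1_def oP_def)+

lemma series_Fm: "fm_series \<theta>0 \<theta>x \<theta>inf B0 Bx Bs \<delta> (1 / G\<^sup>2) R (W Fm)"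
  unfolding fm_series_def Let_def
proof (rule exI[of _ "\<lambda>c0 cx \<sigma> x. zl Fm 0 \<sigma> x - 1"],
    rule exI[of _ "\<lambda>c0 cx \<sigma> x. x * zl Fm 1 \<sigma> x / 2 - 1"],
    rule exI[of _ "\<lambda>c0 cx \<sigma> x. - zl Fm (- 1) \<sigma> x - 2 * tau Fm \<sigma>"],
    rule exI[of _ "\<lambda>c0 cx \<sigma> x. - zl Fm (- 2) \<sigma> x - 1"],
    rule exI[of _ "\<lambda>n c0 cx. zl Fm (int n)"], rule exI[of _ "\<lambda>n c0 cx. zl Fm (- int n)"], intro conjI allI impI ballI)
  fix c0 cx p assume c: "c0 \<in> B0" "cx \<in> Bx" and p: "p \<in> DD"
  obtain \<sigma> x where p': "p = (\<sigma>, x)" by (cases p)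
  have \<sigma>: "\<sigma> \<in> Bs" and x: "x \<in> Dom \<sigma>" using p DD_iff by (auto simp: p')
  note x0 = S_nonzero[OF Dom_S[OF x]]
  show "case p of (\<sigma>, x) \<Rightarrow>
      (\<lambda>n. g0m c0 \<sigma> * (g0m c0 \<sigma> * gxp cx \<sigma>) ^ n * zl Fm (int n) \<sigma> x * (exp x * x powr (\<sigma> - 1)) ^ n) summable_on {2..} \<and>
      (\<lambda>n. gxm cx \<sigma> * (g0p c0 \<sigma> * gxm cx \<sigma>) ^ (n - 1) * zl Fm (- int n) \<sigma> x * (exp (- x) * x powr (- \<sigma> - 1)) ^ n) summable_on {3..} \<and>
      x powr (- (\<sigma> + \<theta>inf) / 2) * W Fm c0 cx \<sigma> x = g0m c0 \<sigma> * (1 + (zl Fm 0 \<sigma> x - 1))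
        + 2 * g0m c0 \<sigma> ^ 2 * gxp cx \<sigma> * (1 + (x * zl Fm 1 \<sigma> x / 2 - 1)) * (exp x * x powr (\<sigma> - 2))
        + (\<Sum>\<^sub>\<infinity>n\<in>{2..}. g0m c0 \<sigma> * (g0m c0 \<sigma> * gxp cx \<sigma>) ^ n * zl Fm (int n) \<sigma> x * (exp x * x powr (\<sigma> - 1)) ^ n)
        - gxm cx \<sigma> * ((\<sigma> - \<theta>inf) / 2 + (- zl Fm (- 1) \<sigma> x - 2 * tau Fm \<sigma>)) * (exp (- x) * x powr (- \<sigma> - 1))
        - g0p c0 \<sigma> * gxm cx \<sigma> ^ 2 * (1 + (- zl Fm (- 2) \<sigma> x - 1)) * (exp (- x) * x powr (- \<sigma> - 1)) ^ 2
        + (\<Sum>\<^sub>\<infinity>n\<in>{3..}. gxm cx \<sigma> * (g0p c0 \<sigma> * gxm cx \<sigma>) ^ (n - 1) * zl Fm (- int n) \<sigma> x * (exp (- x) * x powr (- \<sigma> - 1)) ^ n)"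
    unfolding p' prod.case W_powr[OF Dom_S[OF x]] XY_eq[OF Dom_S[OF x]]
  proof (rule Y_series[OF c \<sigma> x, where q = Fm and z = 0])
    fix n :: nat assume "2 \<le> n"
    then have n: "n = Suc (n - 1)" "1 \<le> n" by auto
    show "g0m c0 \<sigma> * (g0m c0 \<sigma> * gxp cx \<sigma>) ^ n * zl Fm (int n) \<sigma> x * E 1 \<sigma> x ^ n = zl Fm (int n) \<sigma> x * ec c0 cx Fm (int n) \<sigma> x"
      unfolding ee_int[OF n(2)] by (subst (1 2 3 4) n(1)) (simp add: power_mult_distrib)
  next
    fix n :: nat assume "3 \<le> n"
    then have n: "n = Suc (n - 1)" "1 \<le> n" by auto
    show "gxm cx \<sigma> * (g0p c0 \<sigma> * gxm cx \<sigma>) ^ (n - 1) * zl Fm (- int n) \<sigma> x * E (- 1) \<sigma> x ^ n = zl Fm (- int n) \<sigma> x * ec c0 cx Fm (- int n) \<sigma> x"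
      unfolding ee_int[OF n(2)] by (subst (1 2 3 4) n(1)) (simp add: power_mult_distrib)
  qed (use x0 in \<open>simp_all add: sums_12 ee_0 ee_int[of 1, simplified] ee_int[of 2, simplified] s0_def t0_def field_simps power2_eq_square\<close>)
qed (rule br_0 br_s br_2s br_minus_s br_zl; simp add: ordk_def o1_def oP_def)+

lemma series_Gm: "gm_series \<theta>0 \<theta>x \<theta>inf B0 Bx Bs \<delta> (1 / G\<^sup>2) R (W Gm)"
  unfolding gm_series_def Let_def
proof (rule exI[of _ "\<lambda>c0 cx \<sigma> x. zl Gm 0 \<sigma> x - 1"],
    rule exI[of _ "\<lambda>c0 cx \<sigma> x. - zl Gm 1 \<sigma> x - 2 * tau Gm \<sigma>"],
    rule exI[of _ "\<lambda>c0 cx \<sigma> x. - zl Gm 2 \<sigma> x - 1"],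
    rule exI[of _ "\<lambda>c0 cx \<sigma> x. x * zl Gm (- 1) \<sigma> x / 2 - 1"],
    rule exI[of _ "\<lambda>n c0 cx. zl Gm (int n)"], rule exI[of _ "\<lambda>n c0 cx. zl Gm (- int n)"], intro conjI allI impI ballI)
  fix c0 cx p assume c: "c0 \<in> B0" "cx \<in> Bx" and p: "p \<in> DD"
  obtain \<sigma> x where p': "p = (\<sigma>, x)" by (cases p)
  have \<sigma>: "\<sigma> \<in> Bs" and x: "x \<in> Dom \<sigma>" using p DD_iff by (auto simp: p')
  note x0 = S_nonzero[OF Dom_S[OF x]]
  show "case p of (\<sigma>, x) \<Rightarrow>
      (\<lambda>n. g0m c0 \<sigma> * (g0m c0 \<sigma> * gxp cx \<sigma>) ^ (n - 1) * zl Gm (int n) \<sigma> x * (exp x * x powr (\<sigma> - 1)) ^ n) summable_on {3..} \<and>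
      (\<lambda>n. gxm cx \<sigma> * (g0p c0 \<sigma> * gxm cx \<sigma>) ^ n * zl Gm (- int n) \<sigma> x * (exp (- x) * x powr (- \<sigma> - 1)) ^ n) summable_on {2..} \<and>
      exp x * x powr ((\<sigma> - \<theta>inf) / 2) * W Gm c0 cx \<sigma> x = gxm cx \<sigma> * (1 + (zl Gm 0 \<sigma> x - 1))
        - g0m c0 \<sigma> * ((\<sigma> + \<theta>inf) / 2 + (- zl Gm 1 \<sigma> x - 2 * tau Gm \<sigma>)) * (exp x * x powr (\<sigma> - 1))
        - g0m c0 \<sigma> ^ 2 * gxp cx \<sigma> * (1 + (- zl Gm 2 \<sigma> x - 1)) * (exp x * x powr (\<sigma> - 1)) ^ 2
        + (\<Sum>\<^sub>\<infinity>n\<in>{3..}. g0m c0 \<sigma> * (g0m c0 \<sigma> * gxp cx \<sigma>) ^ (n - 1) * zl Gm (int n) \<sigma> x * (exp x * x powr (\<sigma> - 1)) ^ n)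
        + 2 * g0p c0 \<sigma> * gxm cx \<sigma> ^ 2 * (1 + (x * zl Gm (- 1) \<sigma> x / 2 - 1)) * (exp (- x) * x powr (- \<sigma> - 2))
        + (\<Sum>\<^sub>\<infinity>n\<in>{2..}. gxm cx \<sigma> * (g0p c0 \<sigma> * gxm cx \<sigma>) ^ n * zl Gm (- int n) \<sigma> x * (exp (- x) * x powr (- \<sigma> - 1)) ^ n)"
    unfolding p' prod.case W_powr[OF Dom_S[OF x]] XY_eq[OF Dom_S[OF x]]
  proof (rule Y_series[OF c \<sigma> x, where q = Gm and z = 0])
    fix n :: nat assume "3 \<le> n"
    then have n: "n = Suc (n - 1)" "1 \<le> n" by auto
    show "g0m c0 \<sigma> * (g0m c0 \<sigma> * gxp cx \<sigma>) ^ (n - 1) * zl Gm (int n) \<sigma> x * E 1 \<sigma> x ^ n = zl Gm (int n) \<sigma> x * ec c0 cx Gm (int n) \<sigma> x"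
      unfolding ee_int[OF n(2)] by (subst (1 2 3 4) n(1)) (simp add: power_mult_distrib)
  next
    fix n :: nat assume "2 \<le> n"
    then have n: "n = Suc (n - 1)" "1 \<le> n" by auto
    show "gxm cx \<sigma> * (g0p c0 \<sigma> * gxm cx \<sigma>) ^ n * zl Gm (- int n) \<sigma> x * E (- 1) \<sigma> x ^ n = zl Gm (- int n) \<sigma> x * ec c0 cx Gm (- int n) \<sigma> x"
      unfolding ee_int[OF n(2)] by (subst (1 2 3 4) n(1)) (simp add: power_mult_distrib)
  qed (use x0 in \<open>simp_all add: sums_12 ee_0 ee_int[of 1, simplified] ee_int[of 2, simplified] s0_def t0_def field_simps power2_eq_square\<close>)
qed (rule br_0 br_s br_2s br_minus_s br_zl; simp add: ordk_def o1_def oP_def)+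

end

theorem theorem2p1:
  fixes \<theta>0 \<theta>x \<theta>inf :: complex and B0 Bx Bs :: "complex set" and \<delta> :: real
  assumes "open Bs" "connected Bs" "Bs \<noteq> {}" "bounded Bs"
    and "open B0" "connected B0" "B0 \<noteq> {}" "bounded B0" "0 \<notin> closure B0"
    and "open Bx" "connected Bx" "Bx \<noteq> {}" "bounded Bx" "0 \<notin> closure Bx"
    and "0 < \<delta>" "\<delta> < pi / 2"
  shows "\<exists>\<epsilon> xinf :: real. 0 < \<epsilon> \<and> 1 / \<epsilon> < xinf \<and>
    (\<exists>(A0 :: complex \<Rightarrow> complex \<Rightarrow> complex \<Rightarrow> complex \<Rightarrow> mat2)
      (Ax :: complex \<Rightarrow> complex \<Rightarrow> complex \<Rightarrow> complex \<Rightarrow> mat2)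
      (f0 :: fun4) (fp :: fun4) (fm :: fun4) (g0 :: fun4) (gp :: fun4) (gm :: fun4).
      (\<forall>c0\<in>B0. \<forall>cx\<in>Bx. \<forall>\<sigma>\<in>Bs.
         solves_system (A0 c0 cx \<sigma>) (Ax c0 cx \<sigma>) (Sigma_dom \<sigma> \<epsilon> xinf \<delta>)) \<and>
      (\<forall>c0\<in>B0. \<forall>cx\<in>Bx. \<forall>(\<sigma>, x)\<in>D_dom Bs \<epsilon> xinf \<delta>.
         A0 c0 cx \<sigma> x = cscale (f0 c0 cx \<sigma> x) J + cscale (fp c0 cx \<sigma> x) Delta_plus
                          + cscale (fm c0 cx \<sigma> x) Delta_minus \<and>
         Ax c0 cx \<sigma> x = cscale (g0 c0 cx \<sigma> x) J + cscale (gp c0 cx \<sigma> x) Delta_plus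
                          + cscale (gm c0 cx \<sigma> x) Delta_minus \<and>
         eigenvalues (A0 c0 cx \<sigma> x) = {\<theta>0 / 2, - \<theta>0 / 2} \<and>
         eigenvalues (Ax c0 cx \<sigma> x) = {\<theta>x / 2, - \<theta>x / 2} \<and>
         (A0 c0 cx \<sigma> x + Ax c0 cx \<sigma> x) $ 1 $ 1 = - \<theta>inf / 2 \<and>
         - (A0 c0 cx \<sigma> x + Ax c0 cx \<sigma> x) $ 2 $ 2 = - \<theta>inf / 2 \<and>
         g0 c0 cx \<sigma> x = - \<theta>inf / 2 - f0 c0 cx \<sigma> x) \<and>
      (\<forall>h\<in>{f0, fp, fm, g0, gp, gm}. holomorphic4_on h (B0 \<times> Bx \<times> D_dom Bs \<epsilon> xinf \<delta>)) \<and>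
      f0_series \<theta>0 \<theta>x \<theta>inf B0 Bx Bs \<delta> \<epsilon> xinf f0 \<and>
      fp_series \<theta>0 \<theta>x \<theta>inf B0 Bx Bs \<delta> \<epsilon> xinf fp \<and>
      gp_series \<theta>0 \<theta>x \<theta>inf B0 Bx Bs \<delta> \<epsilon> xinf gp \<and>
      fm_series \<theta>0 \<theta>x \<theta>inf B0 Bx Bs \<delta> \<epsilon> xinf fm \<and>
      gm_series \<theta>0 \<theta>x \<theta>inf B0 Bx Bs \<delta> \<epsilon> xinf gm)"
proof -
  \<comment> \<open>A smaller angle means a wider cone: it satisfies
    \<open>2 * k\<^sup>2 \<le> 1\<close> and still contains the sector for \<delta>.\<close>
  define \<delta>' where "\<delta>' = min \<delta> (pi / 4)"
  define k where "k = sin \<delta>'"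
  have \<delta>': "0 < \<delta>'" "\<delta>' \<le> \<delta>" "\<delta>' \<le> pi / 4" using assms(15) by (auto simp: \<delta>'_def)
  have k0: "0 < k" unfolding k_def using \<delta>' pi_gt_zero by (intro sin_gt_zero) linarith+
  have "k \<le> sin (pi / 4)" unfolding k_def using \<delta>' pi_gt_zero by (intro sin_monotone_2pi_le) linarith+
  then have "k\<^sup>2 \<le> (sqrt 2 / 2)\<^sup>2" using k0 by (intro power_mono) (auto simp: sin_45)
  then have k2: "2 * k\<^sup>2 \<le> 1" by (simp add: power_divide)
  have k\<delta>: "k \<le> sin \<delta>" unfolding k_def using \<delta>' assms(16) by (intro sin_monotone_2pi_le) linarith+
  obtain Bd where bd: "0 < Bd" "\<And>\<sigma>. \<sigma> \<in> Bs \<Longrightarrow> norm \<sigma> \<le> Bd" using assms(4) bounded_pos by metis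
  interpret painleve k Bd Bs \<theta>0 \<theta>x \<theta>inf
    by unfold_locales (use k0 k2 assms(1) bd in auto)
  obtain R' M D C where key': "key R' M D C" using key_exists by blast
  \<comment> \<open>The lower \<gamma>s contain the inverses of c0 and cx, which are bounded because
    the closures avoid 0.\<close>
  have away: "\<exists>d>0. \<forall>c\<in>S. d \<le> norm c" if "0 \<notin> closure S" for S :: "complex set"
  proof -
    obtain d where "d > 0" "\<And>c. c \<in> S \<Longrightarrow> \<not> dist c 0 < d" using \<open>0 \<notin> closure S\<close> closure_approachable[of 0 S] by blast
    then show ?thesis by (intro exI[of _ d]) (auto simp: not_less)
  qed
  obtain d0 where d0: "0 < d0" "\<And>c. c \<in> B0 \<Longrightarrow> d0 \<le> norm c" using away[OF assms(9)] by blast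
  obtain dx where dx: "0 < dx" "\<And>c. c \<in> Bx \<Longrightarrow> dx \<le> norm c" using away[OF assms(14)] by blast
  obtain a0 where a0: "0 < a0" "\<And>c. c \<in> B0 \<Longrightarrow> norm c \<le> a0" using assms(8) bounded_pos by metis
  obtain ax where ax: "0 < ax" "\<And>c. c \<in> Bx \<Longrightarrow> norm c \<le> ax" using assms(13) bounded_pos by metis
  \<comment> \<open>P dominates c0, cx and their inverses, Q the linear factors of the \<gamma>s;
    their product bounds all four \<gamma>s, and adding 1 gives \<open>1 \<le> G\<close>.\<close>
  define P where "P = a0 + ax + inverse d0 + inverse dx"
  define Q where "Q = Bd + 2 * norm \<theta>0 + 2 * norm \<theta>x + norm \<theta>inf"
  define G where "G = 1 + P * Q"
  have pos: "0 \<le> inverse d0" "0 \<le> inverse dx" using d0 dx by auto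
  have PQ0: "0 \<le> P" "0 \<le> Q"
    unfolding P_def Q_def using pos a0(1) ax(1) bd(1) by (auto intro!: add_nonneg_nonneg)
  have G1: "1 \<le> G" using PQ0 by (simp add: G_def)
  have G: "norm (c / 4 * q) \<le> G" if "norm c \<le> P" "norm q \<le> Q" for c q :: complex
  proof -
    have "norm (c / 4 * q) \<le> norm c * norm q" by (simp add: norm_mult norm_divide mult_right_mono)
    also have "\<dots> \<le> P * Q" using that PQ0 by (intro mult_mono) auto
    finally show ?thesis by (simp add: G_def)
  qed
  have c0: "norm c \<le> P" "norm (inverse c) \<le> P" if "c \<in> B0" for c
    unfolding P_def norm_inverse using a0(2)[OF that] a0(1) ax(1) pos le_imp_inverse_le[OF d0(2)[OF that] d0(1)] by linarith+
  have cx: "norm c \<le> P" "norm (inverse c) \<le> P" if "c \<in> Bx" for c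
    unfolding P_def norm_inverse using ax(2)[OF that] a0(1) ax(1) pos le_imp_inverse_le[OF dx(2)[OF that] dx(1)] by linarith+
  have tri: "norm (u + 2 * v + w) \<le> norm u + 2 * norm v + norm w" for u v w :: complex
    using norm_triangle_ineq[of "u + 2 * v" w] norm_triangle_ineq[of u "2 * v"] by (simp add: norm_mult)
  have Q: "norm (\<sigma> + 2 * \<theta>0 - \<theta>inf) \<le> Q" "norm (- \<sigma> + 2 * \<theta>0 + \<theta>inf) \<le> Q"
    "norm (- \<sigma> + 2 * \<theta>x - \<theta>inf) \<le> Q" "norm (\<sigma> + 2 * \<theta>x + \<theta>inf) \<le> Q" if "\<sigma> \<in> Bs" for \<sigma>
    using tri[of \<sigma> \<theta>0 "- \<theta>inf"] tri[of "- \<sigma>" \<theta>0 \<theta>inf] tri[of "- \<sigma>" \<theta>x "- \<theta>inf"] tri[of \<sigma> \<theta>x \<theta>inf] bd(2)[OF that]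
      norm_ge_zero[of \<theta>0] norm_ge_zero[of \<theta>x]
    unfolding Q_def by (simp_all, linarith+)
  \<comment> \<open>Four demands at once: the radius from the iteration, G^2 < R for 1 / \<epsilon>
    < x_inf, R >= 1, and a radius beyond which \<rho> / 2 beats Bd (ln \<rho> + 3).\<close>
  define R where "R = max (max R' (G\<^sup>2 + 1)) (max 1 ((10 * Bd + 1)\<^sup>2))"
  have R: "R' \<le> R" "G\<^sup>2 < R" "1 \<le> R" "(10 * Bd + 1)\<^sup>2 \<le> R" by (auto simp: R_def)
  have RH: "Bd * (ln \<rho> + 3) < \<rho> / 2" if "R < \<rho>" for \<rho>
  proof -
    have \<rho>: "1 < \<rho>" using R that by linarith
    \<comment> \<open>From ln \<rho> = 2 ln s <= 2 s - 2 follows ln \<rho> + 3 <= 5 s, and 5 Bd s <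
      s^2 / 2 as soon as s > 10 Bd; this is the origin of (10 Bd + 1)^2.\<close>
    define s where "s = sqrt \<rho>"
    have s: "1 < s" "s\<^sup>2 = \<rho>" using \<rho> by (auto simp: s_def)
    have "ln \<rho> = 2 * ln s" using \<rho> by (simp add: s_def ln_sqrt)
    also have "\<dots> \<le> 2 * s - 2" using ln_le_minus_one[of s] s(1) by simp
    finally have "ln \<rho> + 3 \<le> 5 * s" using s(1) by linarith
    then have "Bd * (ln \<rho> + 3) \<le> Bd * (5 * s)" using bd(1) by (intro mult_left_mono) auto
    moreover have "10 * Bd + 1 < s" by (rule power2_less_imp_less) (use R that s in auto)
    then have "10 * Bd * s < s * s" using s by (intro mult_strict_right_mono) auto
    ultimately show ?thesis using s(2) by (simp add: power2_eq_square)
  qed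
  have se: "sector \<delta> R = {x. sin \<delta> * norm x < Im x \<and> R < norm x}"
    by (rule sector_eq) (use assms R in auto)
  have "sector \<delta> R \<subseteq> S R"
    unfolding se S_def using mult_right_mono[OF k\<delta> norm_ge_zero] by (force intro: le_less_trans)
  moreover have "open (sector \<delta> R)"
    unfolding se by (intro open_Collect_conj open_Collect_less continuous_intros)
  moreover have "0 \<notin> B0" "0 \<notin> Bx" using assms(9,14) closure_subset by blast+
  ultimately interpret family k Bd Bs \<theta>0 \<theta>x \<theta>inf B0 Bx \<delta> G R M D C
    using assms(5,10) G1 key_mono[OF key' R(1)] R(2) RH
      G[OF c0(1) Q(1)] G[OF c0(2) Q(2)] G[OF cx(1) Q(3)] G[OF cx(2) Q(4)]
    by unfold_locales (auto simp: gam0p_def gam0m_def gamxp_def gamxm_def)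
  let ?A0 = "\<lambda>c0 cx \<sigma> x. cscale (F0 c0 cx \<sigma> x) J + cscale (W Fp c0 cx \<sigma> x) Delta_plus + cscale (W Fm c0 cx \<sigma> x) Delta_minus"
  let ?Ax = "\<lambda>c0 cx \<sigma> x. cscale (G0 c0 cx \<sigma> x) J + cscale (W Gp c0 cx \<sigma> x) Delta_plus + cscale (W Gm c0 cx \<sigma> x) Delta_minus"
  let ?P = "\<lambda>c0 cx \<sigma> x. ?A0 c0 cx \<sigma> x = ?A0 c0 cx \<sigma> x \<and> ?Ax c0 cx \<sigma> x = ?Ax c0 cx \<sigma> x \<and>
     eigenvalues (?A0 c0 cx \<sigma> x) = {\<theta>0 / 2, - \<theta>0 / 2} \<and> eigenvalues (?Ax c0 cx \<sigma> x) = {\<theta>x / 2, - \<theta>x / 2} \<and>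
     (?A0 c0 cx \<sigma> x + ?Ax c0 cx \<sigma> x) $ 1 $ 1 = - \<theta>inf / 2 \<and> - (?A0 c0 cx \<sigma> x + ?Ax c0 cx \<sigma> x) $ 2 $ 2 = - \<theta>inf / 2 \<and>
     G0 c0 cx \<sigma> x = - \<theta>inf / 2 - F0 c0 cx \<sigma> x"
  have pt: "\<forall>c0\<in>B0. \<forall>cx\<in>Bx. \<forall>(\<sigma>, x)\<in>DD. ?P c0 cx \<sigma> x"
  proof (intro ballI)
    fix c0 cx p assume c: "c0 \<in> B0" "cx \<in> Bx" and "p \<in> DD"
    moreover obtain \<sigma> x where p: "p = (\<sigma>, x)" by (cases p)
    ultimately have \<sigma>: "\<sigma> \<in> Bs" and x: "x \<in> Dom \<sigma>" using DD_iff by auto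
    show "case p of (\<sigma>, x) \<Rightarrow> ?P c0 cx \<sigma> x"
      unfolding p prod.case vector_add_component[of "?A0 c0 cx \<sigma> x"] vector_add_component[of "?A0 c0 cx \<sigma> x $ _"] mat2_entries
      using eigenvalues_traceless[OF integrals(1)[OF c \<sigma> x]] eigenvalues_traceless[OF integrals(2)[OF c \<sigma> x]]
      by (simp add: G0_def)
  qed
  have e: "0 < 1 / G\<^sup>2" "1 / (1 / G\<^sup>2) < R" using G1 R(2) by simp_all
  show ?thesis
    by (rule exI[of _ "1 / G\<^sup>2"], rule exI[of _ R], rule conjI[OF e(1)], rule conjI[OF e(2)],
        rule exI[of _ ?A0], rule exI[of _ ?Ax], rule exI[of _ F0], rule exI[of _ "W Fp"], rule exI[of _ "W Fm"],
        rule exI[of _ G0], rule exI[of _ "W Gp"], rule exI[of _ "W Gm"],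
        rule conjI[OF _ conjI[OF pt conjI[OF holomorphic4_all conjI[OF series_F0 conjI[OF series_Fp
          conjI[OF series_Gp conjI[OF series_Fm series_Gm]]]]]]])
      (intro ballI system)
qed

end
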